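(* Let $K\subset\mathbb C^n$ be compact and connected, and let $a\in\mathbb C^n$. Then the following are equivalent. (i) $a$ belongs to the polynomial hull $\hat K$ of $K$. (ii) For every neighbourhood $U$ of $K$ and every $\epsilon>0$, there is a Nevanlinna disc $f=(f_1,\dots,f_n):\mathbb D\to\mathbb C^n$ with $f(0)=a$, whose nontangential boundary values $f^*(\zeta)$ lie in $U$ for $\sigma$-almost every $\zeta\in\mathbb T$, and such that for each $j=1,\dots,n$ the singular measure of the component $f_j$ is a positive (nonnegative) measure of total mass less than $\epsilon$.
   Context: $\mathbb D$ is the open unit disc in $\mathbb C$, $\mathbb T$ its boundary circle, and $\sigma$ the normalized arc length measure on $\mathbb T$. The polynomial hull $\hat K$ of a compact set $K\subset\mathbb C^n$ is the set of $x\in\mathbb C^n$ with $|P(x)|\le\sup_K|P|$ for every complex polynomial $P$ in $n$ variables. A holomorphic function $g$ on $\mathbb D$ is in the Nevanlinna class if $\log|g|$ has a positive harmonic majorant on $\mathbb D$ (equivalently, $g$ is a quotient of bounded holomorphic functions on $\mathbb D$ with zero-free denominator). Such $g$ has nontangential boundary values $g^*$ $\sigma$-a.e. on $\mathbb T$ with $\log|g^*|\in L^1(\sigma)$, and if $g\not\equiv 0$ it factors uniquely as a Blaschke product times an outer function times a singular function $s(z)=\exp\int_{\mathbb T}\frac{\zeta+z}{\zeta-z}\,d\mu(\zeta)$, where $\mu$ is a finite real measure on $\mathbb T$ singular with respect to $\sigma$; $\mu$ is called the singular measure of $g$ (equivalently, the least harmonic majorant of $\log|g|$ is the Poisson integral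 of $\log|g^*|\,d\sigma+d\mu$). The singular measure of the identically zero function is taken to be zero. An analytic disc $f:\mathbb D\to\mathbb C^n$ is a Nevanlinna disc if each of its components is in the Nevanlinna class. *)

theory Defs
  imports "HOL-Analysis.Analysis"
begin

inductive_set poly_fun :: "((complex^'n) \<Rightarrow> complex) set" where
  const: "(\<lambda>x. c) \<in> poly_fun"
| coord: "(\<lambda>x. x $ i) \<in> poly_fun"
| add: "P \<in> poly_fun \<Longrightarrow> Q \<in> poly_fun \<Longrightarrow> (\<lambda>x. P x + Q x) \<in> poly_fun"
| mult: "P \<in> poly_fun \<Longrightarrow> Q \<in> poly_fun \<Longrightarrow> (\<lambda>x. P x * Q x) \<in> poly_fun"

text \<open>x is in the polynomial hull iff |P x| \<le> sup_K |P| for all polynomials P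
  (sup written out as: |P x| is below every upper bound of |P| on K).\<close>
definition poly_hull :: "(complex^'n) set \<Rightarrow> (complex^'n) set" where
  "poly_hull K = {x. \<forall>P \<in> poly_fun. \<forall>M::real.
      (\<forall>y\<in>K. norm (P y) \<le> M) \<longrightarrow> norm (P x) \<le> M}"

definition sigma_T :: "complex measure" where
  "sigma_T = distr (lebesgue_on {0..1}) borel (\<lambda>t. cis (2 * pi * t))"

definition nevanlinna :: "(complex \<Rightarrow> complex) \<Rightarrow> bool" where
  "nevanlinna g \<longleftrightarrow> g holomorphic_on ball 0 1 \<and>
     (\<exists>h k. h holomorphic_on ball 0 1 \<and> k holomorphic_on ball 0 1 \<and>
        bounded (h ` ball 0 1) \<and> bounded (k ` ball 0 1) \<and>
        (\<forall>z\<in>ball 0 1. k z \<noteq> 0) \<and> (\<forall>z\<in>ball 0 1. g z = h z / k z))"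

definition nevanlinna_disc :: "(complex \<Rightarrow> complex^'n) \<Rightarrow> bool" where
  "nevanlinna_disc f \<longleftrightarrow> (\<forall>j. nevanlinna (\<lambda>z. f z $ j))"

definition stolz :: "complex \<Rightarrow> real \<Rightarrow> complex set" where
  "stolz \<zeta> C = {z. norm z < 1 \<and> norm (z - \<zeta>) < C * (1 - norm z)}"

definition nt_limit :: "(complex \<Rightarrow> 'a::topological_space) \<Rightarrow> complex \<Rightarrow> 'a \<Rightarrow> bool" where
  "nt_limit f \<zeta> L \<longleftrightarrow> (\<forall>C>1. (f \<longlongrightarrow> L) (at \<zeta> within stolz \<zeta> C))"

definition bfac :: "complex \<Rightarrow> complex \<Rightarrow> complex" where
  "bfac a z = (if a = 0 then z else (of_real (norm a) / a) * (a - z) / (1 - cnj a * z))"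

definition blaschke :: "(complex \<Rightarrow> complex) \<Rightarrow> bool" where
  "blaschke B \<longleftrightarrow> (\<exists>c (a::nat \<Rightarrow> complex) (I::nat set). norm c = 1 \<and>
      (\<forall>k\<in>I. a k \<in> ball 0 1) \<and>
      summable (\<lambda>k. if k \<in> I then 1 - norm (a k) else 0) \<and>
      (\<forall>z\<in>ball 0 1. B z = c * (\<Prod>k. if k \<in> I then bfac (a k) z else 1)))"

definition outer :: "(complex \<Rightarrow> complex) \<Rightarrow> bool" where
  "outer Ou \<longleftrightarrow> (\<exists>c (h::complex \<Rightarrow> real). norm c = 1 \<and> integrable sigma_T h \<and>
      (\<forall>z\<in>ball 0 1. Ou z = c * exp (integral\<^sup>L sigma_T
          (\<lambda>\<zeta>. (\<zeta> + z) / (\<zeta> - z) * of_real (h \<zeta>)))))"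

definition circle_measure :: "complex measure \<Rightarrow> bool" where
  "circle_measure \<mu> \<longleftrightarrow> sets \<mu> = sets borel \<and> finite_measure \<mu> \<and>
      emeasure \<mu> (UNIV - sphere 0 1) = 0"

definition singular_to_sigma :: "complex measure \<Rightarrow> bool" where
  "singular_to_sigma \<mu> \<longleftrightarrow> (\<exists>A \<in> sets borel. A \<subseteq> sphere 0 1 \<and>
      emeasure sigma_T A = 0 \<and> emeasure \<mu> (sphere 0 1 - A) = 0)"

text \<open>A finite real measure on the circle is represented as a difference
  mu_p - mu_n of finite positive measures (both singular to sigma).\<close>
definition sing_fun :: "complex measure \<Rightarrow> complex measure \<Rightarrow> complex \<Rightarrow> complex" where
  "sing_fun \<mu>p \<mu>n z = exp (integral\<^sup>L \<mu>p (\<lambda>\<zeta>. (\<zeta> + z) / (\<zeta> - z))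
                         - integral\<^sup>L \<mu>n (\<lambda>\<zeta>. (\<zeta> + z) / (\<zeta> - z)))"

definition signed_val :: "complex measure \<Rightarrow> complex measure \<Rightarrow> complex set \<Rightarrow> real" where
  "signed_val \<mu>p \<mu>n A = measure \<mu>p A - measure \<mu>n A"

definition is_singular_measure ::
    "(complex \<Rightarrow> complex) \<Rightarrow> complex measure \<Rightarrow> complex measure \<Rightarrow> bool" where
  "is_singular_measure g \<mu>p \<mu>n \<longleftrightarrow>
     circle_measure \<mu>p \<and> circle_measure \<mu>n \<and>
     singular_to_sigma \<mu>p \<and> singular_to_sigma \<mu>n \<and>
     (if (\<forall>z\<in>ball 0 1. g z = 0)
      then (\<forall>A \<in> sets borel. signed_val \<mu>p \<mu>n A = 0)
      else (\<exists>B Ou. blaschke B \<and> outer Ou \<and>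
              (\<forall>z\<in>ball 0 1. g z = B z * Ou z * sing_fun \<mu>p \<mu>n z)))"

end

theory Submission
  imports Defs "HOL-Complex_Analysis.Complex_Analysis"
begin

text \<open>A disc as in (ii) has its centre in the hull because, for a polynomial P, the logarithm of |P(f)|
  is dominated by the Poisson integral of its boundary values plus a multiple of the small singular masses.

  Conversely let a lie in the hull. The infimum over polynomial discs f centred at z of the mean of dist(f, K) over
  the circle is a Lipschitz function of z with the submean value property on complex lines (discs can be glued
  along the boundary of an affine disc), and it vanishes on K. Such functions are at most 0 on the hull: after mollification
  and addition of a small multiple of the squared norm, a maximum over the hull away from K would yield a quadratic polynomial peaking there,
  against the local maximum principle. Hence some polynomial disc centred at a is close to K in mean. Multiplying f - k0 (with k0 in K) by
  exp Xi, where Re Xi is very negative on the few boundary arcs on which f is far from K and Xi is small on the other arcs,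
  brings the boundary values into the given neighbourhood. Here Xi is the Herglotz transform of a difference of a
  small positive measure on countably many points and an absolutely continuous one, so that Xi 0 = 0. A generic small linear
  perturbation of the components makes the remaining bounded factors free of singular inner parts.\<close>

text \<open>The local maximum principle is obtained by algebra. If |F| < th on the fibre g = w of a
  polynomially convex compact set, then some power of F is below the same power of th up to a
  multiple of w - g: this is the spectral radius formula modulo the ideal of w - g. Polynomials with
  a quotient seminorm are not complete, so inverses exist only up to an error, and averages over
  roots of unity take the place of Cauchy integrals. In the construction of the disc, Xi 0 = 0
  forces the mass spent on pushing boundary values towards k0 to reappear as positive singular mass.
  The mass needed at a boundary point is bounded by a multiple of its distance from K, which is why
  smallness in mean is enough. A second obstacle is that the singular measure is that of a component
  of the disc and not of its difference from k0. Each component is exp Xi times f - k0 + k0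
  exp(-Xi), a bounded function, and it is this factor that has to be freed of its singular part. The
  perturbation used for that is a multiple of z, so the centre does not move.\<close>

no_notation fps_nth (infixl "$" 75)

section \<open>Spectra in seminormed algebras\<close>

text \<open>Averaging over the n-th roots of unity annihilates every power with
  \<open>0 < l < n\<close>, so only the constant term of each geometric sum survives. This discrete
  orthogonality stands in for Cauchy's integral formula in the resolvent and kernel
  arguments.\<close>

lemma sum_roots_of_unity_geometric:
  fixes u s :: complex
  assumes "n > 0" "s \<noteq> 0"
  shows "(\<Sum>k<n. \<Sum>l<n. (u / (s * cis (2 * pi / n) ^ k)) ^ l) = of_nat n"
proof -
  let ?w = "cis (2 * pi / n)"
  have z: "(\<Sum>k<n. (1 / ?w ^ l) ^ k) = (if l = 0 then of_nat n else 0)" if "l < n" for l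
  proof (cases "l = 0")
    case False
    have "?w ^ l = cis (2 * pi * l / n)" by (simp add: Complex.DeMoivre mult_ac)
    also have "\<dots> \<noteq> 1"
    proof
      assume "cis (2 * pi * l / n) = 1"
      then obtain m :: int where "2 * pi * l / n = 2 * pi * of_int m"
        unfolding cis_conv_exp exp_eq_1 by (auto simp: mult_ac)
      then have "real l = real n * of_int m" using assms by (simp add: field_simps)
      then have "int l = int n * m" by (metis of_int_eq_iff of_int_mult of_int_of_nat_eq)
      then show False using that False
        by (metis dvd_triv_left nat_dvd_not_less neq0_conv of_nat_dvd_iff)
    qed
    finally have ne: "1 / ?w ^ l \<noteq> 1" by (metis div_by_1 divide_eq_1_iff)
    have "(1 / ?w ^ l) ^ n = 1 / (?w ^ n) ^ l"
      by (simp add: power_divide mult.commute flip: power_mult)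
    also have "?w ^ n = 1" using assms by (simp add: Complex.DeMoivre)
    finally have "(1 / ?w ^ l) ^ n = 1" by simp
    then show ?thesis using geometric_sum[OF ne, of n] False by simp
  qed simp
  have "(\<Sum>k<n. \<Sum>l<n. (u / (s * ?w ^ k)) ^ l) = (\<Sum>l<n. \<Sum>k<n. (u / s) ^ l * (1 / ?w ^ l) ^ k)"
    by (subst sum.swap) (simp add: power_divide power_mult_distrib mult.commute flip: power_mult)
  also have "\<dots> = (\<Sum>l<n. (u / s) ^ l * (if l = 0 then of_nat n else 0))"
    using z by (intro sum.cong) (auto simp flip: sum_distrib_left)
  also have "\<dots> = (\<Sum>l<n. if l = 0 then of_nat n else 0)"
    by (intro sum.cong) auto
  also have "\<dots> = of_nat n" using assms by simp
  finally show ?thesis .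
qed

text \<open>Completeness is not assumed, since the algebra will be that of the polynomials.
  Accordingly \<open>l\<close> counts as a spectral value of \<open>x\<close> when no
  \<open>H\<close> makes \<open>1 - (x - l) H\<close> smaller than 1; in the completion this says
  that \<open>x - l\<close> is not invertible.\<close>

locale seminormed_algebra =
  fixes A :: "('b \<Rightarrow> complex) set" and q :: "('b \<Rightarrow> complex) \<Rightarrow> real"
  assumes const: "(\<lambda>_. c) \<in> A"
    and add: "f \<in> A \<Longrightarrow> g \<in> A \<Longrightarrow> (\<lambda>z. f z + g z) \<in> A"
    and mult: "f \<in> A \<Longrightarrow> g \<in> A \<Longrightarrow> (\<lambda>z. f z * g z) \<in> A"
    and q_nonneg: "f \<in> A \<Longrightarrow> 0 \<le> q f"
    and q_add: "f \<in> A \<Longrightarrow> g \<in> A \<Longrightarrow> q (\<lambda>z. f z + g z) \<le> q f + q g"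
    and q_mult: "f \<in> A \<Longrightarrow> g \<in> A \<Longrightarrow> q (\<lambda>z. f z * g z) \<le> q f * q g"
    and q_const: "q (\<lambda>_. c) \<le> norm c"
begin

lemma scale: "f \<in> A \<Longrightarrow> (\<lambda>z. c * f z) \<in> A"
  using mult[OF const] by blast

lemma diff: "f \<in> A \<Longrightarrow> g \<in> A \<Longrightarrow> (\<lambda>z. f z - g z) \<in> A"
  using add[OF _ scale[of g "-1"], of f] by simp

lemma pow: "f \<in> A \<Longrightarrow> (\<lambda>z. f z ^ n) \<in> A"
  by (induction n) (auto intro: const mult)

lemma sum_in: "(\<And>i. i \<in> I \<Longrightarrow> f i \<in> A) \<Longrightarrow> (\<lambda>z. \<Sum>i\<in>I. f i z) \<in> A"
  by (induction I rule: infinite_finite_induct) (auto intro: const add)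

lemma q_scale: "f \<in> A \<Longrightarrow> q (\<lambda>z. c * f z) \<le> norm c * q f"
  using q_mult[OF const, of f c] mult_right_mono[OF q_const q_nonneg, of f c] by simp

lemma q_diff: "f \<in> A \<Longrightarrow> g \<in> A \<Longrightarrow> q (\<lambda>z. f z - g z) \<le> q f + q g"
  using q_add[OF _ scale[of g "-1"], of f] q_scale[of g "-1"] by simp

lemma q_zero: "q (\<lambda>_. 0) = 0"
  using q_const[of 0] q_nonneg[OF const, of 0] by simp

lemma q_sum: "(\<And>i. i \<in> I \<Longrightarrow> f i \<in> A) \<Longrightarrow> q (\<lambda>z. \<Sum>i\<in>I. f i z) \<le> (\<Sum>i\<in>I. q (f i))"
proof (induction I rule: infinite_finite_induct)
  case (insert x F)
  have "q (\<lambda>z. f x z + (\<Sum>i\<in>F. f i z)) \<le> q (f x) + q (\<lambda>z. \<Sum>i\<in>F. f i z)"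
    using insert.prems by (intro q_add sum_in) auto
  also have "\<dots> \<le> q (f x) + (\<Sum>i\<in>F. q (f i))"
    using insert by simp
  finally show ?case using insert by simp
qed (auto simp: q_zero)

lemma q_pow: "f \<in> A \<Longrightarrow> q (\<lambda>z. f z ^ n) \<le> q f ^ n"
proof (induction n)
  case 0 show ?case using q_const[of 1] by simp
next
  case (Suc n)
  have "q (\<lambda>z. f z * f z ^ n) \<le> q f * q (\<lambda>z. f z ^ n)"
    by (intro q_mult pow Suc)
  also have "\<dots> \<le> q f * q f ^ n" using Suc q_nonneg by (intro mult_left_mono) auto
  finally show ?case by simp
qed

text \<open>A truncated Neumann series \<open>H * (1 + y + ... + y^(k-1))\<close> turns the error
  \<open>y = 1 - (x - l) H\<close> into \<open>y^k\<close>. The bound on \<open>R\<close> does not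
  depend on the accuracy \<open>e\<close>; later proofs fix that bound first and choose
  \<open>e\<close> last.\<close>

lemma approximate_inverse:
  assumes "x \<in> A" "H \<in> A" "q (\<lambda>z. 1 - (x z - l) * H z) \<le> b" "b < 1" "0 < e"
  shows "\<exists>R\<in>A. q R \<le> q H / (1 - b) \<and> q (\<lambda>z. 1 - (x z - l) * R z) < e"
proof -
  let ?y = "\<lambda>z. 1 - (x z - l) * H z"
  have y: "?y \<in> A" using assms by (intro diff mult const)
  have b0: "0 \<le> b" using q_nonneg[OF y] assms by simp
  obtain k where k: "b ^ k < e" using assms real_arch_pow_inv by blast
  define R where "R = (\<lambda>z. H z * (\<Sum>i<k. ?y z ^ i))"
  have RA: "R \<in> A" unfolding R_def using assms y by (intro mult sum_in pow)
  have yk: "q (\<lambda>z. ?y z ^ i) \<le> b ^ i" for i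
    using q_pow[OF y, of i] power_mono[OF assms(3) q_nonneg[OF y], of i] by simp
  have "q R \<le> q H * q (\<lambda>z. \<Sum>i<k. ?y z ^ i)"
    unfolding R_def using assms y by (intro q_mult sum_in pow)
  also have "\<dots> \<le> q H * (\<Sum>i<k. b ^ i)"
  proof (intro mult_left_mono q_nonneg assms)
    have "q (\<lambda>z. \<Sum>i<k. ?y z ^ i) \<le> (\<Sum>i<k. q (\<lambda>z. ?y z ^ i))"
      by (rule q_sum) (intro pow y)
    also have "\<dots> \<le> (\<Sum>i<k. b ^ i)" by (intro sum_mono yk)
    finally show "q (\<lambda>z. \<Sum>i<k. ?y z ^ i) \<le> (\<Sum>i<k. b ^ i)" .
  qed
  also have "\<dots> \<le> q H * (1 / (1 - b))"
    using sum_le_suminf[of "\<lambda>i. b ^ i" "{..<k}"] b0 assms suminf_geometric[of b]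
    by (intro mult_left_mono q_nonneg assms) (auto intro: summable_geometric)
  finally have 1: "q R \<le> q H / (1 - b)" by simp
  have "1 - (x z - l) * R z = ?y z ^ k" for z
    using one_diff_power_eq[of "?y z" k] by (simp add: R_def algebra_simps)
  then have "q (\<lambda>z. 1 - (x z - l) * R z) \<le> b ^ k" using yk by simp
  with k RA 1 show ?thesis by force
qed

text \<open>One \<open>H\<close> serves a whole neighbourhood of \<open>l0\<close>, because moving
  \<open>l\<close> changes the error by at most the displacement times \<open>q H\<close>;
  compactness leaves finitely many bounds.\<close>

lemma approximate_inverse_uniform:
  assumes x: "x \<in> A" and "compact S" and inv: "\<And>l. l \<in> S \<Longrightarrow> \<exists>H\<in>A. q (\<lambda>z. 1 - (x z - l) * H z) < 1"
  shows "\<exists>C>0. \<forall>l\<in>S. \<forall>e>0. \<exists>R\<in>A. q R \<le> C \<and> q (\<lambda>z. 1 - (x z - l) * R z) < e"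
proof -
  have "\<exists>C r. r > 0 \<and> C > 0 \<and> (\<forall>l\<in>ball l0 r. \<forall>e>0. \<exists>R\<in>A. q R \<le> C \<and> q (\<lambda>z. 1 - (x z - l) * R z) < e)"
    if l0: "l0 \<in> S" for l0
  proof -
    obtain H where H: "H \<in> A" "q (\<lambda>z. 1 - (x z - l0) * H z) < 1" using inv[OF l0] by blast
    define b where "b = q (\<lambda>z. 1 - (x z - l0) * H z)"
    \<comment> \<open>With this radius an error \<open>b < 1\<close> grows to at most
      \<open>(1 + b) / 2\<close>, which is still below 1.\<close>
    define r where "r = (1 - b) / (2 * (q H + 1))"
    have qH: "q H \<ge> 0" by (rule q_nonneg[OF H(1)])
    have r: "r > 0" "r * q H \<le> (1 - b) / 2"
      using H qH by (auto simp: r_def b_def field_simps)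
    have *: "q (\<lambda>z. 1 - (x z - l) * H z) \<le> (1 + b) / 2" if "l \<in> ball l0 r" for l
    proof -
      have "(\<lambda>z. 1 - (x z - l) * H z) = (\<lambda>z. (1 - (x z - l0) * H z) + (l - l0) * H z)"
        by (auto simp: algebra_simps)
      then have "q (\<lambda>z. 1 - (x z - l) * H z) \<le> b + q (\<lambda>z. (l - l0) * H z)"
        unfolding b_def using x H by (simp only:) (intro q_add scale diff mult const; simp)
      also have "q (\<lambda>z. (l - l0) * H z) \<le> norm (l - l0) * q H" by (rule q_scale[OF H(1)])
      also have "norm (l - l0) * q H \<le> r * q H" using that qH
        by (intro mult_right_mono) (auto simp: dist_norm norm_minus_commute)
      finally show ?thesis using r by (simp add: field_simps)
    qed
    have "\<exists>R\<in>A. q R \<le> q H / (1 - (1 + b) / 2) + 1 \<and> q (\<lambda>z. 1 - (x z - l) * R z) < e"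
      if "l \<in> ball l0 r" "e > 0" for l e
    proof -
      have "(1 + b) / 2 < 1" using H(2) b_def by simp
      from approximate_inverse[OF x H(1) *[OF that(1)] this that(2)]
      obtain R where "R \<in> A" "q R \<le> q H / (1 - (1 + b) / 2)" "q (\<lambda>z. 1 - (x z - l) * R z) < e" by blast
      then show ?thesis by (intro bexI[of _ R]) auto
    qed
    moreover have "q H / (1 - (1 + b) / 2) + 1 > 0" using qH H(2) b_def
      by (intro add_nonneg_pos divide_nonneg_nonneg) auto
    ultimately show ?thesis using r(1) by blast
  qed
  then obtain C r where Cr: "\<And>l0. l0 \<in> S \<Longrightarrow> r l0 > 0 \<and> C l0 > 0 \<and>
      (\<forall>l\<in>ball l0 (r l0). \<forall>e>0. \<exists>R\<in>A. q R \<le> C l0 \<and> q (\<lambda>z. 1 - (x z - l) * R z) < e)"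
    by metis
  have "S \<subseteq> (\<Union>l\<in>S. ball l (r l))" using Cr by force
  then obtain T where T: "T \<subseteq> S" "finite T" "S \<subseteq> (\<Union>l\<in>T. ball l (r l))"
    using compactE_image[OF \<open>compact S\<close>, of S "\<lambda>l. ball l (r l)"] by auto
  define D where "D = 1 + (\<Sum>l\<in>T. C l)"
  have Cpos: "0 \<le> C l" if "l \<in> T" for l using Cr T that by (meson less_imp_le subsetD)
  have D: "C l \<le> D" if "l \<in> T" for l
    unfolding D_def using member_le_sum[of l T C] that T Cpos by force
  have "D > 0" unfolding D_def using Cpos by (intro add_pos_nonneg sum_nonneg) auto
  moreover have "\<exists>R\<in>A. q R \<le> D \<and> q (\<lambda>z. 1 - (x z - l) * R z) < e" if l: "l \<in> S" and e: "e > 0" for l e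
  proof -
    obtain l0 where l0: "l0 \<in> T" "l \<in> ball l0 (r l0)" using T(3) l by blast
    then obtain R where "R \<in> A" "q R \<le> C l0" "q (\<lambda>z. 1 - (x z - l) * R z) < e"
      using Cr[of l0] T(1) e by blast
    then show ?thesis using D[OF l0(1)] by (intro bexI[of _ R]) auto
  qed
  ultimately show ?thesis by blast
qed

text \<open>Formally \<open>1 / (1 - (x/s)^n)\<close> is the mean of \<open>1 / (1 - x/w)\<close>
  over the \<open>n\<close> points with \<open>w^n = s^n\<close>, and \<open>- w * R\<close>
  approximates \<open>1 / (1 - x/w)\<close> when \<open>R\<close> approximates
  \<open>1 / (x - w)\<close>. Hence \<open>B\<close> is an approximate inverse of
  \<open>1 - (x/s)^n\<close>.\<close>

lemma resolvent_average:
  assumes x: "x \<in> A" and n: "n > 0" and s: "s > 0"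
    and R: "\<And>k. k < n \<Longrightarrow> R k \<in> A"
    and e: "\<And>k. k < n \<Longrightarrow> q (\<lambda>z. 1 - (x z - of_real s * cis (2 * pi / n) ^ k) * R k z) \<le> e"
  defines "B \<equiv> (\<lambda>z. (\<Sum>k<n. - (of_real s * cis (2 * pi / n) ^ k) * R k z) / of_nat n)"
  shows "B \<in> A" "q (\<lambda>z. 1 - (1 - (x z / of_real s) ^ n) * B z) \<le> e * (\<Sum>l<n. (q x / s) ^ l)"
proof -
  define w where "w k = complex_of_real s * cis (2 * pi / n) ^ k" for k
  have w0: "w k \<noteq> 0" for k using s by (simp add: w_def)
  have nw: "norm (w k) = s" for k using s by (simp add: w_def norm_mult norm_power)
  have wn: "w k ^ n = of_real s ^ n" for k
  proof -
    have "(cis (2 * pi / n) ^ k) ^ n = (cis (2 * pi / n) ^ n) ^ k" by (simp add: mult.commute flip: power_mult)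
    also have "cis (2 * pi / n) ^ n = 1" using n by (simp add: Complex.DeMoivre)
    finally show ?thesis by (simp add: w_def power_mult_distrib)
  qed
  have B: "B = (\<lambda>z. 1 / of_nat n * (\<Sum>k<n. - w k * R k z))" by (simp add: B_def w_def)
  show "B \<in> A" unfolding B using R by (intro scale sum_in) auto
  let ?E = "\<lambda>k z. (1 - (x z - w k) * R k z) * (\<Sum>l<n. (1 / w k) ^ l * x z ^ l)"
  have EA: "?E k \<in> A" if "k < n" for k using R[OF that] x
    by (intro mult diff sum_in scale pow const) auto
  have "1 - (1 - (x z / of_real s) ^ n) * B z = 1 / of_nat n * (\<Sum>k<n. ?E k z)" for z
  proof -
    have *: "(1 - (x z / of_real s) ^ n) * (- w k * R k z) = (\<Sum>l<n. (x z / w k) ^ l) - ?E k z" for k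
    proof -
      have "1 - (x z / of_real s) ^ n = 1 - (x z / w k) ^ n" by (simp add: power_divide wn)
      also have "\<dots> = (1 - x z / w k) * (\<Sum>l<n. (x z / w k) ^ l)" by (rule one_diff_power_eq)
      finally have "(1 - (x z / of_real s) ^ n) * (- w k * R k z) =
         (1 - x z / w k) * (- w k * R k z) * (\<Sum>l<n. (x z / w k) ^ l)" by (simp add: mult_ac)
      also have "(1 - x z / w k) * (- w k * R k z) = 1 - (1 - (x z - w k) * R k z)"
        using w0[of k] by (simp add: field_simps)
      finally show ?thesis by (simp add: left_diff_distrib power_divide)
    qed
    have "(1 - (x z / of_real s) ^ n) * B z = 1 / of_nat n * (\<Sum>k<n. (1 - (x z / of_real s) ^ n) * (- w k * R k z))"
      unfolding B by (simp add: sum_distrib_left mult_ac)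
    also have "\<dots> = 1 / of_nat n * ((\<Sum>k<n. \<Sum>l<n. (x z / w k) ^ l) - (\<Sum>k<n. ?E k z))"
      unfolding * sum_subtractf ..
    also have "(\<Sum>k<n. \<Sum>l<n. (x z / w k) ^ l) = of_nat n"
      unfolding w_def using sum_roots_of_unity_geometric[OF n, of "of_real s" "x z"] s by simp
    finally show ?thesis using n by (simp add: right_diff_distrib)
  qed
  then have "q (\<lambda>z. 1 - (1 - (x z / of_real s) ^ n) * B z) \<le> norm (1 / of_nat n :: complex) * q (\<lambda>z. \<Sum>k<n. ?E k z)"
    using q_scale[OF sum_in[of "{..<n}" ?E], of "1 / of_nat n"] EA by auto
  moreover have "q (\<lambda>z. \<Sum>k<n. ?E k z) \<le> (\<Sum>k<n. e * (\<Sum>l<n. (q x / s) ^ l))"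
  proof (rule order_trans[OF q_sum sum_mono])
    fix k assume k: "k \<in> {..<n}"
    have 1: "q (?E k) \<le> q (\<lambda>z. 1 - (x z - w k) * R k z) * q (\<lambda>z. \<Sum>l<n. (1 / w k) ^ l * x z ^ l)"
      using R[of k] k x by (intro q_mult diff sum_in mult scale pow const) auto
    have 2: "q (\<lambda>z. \<Sum>l<n. (1 / w k) ^ l * x z ^ l) \<le> (\<Sum>l<n. (q x / s) ^ l)"
    proof (rule order_trans[OF q_sum sum_mono])
      fix l
      have "q (\<lambda>z. (1 / w k) ^ l * x z ^ l) \<le> norm ((1 / w k) ^ l) * q (\<lambda>z. x z ^ l)"
        by (intro q_scale pow x)
      also have "\<dots> \<le> norm ((1 / w k) ^ l) * q x ^ l" by (intro mult_left_mono q_pow x) auto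
      finally show "q (\<lambda>z. (1 / w k) ^ l * x z ^ l) \<le> (q x / s) ^ l"
        by (simp add: norm_power norm_divide nw power_divide)
    qed (intro scale pow x)
    have q0: "0 \<le> q (\<lambda>z. \<Sum>l<n. (1 / w k) ^ l * x z ^ l)"
      using x by (intro q_nonneg sum_in scale pow)
    have q1: "0 \<le> q (\<lambda>z. 1 - (x z - w k) * R k z)" using R[of k] k x
      by (intro q_nonneg diff mult const) auto
    have e1: "q (\<lambda>z. 1 - (x z - w k) * R k z) \<le> e" using e[of k] k by (simp add: w_def)
    show "q (?E k) \<le> e * (\<Sum>l<n. (q x / s) ^ l)"
      using order_trans[OF 1 mult_mono[OF e1 2 order_trans[OF q1 e1] q0]] .
  qed (use EA in auto)
  ultimately have "q (\<lambda>z. 1 - (1 - (x z / of_real s) ^ n) * B z) \<le>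
      norm (1 / of_nat n :: complex) * (\<Sum>k<n. e * (\<Sum>l<n. (q x / s) ^ l))"
    by (meson mult_left_mono norm_ge_zero order_trans)
  then show "q (\<lambda>z. 1 - (1 - (x z / of_real s) ^ n) * B z) \<le> e * (\<Sum>l<n. (q x / s) ^ l)"
    using n by (simp add: norm_divide)
qed

text \<open>Here \<open>rho\<close> is exactly the spectral radius. If no \<open>l\<close> with
  \<open>norm l \<ge> rho\<close> were spectral, approximate resolvents would be bounded by one
  constant \<open>C\<close> on a closed annulus. On a circle just outside, the average of the
  resolvents is near 1 because high powers of \<open>x/s\<close> are small. By the resolvent
  identity the average on the circle of radius \<open>rho\<close> is then near 1 too, which makes
  \<open>(x/rho)^n\<close> small and contradicts \<open>ge\<close>.\<close>

lemma spectral_radius_aux: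
  assumes x: "x \<in> A" and rho: "rho > 0" and ge: "\<And>N. rho ^ N \<le> q (\<lambda>z. x z ^ N)"
    and lt: "\<And>s. s > rho \<Longrightarrow> \<exists>N>0. q (\<lambda>z. x z ^ N) < s ^ N"
  shows "\<exists>l. norm l \<ge> rho \<and> (\<forall>H\<in>A. 1 \<le> q (\<lambda>z. 1 - (x z - l) * H z))"
proof (rule ccontr)
  assume "\<not> ?thesis"
  then have inv: "\<exists>H\<in>A. q (\<lambda>z. 1 - (x z - l) * H z) < 1" if "norm l \<ge> rho" for l
    using that by (meson not_le)
  define S where "S = cball 0 (rho + 1) - ball (0::complex) rho"
  have "compact S" unfolding S_def by (intro compact_diff) auto
  then obtain C where C: "C > 0" "\<And>l e. l \<in> S \<Longrightarrow> e > 0 \<Longrightarrow> \<exists>R\<in>A. q R \<le> C \<and> q (\<lambda>z. 1 - (x z - l) * R z) < e"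
    using approximate_inverse_uniform[OF x, of S] inv by (auto simp: S_def)
  \<comment> \<open>The resolvent identity bounds the difference of the terms on the two circles by
    \<open>(s - rho) * (C + rho * C^2)\<close> up to the error \<open>e\<close>. The order of choice
    is \<open>C\<close>, \<open>D\<close>, \<open>s\<close>, then the exponent \<open>n\<close>, and
    last the accuracy \<open>e\<close>, which may depend on \<open>n\<close>.\<close>
  define D where "D = C + (rho + 1) * C^2 + 1"
  have D: "D > 0" using C rho by (simp add: D_def add_pos_pos)
  define s where "s = rho + min 1 (1 / (16 * D))"
  have s: "s > rho" "s \<le> rho + 1" "s - rho \<le> 1 / (16 * D)" using D by (auto simp: s_def)
  have s0: "s > 0" using s rho by simp
  obtain N where N: "N > 0" "q (\<lambda>z. x z ^ N) < s ^ N" using lt[OF s(1)] by blast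
  define b where "b = q (\<lambda>z. x z ^ N) / s ^ N"
  have b: "0 \<le> b" "b < 1" using N s0 q_nonneg[OF pow[OF x]] by (auto simp: b_def)
  obtain m where m: "b ^ m < 1 / (16 * s * C)" using b C s0 real_arch_pow_inv[of "1 / (16 * s * C)" b] by auto
  then have m0: "b ^ Suc m < 1 / (16 * s * C)"
    using b power_decreasing[of m "Suc m" b] by linarith
  define n where "n = N * Suc m"
  have n: "n > 0" using N by (simp add: n_def)
  have ys: "q (\<lambda>z. (x z / of_real s) ^ n) \<le> 1 / (16 * s * C)"
  proof -
    have "(\<lambda>z. (x z / of_real s) ^ n) = (\<lambda>z. ((1 / of_real s) ^ N * x z ^ N) ^ Suc m)"
    proof
      fix z
      have "(x z / of_real s) ^ n = ((x z / of_real s) ^ N) ^ Suc m" unfolding n_def by (rule power_mult)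
      also have "(x z / of_real s) ^ N = (1 / of_real s) ^ N * x z ^ N" by (simp add: power_divide)
      finally show "(x z / of_real s) ^ n = ((1 / of_real s) ^ N * x z ^ N) ^ Suc m" .
    qed
    then have 1: "q (\<lambda>z. (x z / of_real s) ^ n) \<le> q (\<lambda>z. (1 / of_real s) ^ N * x z ^ N) ^ Suc m"
      by (simp only:) (intro q_pow scale pow x)
    have "q (\<lambda>z. (1 / of_real s) ^ N * x z ^ N) \<le> norm ((1 / of_real s :: complex) ^ N) * q (\<lambda>z. x z ^ N)"
      by (intro q_scale pow x)
    also have "\<dots> = b" using s0 by (simp add: b_def norm_power norm_divide power_divide)
    finally have "q (\<lambda>z. (1 / of_real s) ^ N * x z ^ N) ^ Suc m \<le> b ^ Suc m"
      by (rule power_mono[OF _ q_nonneg[OF scale[OF pow[OF x]]]])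
    then show ?thesis using 1 m0 by linarith
  qed
  define T where "T = (\<Sum>l<n. (q x / s) ^ l) + (\<Sum>l<n. (q x / rho) ^ l) + C * rho"
  have T1: "0 \<le> (\<Sum>l<n. (q x / s) ^ l)" "0 \<le> (\<Sum>l<n. (q x / rho) ^ l)"
    using q_nonneg[OF x] s0 rho by (auto intro!: sum_nonneg)
  have T: "T > 0" using T1 C rho unfolding T_def by (intro add_nonneg_pos) auto
  define e where "e = 1 / (32 * T)"
  have e: "e > 0" using T by (simp add: e_def)
  let ?w = "\<lambda>r k. complex_of_real r * cis (2 * pi / n) ^ k"
  have nw: "norm (?w r k) = r" if "r > 0" for r k using that by (simp add: norm_mult norm_power)
  have wS: "?w r k \<in> S" if "rho \<le> r" "r \<le> rho + 1" for r k
    using nw[of r k] that rho by (auto simp: S_def)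
  have "\<forall>k. \<exists>R. R \<in> A \<and> q R \<le> C \<and> q (\<lambda>z. 1 - (x z - ?w s k) * R z) < e"
    using C(2)[OF wS e, of s] s by (metis less_imp_le)
  then obtain R where R: "\<And>k. R k \<in> A" "\<And>k. q (R k) \<le> C" "\<And>k. q (\<lambda>z. 1 - (x z - ?w s k) * R k z) < e"
    by (auto dest!: choice)
  have "\<forall>k. \<exists>R. R \<in> A \<and> q R \<le> C \<and> q (\<lambda>z. 1 - (x z - ?w rho k) * R z) < e"
    using C(2)[OF wS e, of rho] by auto
  then obtain R' where R': "\<And>k. R' k \<in> A" "\<And>k. q (R' k) \<le> C" "\<And>k. q (\<lambda>z. 1 - (x z - ?w rho k) * R' k z) < e"
    by (auto dest!: choice)
  define B where "B = (\<lambda>z. (\<Sum>k<n. - ?w s k * R k z) / of_nat n)"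
  define B' where "B' = (\<lambda>z. (\<Sum>k<n. - ?w rho k * R' k z) / of_nat n)"
  have B: "B \<in> A" and BE: "q (\<lambda>z. 1 - (1 - (x z / of_real s) ^ n) * B z) \<le> e * (\<Sum>l<n. (q x / s) ^ l)"
    unfolding B_def using resolvent_average[OF x n s0, of R e] R by (auto intro: less_imp_le)
  have B': "B' \<in> A" and BE': "q (\<lambda>z. 1 - (1 - (x z / of_real rho) ^ n) * B' z) \<le> e * (\<Sum>l<n. (q x / rho) ^ l)"
    unfolding B'_def using resolvent_average[OF x n rho, of R' e] R' by (auto intro: less_imp_le)
  have eT: "e * (\<Sum>l<n. (q x / s) ^ l) \<le> 1 / 32" "e * (\<Sum>l<n. (q x / rho) ^ l) \<le> 1 / 32" "e * (C * rho) \<le> 1 / 32"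
  proof -
    have *: "e * a \<le> 1 / 32" if "a \<le> T" for a using that T by (simp add: e_def field_simps)
    have "0 \<le> C * rho" using C rho by simp
    then show "e * (\<Sum>l<n. (q x / s) ^ l) \<le> 1 / 32" "e * (\<Sum>l<n. (q x / rho) ^ l) \<le> 1 / 32" "e * (C * rho) \<le> 1 / 32"
      using T1 by (intro *; simp add: T_def)+
  qed
  have qavg: "q (\<lambda>z. (\<Sum>k<n. F k z) / of_nat n) \<le> c" if "\<And>k. F k \<in> A" "\<And>k. q (F k) \<le> c" for F c
  proof -
    have "q (\<lambda>z. (\<Sum>k<n. F k z) / of_nat n) \<le> norm (1 / of_nat n :: complex) * q (\<lambda>z. \<Sum>k<n. F k z)"
      using q_scale[OF sum_in[of "{..<n}" F], of "1 / of_nat n"] that by auto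
    moreover have "q (\<lambda>z. \<Sum>k<n. F k z) \<le> (\<Sum>k<n. c)"
      by (rule order_trans[OF q_sum sum_mono]) (use that in auto)
    ultimately have "q (\<lambda>z. (\<Sum>k<n. F k z) / of_nat n) \<le> norm (1 / of_nat n :: complex) * (\<Sum>k<n. c)"
      by (meson mult_left_mono norm_ge_zero order_trans)
    then show ?thesis using n by (simp add: norm_divide)
  qed
  have qB: "q B \<le> s * C" unfolding B_def
  proof (rule qavg)
    fix k show "q (\<lambda>z. - ?w s k * R k z) \<le> s * C"
      using order_trans[OF q_scale[OF R(1)[of k], of "- ?w s k"] mult_left_mono[OF R(2)[of k]]] nw[OF s0, of k] s0 by simp
  qed (intro scale R)
  have yA: "(\<lambda>z. (x z / of_real r) ^ n) \<in> A" for r :: real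
    using scale[OF pow[OF x], of "(1 / of_real r) ^ n" n] by (simp add: power_divide)
  have B1: "q (\<lambda>z. B z - 1) \<le> 1 / 16 + 1 / 32"
  proof -
    have "(\<lambda>z. B z - 1) = (\<lambda>z. (x z / of_real s) ^ n * B z - (1 - (1 - (x z / of_real s) ^ n) * B z))"
      by (auto simp: algebra_simps)
    then have "q (\<lambda>z. B z - 1) \<le> q (\<lambda>z. (x z / of_real s) ^ n * B z) + q (\<lambda>z. 1 - (1 - (x z / of_real s) ^ n) * B z)"
      by (simp only:) (intro q_diff mult diff const yA B)
    also have "q (\<lambda>z. (x z / of_real s) ^ n * B z) \<le> 1 / (16 * s * C) * (s * C)"
      by (rule order_trans[OF q_mult[OF yA B] mult_mono]) (use ys qB C s0 q_nonneg[OF B] in auto)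
    also have "\<dots> = 1 / 16" using s0 C by simp
    finally show ?thesis using BE eT by linarith
  qed
  have "q (\<lambda>z. B' z - B z) \<le> 1 / 8"
  proof -
    have "(\<lambda>z. B' z - B z) = (\<lambda>z. (\<Sum>k<n. ?w s k * R k z - ?w rho k * R' k z) / of_nat n)"
      unfolding B_def B'_def by (simp add: sum_subtractf sum_negf diff_divide_distrib)
    moreover have "q (\<lambda>z. (\<Sum>k<n. ?w s k * R k z - ?w rho k * R' k z) / of_nat n) \<le> 1 / 8"
    proof (rule qavg)
      fix k
      let ?p = "\<lambda>z. 1 - (x z - ?w rho k) * R' k z" and ?r = "\<lambda>z. 1 - (x z - ?w s k) * R k z"
      let ?d = "?w s k - ?w rho k"
      have nd: "norm ?d = s - rho"
      proof -
        have "?d = of_real (s - rho) * cis (2 * pi / n) ^ k" by (simp add: algebra_simps)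
        then show ?thesis using s by (simp only: norm_mult norm_power norm_cis norm_of_real) simp
      qed
      have pA: "?p \<in> A" "?r \<in> A" using x R R' by (auto intro!: diff mult const)
      have eq: "(\<lambda>z. ?w s k * R k z - ?w rho k * R' k z) =
          (\<lambda>z. (?d * R k z + ?w rho k * (?d * (R k z * R' k z))) + ?w rho k * (R k z * ?p z - R' k z * ?r z))"
        (is "_ = ?rhs")
      proof
        fix z
        \<comment> \<open>The resolvent identity with both errors kept, since \<open>r\<close> and
          \<open>r'\<close> are only approximate inverses of \<open>X - a\<close> and
          \<open>X - b\<close>.\<close>
        have "a * r - b * r' = ((a - b) * r + b * ((a - b) * (r * r'))) +
           b * (r * (1 - (X - b) * r') - r' * (1 - (X - a) * r))" for a b r r' X :: complex by algebra
        then show "?w s k * R k z - ?w rho k * R' k z = ?rhs z" .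
      qed
      have t1: "q (\<lambda>z. ?d * R k z) \<le> (s - rho) * C"
        using order_trans[OF q_scale[OF R(1)] mult_left_mono[OF R(2)[of k]], of ?d] nd s(1) by simp
      have RR: "q (\<lambda>z. R k z * R' k z) \<le> C * C"
        by (rule order_trans[OF q_mult mult_mono]) (use R R' C q_nonneg in auto)
      have "q (\<lambda>z. ?d * (R k z * R' k z)) \<le> (s - rho) * (C * C)"
        using order_trans[OF q_scale[OF mult[OF R(1)[of k] R'(1)[of k]]] mult_left_mono[OF RR], of ?d] nd s(1) by simp
      then have t2: "q (\<lambda>z. ?w rho k * (?d * (R k z * R' k z))) \<le> rho * ((s - rho) * (C * C))"
        using order_trans[OF q_scale[OF scale[OF mult[OF R(1)[of k] R'(1)[of k]]], of "?w rho k" ?d] mult_left_mono]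
          nw[OF rho, of k] rho by simp
      have t31: "q (\<lambda>z. R k z * ?p z) \<le> C * e"
        by (rule order_trans[OF q_mult[OF R(1) pA(1)] mult_mono[OF R(2) less_imp_le[OF R'(3)] less_imp_le[OF C(1)] q_nonneg[OF pA(1)]]])
      have t32: "q (\<lambda>z. R' k z * ?r z) \<le> C * e"
        by (rule order_trans[OF q_mult[OF R'(1) pA(2)] mult_mono[OF R'(2) less_imp_le[OF R(3)] less_imp_le[OF C(1)] q_nonneg[OF pA(2)]]])
      have "q (\<lambda>z. R k z * ?p z - R' k z * ?r z) \<le> C * e + C * e"
        using q_diff[OF mult[OF R(1)[of k] pA(1)] mult[OF R'(1)[of k] pA(2)]] t31 t32 by linarith
      then have t3: "q (\<lambda>z. ?w rho k * (R k z * ?p z - R' k z * ?r z)) \<le> rho * (C * e + C * e)"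
        using order_trans[OF q_scale[OF diff[OF mult[OF R(1)[of k] pA(1)] mult[OF R'(1)[of k] pA(2)]], of "?w rho k"] mult_left_mono]
          nw[OF rho, of k] rho by simp
      have "q (\<lambda>z. ?w s k * R k z - ?w rho k * R' k z) \<le> q (\<lambda>z. ?d * R k z + ?w rho k * (?d * (R k z * R' k z))) +
          q (\<lambda>z. ?w rho k * (R k z * ?p z - R' k z * ?r z))"
        unfolding eq by (intro q_add add scale diff mult R R' pA)
      also have "q (\<lambda>z. ?d * R k z + ?w rho k * (?d * (R k z * R' k z))) \<le> q (\<lambda>z. ?d * R k z) + q (\<lambda>z. ?w rho k * (?d * (R k z * R' k z)))"
        by (intro q_add add scale diff mult R R' pA)
      finally have "q (\<lambda>z. ?w s k * R k z - ?w rho k * R' k z) \<le> (s - rho) * C + rho * ((s - rho) * (C * C)) + rho * (C * e + C * e)"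
        using t1 t2 t3 by linarith
      also have "(s - rho) * C + rho * ((s - rho) * (C * C)) \<le> (s - rho) * D"
      proof -
        have "C + rho * (C * C) \<le> D" unfolding D_def power2_eq_square using C rho by (simp add: algebra_simps)
        from mult_left_mono[OF this, of "s - rho"] show ?thesis using s by (simp add: algebra_simps)
      qed
      also have "(s - rho) * D \<le> 1 / 16" using s D by (simp add: field_simps)
      finally show "q (\<lambda>z. ?w s k * R k z - ?w rho k * R' k z) \<le> 1 / 8" using eT(3) by (simp add: algebra_simps)
    qed (intro diff scale R R')
    ultimately show ?thesis by simp
  qed
  moreover have "q (\<lambda>z. (B' z - B z) + (B z - 1)) \<le> q (\<lambda>z. B' z - B z) + q (\<lambda>z. B z - 1)"
    by (intro q_add diff B B' const)
  ultimately have B1': "q (\<lambda>z. B' z - 1) \<le> 1 / 4" using B1 by simp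
  define y where "y = (\<lambda>z. (x z / of_real rho) ^ n)"
  have y: "y \<in> A" unfolding y_def by (rule yA)
  \<comment> \<open>Solving for \<open>y\<close> leaves the term \<open>y * (B' - 1)\<close> on the
    right; the bound \<open>1/4\<close> on \<open>B' - 1\<close> allows it to be absorbed on the
    left.\<close>
  have "y = (\<lambda>z. ((B' z - 1) + (1 - (1 - y z) * B' z)) - y z * (B' z - 1))"
    by (auto simp: algebra_simps)
  then have "q y = q (\<lambda>z. ((B' z - 1) + (1 - (1 - y z) * B' z)) - y z * (B' z - 1))" by simp
  also have "\<dots> \<le> q (\<lambda>z. (B' z - 1) + (1 - (1 - y z) * B' z)) + q (\<lambda>z. y z * (B' z - 1))"
    by (intro q_diff add mult diff const y B')
  also have "q (\<lambda>z. (B' z - 1) + (1 - (1 - y z) * B' z)) \<le> q (\<lambda>z. B' z - 1) + q (\<lambda>z. 1 - (1 - y z) * B' z)"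
    by (intro q_add add mult diff const y B')
  also have "q (\<lambda>z. y z * (B' z - 1)) \<le> q y * q (\<lambda>z. B' z - 1)"
    by (intro q_mult add mult diff const y B')
  also have "\<dots> \<le> q y * (1 / 4)" by (intro mult_left_mono B1' q_nonneg y)
  finally have "q y \<le> 1 / 4 + 1 / 32 + q y * (1 / 4)" using B1' BE' eT(2) unfolding y_def by linarith
  then have qy: "q y < 1" by simp
  have "q (\<lambda>z. x z ^ n) \<le> rho ^ n * q y"
  proof -
    have "(\<lambda>z. x z ^ n) = (\<lambda>z. of_real rho ^ n * y z)" using rho by (auto simp: y_def power_divide)
    then show ?thesis using q_scale[OF y, of "of_real rho ^ n"] rho by (simp add: norm_power)
  qed
  also have "\<dots> < rho ^ n" using qy rho by simp
  finally show False using ge[of n] by simp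
qed

text \<open>The infimum \<open>rho\<close> of all \<open>s > 0\<close> for which some positive power
  satisfies \<open>q (x^N) < s^N\<close> is at least \<open>th\<close> and meets the sharper
  hypotheses of \<open>spectral_radius_aux\<close>.\<close>

lemma spectral_radius:
  assumes x: "x \<in> A" and th: "th > 0" and ge: "\<And>N. th ^ N \<le> q (\<lambda>z. x z ^ N)"
  shows "\<exists>l. norm l \<ge> th \<and> (\<forall>H\<in>A. 1 \<le> q (\<lambda>z. 1 - (x z - l) * H z))"
proof -
  define S where "S = {s. s > 0 \<and> (\<exists>N>0. q (\<lambda>z. x z ^ N) < s ^ N)}"
  have lb: "th \<le> s" if "s \<in> S" for s
  proof (rule ccontr)
    assume "\<not> th \<le> s"
    with that obtain N where "N > 0" "q (\<lambda>z. x z ^ N) < s ^ N" "s > 0" "s < th" by (auto simp: S_def)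
    then show False using ge[of N] power_strict_mono[of s th N] by force
  qed
  have up: "s' \<in> S" if "s \<in> S" "s \<le> s'" for s s'
  proof -
    from that(1) obtain N where N: "N > 0" "q (\<lambda>z. x z ^ N) < s ^ N" "s > 0" by (auto simp: S_def)
    then have "q (\<lambda>z. x z ^ N) < s' ^ N" using power_mono[of s s' N] that(2) by linarith
    then show ?thesis using N that(2) by (auto simp: S_def)
  qed
  have ne: "q x + 1 \<in> S" unfolding S_def using q_nonneg[OF x] by (auto intro!: exI[of _ 1])
  define rho where "rho = Inf S"
  have bb: "bdd_below S" using lb by (auto simp: bdd_below_def)
  have rth: "rho \<ge> th" unfolding rho_def using ne lb by (intro cInf_greatest) auto
  have lt: "\<exists>N>0. q (\<lambda>z. x z ^ N) < s ^ N" if "s > rho" for s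
  proof -
    from that ne cInf_lessD[of S s] obtain s' where "s' \<in> S" "s' < s" by (auto simp: rho_def)
    then have "s \<in> S" using up by auto
    then show ?thesis by (auto simp: S_def)
  qed
  have ge': "rho ^ N \<le> q (\<lambda>z. x z ^ N)" for N
  proof (cases "N = 0")
    case False
    have "s ^ N \<le> q (\<lambda>z. x z ^ N)" if "0 < s" "s < rho" for s
    proof (rule ccontr)
      assume "\<not> ?thesis"
      then have "s \<in> S" using that False by (auto simp: S_def)
      then show False using cInf_lower[OF _ bb, of s] that by (simp add: rho_def)
    qed
    then have "eventually (\<lambda>s. s ^ N \<le> q (\<lambda>z. x z ^ N)) (at_left rho)"
      using rth th by (auto simp: eventually_at_left_field intro!: exI[of _ 0])
    moreover have "((\<lambda>s. s ^ N) \<longlongrightarrow> rho ^ N) (at_left rho)" by (intro tendsto_intros)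
    ultimately show ?thesis by (intro tendsto_upperbound[of _ _ "at_left rho"]) auto
  qed (use ge[of 0] in simp)
  show ?thesis using spectral_radius_aux[OF x _ ge' lt] rth th by force
qed

text \<open>A positive spectral radius is covered by \<open>spectral_radius\<close>. If the spectral
  radius is 0, then 0 is spectral: an approximate inverse \<open>R\<close> of \<open>x\<close>
  bounded by \<open>C\<close> would make 1 close to \<open>x^N * R^N\<close>, whose seminorm is at
  most \<open>(1/2)^N\<close> for a suitable \<open>N\<close>.\<close>

lemma spectrum_nonempty:
  assumes x: "x \<in> A" and one: "1 \<le> q (\<lambda>_. 1)"
  shows "\<exists>l. \<forall>H\<in>A. 1 \<le> q (\<lambda>z. 1 - (x z - l) * H z)"
proof (cases "\<exists>th>0. \<forall>N. th ^ N \<le> q (\<lambda>z. x z ^ N)")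
  case True
  then show ?thesis using spectral_radius[OF x] by blast
next
  case False
  have "1 \<le> q (\<lambda>z. 1 - (x z - 0) * H z)" if H: "H \<in> A" for H
  proof (rule ccontr)
    assume "\<not> ?thesis"
    then obtain b where b: "q (\<lambda>z. 1 - (x z - 0) * H z) \<le> b" "b < 1" using not_le by blast
    define C where "C = q H / (1 - b) + 1"
    have C: "C > 0" unfolding C_def using q_nonneg[OF H] b by (intro add_nonneg_pos) auto
    \<comment> \<open>\<open>N\<close> depends only on the bound \<open>C\<close>, so
      \<open>R\<close> can afterwards be made accurate enough for this \<open>N\<close>.\<close>
    obtain N where N: "q (\<lambda>z. x z ^ N) < (1 / (2 * C)) ^ N"
    proof -
      have "1 / (2 * C) > 0" using C by simp
      with False have "\<not> (\<forall>N. (1 / (2 * C)) ^ N \<le> q (\<lambda>z. x z ^ N))" by blast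
      then show ?thesis using that by (auto simp: not_le)
    qed
    have N0: "N \<noteq> 0" using N one by (cases N) auto
    define T where "T = (\<Sum>l<N. (q x * C) ^ l) + 1"
    have T: "T > 0" unfolding T_def using C q_nonneg[OF x] by (intro add_nonneg_pos sum_nonneg) auto
    obtain R where R: "R \<in> A" "q R \<le> C" "q (\<lambda>z. 1 - (x z - 0) * R z) < 1 / (4 * T)"
      using approximate_inverse[OF x H b, of "1 / (4 * T)"] T unfolding C_def by force
    let ?u = "\<lambda>z. x z * R z"
    have uA: "?u \<in> A" by (intro mult x R)
    have "q ?u \<le> q x * C" by (rule order_trans[OF q_mult mult_left_mono]) (use x R q_nonneg in auto)
    then have "(\<Sum>l<N. q ?u ^ l) \<le> (\<Sum>l<N. (q x * C) ^ l)"
      using q_nonneg[OF uA] by (intro sum_mono power_mono) auto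
    then have s: "q (\<lambda>z. \<Sum>l<N. ?u z ^ l) \<le> T"
      using order_trans[OF q_sum[of "{..<N}" "\<lambda>l z. ?u z ^ l", OF pow[OF uA]] sum_mono[OF q_pow[OF uA]]]
      unfolding T_def by force
    have eq: "(\<lambda>_. 1) = (\<lambda>z. (1 - ?u z) * (\<Sum>l<N. ?u z ^ l) + x z ^ N * R z ^ N)"
    proof
      fix z show "1 = (1 - ?u z) * (\<Sum>l<N. ?u z ^ l) + x z ^ N * R z ^ N"
        using one_diff_power_eq[of "?u z" N] by (metis diff_add_cancel power_mult_distrib)
    qed
    have "1 \<le> q (\<lambda>z. (1 - ?u z) * (\<Sum>l<N. ?u z ^ l) + x z ^ N * R z ^ N)" using one unfolding eq .
    also have "\<dots> \<le> q (\<lambda>z. (1 - ?u z) * (\<Sum>l<N. ?u z ^ l)) + q (\<lambda>z. x z ^ N * R z ^ N)"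
      by (intro q_add mult diff const sum_in pow x R)
    also have "q (\<lambda>z. (1 - ?u z) * (\<Sum>l<N. ?u z ^ l)) \<le> q (\<lambda>z. 1 - ?u z) * q (\<lambda>z. \<Sum>l<N. ?u z ^ l)"
      by (intro q_mult mult diff const sum_in pow x R)
    also have "\<dots> \<le> 1 / (4 * T) * T"
      using R(3) s T by (intro mult_mono q_nonneg sum_in pow uA) auto
    also have "1 / (4 * T) * T = 1 / 4" using T by simp
    also have "q (\<lambda>z. x z ^ N * R z ^ N) \<le> q (\<lambda>z. x z ^ N) * q (\<lambda>z. R z ^ N)" by (intro q_mult pow x R)
    also have "\<dots> \<le> (1 / (2 * C)) ^ N * C ^ N"
      using N R C order_trans[OF q_pow[OF R(1)] power_mono[OF R(2) q_nonneg[OF R(1)]]]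
      by (intro mult_mono q_nonneg pow) auto
    also have "\<dots> = (1 / 2) ^ N" using C by (simp add: power_divide power_mult_distrib)
    also have "\<dots> \<le> 1 / 2" using N0 power_decreasing[of 1 N "1 / 2 :: real"] by simp
    finally show False by simp
  qed
  then show ?thesis by blast
qed

end

section \<open>Polynomial hulls\<close>

lemma poly_hullD:
  assumes "x \<in> poly_hull K" "P \<in> poly_fun" "\<And>y. y \<in> K \<Longrightarrow> norm (P y) \<le> M"
  shows "norm (P x) \<le> M"
  using assms unfolding poly_hull_def by blast

lemma poly_hullI:
  assumes "\<And>P M. P \<in> poly_fun \<Longrightarrow> (\<And>y. y \<in> K \<Longrightarrow> norm (P y) \<le> M) \<Longrightarrow> norm (P x) \<le> M"
  shows "x \<in> poly_hull K"
  using assms unfolding poly_hull_def by blast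

lemma poly_fun_scale: "P \<in> poly_fun \<Longrightarrow> (\<lambda>x. c * P x) \<in> poly_fun"
  by (rule poly_fun.mult[OF poly_fun.const])

lemma poly_fun_diff: "P \<in> poly_fun \<Longrightarrow> Q \<in> poly_fun \<Longrightarrow> (\<lambda>x. P x - Q x) \<in> poly_fun"
  using poly_fun.add[OF _ poly_fun_scale[of Q "-1"], of P] by simp

lemma poly_fun_power: "P \<in> poly_fun \<Longrightarrow> (\<lambda>x. P x ^ k) \<in> poly_fun"
  by (induction k) (auto intro: poly_fun.intros)

lemma poly_fun_sum: "(\<And>i. i \<in> I \<Longrightarrow> P i \<in> poly_fun) \<Longrightarrow> (\<lambda>x. \<Sum>i\<in>I. P i x) \<in> poly_fun"
  by (induction I rule: infinite_finite_induct) (auto intro: poly_fun.intros)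

lemmas poly_fun_rules = poly_fun.intros poly_fun_scale poly_fun_diff poly_fun_power poly_fun_sum

lemma continuous_on_poly_fun: "P \<in> poly_fun \<Longrightarrow> continuous_on S P"
  by (induction rule: poly_fun.induct) (auto intro!: continuous_intros)

lemma poly_fun_bounded_on_compact:
  assumes "P \<in> poly_fun" "compact X"
  shows "\<exists>B>0. \<forall>z\<in>X. norm (P z) \<le> B"
proof -
  have "bounded (P ` X)" using assms by (intro compact_imp_bounded compact_continuous_image continuous_on_poly_fun)
  then show ?thesis by (auto simp: bounded_pos)
qed

lemma poly_hull_subset: "K \<subseteq> poly_hull K"
  by (auto simp: poly_hull_def)

lemma poly_hull_mono: "K \<subseteq> L \<Longrightarrow> poly_hull K \<subseteq> poly_hull L"
  unfolding poly_hull_def by blast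

lemma poly_hull_idem: "poly_hull (poly_hull K) = poly_hull K"
proof
  show "poly_hull (poly_hull K) \<subseteq> poly_hull K"
    unfolding poly_hull_def by blast
qed (rule poly_hull_subset)

lemma poly_hull_empty: "poly_hull {} = {}"
proof -
  have "x \<notin> poly_hull {}" for x :: "complex^'n"
    using poly_fun.const[of 0] by (auto simp: poly_hull_def intro!: bexI[of _ "\<lambda>_. 0"] exI[of _ "-1"])
  then show ?thesis by blast
qed

lemma compact_poly_hull:
  fixes K :: "(complex^'n) set"
  assumes "compact K"
  shows "compact (poly_hull K)"
proof -
  have "poly_hull K = (\<Inter>P\<in>poly_fun. \<Inter>M\<in>{M. \<forall>y\<in>K. norm (P y) \<le> M}. {x. norm (P x) \<le> M})"
    by (auto simp: poly_hull_def)
  moreover have "closed {x. norm (P x) \<le> M}" if "P \<in> poly_fun" for P :: "complex^'n \<Rightarrow> complex" and M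
    using continuous_on_poly_fun[OF that, of UNIV] by (intro closed_Collect_le continuous_intros) auto
  ultimately have "closed (poly_hull K)" by (auto intro!: closed_INT)
  moreover have "bounded (poly_hull K)"
  proof -
    have "\<exists>B. \<forall>x\<in>poly_hull K. norm (x $ i) \<le> B" for i
    proof -
      obtain B where "\<forall>y\<in>K. norm (y $ i) \<le> B"
        using poly_fun_bounded_on_compact[OF poly_fun.coord assms, of i] by blast
      then have "norm (x $ i) \<le> B" if "x \<in> poly_hull K" for x
        using poly_hullD[OF that poly_fun.coord, of i] by blast
      then show ?thesis by blast
    qed
    then obtain B where B: "\<And>i x. x \<in> poly_hull K \<Longrightarrow> norm (x $ i) \<le> B i" by metis
    have "norm x \<le> (\<Sum>i\<in>UNIV. B i)" if "x \<in> poly_hull K" for x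
    proof -
      have "norm x \<le> (\<Sum>i\<in>UNIV. norm (x $ i))" unfolding norm_vec_def by (rule L2_set_le_sum) simp
      also have "\<dots> \<le> (\<Sum>i\<in>UNIV. B i)" by (intro sum_mono B[OF that])
      finally show ?thesis .
    qed
    then show ?thesis by (auto simp: bounded_iff)
  qed
  ultimately show ?thesis by (simp add: compact_eq_bounded_closed)
qed

section \<open>Polynomial ideals, their quotient seminorms and common zeros\<close>

definition poly_ideal :: "((complex^'n) \<Rightarrow> complex) set \<Rightarrow> bool" where
  "poly_ideal I \<longleftrightarrow> I \<subseteq> poly_fun \<and> (\<lambda>_. 0) \<in> I \<and> (\<forall>f\<in>I. \<forall>g\<in>I. (\<lambda>z. f z + g z) \<in> I) \<and>
     (\<forall>f\<in>I. \<forall>g\<in>poly_fun. (\<lambda>z. g z * f z) \<in> I)"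

lemma poly_idealD:
  assumes "poly_ideal I"
  shows "I \<subseteq> poly_fun" "(\<lambda>_. 0) \<in> I" "\<And>f g. f \<in> I \<Longrightarrow> g \<in> I \<Longrightarrow> (\<lambda>z. f z + g z) \<in> I"
    "\<And>f g. f \<in> I \<Longrightarrow> g \<in> poly_fun \<Longrightarrow> (\<lambda>z. g z * f z) \<in> I"
  using assms by (auto simp: poly_ideal_def)

text \<open>The seminorm of the quotient by \<open>I\<close> of the polynomials with the supremum
  norm on \<open>X\<close>. Demanding \<open>0 \<le> M\<close> keeps the set of bounds bounded below
  when \<open>X\<close> is empty.\<close>

definition quotient_norm :: "(complex^'n) set \<Rightarrow> ((complex^'n) \<Rightarrow> complex) set \<Rightarrow> ((complex^'n) \<Rightarrow> complex) \<Rightarrow> real" where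
  "quotient_norm X I f = Inf {M. 0 \<le> M \<and> (\<exists>h\<in>I. \<forall>z\<in>X. norm (f z + h z) \<le> M)}"

lemma quotient_norm_le:
  assumes "0 \<le> M" "h \<in> I" "\<And>z. z \<in> X \<Longrightarrow> norm (f z + h z) \<le> M"
  shows "quotient_norm X I f \<le> M"
  unfolding quotient_norm_def using assms by (intro cInf_lower) (auto intro!: bdd_belowI[of _ 0])

lemma quotient_norm_lessE:
  assumes "compact X" "poly_ideal I" "f \<in> poly_fun" "quotient_norm X I f < b"
  obtains M h where "0 \<le> M" "M < b" "h \<in> I" "\<And>z. z \<in> X \<Longrightarrow> norm (f z + h z) \<le> M"
proof -
  let ?S = "{M. 0 \<le> M \<and> (\<exists>h\<in>I. \<forall>z\<in>X. norm (f z + h z) \<le> M)}"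
  obtain B where "B > 0" "\<forall>z\<in>X. norm (f z) \<le> B" using poly_fun_bounded_on_compact[OF assms(3,1)] by blast
  then have "B \<in> ?S" using assms(2) by (auto simp: poly_ideal_def intro!: bexI[of _ "\<lambda>_. 0"])
  then obtain M where M: "M \<in> ?S" "M < b" using assms(4) cInf_lessD[of ?S b] unfolding quotient_norm_def by blast
  then obtain h where "h \<in> I" "\<forall>z\<in>X. norm (f z + h z) \<le> M" by blast
  then show ?thesis using M by (intro that[of M h]) auto
qed

lemma quotient_norm_geI:
  assumes "compact X" "poly_ideal I" "f \<in> poly_fun"
    and "\<And>M h. 0 \<le> M \<Longrightarrow> h \<in> I \<Longrightarrow> (\<And>z. z \<in> X \<Longrightarrow> norm (f z + h z) \<le> M) \<Longrightarrow> b \<le> M"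
  shows "b \<le> quotient_norm X I f"
proof (rule ccontr)
  assume "\<not> ?thesis"
  then have "quotient_norm X I f < b" by simp
  from quotient_norm_lessE[OF assms(1-3) this] show False using assms(4) by (metis not_le)
qed

lemma seminormed_algebra_quotient:
  fixes X :: "(complex^'n) set"
  assumes X: "compact X" and I: "poly_ideal I"
  shows "seminormed_algebra poly_fun (quotient_norm X I)"
proof
  show "0 \<le> quotient_norm X I f" if "f \<in> poly_fun" for f
    by (rule quotient_norm_geI[OF X I that])
  show "quotient_norm X I (\<lambda>z. f z + g z) \<le> quotient_norm X I f + quotient_norm X I g"
    if f: "f \<in> poly_fun" and g: "g \<in> poly_fun" for f g
  proof (rule field_le_epsilon)
    fix e :: real assume "e > 0"
    then have e: "quotient_norm X I f < quotient_norm X I f + e / 2" "quotient_norm X I g < quotient_norm X I g + e / 2" by auto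
    obtain M h where 1: "0 \<le> M" "M < quotient_norm X I f + e / 2" "h \<in> I" "\<And>z. z \<in> X \<Longrightarrow> norm (f z + h z) \<le> M"
      by (rule quotient_norm_lessE[OF X I f e(1)]) (blast intro: that)
    obtain M' h' where 2: "0 \<le> M'" "M' < quotient_norm X I g + e / 2" "h' \<in> I" "\<And>z. z \<in> X \<Longrightarrow> norm (g z + h' z) \<le> M'"
      by (rule quotient_norm_lessE[OF X I g e(2)]) (blast intro: that)
    have "quotient_norm X I (\<lambda>z. f z + g z) \<le> M + M'"
    proof (rule quotient_norm_le)
      show "(\<lambda>z. h z + h' z) \<in> I" using 1 2 by (intro poly_idealD(3)[OF I])
      fix z assume z: "z \<in> X"
      have "f z + g z + (h z + h' z) = (f z + h z) + (g z + h' z)" by simp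
      then show "norm (f z + g z + (h z + h' z)) \<le> M + M'"
        using norm_triangle_ineq[of "f z + h z" "g z + h' z"] 1(4)[OF z] 2(4)[OF z] by (metis (no_types, lifting) add_mono order_trans)
    qed (use 1 2 in simp)
    then show "quotient_norm X I (\<lambda>z. f z + g z) \<le> quotient_norm X I f + quotient_norm X I g + e"
      using 1 2 by simp
  qed
  show "quotient_norm X I (\<lambda>z. f z * g z) \<le> quotient_norm X I f * quotient_norm X I g"
    if f: "f \<in> poly_fun" and g: "g \<in> poly_fun" for f g
  proof (rule ccontr)
    let ?a = "quotient_norm X I f" and ?b = "quotient_norm X I g"
    assume "\<not> ?thesis"
    then have lt: "?a * ?b < quotient_norm X I (\<lambda>z. f z * g z)" by simp
    have "((\<lambda>e. (?a + e) * (?b + e)) \<longlongrightarrow> (?a + 0) * (?b + 0)) (at_right 0)"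
      by (intro tendsto_intros)
    then have "eventually (\<lambda>e. (?a + e) * (?b + e) < quotient_norm X I (\<lambda>z. f z * g z)) (at_right 0)"
      using lt by (intro order_tendstoD(2)[of _ "?a * ?b"]) auto
    moreover have "eventually (\<lambda>e::real. e > 0) (at_right 0)" by (simp add: eventually_at_right_less)
    ultimately obtain e where e: "e > 0" "(?a + e) * (?b + e) < quotient_norm X I (\<lambda>z. f z * g z)"
      by (metis (mono_tags, lifting) eventually_conj eventually_happens trivial_limit_at_right_real)
    obtain M h where 1: "0 \<le> M" "M < ?a + e" "h \<in> I" "\<And>z. z \<in> X \<Longrightarrow> norm (f z + h z) \<le> M"
      by (rule quotient_norm_lessE[OF X I f, of "?a + e"]) (use e in \<open>auto intro: that\<close>)
    obtain M' h' where 2: "0 \<le> M'" "M' < ?b + e" "h' \<in> I" "\<And>z. z \<in> X \<Longrightarrow> norm (g z + h' z) \<le> M'"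
      by (rule quotient_norm_lessE[OF X I g, of "?b + e"]) (use e in \<open>auto intro: that\<close>)
    have "quotient_norm X I (\<lambda>z. f z * g z) \<le> M * M'"
    proof (rule quotient_norm_le)
      have "(\<lambda>z. f z * h' z) \<in> I" "(\<lambda>z. (g z + h' z) * h z) \<in> I"
        using 1 2 f g poly_idealD(1)[OF I] by (auto intro!: poly_idealD(4)[OF I] poly_fun.add)
      then show "(\<lambda>z. f z * h' z + (g z + h' z) * h z) \<in> I" by (rule poly_idealD(3)[OF I])
      fix z assume z: "z \<in> X"
      have "f z * g z + (f z * h' z + (g z + h' z) * h z) = (f z + h z) * (g z + h' z)" by (simp add: algebra_simps)
      then show "norm (f z * g z + (f z * h' z + (g z + h' z) * h z)) \<le> M * M'"
        using mult_mono[OF 1(4)[OF z] 2(4)[OF z]] 1(1) by (simp add: norm_mult)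
    qed (use 1 2 in simp)
    also have "M * M' \<le> (?a + e) * (?b + e)" using 1 2 by (intro mult_mono) auto
    finally show False using e by simp
  qed
  show "quotient_norm X I (\<lambda>_. c) \<le> norm c" for c
    using I by (intro quotient_norm_le[of _ "\<lambda>_. 0"]) (auto simp: poly_ideal_def)
qed (auto intro: poly_fun.intros)

lemma poly_ideal_adjoin:
  assumes "poly_ideal I" "f \<in> poly_fun"
  shows "poly_ideal {\<lambda>z. h z + f z * g z |h g. h \<in> I \<and> g \<in> poly_fun}" (is "poly_ideal ?J")
    and "I \<subseteq> {\<lambda>z. h z + f z * g z |h g. h \<in> I \<and> g \<in> poly_fun}"
    and "f \<in> {\<lambda>z. h z + f z * g z |h g. h \<in> I \<and> g \<in> poly_fun}"
proof -
  note i = poly_idealD[OF assms(1)]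
  have mem: "k \<in> ?J" if "h \<in> I" "g \<in> poly_fun" "k = (\<lambda>z. h z + f z * g z)" for h g k using that by blast
  show "f \<in> ?J" by (rule mem[OF i(2) poly_fun.const[of 1]]) auto
  show "I \<subseteq> ?J" using mem[OF _ poly_fun.const[of 0]] by auto
  show "poly_ideal ?J" unfolding poly_ideal_def
  proof (intro conjI ballI)
    show "?J \<subseteq> poly_fun" using i assms by (auto intro!: poly_fun.intros)
    show "(\<lambda>_. 0) \<in> ?J" by (rule mem[OF i(2) poly_fun.const[of 0]]) auto
    fix a assume "a \<in> ?J"
    then obtain h g where a: "a = (\<lambda>z. h z + f z * g z)" "h \<in> I" "g \<in> poly_fun" by blast
    show "(\<lambda>z. a z + b z) \<in> ?J" if "b \<in> ?J" for b
    proof -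
      from that obtain h' g' where b: "b = (\<lambda>z. h' z + f z * g' z)" "h' \<in> I" "g' \<in> poly_fun" by blast
      show ?thesis by (rule mem[OF i(3)[OF a(2) b(2)] poly_fun.add[OF a(3) b(3)]]) (auto simp: a b algebra_simps)
    qed
    show "(\<lambda>z. b z * a z) \<in> ?J" if "b \<in> poly_fun" for b
      by (rule mem[OF i(4)[OF a(2) that] poly_fun.mult[OF that a(3)]]) (auto simp: a algebra_simps)
  qed
qed

text \<open>If \<open>1 + h + f * g\<close> were small on \<open>X\<close>, then \<open>- g\<close>
  would be an approximate inverse of \<open>f\<close> modulo \<open>I\<close>. So adjoining a
  non-invertible \<open>f\<close> keeps the ideal proper, properness being expressed by the seminorm
  of 1.\<close>

lemma quotient_norm_one_adjoin:
  assumes X: "compact X" and I: "poly_ideal I" and f: "f \<in> poly_fun"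
    and ge: "\<And>H. H \<in> poly_fun \<Longrightarrow> 1 \<le> quotient_norm X I (\<lambda>z. 1 - f z * H z)"
  shows "1 \<le> quotient_norm X {\<lambda>z. h z + f z * g z |h g. h \<in> I \<and> g \<in> poly_fun} (\<lambda>_. 1)"
proof (rule quotient_norm_geI[OF X poly_ideal_adjoin(1)[OF I f] poly_fun.const])
  fix M k assume M: "0 \<le> M" and k: "k \<in> {\<lambda>z. h z + f z * g z |h g. h \<in> I \<and> g \<in> poly_fun}"
    and le: "\<And>z. z \<in> X \<Longrightarrow> norm (1 + k z) \<le> M"
  then obtain h g where hg: "k = (\<lambda>z. h z + f z * g z)" "h \<in> I" "g \<in> poly_fun" by blast
  have "quotient_norm X I (\<lambda>z. 1 - f z * (-1 * g z)) \<le> M"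
    using le by (intro quotient_norm_le[OF M hg(2)]) (simp add: hg(1) algebra_simps)
  then show "1 \<le> M" using ge[OF poly_fun_scale[OF hg(3), of "-1"]] by linarith
qed

text \<open>A maximal ideal is reached without Zorn's lemma: for one coordinate after the other, its
  difference from a spectral value modulo the ideal built so far is adjoined. Since the coordinates
  generate all polynomials, every \<open>P\<close> then agrees with the constant \<open>P c\<close>
  modulo \<open>J\<close>, and properness of \<open>J\<close> makes evaluation at \<open>c\<close> a
  contraction for the supremum norm on \<open>X\<close>.\<close>

lemma proper_ideal_zero:
  fixes X :: "(complex^'n) set"
  assumes X: "compact X" and I: "poly_ideal I" and one: "1 \<le> quotient_norm X I (\<lambda>_. 1)"
  shows "\<exists>c\<in>poly_hull X. \<forall>f\<in>I. f c = 0"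
proof -
  have "\<exists>c J. poly_ideal J \<and> I \<subseteq> J \<and> 1 \<le> quotient_norm X J (\<lambda>_. 1) \<and> (\<forall>i\<in>S. (\<lambda>z. z $ i - c i) \<in> J)"
    if "finite S" for S :: "'n set" using that
  proof (induction S rule: finite_induct)
    case (insert i S)
    then obtain c J where J: "poly_ideal J" "I \<subseteq> J" "1 \<le> quotient_norm X J (\<lambda>_. 1)" "\<forall>i\<in>S. (\<lambda>z. z $ i - c i) \<in> J" by blast
    obtain l where l: "\<forall>H\<in>poly_fun. 1 \<le> quotient_norm X J (\<lambda>z. 1 - (z $ i - l) * H z)"
      using seminormed_algebra.spectrum_nonempty[OF seminormed_algebra_quotient[OF X J(1)] poly_fun.coord J(3)] by blast
    have f: "(\<lambda>z. z $ i - l) \<in> poly_fun" by (intro poly_fun_rules)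
    let ?J = "{\<lambda>z. h z + (z $ i - l) * g z |h g. h \<in> J \<and> g \<in> poly_fun}"
    have J': "poly_ideal ?J" "J \<subseteq> ?J" "(\<lambda>z. z $ i - l) \<in> ?J" using poly_ideal_adjoin[OF J(1) f] by auto
    have "1 \<le> quotient_norm X ?J (\<lambda>_. 1)" using l by (intro quotient_norm_one_adjoin[OF X J(1) f]) auto
    moreover have "\<forall>j\<in>insert i S. (\<lambda>z. z $ j - (c(i := l)) j) \<in> ?J"
      using J(4) J'(2,3) insert(2) by auto
    ultimately show ?case using J' J(2) by blast
  qed (use I one in auto)
  from this[OF finite, of UNIV] obtain c0 J where J: "poly_ideal J" "I \<subseteq> J" "1 \<le> quotient_norm X J (\<lambda>_. 1)"
    "\<And>i. (\<lambda>z. z $ i - c0 i) \<in> J" by auto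
  define c where "c = (\<chi> i. c0 i)"
  note Jr = poly_idealD[OF J(1)]
  have PJ: "(\<lambda>z. P z - P c) \<in> J" if "P \<in> poly_fun" for P using that
  proof (induction rule: poly_fun.induct)
    case (coord i) then show ?case using J(4)[of i] by (simp add: c_def)
  next
    case (add P Q)
    then show ?case using Jr(3)[OF add(3,4)] by (simp add: algebra_simps)
  next
    case (mult P Q)
    have "(\<lambda>z. Q z * (P z - P c) + P c * (Q z - Q c)) \<in> J"
      by (intro Jr(3) Jr(4) mult poly_fun.const)
    then show ?case by (simp add: algebra_simps)
  qed (use Jr in simp)
  \<comment> \<open>Were \<open>norm (P c) > M\<close>, dividing by \<open>P c\<close> would
    represent 1 modulo \<open>J\<close> by a function smaller than 1 on \<open>X\<close>. With
    \<open>k = 0\<close> this puts \<open>c\<close> into the hull; with \<open>k = - f\<close> and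
    \<open>M = 0\<close> it makes \<open>f\<close> vanish at \<open>c\<close>.\<close>
  have key: "norm (P c) \<le> M" if P: "P \<in> poly_fun" and k: "k \<in> J" and M: "\<And>z. z \<in> X \<Longrightarrow> norm (P z + k z) \<le> M" "0 \<le> M" for P k M
  proof (rule ccontr)
    assume n: "\<not> norm (P c) \<le> M"
    then have 0: "P c \<noteq> 0" using M by auto
    have "(\<lambda>z. 1 / P c * ((P z - P c) + k z)) \<in> J" by (intro Jr(4) Jr(3) PJ P k poly_fun.const)
    then have "quotient_norm X J (\<lambda>_. 1) \<le> M / norm (P c)"
    proof (rule quotient_norm_le[rotated])
      fix z assume "z \<in> X"
      have "1 + 1 / P c * ((P z - P c) + k z) = (P z + k z) / P c" using 0 by (simp add: field_simps)
      then show "norm (1 + 1 / P c * ((P z - P c) + k z)) \<le> M / norm (P c)"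
        using M(1)[OF \<open>z \<in> X\<close>] by (simp add: norm_divide divide_right_mono)
    qed (use M in simp)
    moreover have "M / norm (P c) < 1" using n 0 by simp
    ultimately show False using J(3) by linarith
  qed
  have X0: "X \<noteq> {}"
  proof
    assume "X = {}"
    then have "quotient_norm X J (\<lambda>_. 1) \<le> 0" using Jr(2) by (intro quotient_norm_le[of 0 "\<lambda>_. 0"]) auto
    then show False using J(3) by simp
  qed
  have "c \<in> poly_hull X" unfolding poly_hull_def
  proof (intro CollectI ballI allI impI)
    fix P and M :: real assume P: "P \<in> poly_fun" "\<forall>y\<in>X. norm (P y) \<le> M"
    moreover have "0 \<le> M" using X0 P(2) by (metis ex_in_conv norm_ge_zero order_trans)
    ultimately show "norm (P c) \<le> M" using key[OF P(1) Jr(2), of M] by auto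
  qed
  moreover have "f c = 0" if "f \<in> I" for f
  proof -
    have f: "f \<in> J" "f \<in> poly_fun" using that J Jr by auto
    have "(\<lambda>z. -1 * f z) \<in> J" by (intro Jr(4) f poly_fun.const)
    from key[OF f(2) this, of 0] show ?thesis by simp
  qed
  ultimately show ?thesis by blast
qed

text \<open>Otherwise the spectral radius of \<open>F\<close> modulo the ideal of
  \<open>w - g\<close> is at least \<open>th\<close>, so some \<open>l\<close> with
  \<open>norm l \<ge> th\<close> is spectral. The ideal generated by \<open>w - g\<close> and
  \<open>F - l\<close> is then proper and has a zero in \<open>X\<close>: a point of the fibre
  \<open>g = w\<close> where \<open>norm F\<close> is at least \<open>th\<close>.\<close>

lemma power_small_modulo:
  fixes X :: "(complex^'n) set"
  assumes X: "compact X" "poly_hull X = X" and F: "F \<in> poly_fun" and g: "g \<in> poly_fun" and th: "th > 0"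
    and small: "\<And>z. z \<in> X \<Longrightarrow> g z = w \<Longrightarrow> norm (F z) < th"
  shows "\<exists>N>0. \<exists>H\<in>poly_fun. \<exists>b<th ^ N. \<forall>z\<in>X. norm (F z ^ N + (w - g z) * H z) \<le> b"
proof (rule ccontr)
  assume no: "\<not> ?thesis"
  let ?I = "{\<lambda>z. h z + (w - g z) * k z |h k. h \<in> {\<lambda>_. 0} \<and> k \<in> poly_fun}"
  have wg: "(\<lambda>z. w - g z) \<in> poly_fun" by (intro poly_fun_rules g)
  have z: "poly_ideal {\<lambda>_::complex^'n. 0}" by (auto simp: poly_ideal_def intro: poly_fun.intros)
  have I: "poly_ideal ?I" by (rule poly_ideal_adjoin(1)[OF z wg])
  interpret seminormed_algebra poly_fun "quotient_norm X ?I" by (rule seminormed_algebra_quotient[OF X(1) I])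
  have ge1: "th ^ N \<le> quotient_norm X ?I (\<lambda>z. F z ^ N)" if "N > 0" for N
  proof (rule quotient_norm_geI[OF X(1) I poly_fun_power[OF F]])
    fix M h assume "h \<in> ?I" and *: "\<And>z. z \<in> X \<Longrightarrow> norm (F z ^ N + h z) \<le> M"
    then obtain k where "k \<in> poly_fun" "h = (\<lambda>z. (w - g z) * k z)" by auto
    then show "th ^ N \<le> M" using no * that by (metis not_le)
  qed
  have ge: "th ^ N \<le> quotient_norm X ?I (\<lambda>z. F z ^ N)" for N
  proof (cases "N = 0")
    case True
    \<comment> \<open>The exponent 0 needs its own argument: \<open>?q F \<le> ?q F * ?q 1\<close>
      together with \<open>?q F \<ge> th > 0\<close> rules out \<open>?q 1 < 1\<close>.\<close>
    have "1 \<le> quotient_norm X ?I (\<lambda>_. 1)"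
    proof (rule ccontr)
      let ?q = "quotient_norm X ?I"
      assume "\<not> 1 \<le> ?q (\<lambda>_. 1)"
      then have lt: "?q (\<lambda>_. 1) < 1" by simp
      have p: "?q F \<le> ?q F * ?q (\<lambda>_. 1)" using q_mult[OF F const[of 1]] by simp
      have "0 < ?q F" using ge1[of 1] th by simp
      then show False using p lt by (simp add: mult_le_cancel_left1)
    qed
    then show ?thesis using True by simp
  qed (use ge1 in auto)
  obtain l where l: "norm l \<ge> th" "\<And>H. H \<in> poly_fun \<Longrightarrow> 1 \<le> quotient_norm X ?I (\<lambda>z. 1 - (F z - l) * H z)"
    using spectral_radius[OF F th ge] by blast
  have Fl: "(\<lambda>z. F z - l) \<in> poly_fun" by (intro poly_fun_rules F)
  let ?J = "{\<lambda>z. h z + (F z - l) * k z |h k. h \<in> ?I \<and> k \<in> poly_fun}"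
  obtain c where c: "c \<in> poly_hull X" "\<forall>f\<in>?J. f c = 0"
    using proper_ideal_zero[OF X(1) poly_ideal_adjoin(1)[OF I Fl] quotient_norm_one_adjoin[OF X(1) I Fl l(2)]] by blast
  have "(\<lambda>z. F z - l) \<in> ?J" by (rule poly_ideal_adjoin(3)[OF I Fl])
  from bspec[OF c(2) this] have "F c = l" by simp
  have "(\<lambda>z. w - g z) \<in> ?J" by (rule subsetD[OF poly_ideal_adjoin(2)[OF I Fl] poly_ideal_adjoin(3)[OF z wg]])
  from bspec[OF c(2) this] have "g c = w" by simp
  with \<open>F c = l\<close> show False using small[of c] c(1) X(2) l(1) by auto
qed

section \<open>The local maximum principle\<close>

text \<open>A discrete Cauchy integral of the constant 1: for large \<open>m\<close> the right side
  is near 1 inside the circle of radius \<open>s\<close> and near 0 outside it, so the mean acts as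
  a cut-off.\<close>

lemma roots_of_unity_kernel:
  fixes u :: complex and s :: real
  assumes "m > 0" "s > 0" "norm u \<noteq> s"
  shows "(\<Sum>k<m. 1 / (1 - u / (of_real s * cis (2 * pi / m) ^ k))) / of_nat m = 1 / (1 - (u / of_real s) ^ m)"
proof -
  define w where "w k = complex_of_real s * cis (2 * pi / m) ^ k" for k
  have nw: "norm (w k) = s" for k using assms by (simp add: w_def norm_mult norm_power)
  have wm: "w k ^ m = of_real s ^ m" for k
  proof -
    have "(cis (2 * pi / m) ^ k) ^ m = (cis (2 * pi / m) ^ m) ^ k" by (simp add: mult.commute flip: power_mult)
    also have "cis (2 * pi / m) ^ m = 1" using assms by (simp add: Complex.DeMoivre)
    finally show ?thesis by (simp add: w_def power_mult_distrib)
  qed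
  have ne: "1 - u / w k \<noteq> 0" for k
    using nw[of k] assms by (metis diff_eq_diff_eq diff_self divide_eq_1_iff)
  have "norm ((u / of_real s) ^ m) \<noteq> 1"
    using assms power_eq_iff_eq_base[of m "norm u / s" 1] by (auto simp: norm_power norm_divide)
  then have n1: "1 - (u / of_real s) ^ m \<noteq> 0" by (metis eq_iff_diff_eq_0 norm_one)
  have "(\<Sum>l<m. (u / w k) ^ l) = (1 - (u / of_real s) ^ m) * (1 / (1 - u / w k))" for k
  proof -
    have "(u / w k) ^ m = (u / of_real s) ^ m" by (simp add: power_divide wm)
    then have "1 - (u / of_real s) ^ m = (1 - u / w k) * (\<Sum>l<m. (u / w k) ^ l)"
      using one_diff_power_eq[of "u / w k" m] by simp
    then show ?thesis using ne[of k] by (simp only:) simp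
  qed
  then have "of_nat m = (\<Sum>k<m. (1 - (u / of_real s) ^ m) * (1 / (1 - u / w k)))"
    using sum_roots_of_unity_geometric[of m "of_real s" u] assms by (simp add: w_def)
  also have "\<dots> = (1 - (u / of_real s) ^ m) * (\<Sum>k<m. 1 / (1 - u / w k))" by (simp only: sum_distrib_left)
  finally show ?thesis using n1 assms by (simp add: w_def field_simps)
qed

text \<open>The factor \<open>M\<close> is the price of expanding an \<open>M\<close>-th power in
  \<open>local_maximum_one_function\<close>; divisibility by \<open>N\<close> lets one exponent
  serve all local choices there.\<close>

lemma power_dominates_linear:
  fixes a b C :: real
  assumes "0 < b" "b < a" "N > 0"
  shows "\<exists>M. M > 0 \<and> N dvd M \<and> C * real M * b ^ M < a ^ M"
proof -
  have "(\<lambda>n. C * (of_nat n / (a / b) ^ n)) \<longlonglongrightarrow> C * 0"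
    using assms by (intro tendsto_mult tendsto_const lim_n_over_pown) (auto simp: less_divide_eq)
  then have "\<forall>\<^sub>F n in sequentially. C * (of_nat n / (a / b) ^ n) < 1"
    by (rule order_tendstoD(2)) simp
  then obtain n0 where n0: "\<And>n. n \<ge> n0 \<Longrightarrow> C * (of_nat n / (a / b) ^ n) < 1"
    by (auto simp: eventually_sequentially)
  define M where "M = N * Suc n0"
  have "M \<ge> n0" using assms mult_le_mono1[of 1 N "Suc n0"] unfolding M_def by simp
  from n0[OF this] have "C * real M * b ^ M < a ^ M" using assms by (simp add: power_divide field_simps)
  then show ?thesis using assms by (intro exI[of _ M]) (auto simp: M_def)
qed

lemma power_add_diff_bound:
  fixes a b h :: complex and th :: real
  assumes "norm (a + h) \<le> th" "norm a \<le> th"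
  shows "norm (\<Sum>i<k. (a + h) ^ i * a ^ (k - Suc i)) \<le> real k * th ^ (k - 1)"
proof -
  have th: "0 \<le> th" using assms norm_ge_zero order_trans by blast
  have "norm (\<Sum>i<k. (a + h) ^ i * a ^ (k - Suc i)) \<le> (\<Sum>i<k. th ^ (k - 1))"
  proof (rule order_trans[OF norm_sum sum_mono])
    fix i assume "i \<in> {..<k}"
    then have "th ^ (k - 1) = th ^ i * th ^ (k - Suc i)" by (simp flip: power_add)
    then show "norm ((a + h) ^ i * a ^ (k - Suc i)) \<le> th ^ (k - 1)"
      using assms th by (auto simp: norm_mult norm_power intro!: mult_mono power_mono)
  qed
  then show ?thesis by simp
qed

lemma roots_of_unity_kernel_bounds:
  fixes s d :: real
  assumes "0 < s" "0 < d" "d < s" "e > 0"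
  shows "\<exists>m>0. \<forall>u::complex. (norm u \<le> s - d \<longrightarrow> norm (1 / (1 - (u / of_real s) ^ m) - 1) \<le> e) \<and>
     (norm u \<ge> s + d \<longrightarrow> norm (1 / (1 - (u / of_real s) ^ m)) \<le> e)"
proof -
  define r where "r = (s - d) / s"
  define R where "R = (s + d) / s"
  have r: "0 < r" "r < 1" and R: "R > 1" using assms by (auto simp: r_def R_def field_simps)
  define e' where "e' = min (1/2) (e/2)"
  have e': "0 < e'" "e' \<le> 1/2" "2 * e' \<le> e" using assms by (auto simp: e'_def)
  obtain m1 where m1: "r ^ m1 < e'" using r e' real_arch_pow_inv by blast
  obtain m2 where m2: "1 + 1 / e < R ^ m2" using R real_arch_pow by blast
  define m where "m = Suc (m1 + m2)"
  have rm: "r ^ m < e'" using m1 power_decreasing[of m1 m r] r by (auto simp: m_def)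
  have Rm: "1 + 1 / e < R ^ m" using m2 power_increasing[of m2 m R] R by (auto simp: m_def)
  have A: "norm (1 / (1 - (u / of_real s) ^ m) - 1) \<le> e" if "norm u \<le> s - d" for u :: complex
  proof -
    let ?v = "(u / of_real s) ^ m"
    have "norm u / s \<le> r" using that assms by (simp add: r_def divide_right_mono)
    then have v: "norm ?v \<le> e'" using rm assms power_mono[of "norm u / s" r m] by (simp add: norm_power norm_divide)
    then have v2: "norm (1 - ?v) \<ge> 1 / 2" using norm_triangle_ineq2[of 1 ?v] e' by simp
    then have "1 - ?v \<noteq> 0" by force
    then have "1 / (1 - ?v) - 1 = ?v / (1 - ?v)" by (simp add: field_simps)
    then have "norm (1 / (1 - ?v) - 1) = norm ?v / norm (1 - ?v)" by (simp only: norm_divide)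
    also have "\<dots> \<le> e' / (1 / 2)" using v v2 e' by (intro frac_le) auto
    finally show ?thesis using e' by simp
  qed
  have B: "norm (1 / (1 - (u / of_real s) ^ m)) \<le> e" if "norm u \<ge> s + d" for u :: complex
  proof -
    let ?v = "(u / of_real s) ^ m"
    have "R \<le> norm u / s" using that assms by (simp add: R_def divide_right_mono)
    then have "R ^ m \<le> norm ?v" using R assms power_mono[of R "norm u / s" m] by (simp add: norm_power norm_divide)
    then have "1 / e \<le> norm (1 - ?v)" using norm_triangle_ineq2[of ?v 1] Rm norm_minus_commute[of ?v 1] by simp
    then have "1 / norm (1 - ?v) \<le> 1 / (1 / e)" using assms by (intro divide_left_mono mult_pos_pos) (auto intro: less_le_trans)
    then show ?thesis by (simp add: norm_divide)
  qed
  show ?thesis using A B by (intro exI[of _ m]) (auto simp: m_def)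
qed

text \<open>Suppose \<open>F\<close> is below \<open>th\<close> on the set in question but not at
  \<open>z1\<close>. For each \<open>w\<close> on the circle, \<open>power_small_modulo\<close>
  yields \<open>h w\<close> with \<open>F^M + (w - g) * h w\<close> small on the hull, so
  \<open>- h w\<close> acts as \<open>F^M / (w - g)\<close>. The mean of
  \<open>- (w - c) * h w\<close> over equally spaced \<open>w\<close> is a polynomial close to
  \<open>F^M\<close> where \<open>g\<close> lies well inside the circle and small where it lies well
  outside. Once \<open>M\<close> is large it violates the hull inequality at
  \<open>z1\<close>.\<close>

lemma local_maximum_one_function:
  fixes K :: "(complex^'n) set"
  assumes K: "compact K" and z1: "z1 \<in> poly_hull K" and g: "g \<in> poly_fun" and gz1: "norm (g z1 - c) < s"
  shows "z1 \<in> poly_hull ({z\<in>K. norm (g z - c) \<le> s} \<union> {z\<in>poly_hull K. norm (g z - c) = s})"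
proof (rule poly_hullI, rule ccontr)
  fix F and B :: real
  assume F: "F \<in> poly_fun"
    and bound0: "\<And>y. y \<in> {z\<in>K. norm (g z - c) \<le> s} \<union> {z\<in>poly_hull K. norm (g z - c) = s} \<Longrightarrow> norm (F y) \<le> B"
    and neg: "\<not> norm (F z1) \<le> B"
  define X where "X = poly_hull K"
  have X: "compact X" "poly_hull X = X" "K \<subseteq> X" "z1 \<in> X"
    using compact_poly_hull[OF K] poly_hull_idem poly_hull_subset z1 by (auto simp: X_def)
  have s: "s > 0" using gz1 norm_ge_zero le_less_trans by blast
  \<comment> \<open>A strict bound is inserted between \<open>B\<close> and
    \<open>norm (F z1)\<close>. A negative \<open>B\<close> means that the set is empty, and then
    the constant 1 with \<open>th = 1/2\<close> serves.\<close>
  obtain F th where F: "F \<in> poly_fun" and th: "0 < th" "th < norm (F z1)"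
    and bound: "\<And>y. y \<in> K \<and> norm (g y - c) \<le> s \<or> y \<in> X \<and> norm (g y - c) = s \<Longrightarrow> norm (F y) < th"
  proof (cases "B \<ge> 0")
    case True
    define t where "t = (B + norm (F z1)) / 2"
    have "B < t" "t < norm (F z1)" using neg by (auto simp: t_def)
    then show ?thesis using True bound0 by (intro that[OF F, of t]) (force simp: X_def)+
  next
    case False
    have "y \<notin> {z\<in>K. norm (g z - c) \<le> s} \<union> {z\<in>poly_hull K. norm (g z - c) = s}" for y
      using order_trans[OF norm_ge_zero bound0] False by blast
    then show ?thesis by (intro that[OF poly_fun.const[of 1], of "1/2"]) (auto simp: X_def)
  qed
  have gc: "continuous_on S g" "continuous_on S F" for S by (intro continuous_on_poly_fun g F)+
  \<comment> \<open>On the collar of width \<open>d\<close> around the circle the kernel is of no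
    use, and the bound on \<open>h\<close> has to come from the smallness of
    \<open>F\<close>.\<close>
  obtain d where d: "0 < d" "d < s" "norm (g z1 - c) \<le> s - d"
    and dF: "\<And>z. z \<in> X \<Longrightarrow> \<bar>norm (g z - c) - s\<bar> < d \<Longrightarrow> norm (F z) < th"
  proof -
    define Y where "Y = {z\<in>X. norm (F z) \<ge> th}"
    have "closed {z. th \<le> norm (F z)}" using gc by (intro closed_Collect_le continuous_intros)
    moreover have "Y = X \<inter> {z. th \<le> norm (F z)}" by (auto simp: Y_def)
    ultimately have Y: "compact Y" using X(1) by (simp add: compact_Int_closed)
    have Yne: "Y \<noteq> {}" using X(4) th by (auto simp: Y_def)
    have "continuous_on Y (\<lambda>z. \<bar>norm (g z - c) - s\<bar>)" by (intro continuous_intros gc)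
    then obtain y where y: "y \<in> Y" "\<And>z. z \<in> Y \<Longrightarrow> \<bar>norm (g y - c) - s\<bar> \<le> \<bar>norm (g z - c) - s\<bar>"
      using continuous_attains_inf[OF Y Yne] by blast
    define e where "e = \<bar>norm (g y - c) - s\<bar>"
    have "e \<noteq> 0" using y(1) bound[of y] unfolding Y_def e_def by force
    then have e: "e > 0" unfolding e_def by simp
    define d where "d = min e (min (s / 2) (s - norm (g z1 - c)))"
    have "0 < d" "d < s" "norm (g z1 - c) \<le> s - d" "d \<le> e" using e s gz1 by (auto simp: d_def)
    moreover have "norm (F z) < th" if "z \<in> X" "\<bar>norm (g z - c) - s\<bar> < d" for z
      using y(2)[of z] that \<open>d \<le> e\<close> unfolding Y_def e_def by force
    ultimately show ?thesis using that by blast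
  qed
  have "\<exists>N H r. N > 0 \<and> H \<in> poly_fun \<and> r > 0 \<and> (\<forall>w'\<in>ball w r. \<forall>z\<in>X. norm (F z ^ N + (w' - g z) * H z) \<le> th ^ N)"
    if w: "w \<in> sphere c s" for w
  proof -
    have "norm (F z) < th" if "z \<in> X" "g z = w" for z
      using bound[of z] that w by (auto simp: dist_norm norm_minus_commute)
    then obtain N H b where NH: "N > 0" "H \<in> poly_fun" "b < th ^ N" "\<And>z. z \<in> X \<Longrightarrow> norm (F z ^ N + (w - g z) * H z) \<le> b"
      using power_small_modulo[OF X(1,2) F g th(1), of w] by blast
    obtain C where C: "C > 0" "\<And>z. z \<in> X \<Longrightarrow> norm (H z) \<le> C" using poly_fun_bounded_on_compact[OF NH(2) X(1)] by blast
    define r where "r = (th ^ N - b) / C"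
    have r: "r > 0" using NH C by (simp add: r_def)
    have "norm (F z ^ N + (w' - g z) * H z) \<le> th ^ N" if "w' \<in> ball w r" "z \<in> X" for w' z
    proof -
      have "F z ^ N + (w' - g z) * H z = (F z ^ N + (w - g z) * H z) + (w' - w) * H z" by (simp add: algebra_simps)
      then have "norm (F z ^ N + (w' - g z) * H z) \<le> norm (F z ^ N + (w - g z) * H z) + norm ((w' - w) * H z)"
        using norm_triangle_ineq by metis
      also have "norm ((w' - w) * H z) \<le> r * C" unfolding norm_mult
        using that C r by (intro mult_mono) (auto simp: dist_norm norm_minus_commute)
      also have "r * C = th ^ N - b" using C by (simp add: r_def)
      finally show ?thesis using NH(4)[OF that(2)] by simp
    qed
    then show ?thesis using NH r by blast
  qed
  then obtain N H r where NHr: "\<And>w. w \<in> sphere c s \<Longrightarrow> N w > 0 \<and> H w \<in> poly_fun \<and> r w > 0 \<and>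
      (\<forall>w'\<in>ball w (r w). \<forall>z\<in>X. norm (F z ^ N w + (w' - g z) * H w z) \<le> th ^ N w)"
    by metis
  have "sphere c s \<subseteq> (\<Union>w\<in>sphere c s. ball w (r w))" using NHr by force
  then obtain T where T: "T \<subseteq> sphere c s" "finite T" "sphere c s \<subseteq> (\<Union>w\<in>T. ball w (r w))"
    using compactE_image[OF compact_sphere, of "sphere c s" "\<lambda>w. ball w (r w)"] by (metis open_ball)
  \<comment> \<open>\<open>tau\<close> selects the local solution used at \<open>w\<close>. It may
    jump, since only finitely many \<open>w\<close> enter the polynomial.\<close>
  have "\<forall>w\<in>sphere c s. \<exists>t. t \<in> T \<and> w \<in> ball t (r t)" using T(3) by blast
  from bchoice[OF this] obtain tau where tau: "\<And>w. w \<in> sphere c s \<Longrightarrow> tau w \<in> T \<and> w \<in> ball (tau w) (r (tau w))"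
    by blast
  have NT: "N t > 0" "H t \<in> poly_fun" if "t \<in> T" for t using NHr T(1) that by auto
  have tH: "norm (F z ^ N (tau w) + (w - g z) * H (tau w) z) \<le> th ^ N (tau w)" if "w \<in> sphere c s" "z \<in> X" for w z
    using NHr[OF subsetD[OF T(1) conjunct1[OF tau[OF that(1)]]]] tau[OF that(1)] that(2) by blast
  have "\<exists>C. \<forall>z\<in>X. norm (H t z) \<le> C" if "t \<in> T" for t using poly_fun_bounded_on_compact[OF NT(2)[OF that] X(1)] by blast
  then obtain CH where CH: "\<And>t z. t \<in> T \<Longrightarrow> z \<in> X \<Longrightarrow> norm (H t z) \<le> CH t" by metis
  define C1 where "C1 = (\<Sum>t\<in>T. \<bar>CH t\<bar> / th ^ N t)"
  have C1: "\<bar>CH t\<bar> / th ^ N t \<le> C1" if "t \<in> T" for t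
    unfolding C1_def using th T(2) that by (intro member_le_sum) auto
  define Ns where "Ns = (\<Prod>t\<in>T. N t)"
  have Ns: "Ns > 0" unfolding Ns_def using NT(1) by (intro prod_pos) auto
  have Ndvd: "N t dvd Ns" if "t \<in> T" for t unfolding Ns_def using T(2) that by (rule dvd_prodI)
  define C2 where "C2 = s * C1 + s / d + 2"
  have C10: "0 \<le> C1" unfolding C1_def using th by (intro sum_nonneg) auto
  obtain M where M: "M > 0" "Ns dvd M" "(C2 + (1 + s / d)) * real M * th ^ M < norm (F z1) ^ M"
    using power_dominates_linear[OF th Ns, of "C2 + (1 + s / d)"] by blast
  \<comment> \<open>The quotient of \<open>(F^N + (w - g) * H)^k - (F^N)^k\<close> by
    \<open>w - g\<close>, where \<open>N * k = M\<close>; it passes from the local exponents to the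
    common exponent.\<close>
  define h where "h w z = H (tau w) z * (\<Sum>i<M div N (tau w). (F z ^ N (tau w) + (w - g z) * H (tau w) z) ^ i *
      (F z ^ N (tau w)) ^ (M div N (tau w) - Suc i))" for w z
  have hid: "F z ^ M + (w - g z) * h w z = (F z ^ N (tau w) + (w - g z) * H (tau w) z) ^ (M div N (tau w))"
    and Mdiv: "N (tau w) * (M div N (tau w)) = M" if w: "w \<in> sphere c s" for w z
  proof -
    let ?N = "N (tau w)" and ?k = "M div N (tau w)"
    have t: "tau w \<in> T" using tau[OF w] by blast
    show k: "?N * ?k = M" using Ndvd[OF t] M(2) by (metis dvd_mult_div_cancel dvd_trans)
    have "(F z ^ ?N + (w - g z) * H (tau w) z) ^ ?k - (F z ^ ?N) ^ ?k = (w - g z) * h w z"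
      using power_diff_sumr2[of "F z ^ ?N + (w - g z) * H (tau w) z" ?k "F z ^ ?N"] unfolding h_def
      by (simp add: mult_ac)
    then show "F z ^ M + (w - g z) * h w z = (F z ^ ?N + (w - g z) * H (tau w) z) ^ ?k"
      using k by (metis add.commute diff_add_cancel power_mult)
  qed
  have hP: "h w \<in> poly_fun" if w: "w \<in> sphere c s" for w
    unfolding h_def using NT(2)[of "tau w"] tau[OF w] by (intro poly_fun_rules g F) auto
  have hsmall: "norm (F z ^ M + (w - g z) * h w z) \<le> th ^ M" if w: "w \<in> sphere c s" and z: "z \<in> X" for w z
    using power_mono[OF tH[OF w z], of "M div N (tau w)"] Mdiv[OF w] unfolding hid[OF w]
    by (simp add: norm_power flip: power_mult)
  \<comment> \<open>Both \<open>F^N\<close> and \<open>F^N + (w - g) * H\<close> are at most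
    \<open>th^N\<close> in modulus here, so each of the \<open>k\<close> summands of
    \<open>h\<close> is under control. This is where the factor \<open>M\<close> enters.\<close>
  have hnear: "norm (h w z) \<le> C1 * M * th ^ M" if w: "w \<in> sphere c s" and z: "z \<in> X" "norm (F z) \<le> th" for w z
  proof -
    let ?N = "N (tau w)" and ?k = "M div N (tau w)"
    have t: "tau w \<in> T" using tau[OF w] by blast
    have Fz: "norm (F z ^ ?N) \<le> th ^ ?N" using power_mono[OF z(2), of ?N] by (simp add: norm_power)
    have "norm (h w z) \<le> \<bar>CH (tau w)\<bar> * (real ?k * (th ^ ?N) ^ (?k - 1))"
      unfolding h_def norm_mult
      using power_add_diff_bound[OF tH[OF w z(1)] Fz, of ?k] CH[OF t z(1)]
      by (intro mult_mono) auto
    also have "(th ^ ?N) ^ (?k - 1) = th ^ M / th ^ ?N"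
    proof -
      have "?k > 0" using Mdiv[OF w] M(1) by (metis mult_0_right neq0_conv)
      then have "th ^ ?N * (th ^ ?N) ^ (?k - 1) = (th ^ ?N) ^ ?k" by (metis power_minus_mult mult.commute)
      also have "\<dots> = th ^ M" using Mdiv[OF w] by (metis power_mult)
      finally show ?thesis using th by (simp add: field_simps)
    qed
    also have "\<bar>CH (tau w)\<bar> * (real ?k * (th ^ M / th ^ ?N)) = (\<bar>CH (tau w)\<bar> / th ^ ?N) * real ?k * th ^ M" by simp
    also have "\<dots> \<le> C1 * M * th ^ M"
      using C1[OF t] C10 th by (intro mult_mono) auto
    finally show ?thesis .
  qed
  obtain CF where CF: "CF > 0" "\<And>z. z \<in> X \<Longrightarrow> norm (F z) \<le> CF" using poly_fun_bounded_on_compact[OF F X(1)] by blast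
  \<comment> \<open>The kernel is compared after multiplication by \<open>F^M\<close>, which may be
    as large as \<open>CF^M\<close>; the accuracy \<open>(th / CF)^M\<close> brings the product down
    to \<open>th^M\<close>.\<close>
  obtain m where m: "m > 0"
    and mA: "\<And>u::complex. norm u \<le> s - d \<Longrightarrow> norm (1 / (1 - (u / of_real s) ^ m) - 1) \<le> (th / CF) ^ M"
    and mB: "\<And>u::complex. norm u \<ge> s + d \<Longrightarrow> norm (1 / (1 - (u / of_real s) ^ m)) \<le> (th / CF) ^ M"
    using roots_of_unity_kernel_bounds[OF s d(1,2), of "(th / CF) ^ M"] th CF by auto
  define w where "w k = c + complex_of_real s * cis (2 * pi / m) ^ k" for k
  have ws: "w k \<in> sphere c s" for k using s by (simp add: w_def dist_norm norm_mult norm_power)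
  have wc: "norm (w k - c) = s" for k using s by (simp add: w_def norm_mult norm_power)
  define p where "p z = - (\<Sum>k<m. (w k - c) * h (w k) z) / of_nat m" for z
  have pP: "p \<in> poly_fun"
  proof -
    have "(\<lambda>z. (- 1 / of_nat m) * (\<Sum>k<m. (w k - c) * h (w k) z)) \<in> poly_fun"
      using hP[OF ws] by (intro poly_fun_scale poly_fun_sum)
    then show ?thesis unfolding p_def by simp
  qed
  have avg: "norm ((\<Sum>k<m. a k) / of_nat m) \<le> b" if "\<And>k. norm (a k) \<le> b" for a :: "nat \<Rightarrow> complex" and b
  proof -
    have "norm (\<Sum>k<m. a k) \<le> (\<Sum>k<m. b)" by (rule order_trans[OF norm_sum sum_mono]) (rule that)
    then show ?thesis using m by (simp add: norm_divide divide_le_eq mult.commute)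
  qed
  define E where "E z = 1 / (1 - ((g z - c) / of_real s) ^ m)" for z
  have far: "norm (F z ^ M * E z - p z) \<le> s / d * th ^ M" if z: "z \<in> X" "\<bar>norm (g z - c) - s\<bar> \<ge> d" for z
  proof -
    have dist: "norm (w k - g z) \<ge> d" for k
      using z(2) wc[of k] norm_triangle_ineq3[of "w k - c" "g z - c"] by simp
    then have ne: "w k - g z \<noteq> 0" for k using d by (metis norm_zero not_le)
    have "norm (g z - c) \<noteq> s" using z(2) d by auto
    from roots_of_unity_kernel[OF m s this]
    have E: "E z = (\<Sum>k<m. 1 / (1 - (g z - c) / (w k - c))) / of_nat m" by (simp add: E_def w_def)
    have "1 / (1 - (g z - c) / (w k - c)) = (w k - c) / (w k - g z)" for k
      using ne[of k] wc[of k] s by (auto simp: field_simps)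
    then have E': "E z = (\<Sum>k<m. (w k - c) / (w k - g z)) / of_nat m" using E by simp
    have "(w k - c) / (w k - g z) * (F z ^ M + (w k - g z) * h (w k) z) =
        F z ^ M * ((w k - c) / (w k - g z)) + (w k - c) * h (w k) z" for k
      using ne[of k] by (simp add: distrib_left)
    then have "F z ^ M * E z - p z = (\<Sum>k<m. (w k - c) / (w k - g z) * (F z ^ M + (w k - g z) * h (w k) z)) / of_nat m"
      unfolding E' p_def by (simp only: sum.distrib flip: sum_distrib_left) (simp add: add_divide_distrib)
    also have "norm \<dots> \<le> s / d * th ^ M"
    proof (rule avg)
      fix k
      have "norm ((w k - c) / (w k - g z)) \<le> s / d" using wc[of k] dist[of k] d s
        by (simp add: norm_divide frac_le)
      then show "norm ((w k - c) / (w k - g z) * (F z ^ M + (w k - g z) * h (w k) z)) \<le> s / d * th ^ M"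
        unfolding norm_mult using hsmall[OF ws z(1), of k] d s by (intro mult_mono) auto
    qed
    finally show ?thesis .
  qed
  have FM: "norm (F z) ^ M * e \<le> th ^ M" if "z \<in> X" "e \<le> (th / CF) ^ M" "0 \<le> e" for z e
  proof -
    have "norm (F z) ^ M * e \<le> CF ^ M * (th / CF) ^ M"
      using CF(2)[OF that(1)] that(2,3) CF(1) th by (intro mult_mono power_mono) auto
    also have "\<dots> = th ^ M" using CF by (simp add: power_divide)
    finally show ?thesis .
  qed
  have in1: "norm (F z ^ M - p z) \<le> (1 + s / d) * th ^ M" if z: "z \<in> X" "norm (g z - c) \<le> s - d" for z
  proof -
    have "F z ^ M - p z = (F z ^ M * E z - p z) - F z ^ M * (E z - 1)" by (simp add: algebra_simps)
    also have "norm \<dots> \<le> s / d * th ^ M + norm (F z) ^ M * norm (E z - 1)"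
      using norm_triangle_ineq4[of "F z ^ M * E z - p z" "F z ^ M * (E z - 1)"] far[of z] z d
      by (simp add: norm_mult norm_power)
    also have "norm (F z) ^ M * norm (E z - 1) \<le> th ^ M" using FM[OF z(1) mA[OF z(2)]] by (simp add: E_def)
    finally show ?thesis by (simp add: algebra_simps)
  qed
  have sd: "s / d > 0" using s d by simp
  have thM: "th ^ M > 0" using th by simp
  have M1: "1 \<le> real M" using M(1) by simp
  have pK: "norm (p z) \<le> C2 * M * th ^ M" if z: "z \<in> K" for z
  proof -
    have zX: "z \<in> X" using z X(3) by blast
    consider "\<bar>norm (g z - c) - s\<bar> < d" | "norm (g z - c) \<ge> s + d" | "norm (g z - c) \<le> s - d" by linarith
    then have "norm (p z) \<le> (s * C1 * M + (s / d + 2)) * th ^ M"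
    proof cases
      case 1
      have "norm (p z) \<le> s * (C1 * M * th ^ M)" unfolding p_def minus_divide_left[symmetric] norm_minus_cancel
        using hnear[OF ws zX less_imp_le[OF dF[OF zX 1]]] wc s by (intro avg) (auto simp: norm_mult mult.assoc)
      also have "\<dots> \<le> (s * C1 * M + (s / d + 2)) * th ^ M" using mult_nonneg_nonneg[of "s / d + 2" "th ^ M"] sd thM by (simp add: algebra_simps)
      finally show ?thesis .
    next
      case 2
      have "norm (p z) \<le> norm (F z ^ M * E z) + norm (F z ^ M * E z - p z)"
        using norm_triangle_ineq4[of "F z ^ M * E z" "F z ^ M * E z - p z"] by simp
      also have "norm (F z ^ M * E z) \<le> th ^ M" using FM[OF zX mB[OF 2]] by (simp add: E_def norm_mult norm_power norm_divide)
      also have "norm (F z ^ M * E z - p z) \<le> s / d * th ^ M" using far[OF zX] 2 by simp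
      finally have "norm (p z) \<le> (s / d + 1) * th ^ M" by (simp add: algebra_simps)
      also have "\<dots> \<le> (s * C1 * M + (s / d + 2)) * th ^ M" using thM s C10 by (intro mult_right_mono) auto
      finally show ?thesis .
    next
      case 3
      have "norm (F z) < th" using bound[of z] z 3 d by auto
      then have "norm (F z ^ M) \<le> th ^ M" using power_mono[of "norm (F z)" th M] by (simp add: norm_power)
      moreover have "norm (p z) \<le> norm (F z ^ M) + norm (F z ^ M - p z)"
        using norm_triangle_ineq4[of "F z ^ M" "F z ^ M - p z"] by simp
      ultimately have "norm (p z) \<le> (s / d + 2) * th ^ M" using in1[OF zX 3] by (simp add: algebra_simps)
      also have "\<dots> \<le> (s * C1 * M + (s / d + 2)) * th ^ M" using thM s C10 by (intro mult_right_mono) auto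
      finally show ?thesis .
    qed
    also have "s * C1 * M + (s / d + 2) \<le> C2 * M"
      using mult_left_mono[OF M1, of "s / d + 2"] sd unfolding C2_def by (simp add: algebra_simps)
    finally show ?thesis using thM by (simp add: mult_right_mono)
  qed
  have "norm (p z1) \<le> C2 * M * th ^ M" using poly_hullD[OF z1 pP pK] .
  moreover have "norm (F z1 ^ M) \<le> norm (p z1) + norm (F z1 ^ M - p z1)"
    using norm_triangle_ineq[of "p z1" "F z1 ^ M - p z1"] by simp
  moreover have "norm (F z1 ^ M - p z1) \<le> (1 + s / d) * th ^ M" using in1[OF X(4) d(3)] .
  moreover have "(1 + s / d) * th ^ M \<le> (1 + s / d) * M * th ^ M"
    using M1 sd thM by (intro mult_right_mono) auto
  ultimately have "norm (F z1) ^ M \<le> (C2 + (1 + s / d)) * M * th ^ M" by (simp add: norm_power algebra_simps)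
  then show False using M(3) by simp
qed

text \<open>The principle for one function is applied to the coordinates in turn. Constraints
  already imposed survive each step, because a bound on a coordinate passes from a set to its
  hull.\<close>

lemma local_maximum_polydisc:
  fixes K :: "(complex^'n) set"
  assumes K: "compact K" and z0: "z0 \<in> poly_hull K" and s: "s > 0"
  shows "z0 \<in> poly_hull {z \<in> poly_hull K. (\<forall>i. norm (z $ i - z0 $ i) \<le> s) \<and> (z \<in> K \<or> (\<exists>i. norm (z $ i - z0 $ i) = s))}"
proof -
  let ?L = "\<lambda>I. {z \<in> poly_hull K. (\<forall>i\<in>I. norm (z $ i - z0 $ i) \<le> s) \<and> (z \<in> K \<or> (\<exists>i\<in>I. norm (z $ i - z0 $ i) = s))}"
  have "z0 \<in> poly_hull (?L I)" if "finite I" for I :: "'n set" using that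
  proof (induction I rule: finite_induct)
    case empty
    have "?L {} = K" using poly_hull_subset[of K] by auto
    then show ?case using z0 by simp
  next
    case (insert j I)
    have cont: "continuous_on UNIV (\<lambda>z::complex^'n. norm (z $ i - z0 $ i))" for i by (intro continuous_intros)
    have "?L I = (poly_hull K \<inter> (\<Inter>i\<in>I. {z. norm (z $ i - z0 $ i) \<le> s})) \<inter> (K \<union> (\<Union>i\<in>I. {z. norm (z $ i - z0 $ i) = s}))"
      by auto
    moreover have "closed (\<Inter>i\<in>I. {z::complex^'n. norm (z $ i - z0 $ i) \<le> s})"
      by (intro closed_INT ballI closed_Collect_le cont continuous_on_const)
    moreover have "closed (\<Union>i\<in>I. {z::complex^'n. norm (z $ i - z0 $ i) = s})"
      using insert(1) by (intro closed_UN ballI closed_Collect_eq cont continuous_on_const) auto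
    ultimately have cL: "compact (?L I)" using compact_poly_hull[OF K] K
      by (simp add: compact_Int_closed closed_Un compact_imp_closed)
    have sub: "poly_hull (?L I) \<subseteq> {z \<in> poly_hull K. \<forall>i\<in>I. norm (z $ i - z0 $ i) \<le> s}"
    proof
      fix z assume z: "z \<in> poly_hull (?L I)"
      have "z \<in> poly_hull (poly_hull K)" using z poly_hull_mono[of "?L I" "poly_hull K"] by blast
      moreover have "norm (z $ i - z0 $ i) \<le> s" if "i \<in> I" for i
      proof -
        have p: "(\<lambda>z::complex^'n. z $ i - z0 $ i) \<in> poly_fun" by (intro poly_fun_rules)
        show ?thesis by (rule poly_hullD[OF z p]) (use that in auto)
      qed
      ultimately show "z \<in> {z \<in> poly_hull K. \<forall>i\<in>I. norm (z $ i - z0 $ i) \<le> s}" by (simp add: poly_hull_idem)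
    qed
    have "z0 \<in> poly_hull ({z\<in>?L I. norm (z $ j - z0 $ j) \<le> s} \<union> {z\<in>poly_hull (?L I). norm (z $ j - z0 $ j) = s})"
      by (rule local_maximum_one_function[OF cL insert(3) poly_fun.coord]) (use s in simp)
    moreover have "{z\<in>?L I. norm (z $ j - z0 $ j) \<le> s} \<union> {z\<in>poly_hull (?L I). norm (z $ j - z0 $ j) = s} \<subseteq> ?L (insert j I)"
      using sub by auto
    ultimately show ?case using poly_hull_mono by blast
  qed
  from this[of UNIV] show ?thesis by simp
qed

section \<open>Mollification\<close>

lemma norm_vector_scalar_mult: "norm (c *s v) = norm c * norm (v :: complex^'n)"
proof -
  have "(\<Sum>i\<in>UNIV. (norm (c * v $ i))\<^sup>2) = (norm c)\<^sup>2 * (\<Sum>i\<in>UNIV. (norm (v $ i))\<^sup>2)"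
    by (simp add: norm_mult power_mult_distrib sum_distrib_left)
  then show ?thesis by (simp add: norm_vec_def L2_set_def real_sqrt_mult)
qed

lemma continuous_on_vector_scalar_mult [continuous_intros]:
  fixes f :: "'a::topological_space \<Rightarrow> complex" and g :: "'a \<Rightarrow> complex^'n"
  assumes "continuous_on S f" "continuous_on S g"
  shows "continuous_on S (\<lambda>x. f x *s g x)"
  unfolding vector_scalar_mult_def using assms by (intro continuous_intros)

lemma continuous_on_cis_2pi [continuous_intros]:
  "continuous_on S f \<Longrightarrow> continuous_on S (\<lambda>t. cis (2 * pi * f t))"
  by (intro continuous_intros)

lemma integral_cis: "k > 0 \<Longrightarrow> integral {0..1} (\<lambda>t. cis (2 * pi * (real k * t))) = 0"
proof -
  assume k: "k > 0"
  have "((\<lambda>t. cis (2 * pi * (real k * t))) has_integral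
      (cis (2 * pi * (real k * 1)) / (2 * pi * real k * \<i>) - cis (2 * pi * (real k * 0)) / (2 * pi * real k * \<i>))) {0..1}"
  proof (rule fundamental_theorem_of_calculus)
    fix t :: real assume "t \<in> {0..1}"
    show "((\<lambda>t. cis (2 * pi * (real k * t)) / (2 * pi * real k * \<i>)) has_vector_derivative cis (2 * pi * (real k * t))) (at t within {0..1})"
      unfolding cis_conv_exp using k
      by (auto intro!: derivative_eq_intros has_vector_derivative_real_field simp: field_simps)
  qed simp
  moreover have "cis (2 * pi * (real k * 1)) = 1" by (metis Complex.DeMoivre cis_2pi mult.commute mult.right_neutral power_one)
  ultimately show ?thesis by (auto simp: integral_unique)
qed

text \<open>The cube of the positive part is twice differentiable with Lipschitz second derivative,
  so its second-order Taylor polynomial has a cubic error even across the kink at 0.\<close>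

lemma cubic_bump_expansion:
  fixes y d :: real
  shows "\<bar>max 0 (y + d) ^ 3 - (max 0 y ^ 3 + 3 * max 0 y ^ 2 * d + 3 * max 0 y * d ^ 2)\<bar> \<le> \<bar>d\<bar> ^ 3"
proof -
  consider "y \<ge> 0" "y + d \<ge> 0" | "y \<ge> 0" "y + d < 0" | "y < 0" "y + d \<ge> 0" | "y < 0" "y + d < 0" by linarith
  then show ?thesis
  proof cases
    case 1
    then have "max 0 (y + d) ^ 3 - (max 0 y ^ 3 + 3 * max 0 y ^ 2 * d + 3 * max 0 y * d ^ 2) = d ^ 3"
      by (simp add: power2_eq_square power3_eq_cube algebra_simps)
    then show ?thesis by (simp add: power_abs)
  next
    case 2
    have "max 0 (y + d) ^ 3 - (max 0 y ^ 3 + 3 * max 0 y ^ 2 * d + 3 * max 0 y * d ^ 2) = d ^ 3 - (y + d) ^ 3"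
      using 2 by (simp add: power2_eq_square power3_eq_cube algebra_simps)
    moreover have "d ^ 3 \<le> (y + d) ^ 3" "(y + d) ^ 3 \<le> 0" using 2 by (auto simp: power_mono_odd)
    moreover have "\<bar>d\<bar> ^ 3 = - (d ^ 3)" using 2 by (simp add: power_abs abs_if)
    ultimately show ?thesis by linarith
  next
    case 3
    then have "(y + d) ^ 3 \<le> d ^ 3" by (intro power_mono) auto
    then show ?thesis using 3 by simp
  next
    case 4
    then show ?thesis by simp
  qed
qed

text \<open>Integrals are taken over boxes; the bump vanishes outside the ball of radius
  \<open>r\<close>, so integrating over the cube around that ball adds nothing.\<close>

definition symcube :: "real \<Rightarrow> (complex^'n) set" where
  "symcube r = cbox (- (r *\<^sub>R One)) (r *\<^sub>R One)"

lemma mem_symcube: "x \<in> symcube r \<longleftrightarrow> (\<forall>i\<in>Basis. \<bar>x \<bullet> i\<bar> \<le> r)"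
  by (auto simp: symcube_def mem_box abs_le_iff)

lemma cball_subset_symcube: "norm x \<le> r \<Longrightarrow> x \<in> symcube r"
  using Basis_le_norm order_trans by (fastforce simp: mem_symcube)

lemma compact_symcube: "compact (symcube r)"
  by (simp add: symcube_def compact_cbox)

text \<open>The exponent 3 gives just enough smoothness for a second-order expansion with cubic
  error.\<close>

definition bump :: "real \<Rightarrow> complex^'n \<Rightarrow> real" where
  "bump r x = max 0 (r\<^sup>2 - (norm x)\<^sup>2) ^ 3"

lemma bump_nonneg: "0 \<le> bump r x" by (simp add: bump_def)

lemma continuous_on_bump [continuous_intros]:
  "continuous_on S f \<Longrightarrow> continuous_on S (\<lambda>x. bump r (f x))"
  unfolding bump_def by (intro continuous_intros)

lemma bump_eq_0: "r \<ge> 0 \<Longrightarrow> norm x \<ge> r \<Longrightarrow> bump r x = 0"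
  using power_mono[of r "norm x" 2] by (simp add: bump_def)

definition mollify :: "real \<Rightarrow> (complex^'n \<Rightarrow> real) \<Rightarrow> complex^'n \<Rightarrow> real" where
  "mollify r V z = integral (symcube r) (\<lambda>x. bump r x * V (z + x))"

lemma integrable_symcube: "continuous_on UNIV f \<Longrightarrow> (f :: complex^'n \<Rightarrow> 'b::banach) integrable_on symcube r"
  unfolding symcube_def by (intro integrable_continuous) (auto intro: continuous_on_subset)

text \<open>Moving the increment from \<open>V\<close> to the bump makes the dependence on
  \<open>h\<close> as smooth as the bump. The cube is enlarged by 1 so that the domain does not
  depend on \<open>h\<close>.\<close>

lemma mollify_translate:
  assumes V: "continuous_on UNIV V" and r: "r > 0" and h: "norm h \<le> 1"
  shows "mollify r V (z + h) = integral (symcube (r + 1)) (\<lambda>y. bump r (y - h) * V (z + y))"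
proof -
  let ?f = "\<lambda>y. bump r (y - h) * V (z + y)"
  have Vc: "continuous_on UNIV (\<lambda>x. V (g x))" if "continuous_on UNIV g" for g
    using continuous_on_compose2[OF V that] by simp
  have cont: "continuous_on UNIV ?f" by (intro continuous_intros Vc)
  have "((\<lambda>x. ?f (x + h)) has_integral mollify r V (z + h)) (symcube r)"
  proof -
    have "(\<lambda>x. ?f (x + h)) = (\<lambda>x. bump r x * V (z + h + x))" by (auto simp: add_ac)
    moreover have "(\<lambda>x. bump r x * V (z + h + x)) integrable_on symcube r"
      by (intro integrable_symcube continuous_intros Vc)
    ultimately show ?thesis by (simp add: mollify_def has_integral_integral)
  qed
  then have 1: "(?f has_integral mollify r V (z + h)) (cbox (- (r *\<^sub>R One) + h) (r *\<^sub>R One + h))"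
    using has_integral_shift_cbox_iff[of ?f h "mollify r V (z + h)" "- (r *\<^sub>R One)" "r *\<^sub>R One"]
    unfolding symcube_def by (simp add: o_def add.commute)
  have sub: "cbox (- (r *\<^sub>R One) + h) (r *\<^sub>R One + h) \<subseteq> symcube (r + 1)"
  proof
    fix x assume x: "x \<in> cbox (- (r *\<^sub>R One) + h) (r *\<^sub>R One + h)"
    have "\<bar>x \<bullet> i\<bar> \<le> r + 1" if "i \<in> Basis" for i
    proof -
      have "- r + h \<bullet> i \<le> x \<bullet> i" "x \<bullet> i \<le> r + h \<bullet> i" using x that by (auto simp: mem_box inner_simps)
      moreover have "\<bar>h \<bullet> i\<bar> \<le> 1" using Basis_le_norm[OF that, of h] h by simp
      ultimately show ?thesis by (auto simp: abs_if split: if_splits)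
    qed
    then show "x \<in> symcube (r + 1)" by (simp add: mem_symcube)
  qed
  have "(?f has_integral mollify r V (z + h)) (symcube (r + 1))"
  proof (rule has_integral_on_superset[OF 1 _ sub])
    fix y assume y: "y \<notin> cbox (- (r *\<^sub>R One) + h) (r *\<^sub>R One + h)"
    have "norm (y - h) \<ge> r"
    proof (rule ccontr)
      assume "\<not> ?thesis"
      then have "y - h \<in> symcube r" by (intro cball_subset_symcube) auto
      then show False using y by (auto simp: mem_symcube mem_box inner_simps abs_le_iff)
    qed
    then show "?f y = 0" using bump_eq_0[of r "y - h"] r by simp
  qed
  then show ?thesis by (simp add: integral_unique)
qed

lemma mollify_submean:
  fixes V :: "complex^'n \<Rightarrow> real"
  assumes V: "continuous_on UNIV V"
    and submean: "\<And>z v. V z \<le> integral {0..1} (\<lambda>t. V (z + cis (2 * pi * t) *s v))"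
  shows "mollify r V z \<le> integral {0..1} (\<lambda>t. mollify r V (z + cis (2 * pi * t) *s v))"
proof -
  have Vc: "continuous_on S (\<lambda>x. V (g x))" if "continuous_on S g" for g and S :: "'b::topological_space set"
    using continuous_on_compose2[OF V that] by simp
  have "mollify r V z \<le> integral (symcube r) (\<lambda>x. integral {0..1} (\<lambda>t. bump r x * V (z + x + cis (2 * pi * t) *s v)))"
    unfolding mollify_def
  proof (rule integral_le)
    show "(\<lambda>x. bump r x * V (z + x)) integrable_on symcube r"
      by (intro integrable_symcube continuous_intros Vc)
    have "continuous_on UNIV (\<lambda>x. integral (cbox 0 1) (\<lambda>t. bump r x * V (z + x + cis (2 * pi * t) *s v)))"
      by (rule integral_continuous_on_param)
        (auto simp: split_def intro!: continuous_intros Vc)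
    then show "(\<lambda>x. integral {0..1} (\<lambda>t. bump r x * V (z + x + cis (2 * pi * t) *s v))) integrable_on symcube r"
      by (intro integrable_symcube) simp
    fix x :: "complex^'n"
    show "bump r x * V (z + x) \<le> integral {0..1} (\<lambda>t. bump r x * V (z + x + cis (2 * pi * t) *s v))"
      using mult_left_mono[OF submean[of "z + x" v] bump_nonneg[of r x]] by simp
  qed
  also have "\<dots> = integral {0..1} (\<lambda>t. integral (symcube r) (\<lambda>x. bump r x * V (z + x + cis (2 * pi * t) *s v)))"
    unfolding symcube_def box_real(2)[symmetric]
    by (rule integral_swap_continuous) (auto simp: split_def intro!: continuous_intros Vc)
  also have "\<dots> = integral {0..1} (\<lambda>t. mollify r V (z + cis (2 * pi * t) *s v))"
    unfolding mollify_def by (simp add: add_ac)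
  finally show ?thesis .
qed

lemma continuous_on_mollify:
  assumes V: "continuous_on UNIV V"
  shows "continuous_on UNIV (mollify r V)"
proof -
  have Vc: "continuous_on S (\<lambda>x. V (g x))" if "continuous_on S g" for g and S :: "'b::topological_space set"
    using continuous_on_compose2[OF V that] by simp
  show ?thesis unfolding mollify_def[abs_def] symcube_def
    by (rule integral_continuous_on_param) (auto simp: split_def intro!: continuous_intros Vc)
qed

text \<open>Conjugation sits on the first argument, so that the product is complex linear in
  \<open>h\<close> and yields polynomials in \<open>h\<close>.\<close>

definition hermitian_product :: "complex^'n \<Rightarrow> complex^'n \<Rightarrow> complex" where
  "hermitian_product y h = (\<Sum>i\<in>UNIV. cnj (y $ i) * h $ i)"

lemma Re_hermitian_product: "Re (hermitian_product y h) = y \<bullet> h"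
  by (simp add: hermitian_product_def inner_vec_def inner_complex_def)

lemma hermitian_product_scale: "hermitian_product y (c *s h) = c * hermitian_product y h"
  by (simp add: hermitian_product_def sum_distrib_left mult_ac)

lemma continuous_on_hermitian_product [continuous_intros]:
  "continuous_on S f \<Longrightarrow> continuous_on S g \<Longrightarrow> continuous_on S (\<lambda>x. hermitian_product (f x) (g x))"
  unfolding hermitian_product_def by (intro continuous_intros)

text \<open>With \<open>b = Re x\<close> and \<open>d = 2 * b - (norm h)^2\<close>, the identity
  \<open>2 * b^2 = (norm x)^2 + Re (x^2)\<close> sorts the second-order terms by type: the real part
  of a holomorphic quadratic polynomial in \<open>h\<close>, and a Levi form, which is the part that
  circle means detect.\<close>

lemma bump_expansion:
  fixes y h :: "complex^'n" and r :: real
  assumes h: "norm h \<le> 1" and y: "norm y \<le> R" "1 \<le> R" and r: "0 \<le> r"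
  defines "Y \<equiv> max 0 (r\<^sup>2 - (norm y)\<^sup>2)" and "x \<equiv> hermitian_product y h"
  shows "\<bar>bump r (y - h) - (bump r y + Re (of_real (6 * Y\<^sup>2) * x + of_real (6 * Y) * x\<^sup>2)
       + (6 * Y * (norm x)\<^sup>2 - 3 * Y\<^sup>2 * (norm h)\<^sup>2))\<bar> \<le> (27 * R ^ 3 + 15 * r\<^sup>2 * R) * norm h ^ 3"
proof -
  define d where "d = 2 * (y \<bullet> h) - (norm h)\<^sup>2"
  define b where "b = y \<bullet> h"
  define n where "n = norm h"
  have n: "0 \<le> n" "n \<le> 1" using h by (auto simp: n_def)
  have bn: "\<bar>b\<bar> \<le> R * n"
    using Cauchy_Schwarz_ineq2[of y h] mult_right_mono[OF y(1) norm_ge_zero[of h]] by (simp add: b_def n_def)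
  have db: "d = 2 * b - n\<^sup>2" by (simp add: d_def b_def n_def)
  have "(norm (y - h))\<^sup>2 = (norm y)\<^sup>2 - 2 * (y \<bullet> h) + (norm h)\<^sup>2"
    by (simp add: power2_norm_eq_inner inner_diff_left inner_diff_right inner_commute)
  then have "r\<^sup>2 - (norm (y - h))\<^sup>2 = (r\<^sup>2 - (norm y)\<^sup>2) + d" by (simp add: d_def)
  then have 1: "bump r (y - h) = max 0 ((r\<^sup>2 - (norm y)\<^sup>2) + d) ^ 3" unfolding bump_def by (simp only:)
  have nn: "n\<^sup>2 \<le> n" using n by (simp add: power2_eq_square mult_left_le_one_le)
  have "\<bar>d\<bar> \<le> 3 * R * n"
  proof -
    have "\<bar>d\<bar> \<le> 2 * \<bar>b\<bar> + n\<^sup>2" unfolding db using abs_triangle_ineq4[of "2 * b" "n\<^sup>2"] by (simp add: abs_mult)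
    also have "n\<^sup>2 \<le> R * n" using nn mult_right_mono[OF y(2) n(1)] by simp
    finally show ?thesis using bn by simp
  qed
  then have d3: "\<bar>d\<bar> ^ 3 \<le> 27 * R ^ 3 * n ^ 3" using power_mono[of "\<bar>d\<bar>" "3 * R * n" 3] by (simp add: power_mult_distrib)
  have Re2: "2 * b\<^sup>2 = (norm x)\<^sup>2 + Re (x\<^sup>2)"
  proof -
    have "Re x = b" using Re_hermitian_product[of y h] by (simp add: x_def b_def)
    then show ?thesis unfolding cmod_power2 Re_power2 by simp
  qed
  have "bump r y + 3 * Y\<^sup>2 * d + 3 * Y * d\<^sup>2 = bump r y + Re (of_real (6 * Y\<^sup>2) * x + of_real (6 * Y) * x\<^sup>2)
       + (6 * Y * (norm x)\<^sup>2 - 3 * Y\<^sup>2 * n\<^sup>2) + 3 * Y * (n ^ 4 - 4 * b * n\<^sup>2)"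
  proof -
    have "Re (of_real (6 * Y\<^sup>2) * x + of_real (6 * Y) * x\<^sup>2) = 6 * Y\<^sup>2 * b + 6 * Y * Re (x\<^sup>2)"
      using Re_hermitian_product[of y h] by (simp add: x_def b_def)
    then have "Re (of_real (6 * Y\<^sup>2) * x + of_real (6 * Y) * x\<^sup>2) + 6 * Y * (norm x)\<^sup>2 = 6 * Y\<^sup>2 * b + 6 * Y * (2 * b\<^sup>2)"
      unfolding Re2 by (simp add: algebra_simps)
    moreover have "3 * Y\<^sup>2 * d + 3 * Y * d\<^sup>2 = 6 * Y\<^sup>2 * b + 6 * Y * (2 * b\<^sup>2) - 3 * Y\<^sup>2 * n\<^sup>2 + 3 * Y * (n ^ 4 - 4 * b * n\<^sup>2)"
      unfolding db by (simp add: power2_eq_square power4_eq_xxxx algebra_simps)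
    ultimately show ?thesis by linarith
  qed
  moreover have "\<bar>3 * Y * (n ^ 4 - 4 * b * n\<^sup>2)\<bar> \<le> 15 * r\<^sup>2 * R * n ^ 3"
  proof -
    have "\<bar>n ^ 4 - 4 * b * n\<^sup>2\<bar> \<le> n ^ 4 + 4 * \<bar>b\<bar> * n\<^sup>2" using abs_triangle_ineq4[of "n ^ 4" "4 * b * n\<^sup>2"] by (simp add: abs_mult)
    also have "\<dots> \<le> R * n ^ 3 + 4 * (R * n) * n\<^sup>2"
    proof (intro add_mono mult_mono)
      have "n ^ 4 = n * n ^ 3" by (simp add: power4_eq_xxxx power3_eq_cube)
      then show "n ^ 4 \<le> R * n ^ 3" using n y by (simp add: mult_right_mono)
    qed (use bn n in auto)
    also have "\<dots> = 5 * R * n ^ 3" by (simp add: power2_eq_square power3_eq_cube)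
    finally have *: "\<bar>n ^ 4 - 4 * b * n\<^sup>2\<bar> \<le> 5 * R * n ^ 3" .
    have Y: "0 \<le> Y" "Y \<le> r\<^sup>2" by (auto simp: Y_def)
    have "\<bar>3 * Y * (n ^ 4 - 4 * b * n\<^sup>2)\<bar> = 3 * Y * \<bar>n ^ 4 - 4 * b * n\<^sup>2\<bar>" using Y by (simp add: abs_mult)
    also have "\<dots> \<le> 3 * r\<^sup>2 * (5 * R * n ^ 3)" using Y * by (intro mult_mono) auto
    finally show ?thesis by simp
  qed
  moreover have "\<bar>bump r (y - h) - (bump r y + 3 * Y\<^sup>2 * d + 3 * Y * d\<^sup>2)\<bar> \<le> \<bar>d\<bar> ^ 3"
    using cubic_bump_expansion[of "r\<^sup>2 - (norm y)\<^sup>2" d] unfolding 1 by (simp add: bump_def Y_def)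
  ultimately have "\<bar>bump r (y - h) - (bump r y + Re (of_real (6 * Y\<^sup>2) * x + of_real (6 * Y) * x\<^sup>2)
       + (6 * Y * (norm x)\<^sup>2 - 3 * Y\<^sup>2 * n\<^sup>2))\<bar> \<le> 27 * R ^ 3 * n ^ 3 + 15 * r\<^sup>2 * R * n ^ 3"
    using d3 by linarith
  then show ?thesis unfolding n_def by (simp add: distrib_right)
qed

text \<open>The expansion of the bump is integrated against \<open>V\<close>, giving a holomorphic
  part \<open>a + b\<close> and a Levi form \<open>lam\<close>. Circle means kill the real part of
  the former, so the submean property forces \<open>lam h \<ge> 0\<close>, and dropping
  \<open>lam\<close> leaves a minorant.\<close>

lemma mollify_quadratic_minorant:
  fixes V :: "complex^'n \<Rightarrow> real"
  assumes V: "continuous_on UNIV V" and r: "r > 0"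
    and submean: "\<And>z v. V z \<le> integral {0..1} (\<lambda>t. V (z + cis (2 * pi * t) *s v))"
  shows "\<exists>P\<in>poly_fun. \<exists>C. P 0 = 0 \<and> (\<forall>h. norm h \<le> 1 \<longrightarrow> mollify r V z0 + Re (P h) - C * norm h ^ 3 \<le> mollify r V (z0 + h))"
proof -
  define S :: "(complex^'n) set" where "S = symcube (r + 1)"
  have Vc: "continuous_on A (\<lambda>x. V (g x))" if "continuous_on A g" for g and A :: "'b::topological_space set"
    using continuous_on_compose2[OF V that] by simp
  define Y where "Y y = max 0 (r\<^sup>2 - (norm y)\<^sup>2)" for y :: "complex^'n"
  have Yc: "continuous_on A Y" for A unfolding Y_def by (intro continuous_intros)
  have Yc': "continuous_on A (\<lambda>x. Y (g x))" if "continuous_on A g" for g and A :: "'b::topological_space set"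
    using continuous_on_compose2[OF Yc[of UNIV] that] by simp
  note cont = continuous_intros Vc Yc'
  define a where "a h = integral S (\<lambda>y. of_real (6 * (Y y)\<^sup>2 * V (z0 + y)) * hermitian_product y h)" for h
  define b where "b h = integral S (\<lambda>y. of_real (6 * Y y * V (z0 + y)) * (hermitian_product y h)\<^sup>2)" for h
  define lam where "lam h = integral S (\<lambda>y. V (z0 + y) * (6 * Y y * (norm (hermitian_product y h))\<^sup>2 - 3 * (Y y)\<^sup>2 * (norm h)\<^sup>2))" for h
  have int: "f integrable_on S" if "continuous_on UNIV f" for f :: "complex^'n \<Rightarrow> 'c::banach"
    unfolding S_def by (rule integrable_symcube[OF that])
  have scale: "a (c *s h) = c * a h" "b (c *s h) = c\<^sup>2 * b h" for c h
    unfolding a_def b_def hermitian_product_scale power_mult_distrib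
    by (simp_all add: mult.left_commute flip: integral_mult_right)
  have lscale: "lam (c *s h) = (norm c)\<^sup>2 * lam h" for c h
    unfolding lam_def hermitian_product_scale norm_vector_scalar_mult norm_mult power_mult_distrib
    by (subst integral_mult_right[symmetric]) (simp add: algebra_simps)
  have aP: "a \<in> poly_fun"
  proof -
    have "a h = (\<Sum>i\<in>UNIV. integral S (\<lambda>y. of_real (6 * (Y y)\<^sup>2 * V (z0 + y)) * cnj (y $ i)) * h $ i)" for h
    proof -
      have "a h = integral S (\<lambda>y. \<Sum>i\<in>UNIV. of_real (6 * (Y y)\<^sup>2 * V (z0 + y)) * cnj (y $ i) * h $ i)"
        by (simp add: a_def hermitian_product_def sum_distrib_left mult.assoc)
      also have "\<dots> = (\<Sum>i\<in>UNIV. integral S (\<lambda>y. of_real (6 * (Y y)\<^sup>2 * V (z0 + y)) * cnj (y $ i) * h $ i))"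
        by (intro integral_sum int cont) auto
      finally show ?thesis by simp
    qed
    then have "a = (\<lambda>h. \<Sum>i\<in>UNIV. integral S (\<lambda>y. of_real (6 * (Y y)\<^sup>2 * V (z0 + y)) * cnj (y $ i)) * h $ i)" by (rule ext)
    then show ?thesis by (simp only:) (intro poly_fun_rules)
  qed
  have bP: "b \<in> poly_fun"
  proof -
    have "b h = (\<Sum>i\<in>UNIV. \<Sum>j\<in>UNIV. integral S (\<lambda>y. of_real (6 * Y y * V (z0 + y)) * (cnj (y $ i) * cnj (y $ j))) * (h $ i * h $ j))" for h
    proof -
      have "b h = integral S (\<lambda>y. \<Sum>i\<in>UNIV. \<Sum>j\<in>UNIV. of_real (6 * Y y * V (z0 + y)) * (cnj (y $ i) * cnj (y $ j)) * (h $ i * h $ j))"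
        by (simp add: b_def hermitian_product_def power2_eq_square sum_product sum_distrib_left mult_ac)
      also have "\<dots> = (\<Sum>i\<in>UNIV. integral S (\<lambda>y. \<Sum>j\<in>UNIV. of_real (6 * Y y * V (z0 + y)) * (cnj (y $ i) * cnj (y $ j)) * (h $ i * h $ j)))"
        by (intro integral_sum int cont) auto
      also have "\<dots> = (\<Sum>i\<in>UNIV. \<Sum>j\<in>UNIV. integral S (\<lambda>y. of_real (6 * Y y * V (z0 + y)) * (cnj (y $ i) * cnj (y $ j)) * (h $ i * h $ j)))"
        by (intro sum.cong refl integral_sum int cont) auto
      finally show ?thesis by simp
    qed
    then have "b = (\<lambda>h. \<Sum>i\<in>UNIV. \<Sum>j\<in>UNIV. integral S (\<lambda>y. of_real (6 * Y y * V (z0 + y)) * (cnj (y $ i) * cnj (y $ j))) * (h $ i * h $ j))" by (rule ext)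
    then show ?thesis by (simp only:) (intro poly_fun_rules)
  qed
  obtain R where R: "R \<ge> 1" "\<And>y. y \<in> S \<Longrightarrow> norm y \<le> R"
  proof -
    obtain R where "\<forall>y\<in>S. norm y \<le> R" using compact_imp_bounded[OF compact_symcube, of "r + 1"] unfolding S_def bounded_iff by blast
    then show ?thesis by (intro that[of "max 1 R"]) auto
  qed
  obtain CV where CV: "\<And>y. y \<in> S \<Longrightarrow> norm (V (z0 + y)) \<le> CV"
  proof -
    have "compact ((\<lambda>y. V (z0 + y)) ` S)" unfolding S_def by (intro compact_continuous_image compact_symcube cont)
    then obtain B where "\<forall>y\<in>S. norm (V (z0 + y)) \<le> B" by (auto dest!: compact_imp_bounded simp: bounded_iff)
    then show ?thesis by (intro that[of B]) blast
  qed
  define C0 where "C0 = 27 * R ^ 3 + 15 * r\<^sup>2 * R"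
  have C0: "C0 \<ge> 0" using R by (simp add: C0_def)
  define C where "C = integral S (\<lambda>y. CV * C0)"
  have exp: "\<bar>mollify r V (z0 + h) - (mollify r V z0 + Re (a h + b h) + lam h)\<bar> \<le> C * norm h ^ 3" if h: "norm h \<le> 1" for h
  proof -
    let ?m = "\<lambda>y. V (z0 + y) * (bump r y + Re (of_real (6 * (Y y)\<^sup>2) * hermitian_product y h + of_real (6 * Y y) * (hermitian_product y h)\<^sup>2)
       + (6 * Y y * (norm (hermitian_product y h))\<^sup>2 - 3 * (Y y)\<^sup>2 * (norm h)\<^sup>2))"
    have m0: "mollify r V z0 = integral S (\<lambda>y. V (z0 + y) * bump r y)"
      using mollify_translate[OF V r, of 0 z0] by (simp add: S_def mult.commute)
    have mh: "mollify r V (z0 + h) = integral S (\<lambda>y. V (z0 + y) * bump r (y - h))"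
      using mollify_translate[OF V r h, of z0] by (simp add: S_def mult.commute)
    have "integral S ?m = integral S (\<lambda>y. (V (z0 + y) * bump r y + (Re (of_real (6 * (Y y)\<^sup>2 * V (z0 + y)) * hermitian_product y h)
        + Re (of_real (6 * Y y * V (z0 + y)) * (hermitian_product y h)\<^sup>2)))
        + V (z0 + y) * (6 * Y y * (norm (hermitian_product y h))\<^sup>2 - 3 * (Y y)\<^sup>2 * (norm h)\<^sup>2))"
      by (rule arg_cong[where f = "integral S"]) (auto simp: algebra_simps)
    also have "\<dots> = mollify r V z0 + (Re (a h) + Re (b h)) + lam h"
    proof -
      have Re: "integral S (\<lambda>y. Re (f y)) = Re (integral S f)" if "continuous_on UNIV f" for f
        using integral_linear[OF int[OF that] bounded_linear_Re] by (simp add: o_def)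
      have add4: "integral S (\<lambda>y. (f0 y + (f1 y + f2 y)) + f3 y) = integral S f0 + (integral S f1 + integral S f2) + integral S f3"
        if "continuous_on UNIV f0" "continuous_on UNIV f1" "continuous_on UNIV f2" "continuous_on UNIV f3"
        for f0 f1 f2 f3 :: "complex^'n \<Rightarrow> real"
        using that by (simp add: integral_add int continuous_on_add)
      have Rea: "Re (a h) = integral S (\<lambda>y. Re (of_real (6 * (Y y)\<^sup>2 * V (z0 + y)) * hermitian_product y h))"
        unfolding a_def by (rule Re[symmetric]) (intro cont)
      have Reb: "Re (b h) = integral S (\<lambda>y. Re (of_real (6 * Y y * V (z0 + y)) * (hermitian_product y h)\<^sup>2))"
        unfolding b_def by (rule Re[symmetric]) (intro cont)
      show ?thesis unfolding m0 lam_def Rea Reb by (rule add4) (intro cont)+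
    qed
    finally have m: "integral S ?m = mollify r V z0 + Re (a h + b h) + lam h" by simp
    have eq: "mollify r V (z0 + h) - integral S ?m = integral S (\<lambda>y. V (z0 + y) * bump r (y - h) - ?m y)"
      unfolding mh by (intro integral_diff[symmetric] int cont)
    have le: "norm (integral S (\<lambda>y. V (z0 + y) * bump r (y - h) - ?m y)) \<le> integral S (\<lambda>y. CV * C0 * norm h ^ 3)"
    proof (rule Henstock_Kurzweil_Integration.integral_norm_bound_integral)
      fix y assume y: "y \<in> S"
      have "norm (V (z0 + y) * bump r (y - h) - ?m y) = norm (V (z0 + y)) * \<bar>bump r (y - h) - (bump r y + Re (of_real (6 * (Y y)\<^sup>2) * hermitian_product y h + of_real (6 * Y y) * (hermitian_product y h)\<^sup>2)
       + (6 * Y y * (norm (hermitian_product y h))\<^sup>2 - 3 * (Y y)\<^sup>2 * (norm h)\<^sup>2))\<bar>"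
        by (simp only: right_diff_distrib[symmetric] real_norm_def abs_mult)
      also have "\<dots> \<le> CV * (C0 * norm h ^ 3)"
        unfolding Y_def C0_def using CV[OF y] R r bump_expansion[OF h R(2)[OF y] R(1), of r]
        by (intro mult_mono) (auto intro: order_trans[OF norm_ge_zero])
      finally show "norm (V (z0 + y) * bump r (y - h) - ?m y) \<le> CV * C0 * norm h ^ 3" by (simp add: mult.assoc)
    qed (intro int cont)+
    have "integral S (\<lambda>y. CV * C0 * norm h ^ 3) = C * norm h ^ 3"
      unfolding C_def S_def symcube_def by (simp add: mult.assoc)
    then show ?thesis using le unfolding eq[symmetric] m by (simp only: real_norm_def)
  qed
  have int0: "integral {0..1} (\<lambda>t. Re (cis (2 * pi * t) * u + (cis (2 * pi * t))\<^sup>2 * v)) = 0" for u v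
  proof -
    have i: "(\<lambda>t. cis (2 * pi * t) * u + (cis (2 * pi * t))\<^sup>2 * v) integrable_on {0..1}"
      by (intro integrable_continuous_real continuous_intros)
    have "integral {0..1} (\<lambda>t. cis (2 * pi * t) * u + (cis (2 * pi * t))\<^sup>2 * v) =
       integral {0..1} (\<lambda>t. cis (2 * pi * t)) * u + integral {0..1} (\<lambda>t. (cis (2 * pi * t))\<^sup>2) * v"
      by (subst integral_add) (auto intro!: integrable_continuous_real continuous_intros)
    moreover have "integral {0..1} (\<lambda>t. (cis (2 * pi * t))\<^sup>2) = 0"
    proof -
      have "(cis (2 * pi * t))\<^sup>2 = cis (2 * pi * (real 2 * t))" for t by (simp add: Complex.DeMoivre mult_ac)
      then show ?thesis using integral_cis[of 2] by simp
    qed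
    ultimately have "integral {0..1} (\<lambda>t. cis (2 * pi * t) * u + (cis (2 * pi * t))\<^sup>2 * v) = 0"
      using integral_cis[of 1] by simp
    then show ?thesis using integral_linear[OF i bounded_linear_Re] by (simp add: o_def)
  qed
  have lam1: "lam h \<ge> - (C * norm h ^ 3)" if h: "norm h \<le> 1" for h
  proof -
    have "mollify r V z0 \<le> integral {0..1} (\<lambda>t. mollify r V (z0 + cis (2 * pi * t) *s h))"
      by (rule mollify_submean[OF V submean])
    also have "\<dots> \<le> integral {0..1} (\<lambda>t. (mollify r V z0 + lam h + C * norm h ^ 3) + Re (cis (2 * pi * t) * a h + (cis (2 * pi * t))\<^sup>2 * b h))"
    proof (rule integral_le)
      have "continuous_on {0..1} (\<lambda>t. mollify r V (z0 + cis (2 * pi * t) *s h))"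
        by (rule continuous_on_compose2[OF continuous_on_mollify[OF V]]) (auto intro!: continuous_intros)
      then show "(\<lambda>t. mollify r V (z0 + cis (2 * pi * t) *s h)) integrable_on {0..1}" by (rule integrable_continuous_real)
      show "(\<lambda>t. (mollify r V z0 + lam h + C * norm h ^ 3) + Re (cis (2 * pi * t) * a h + (cis (2 * pi * t))\<^sup>2 * b h)) integrable_on {0..1}"
        by (intro integrable_continuous_real continuous_intros)
      fix t :: real
      have "norm (cis (2 * pi * t) *s h) \<le> 1" using h by (simp add: norm_vector_scalar_mult)
      from exp[OF this] show "mollify r V (z0 + cis (2 * pi * t) *s h) \<le> (mollify r V z0 + lam h + C * norm h ^ 3) + Re (cis (2 * pi * t) * a h + (cis (2 * pi * t))\<^sup>2 * b h)"
        unfolding scale lscale norm_vector_scalar_mult by (simp add: abs_le_iff)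
    qed
    also have "\<dots> = integral {0..1} (\<lambda>t::real. mollify r V z0 + lam h + C * norm h ^ 3) + integral {0..1} (\<lambda>t. Re (cis (2 * pi * t) * a h + (cis (2 * pi * t))\<^sup>2 * b h))"
      by (intro integral_add integrable_continuous_real continuous_intros)
    also have "\<dots> = mollify r V z0 + lam h + C * norm h ^ 3" unfolding int0 by simp
    finally show ?thesis by simp
  qed
  \<comment> \<open>Scaling \<open>h\<close> by \<open>s\<close> multiplies the form by
    \<open>s^2\<close> and the lower bound in \<open>lam1\<close> by \<open>s^3\<close>, so letting
    \<open>s\<close> tend to 0 removes the bound.\<close>
  have lam0: "lam h \<ge> 0" if h: "norm h \<le> 1" for h
  proof -
    have "- (C * norm h ^ 3) * s \<le> lam h" if s: "0 < s" "s < 1" for s :: real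
    proof -
      have n: "norm (of_real s *s h) = s * norm h" using s by (simp add: norm_vector_scalar_mult)
      have "norm (of_real s *s h) \<le> 1" using n h s by (simp add: mult_le_one)
      from lam1[OF this] have "- (C * (s * norm h) ^ 3) \<le> s\<^sup>2 * lam h" unfolding n lscale using s by simp
      then have "s\<^sup>2 * (- (C * norm h ^ 3) * s) \<le> s\<^sup>2 * lam h" by (simp add: power_mult_distrib power2_eq_square power3_eq_cube mult_ac)
      then show ?thesis using s by (simp only: mult_le_cancel_left_pos zero_less_power)
    qed
    then have "\<forall>\<^sub>F s in at_right 0. - (C * norm h ^ 3) * s \<le> lam h"
      by (auto simp: eventually_at_right_field intro!: exI[of _ 1])
    moreover have "((\<lambda>s. - (C * norm h ^ 3) * s) \<longlongrightarrow> - (C * norm h ^ 3) * 0) (at_right 0)" by (intro tendsto_intros)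
    ultimately show ?thesis using tendsto_upperbound[of "\<lambda>s. - (C * norm h ^ 3) * s" _ "at_right 0"] by simp
  qed
  have "(\<lambda>h. a h + b h) \<in> poly_fun" by (intro poly_fun.add aP bP)
  moreover have "a 0 + b 0 = 0" by (simp add: a_def b_def hermitian_product_def)
  moreover have "mollify r V z0 + Re (a h + b h) - C * norm h ^ 3 \<le> mollify r V (z0 + h)" if "norm h \<le> 1" for h
    using exp[OF that] lam0[OF that] by (simp add: abs_le_iff)
  ultimately show ?thesis by (intro bexI[of _ "\<lambda>h. a h + b h"] exI[of _ C]) auto
qed

section \<open>Mollification of Lipschitz functions\<close>

lemma continuous_on_of_Lipschitz:
  fixes V :: "'a::real_normed_vector \<Rightarrow> real"
  assumes "\<And>z w. \<bar>V z - V w\<bar> \<le> norm (z - w)"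
  shows "continuous_on UNIV V"
proof (rule lipschitz_on_continuous_on)
  show "1-lipschitz_on UNIV V" using assms by (auto simp: lipschitz_on_def dist_norm)
qed

lemma integral_bump_pos: "r > 0 \<Longrightarrow> integral (symcube r) (bump r :: complex^'n \<Rightarrow> real) > 0"
proof (rule ccontr)
  assume r: "r > 0" and n: "\<not> integral (symcube r) (bump r :: complex^'n \<Rightarrow> real) > 0"
  have c: "continuous_on S (bump r)" for S :: "(complex^'n) set" using continuous_on_bump[OF continuous_on_id] by simp
  have i: "(bump r :: complex^'n \<Rightarrow> real) integrable_on symcube r" by (rule integrable_symcube[OF c])
  have "integral (symcube r) (bump r :: complex^'n \<Rightarrow> real) \<ge> 0" using i by (intro integral_nonneg bump_nonneg)
  then have "((bump r :: complex^'n \<Rightarrow> real) has_integral 0) (symcube r)"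
    using n i by (metis has_integral_integral order_antisym not_less)
  moreover have "box (- (r *\<^sub>R One)) (r *\<^sub>R One) \<noteq> ({} :: (complex^'n) set)"
    using r by (simp add: box_ne_empty)
  moreover have "(0::complex^'n) \<in> symcube r" using r by (simp add: mem_symcube)
  ultimately have "bump r (0::complex^'n) = 0"
    unfolding symcube_def using has_integral_0_cbox_imp_0[OF c bump_nonneg] by blast
  then show False using r by (simp add: bump_def max_def split: if_splits)
qed

lemma mollify_close:
  fixes V :: "complex^'n \<Rightarrow> real"
  assumes lip: "\<And>z w. \<bar>V z - V w\<bar> \<le> norm (z - w)" and r: "r > 0"
  shows "\<exists>c>0. \<forall>z. \<bar>mollify r V z / c - V z\<bar> \<le> r"
proof -
  have V: "continuous_on UNIV V" by (rule continuous_on_of_Lipschitz[OF lip])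
  have Vc: "continuous_on UNIV (\<lambda>x. V (z + x))" for z
    by (rule continuous_on_compose2[OF V]) (auto intro!: continuous_intros)
  define c where "c = integral (symcube r) (bump r :: complex^'n \<Rightarrow> real)"
  have c: "c > 0" unfolding c_def by (rule integral_bump_pos[OF r])
  have "\<bar>mollify r V z / c - V z\<bar> \<le> r" for z
  proof -
    have b: "continuous_on UNIV (bump r :: complex^'n \<Rightarrow> real)" using continuous_on_bump[OF continuous_on_id] by simp
    have "mollify r V z - c * V z = integral (symcube r) (\<lambda>x. bump r x * V (z + x) - bump r x * V z)"
      unfolding mollify_def c_def integral_mult_left[symmetric]
      by (intro integral_diff[symmetric] integrable_symcube continuous_intros Vc b)
    also have "norm \<dots> \<le> integral (symcube r) (\<lambda>x :: complex^'n. bump r x * r)"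
    proof (rule Henstock_Kurzweil_Integration.integral_norm_bound_integral)
      fix x :: "complex^'n"
      have "norm (bump r x * V (z + x) - bump r x * V z) = bump r x * \<bar>V (z + x) - V z\<bar>"
        using bump_nonneg[of r x] by (simp add: abs_mult flip: right_diff_distrib)
      also have "\<dots> \<le> bump r x * norm x" using lip[of "z + x" z] by (intro mult_left_mono bump_nonneg) simp
      also have "\<dots> \<le> bump r x * r" using bump_eq_0[of r x] r bump_nonneg[of r x]
        by (cases "norm x \<ge> r") (auto intro: mult_left_mono)
      finally show "norm (bump r x * V (z + x) - bump r x * V z) \<le> bump r x * r" .
    qed (intro integrable_symcube continuous_intros Vc b)+
    also have "\<dots> = c * r" by (simp add: c_def)
    finally have "\<bar>mollify r V z - c * V z\<bar> \<le> c * r" by simp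
    then have "\<bar>mollify r V z - c * V z\<bar> / c \<le> r" using c by (simp add: divide_le_eq mult.commute)
    moreover have "\<bar>mollify r V z / c - V z\<bar> = \<bar>mollify r V z - c * V z\<bar> / c"
    proof -
      have "mollify r V z / c - V z = (mollify r V z - c * V z) / c" using c by (simp add: diff_divide_distrib)
      then show ?thesis using c by (simp only: abs_divide abs_of_pos)
    qed
    ultimately show ?thesis by simp
  qed
  then show ?thesis using c by blast
qed

section \<open>Submean functions on polynomial hulls\<close>

lemma poly_fun_translate: "P \<in> poly_fun \<Longrightarrow> (\<lambda>z. P (z - w)) \<in> poly_fun"
  by (induction rule: poly_fun.induct) (auto intro!: poly_fun_rules)

theorem submean_le_on_poly_hull:
  fixes V :: "complex^'n \<Rightarrow> real"
  assumes K: "compact K" and lip: "\<And>z w. \<bar>V z - V w\<bar> \<le> norm (z - w)"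
    and submean: "\<And>z v. V z \<le> integral {0..1} (\<lambda>t. V (z + cis (2 * pi * t) *s v))"
    and VK: "\<And>z. z \<in> K \<Longrightarrow> V z \<le> 0" and a: "a \<in> poly_hull K"
  shows "V a \<le> 0"
proof (rule ccontr)
  assume "\<not> V a \<le> 0"
  define eta where "eta = V a"
  have eta: "eta > 0" using \<open>\<not> V a \<le> 0\<close> by (simp add: eta_def)
  define r where "r = eta / 4"
  have r: "r > 0" using eta by (simp add: r_def)
  obtain c where c: "c > 0" "\<And>z. \<bar>mollify r V z / c - V z\<bar> \<le> r" using mollify_close[OF lip r] by blast
  have V: "continuous_on UNIV V" by (rule continuous_on_of_Lipschitz[OF lip])
  define X where "X = poly_hull K"
  have X: "compact X" "a \<in> X" "K \<subseteq> X" using compact_poly_hull[OF K] a poly_hull_subset by (auto simp: X_def)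
  obtain R where R: "R > 0" "\<And>z. z \<in> X \<Longrightarrow> norm z \<le> R" using compact_imp_bounded[OF X(1)] by (auto simp: bounded_pos)
  \<comment> \<open>On the hull the added term is at most \<open>eta / 8\<close>. Hence
    \<open>u\<close> is at most \<open>3 * eta / 8\<close> on \<open>K\<close> but at least
    \<open>3 * eta / 4\<close> at \<open>a\<close>, so the maximum point lies off
    \<open>K\<close>.\<close>
  define d where "d = eta / (8 * R\<^sup>2)"
  have d: "d > 0" using eta R by (simp add: d_def)
  define u where "u z = mollify r V z / c + d * (norm z)\<^sup>2" for z
  have "continuous_on X u" unfolding u_def using c
    by (intro continuous_intros continuous_on_subset[OF continuous_on_mollify[OF V]]) auto
  then obtain z0 where z0: "z0 \<in> X" "\<And>z. z \<in> X \<Longrightarrow> u z \<le> u z0"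
    using continuous_attains_sup[OF X(1)] X(2) by blast
  have "u a \<ge> 3 * eta / 4"
  proof -
    have "V a - r \<le> mollify r V a / c" using c(2)[of a] by (simp add: abs_le_iff)
    moreover have "0 \<le> d * (norm a)\<^sup>2" using d by simp
    ultimately show ?thesis unfolding u_def eta_def[symmetric] r_def by linarith
  qed
  then have uz0: "u z0 \<ge> 3 * eta / 4" using z0(2)[OF X(2)] by simp
  have z0K: "z0 \<notin> K"
  proof
    assume z: "z0 \<in> K"
    have "(norm z0)\<^sup>2 \<le> R\<^sup>2" using R z0 by (intro power_mono) auto
    then have "d * (norm z0)\<^sup>2 \<le> d * R\<^sup>2" using d by simp
    also have "d * R\<^sup>2 = eta / 8" using R by (simp add: d_def)
    finally have "u z0 \<le> r + eta / 8" using c(2)[of z0] VK[OF z] unfolding u_def by (simp add: abs_le_iff)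
    then show False using uz0 eta by (simp add: r_def)
  qed
  obtain P C where P: "P \<in> poly_fun" "P 0 = 0"
    and PC: "\<And>h. norm h \<le> 1 \<Longrightarrow> mollify r V z0 + Re (P h) - C * norm h ^ 3 \<le> mollify r V (z0 + h)"
    using mollify_quadratic_minorant[OF V r submean, of z0] by blast
  \<comment> \<open>The linear term comes from expanding \<open>d * (norm z)^2\<close> about
    \<open>z0\<close>; the remaining \<open>d * (norm h)^2\<close> makes \<open>Re Q\<close>
    strictly negative at points of the hull near \<open>z0\<close> other than
    \<open>z0\<close>.\<close>
  define Q where "Q z = P (z - z0) / c + 2 * d * hermitian_product z0 (z - z0)" for z
  have QP: "Q \<in> poly_fun"
  proof -
    have "(\<lambda>z. (1 / c) * P (z - z0) + (2 * of_real d) * (\<Sum>i\<in>UNIV. cnj (z0 $ i) * (z $ i - z0 $ i))) \<in> poly_fun"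
      by (intro poly_fun_rules poly_fun_translate P)
    then show ?thesis by (simp add: Q_def[abs_def] hermitian_product_def)
  qed
  have Q0: "Q z0 = 0" by (simp add: Q_def P hermitian_product_def)
  have "open (- K)" using K by (simp add: compact_imp_closed open_Compl)
  then obtain e where e: "e > 0" "ball z0 e \<subseteq> - K" using z0K by (meson ComplI open_contains_ball)
  \<comment> \<open>Division by the dimension keeps the Euclidean norm in the polydisc below three
    bounds: it stays off \<open>K\<close>, within the range of the expansion, and the cubic error
    takes at most half of the quadratic gain.\<close>
  define s where "s = min (e / 2) (min 1 (d * c / (2 * (\<bar>C\<bar> + 1)))) / real CARD('n)"
  have s: "s > 0" using e d c by (simp add: s_def)
  define E where "E = {z \<in> X. (\<forall>i. norm (z $ i - z0 $ i) \<le> s) \<and> (z \<in> K \<or> (\<exists>i. norm (z $ i - z0 $ i) = s))}"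
  have E: "z0 \<in> poly_hull E" unfolding E_def X_def using local_maximum_polydisc[OF K _ s] z0(1) by (simp add: X_def)
  define b where "b = d / 2 * s\<^sup>2"
  have b: "b > 0" using d s by (simp add: b_def)
  have QE: "Re (Q z) \<le> - b" if z: "z \<in> E" for z
  proof -
    define h where "h = z - z0"
    have zX: "z \<in> X" and zi: "\<And>i. norm (h $ i) \<le> s" using z by (auto simp: E_def h_def)
    have "norm h \<le> (\<Sum>i\<in>UNIV. norm (h $ i))" unfolding norm_vec_def by (rule L2_set_le_sum) simp
    also have "\<dots> \<le> real CARD('n) * s" using sum_mono[of UNIV "\<lambda>i. norm (h $ i)" "\<lambda>_. s"] zi by simp
    also have "\<dots> = min (e / 2) (min 1 (d * c / (2 * (\<bar>C\<bar> + 1))))" by (simp add: s_def)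
    finally have h: "norm h \<le> e / 2" "norm h \<le> 1" "norm h \<le> d * c / (2 * (\<bar>C\<bar> + 1))" by auto
    have "z \<notin> K"
    proof
      assume "z \<in> K"
      moreover have "z \<in> ball z0 e" using h(1) e(1) by (simp add: h_def dist_norm norm_minus_commute)
      ultimately show False using e(2) by blast
    qed
    then obtain i where "norm (h $ i) = s" using z by (auto simp: E_def h_def)
    then have sh: "s \<le> norm h" using Finite_Cartesian_Product.norm_nth_le[of h i] by simp
    have Ch: "C * norm h ^ 3 \<le> c * (d / 2) * (norm h)\<^sup>2"
    proof -
      have "C * norm h \<le> (\<bar>C\<bar> + 1) * norm h" by (intro mult_right_mono) auto
      also have "\<dots> \<le> (\<bar>C\<bar> + 1) * (d * c / (2 * (\<bar>C\<bar> + 1)))" using h(3) by (intro mult_left_mono) auto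
      also have "\<dots> = c * (d / 2)" by (simp add: field_simps)
      finally have "C * norm h * (norm h)\<^sup>2 \<le> c * (d / 2) * (norm h)\<^sup>2" by (intro mult_right_mono) auto
      then show ?thesis by (simp add: power2_eq_square power3_eq_cube mult.assoc)
    qed
    have zh: "z = z0 + h" by (simp add: h_def)
    have "(mollify r V z0 + Re (P h) - C * norm h ^ 3) / c \<le> mollify r V z / c"
      unfolding zh using PC[OF h(2)] c(1) by (intro divide_right_mono) auto
    moreover have "(norm z)\<^sup>2 = (norm z0)\<^sup>2 + 2 * (z0 \<bullet> h) + (norm h)\<^sup>2"
      unfolding zh by (simp add: power2_norm_eq_inner inner_add_left inner_add_right inner_commute)
    moreover have "u z \<le> u z0" using z0(2)[OF zX] .
    ultimately have "(mollify r V z0 + Re (P h) - C * norm h ^ 3) / c + d * ((norm z0)\<^sup>2 + 2 * (z0 \<bullet> h) + (norm h)\<^sup>2) \<le> mollify r V z0 / c + d * (norm z0)\<^sup>2"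
      unfolding u_def by simp
    then have 1: "Re (P h) / c + 2 * d * (z0 \<bullet> h) + d * (norm h)\<^sup>2 \<le> C * norm h ^ 3 / c"
      by (simp add: add_divide_distrib diff_divide_distrib algebra_simps)
    have "C * norm h ^ 3 / c \<le> d / 2 * (norm h)\<^sup>2" using Ch c by (simp add: divide_le_eq mult_ac)
    moreover have "Re (Q z) = Re (P h) / c + 2 * d * (z0 \<bullet> h)" by (simp add: Q_def h_def Re_hermitian_product)
    moreover have "d / 2 * s\<^sup>2 \<le> d / 2 * (norm h)\<^sup>2" using sh s d by (intro mult_left_mono power_mono) auto
    ultimately show ?thesis using 1 unfolding b_def by linarith
  qed
  obtain B where B: "B > 0" "\<And>z. z \<in> X \<Longrightarrow> norm (Q z) \<le> B" using poly_fun_bounded_on_compact[OF QP X(1)] by blast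
  \<comment> \<open>The squared modulus of \<open>1 + Q / n\<close> is
    \<open>1 + 2 * Re Q / n + (norm Q)^2 / n^2\<close>; for this \<open>n\<close> the last term
    costs at most half of the gain \<open>2 * b / n\<close>.\<close>
  define n where "n = B\<^sup>2 / b + 1"
  have n: "n > 0" using b by (simp add: n_def add_nonneg_pos)
  define p where "p z = 1 + of_real (1 / n) * Q z" for z
  have pP: "p \<in> poly_fun" unfolding p_def by (intro poly_fun_rules QP)
  have "norm (p z) \<le> sqrt (1 - b / n)" if z: "z \<in> E" for z
  proof (rule real_le_rsqrt)
    have zX: "z \<in> X" using z by (simp add: E_def)
    have "(norm (p z))\<^sup>2 = 1 + 2 * Re (Q z) / n + (norm (Q z))\<^sup>2 / n\<^sup>2"
      unfolding p_def cmod_power2 using n by (simp add: power2_eq_square field_simps)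
    also have "\<dots> \<le> 1 + 2 * (- b) / n + B\<^sup>2 / n\<^sup>2"
      using QE[OF z] B(2)[OF zX] n by (intro add_mono divide_right_mono power_mono) auto
    also have "B\<^sup>2 / n\<^sup>2 \<le> b / n"
    proof -
      have "B\<^sup>2 \<le> b * n" using b by (simp add: n_def field_simps)
      then show ?thesis using n by (simp add: power2_eq_square divide_simps)
    qed
    finally show "(norm (p z))\<^sup>2 \<le> 1 - b / n" by simp
  qed
  then have "norm (p z0) \<le> sqrt (1 - b / n)" by (rule poly_hullD[OF E pP])
  moreover have "p z0 = 1" by (simp add: p_def Q0)
  moreover have "sqrt (1 - b / n) < 1" using b n by simp
  ultimately show False by simp
qed

section \<open>Envelopes of polynomial discs\<close>

definition poly_disc :: "(complex \<Rightarrow> complex^'n) \<Rightarrow> bool" where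
  "poly_disc f \<longleftrightarrow> (\<forall>j. \<exists>q. \<forall>z. f z $ j = poly q z)"

lemma poly_disc_const: "poly_disc (\<lambda>z. c)"
  unfolding poly_disc_def by (intro allI exI[of _ "[:_:]"]) simp

lemma poly_disc_add: "poly_disc f \<Longrightarrow> poly_disc g \<Longrightarrow> poly_disc (\<lambda>z. f z + g z)"
  unfolding poly_disc_def by (metis poly_add vector_add_component)

lemma poly_disc_sum: "(\<And>i. i \<in> I \<Longrightarrow> poly_disc (f i)) \<Longrightarrow> poly_disc (\<lambda>z. \<Sum>i\<in>I. f i z)"
  by (induction I rule: infinite_finite_induct) (auto intro: poly_disc_const poly_disc_add)

lemma poly_disc_scale: "poly_disc f \<Longrightarrow> poly_disc (\<lambda>z. poly p z *s f z)"
  unfolding poly_disc_def by (metis poly_mult vector_smult_component)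

lemma poly_disc_compose: "poly_disc f \<Longrightarrow> poly_disc (\<lambda>z. f (poly p z))"
  unfolding poly_disc_def by (metis poly_pcompose)

lemma poly_disc_factor:
  fixes f :: "complex \<Rightarrow> complex^'n"
  assumes "poly_disc f"
  shows "\<exists>k. poly_disc k \<and> (\<forall>z. f z - f 0 = z *s k z)"
proof -
  obtain q where q: "\<And>j z. f z $ j = poly (q j) z" using assms unfolding poly_disc_def by metis
  have "\<exists>r. \<forall>z. poly (q j) z - poly (q j) 0 = z * poly r z" for j
  proof -
    obtain a p where "q j = pCons a p" by (cases "q j")
    then show ?thesis by (intro exI[of _ p]) simp
  qed
  then obtain r where r: "\<And>j z. poly (q j) z - poly (q j) 0 = z * poly (r j) z" by metis
  show ?thesis
    by (intro exI[of _ "\<lambda>z. \<chi> j. poly (r j) z"]) (auto simp: poly_disc_def vec_eq_iff q r)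
qed

lemma continuous_on_poly_disc:
  fixes f :: "complex \<Rightarrow> complex^'n"
  assumes "poly_disc f"
  shows "continuous_on S f"
proof -
  obtain q where q: "\<And>j z. f z $ j = poly (q j) z" using assms unfolding poly_disc_def by metis
  have "f = (\<lambda>z. \<chi> j. poly (q j) z)" by (auto simp: vec_eq_iff q)
  then show ?thesis by (simp only:) (intro continuous_intros)
qed

text \<open>Real trigonometric polynomials, encoded by clearing the negative frequencies with a
  power of \<open>z\<close>. They form a ring to which the Stone-Weierstrass theorem applies, and
  they supply the cut-offs for gluing discs.\<close>

definition trig_poly :: "(complex \<Rightarrow> real) set" where
  "trig_poly = {f. continuous_on (sphere 0 1) f \<and> (\<exists>N q. \<forall>z\<in>sphere 0 1. of_real (f z) * z ^ N = poly q z)}"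

lemma trig_polyI:
  assumes "continuous_on (sphere 0 1) f" "\<And>z. z \<in> sphere 0 1 \<Longrightarrow> of_real (f z) * z ^ N = poly q z"
  shows "f \<in> trig_poly"
  using assms unfolding trig_poly_def by blast

lemma function_ring_trig_poly: "function_ring_on trig_poly (sphere 0 1)"
proof
  fix f g assume f: "f \<in> trig_poly" and g: "g \<in> trig_poly"
  obtain N q where q: "\<And>z. z \<in> sphere 0 1 \<Longrightarrow> of_real (f z) * z ^ N = poly q z" using f unfolding trig_poly_def by blast
  obtain M p where p: "\<And>z. z \<in> sphere 0 1 \<Longrightarrow> of_real (g z) * z ^ M = poly p z" using g unfolding trig_poly_def by blast
  have c: "continuous_on (sphere 0 1) f" "continuous_on (sphere 0 1) g" using f g by (auto simp: trig_poly_def)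
  have "of_real (f z * g z) * z ^ (N + M) = poly (q * p) z" if "z \<in> sphere 0 1" for z
    using q[OF that] p[OF that] by (simp add: power_add mult_ac) (metis mult.assoc mult.commute)
  then show "(\<lambda>x. f x * g x) \<in> trig_poly" using c by (intro trig_polyI continuous_intros)
  have "of_real (f z + g z) * z ^ (N + M) = poly (q * monom 1 M + p * monom 1 N) z" if "z \<in> sphere 0 1" for z
    using q[OF that, symmetric] p[OF that, symmetric] by (simp add: power_add poly_monom algebra_simps)
  then show "(\<lambda>x. f x + g x) \<in> trig_poly" using c by (intro trig_polyI continuous_intros)
next
  fix c :: real
  have "of_real c * z ^ 0 = poly [:of_real c:] z" for z :: complex by simp
  then show "(\<lambda>_. c) \<in> trig_poly" by (intro trig_polyI continuous_intros)
next
  fix x y :: complex assume xy: "x \<in> sphere 0 1" "y \<in> sphere 0 1" "x \<noteq> y"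
  have zz: "cnj z * z = 1" if "z \<in> sphere 0 1" for z using that complex_norm_square[of z] by (simp add: mult.commute)
  have "of_real (Re z) * z ^ 1 = poly [:1/2, 0, 1/2:] z" if "z \<in> sphere 0 1" for z
  proof -
    have "of_real (Re z) = (z + cnj z) / 2" by (simp add: complex_add_cnj)
    then show ?thesis using zz[OF that] by (simp add: algebra_simps add_divide_distrib)
  qed
  then have R: "Re \<in> trig_poly" by (intro trig_polyI continuous_intros)
  have "of_real (Im z) * z ^ 1 = poly [:-1/(2*\<i>), 0, 1/(2*\<i>):] z" if "z \<in> sphere 0 1" for z
  proof -
    have "of_real (Im z) = (z - cnj z) / (2 * \<i>)" by (simp add: complex_eq_iff)
    then have "of_real (Im z) * z = (z * z - cnj z * z) / (2 * \<i>)" by (simp add: left_diff_distrib)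
    then show ?thesis unfolding zz[OF that] by (simp add: algebra_simps diff_divide_distrib)
  qed
  then have I: "Im \<in> trig_poly" by (intro trig_polyI continuous_intros)
  show "\<exists>f\<in>trig_poly. f x \<noteq> f y" using R I xy(3) by (metis complex_eqI)
qed (auto simp: trig_poly_def)

section \<open>Rotation invariance of circle integrals\<close>

lemma cis_frac: "cis (2 * pi * frac t) = cis (2 * pi * t)"
proof -
  have "2 * pi * t = 2 * pi * frac t + 2 * pi * of_int (floor t)" by (simp add: frac_def algebra_simps)
  then show ?thesis by (simp add: cis_mult[symmetric])
qed

lemma integral_circle_rotate:
  fixes h :: "complex \<Rightarrow> real"
  assumes "continuous_on (sphere 0 1) h"
  shows "integral {0..1} (\<lambda>t. h (cis (2 * pi * (c + t)))) = integral {0..1} (\<lambda>t. h (cis (2 * pi * t)))"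
proof -
  define c' where "c' = frac c"
  have c': "0 \<le> c'" "c' \<le> 1" by (auto simp: c'_def less_imp_le frac_lt_1)
  define g where "g t = h (cis (2 * pi * t))" for t
  have cont: "continuous_on S g" for S unfolding g_def
    by (rule continuous_on_compose2[OF assms]) (auto intro!: continuous_intros)
  have i: "g integrable_on {a..b}" for a b by (intro integrable_continuous_real cont)
  have per: "g (t + 1) = g t" for t
    unfolding g_def by (simp add: distrib_left cis_mult[symmetric])
  have "h (cis (2 * pi * (c + t))) = g (c' + t)" for t
    unfolding g_def c'_def by (metis cis_frac cis_mult distrib_left)
  then have "integral {0..1} (\<lambda>t. h (cis (2 * pi * (c + t)))) = integral {0..1} (\<lambda>t. g (c' + t))" by simp
  also have "\<dots> = integral {c'..c' + 1} g"
    using integral_shift_Icc_real[of 0 1 g c'] by (simp add: o_def add.commute)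
  also have "\<dots> = integral {c'..1} g + integral {1..c' + 1} g"
    using Henstock_Kurzweil_Integration.integral_combine[where a = c' and c = 1 and b = "c' + 1" and f = g] c' i by simp
  also have "integral {1..c' + 1} g = integral {0..c'} (\<lambda>t. g (t + 1))"
    using integral_shift_Icc_real[of 0 c' g 1] by (simp add: o_def add.commute)
  also have "integral {c'..1} g + integral {0..c'} (\<lambda>t. g (t + 1)) = integral {0..1} g"
    unfolding per using Henstock_Kurzweil_Integration.integral_combine[where a = 0 and c = c' and b = 1 and f = g] c' i by simp
  finally show ?thesis unfolding g_def .
qed

definition disc_envelope :: "(complex^'n \<Rightarrow> real) \<Rightarrow> complex^'n \<Rightarrow> real" where
  "disc_envelope phi z = Inf {integral {0..1} (\<lambda>t. phi (f (cis (2 * pi * t)))) |f. poly_disc f \<and> f 0 = z}"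

section \<open>The envelope of a nonnegative Lipschitz function\<close>

context
  fixes phi :: "complex^'n \<Rightarrow> real"
  assumes phi_lip: "\<And>z w. \<bar>phi z - phi w\<bar> \<le> norm (z - w)" and phi_nonneg: "\<And>z. 0 \<le> phi z"
begin

lemma phi_cont: "continuous_on S g \<Longrightarrow> continuous_on S (\<lambda>x. phi (g x))"
  using continuous_on_compose2[OF continuous_on_of_Lipschitz[of phi, OF phi_lip], of S g] by auto

lemma disc_cost_integrable:
  assumes "poly_disc f"
  shows "(\<lambda>t. phi (f (cis (2 * pi * t)))) integrable_on {0..1}"
proof -
  have "continuous_on {0..1} (\<lambda>t. f (cis (2 * pi * t)))"
    by (rule continuous_on_compose2[OF continuous_on_poly_disc[OF assms, of UNIV]]) (auto intro!: continuous_intros)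
  then show ?thesis by (intro integrable_continuous_real phi_cont)
qed

lemma disc_cost_nonneg: "poly_disc f \<Longrightarrow> 0 \<le> integral {0..1} (\<lambda>t. phi (f (cis (2 * pi * t))))"
  by (intro integral_nonneg disc_cost_integrable phi_nonneg)

lemma disc_envelope_le: "poly_disc f \<Longrightarrow> disc_envelope phi (f 0) \<le> integral {0..1} (\<lambda>t. phi (f (cis (2 * pi * t))))"
  unfolding disc_envelope_def by (intro cInf_lower bdd_belowI[of _ 0]) (auto intro: disc_cost_nonneg)

lemma disc_envelope_nonneg: "0 \<le> disc_envelope phi z"
  unfolding disc_envelope_def using poly_disc_const[of z]
  by (intro cInf_greatest) (auto intro: disc_cost_nonneg)

lemma disc_envelope_approx:
  assumes "e > 0"
  shows "\<exists>f. poly_disc f \<and> f 0 = z \<and> integral {0..1} (\<lambda>t. phi (f (cis (2 * pi * t)))) < disc_envelope phi z + e"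
proof -
  let ?S = "{integral {0..1} (\<lambda>t. phi (f (cis (2 * pi * t)))) |f. poly_disc f \<and> f 0 = z}"
  have "?S \<noteq> {}" using poly_disc_const[of z] by blast
  moreover have "Inf ?S < disc_envelope phi z + e" using assms by (simp add: disc_envelope_def)
  ultimately have "\<exists>x\<in>?S. x < disc_envelope phi z + e" by (rule cInf_lessD)
  then show ?thesis by blast
qed

lemma disc_envelope_le_self: "disc_envelope phi z \<le> phi z"
  using disc_envelope_le[OF poly_disc_const[of z]] by simp

lemma disc_envelope_lipschitz: "\<bar>disc_envelope phi z - disc_envelope phi w\<bar> \<le> norm (z - w)"
proof -
  have "disc_envelope phi z \<le> disc_envelope phi w + norm (z - w)" for z w
  proof (rule field_le_epsilon)
    fix e :: real assume "e > 0"
    then obtain f where f: "poly_disc f" "f 0 = w" "integral {0..1} (\<lambda>t. phi (f (cis (2 * pi * t)))) < disc_envelope phi w + e"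
      using disc_envelope_approx by blast
    let ?g = "\<lambda>u. f u + (z - w)"
    have g: "poly_disc ?g" by (intro poly_disc_add f poly_disc_const)
    have "disc_envelope phi z \<le> integral {0..1} (\<lambda>t. phi (?g (cis (2 * pi * t))))"
      using disc_envelope_le[OF g] f(2) by simp
    also have "\<dots> \<le> integral {0..1} (\<lambda>t. phi (f (cis (2 * pi * t))) + norm (z - w))"
    proof (rule integral_le)
      show "(\<lambda>t. phi (f (cis (2 * pi * t))) + norm (z - w)) integrable_on {0..1}"
        by (intro integrable_add disc_cost_integrable f integrable_const_ivl)
      fix t show "phi (?g (cis (2 * pi * t))) \<le> phi (f (cis (2 * pi * t))) + norm (z - w)"
        using phi_lip[of "?g (cis (2 * pi * t))" "f (cis (2 * pi * t))"] by simp
    qed (rule disc_cost_integrable[OF g])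
    also have "\<dots> = integral {0..1} (\<lambda>t. phi (f (cis (2 * pi * t)))) + norm (z - w)"
      by (subst integral_add) (auto intro: disc_cost_integrable f integrable_const_ivl)
    finally show "disc_envelope phi z \<le> disc_envelope phi w + norm (z - w) + e" using f(3) by simp
  qed
  from this[of z w] this[of w z] show ?thesis by (simp add: abs_le_iff norm_minus_commute)
qed

text \<open>The disc built here follows, near a boundary point u of the affine disc, the disc attached to the arc
  containing u; the cut-off functions have negative frequencies, which are absorbed by the vanishing of
  \<^term>\<open>g w - g 0\<close> at the centre after substituting a high power for w.\<close>
lemma disc_envelope_glue:
  fixes chi :: "'i \<Rightarrow> complex \<Rightarrow> real" and g :: "'i \<Rightarrow> complex \<Rightarrow> complex^'n"
  assumes I: "finite I" and chi: "\<And>i. i \<in> I \<Longrightarrow> chi i \<in> trig_poly" and g: "\<And>i. i \<in> I \<Longrightarrow> poly_disc (g i)"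
  shows "disc_envelope phi z \<le> integral {0..1} (\<lambda>s. integral {0..1} (\<lambda>t. phi (z + cis (2 * pi * s) *s v +
     (\<Sum>i\<in>I. of_real (chi i (cis (2 * pi * s))) *s (g i (cis (2 * pi * t)) - g i 0)))))"
proof -
  have "\<exists>N q. \<forall>z\<in>sphere 0 1. of_real (chi i z) * z ^ N = poly q z" if "i \<in> I" for i
    using chi[OF that] by (auto simp: trig_poly_def)
  then obtain Ni q where q: "\<And>i z. i \<in> I \<Longrightarrow> z \<in> sphere 0 1 \<Longrightarrow> of_real (chi i z) * z ^ Ni i = poly (q i) z" by metis
  have "\<exists>k. poly_disc k \<and> (\<forall>z. g i z - g i 0 = z *s k z)" if "i \<in> I" for i by (rule poly_disc_factor[OF g[OF that]])
  then obtain k where k: "\<And>i. i \<in> I \<Longrightarrow> poly_disc (k i)" "\<And>i z. i \<in> I \<Longrightarrow> g i z - g i 0 = z *s k i z" by metis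
  \<comment> \<open>Strictly larger than every \<open>Ni i\<close>, so that a positive power of
    \<open>u\<close> remains in each summand and the sum vanishes at the centre.\<close>
  define N where "N = Suc (\<Sum>i\<in>I. Ni i)"
  have N: "Ni i < N" if "i \<in> I" for i using member_le_sum[of i I Ni] I that by (simp add: N_def)
  define G where "G s t = z + cis (2 * pi * s) *s v +
     (\<Sum>i\<in>I. of_real (chi i (cis (2 * pi * s))) *s (g i (cis (2 * pi * t)) - g i 0))" for s t
  \<comment> \<open>On the circle the summand equals \<open>chi i u *s (g i w - g i 0)\<close> with
    \<open>w = cis (2 * pi * th) * u ^ N\<close>: the factor \<open>w\<close> split off from
    \<open>g i w - g i 0\<close> supplies the power of \<open>u\<close> that turns
    \<open>chi i\<close> into a polynomial.\<close>
  define f where "f th u = z + u *s v + (\<Sum>i\<in>I. (poly (q i) u * u ^ (N - Ni i) * cis (2 * pi * th)) *s k i (cis (2 * pi * th) * u ^ N))" for th u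
  have cis1: "cis x \<in> sphere 0 1" for x by simp
  have fG: "f th (cis (2 * pi * s)) = G s (real N * s + th)" for th s
  proof -
    let ?u = "cis (2 * pi * s)"
    have uN: "cis (2 * pi * th) * ?u ^ N = cis (2 * pi * (real N * s + th))"
      by (simp add: Complex.DeMoivre cis_mult algebra_simps)
    have "(poly (q i) ?u * ?u ^ (N - Ni i) * cis (2 * pi * th)) *s k i (cis (2 * pi * th) * ?u ^ N) =
       of_real (chi i ?u) *s (g i (cis (2 * pi * (real N * s + th))) - g i 0)" if i: "i \<in> I" for i
    proof -
      have "poly (q i) ?u * ?u ^ (N - Ni i) = of_real (chi i ?u) * ?u ^ N"
        using q[OF i cis1, of "2 * pi * s", symmetric] N[OF i] by (simp add: mult.assoc flip: power_add)
      then have "poly (q i) ?u * ?u ^ (N - Ni i) * cis (2 * pi * th) = of_real (chi i ?u) * (cis (2 * pi * th) * ?u ^ N)"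
        by (simp add: mult_ac)
      then show ?thesis unfolding k(2)[OF i] uN by (simp add: vector_smult_assoc)
    qed
    then show ?thesis unfolding f_def G_def by simp
  qed
  have fP: "poly_disc (f th)" for th
  proof -
    have 1: "poly_disc (\<lambda>u. poly (q i * monom 1 (N - Ni i) * [:cis (2 * pi * th):]) u *s k i (poly (monom (cis (2 * pi * th)) N) u))"
      if "i \<in> I" for i by (rule poly_disc_scale[OF poly_disc_compose[OF k(1)[OF that]]])
    have 2: "poly_disc (\<lambda>u. poly [:0, 1:] u *s v)" by (rule poly_disc_scale[OF poly_disc_const])
    have "f th = (\<lambda>u. z + poly [:0, 1:] u *s v + (\<Sum>i\<in>I. poly (q i * monom 1 (N - Ni i) * [:cis (2 * pi * th):]) u *s k i (poly (monom (cis (2 * pi * th)) N) u)))"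
      unfolding f_def by (rule ext) (simp add: poly_monom mult_ac)
    then show ?thesis using poly_disc_add[OF poly_disc_add[OF poly_disc_const 2] poly_disc_sum[OF 1]] by simp
  qed
  have f0: "f th 0 = z" for th
  proof -
    have "(0::complex) ^ (N - Ni i) = 0" if "i \<in> I" for i using N[OF that] by simp
    then have "(\<Sum>i\<in>I. (poly (q i) 0 * 0 ^ (N - Ni i) * cis (2 * pi * th)) *s k i (cis (2 * pi * th) * 0 ^ N)) = 0"
      by (intro sum.neutral ballI) (simp only: mult_zero_left mult_zero_right vector_smult_lzero)
    then show ?thesis unfolding f_def by simp
  qed
  have chic: "continuous_on (sphere 0 1) (chi i)" if "i \<in> I" for i using chi[OF that] by (simp add: trig_poly_def)
  have Gc: "continuous_on UNIV (\<lambda>x. G (fst x) (snd x))" for z :: nat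
    unfolding G_def
    by (intro continuous_intros continuous_on_compose2[OF chic] continuous_on_compose2[OF continuous_on_poly_disc[OF g]]) auto
  have Gc': "continuous_on S (\<lambda>x. phi (G (a x) (b x)))" if "continuous_on S a" "continuous_on S b" for S :: "'c::topological_space set" and a b
    using continuous_on_compose2[OF phi_cont[OF Gc] continuous_on_Pair[OF that]] by simp
  \<comment> \<open>Averaging over the rotation \<open>th\<close> makes the fast variable
    independent of \<open>s\<close>, so the double integral is reached exactly and no limit in
    \<open>N\<close> is taken.\<close>
  have "disc_envelope phi z = integral {0..1} (\<lambda>th::real. disc_envelope phi z)" by simp
  also have "\<dots> \<le> integral {0..1} (\<lambda>th. integral {0..1} (\<lambda>s. phi (G s (real N * s + th))))"
  proof (rule integral_le)
    have "continuous_on UNIV (\<lambda>th. integral (cbox 0 1) (\<lambda>s. phi (G s (real N * s + th))))"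
      by (rule integral_continuous_on_param) (auto simp: split_def intro!: Gc' continuous_intros)
    then show "(\<lambda>th. integral {0..1} (\<lambda>s. phi (G s (real N * s + th)))) integrable_on {0..1}"
      by (intro integrable_continuous_real) (auto intro: continuous_on_subset)
    fix th show "disc_envelope phi z \<le> integral {0..1} (\<lambda>s. phi (G s (real N * s + th)))"
      using disc_envelope_le[OF fP[of th]] by (simp add: f0 fG)
  qed (rule integrable_const_ivl)
  also have "\<dots> = integral {0..1} (\<lambda>s. integral {0..1} (\<lambda>th. phi (G s (real N * s + th))))"
    unfolding box_real(2)[symmetric]
    by (rule integral_swap_continuous) (auto simp: split_def intro!: Gc' continuous_intros)
  also have "\<dots> = integral {0..1} (\<lambda>s. integral {0..1} (\<lambda>t. phi (G s t)))"
  proof (rule arg_cong[where f = "integral {0..1}"], rule ext)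
    fix s
    define h where "h w = phi (z + cis (2 * pi * s) *s v + (\<Sum>i\<in>I. of_real (chi i (cis (2 * pi * s))) *s (g i w - g i 0)))" for w
    have "continuous_on (sphere 0 1) h" unfolding h_def
      by (intro phi_cont continuous_intros continuous_on_poly_disc g)
    from integral_circle_rotate[OF this, of "real N * s"]
    show "integral {0..1} (\<lambda>th. phi (G s (real N * s + th))) = integral {0..1} (\<lambda>t. phi (G s t))"
      by (simp add: h_def G_def)
  qed
  finally show ?thesis by (simp add: G_def)
qed

text \<open>Nearly optimal discs at \<open>M\<close> equally spaced points of the circle are glued
  by cut-offs that are nearly 1 on one arc and nearly 0 on the others. The error \<open>e\<close> is
  split in four: optimality of the discs, size of the arcs, cut-offs, and gaps between the
  arcs.\<close>

lemma disc_envelope_submean: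
  "disc_envelope phi z \<le> integral {0..1} (\<lambda>t. disc_envelope phi (z + cis (2 * pi * t) *s v))"
proof (rule field_le_epsilon)
  fix e :: real assume e: "e > 0"
  let ?E = "disc_envelope phi"
  have Ec: "continuous_on S (\<lambda>t. ?E (z + cis (2 * pi * t) *s v))" for S
    by (rule continuous_on_compose2[OF continuous_on_of_Lipschitz[of ?E, OF disc_envelope_lipschitz]]) (auto intro!: continuous_intros)
  obtain M :: nat where M: "16 * pi * norm v / e < real M" using reals_Archimedean2 by blast
  moreover have "0 \<le> 16 * pi * norm v / e" using e by simp
  ultimately have M0: "M > 0" by (cases M) auto
  have Mv: "4 * pi / M * norm v \<le> e / 4" using M e M0 by (simp add: field_simps)
  have "\<exists>f. poly_disc f \<and> f 0 = z + cis (2 * pi * (real i / M)) *s v \<and>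
      integral {0..1} (\<lambda>t. phi (f (cis (2 * pi * t)))) < ?E (z + cis (2 * pi * (real i / M)) *s v) + e / 4" for i :: nat
    by (rule disc_envelope_approx) (use e in simp)
  then obtain g where g: "\<And>i. poly_disc (g i)" "\<And>i. g i 0 = z + cis (2 * pi * (real i / M)) *s v"
    "\<And>i. integral {0..1} (\<lambda>t. phi (g i (cis (2 * pi * t)))) < ?E (z + cis (2 * pi * (real i / M)) *s v) + e / 4"
    by metis
  have "\<exists>D\<ge>0. \<forall>w\<in>sphere 0 1. norm (g i w - g i 0) \<le> D" for i
  proof -
    have "compact ((\<lambda>w. g i w - g i 0) ` sphere 0 1)"
      by (intro compact_continuous_image continuous_intros continuous_on_poly_disc g compact_sphere)
    then obtain D where "\<forall>w\<in>sphere 0 1. norm (g i w - g i 0) \<le> D" by (auto dest!: compact_imp_bounded simp: bounded_iff)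
    then show ?thesis by (intro exI[of _ "max 0 D"]) (auto simp: le_max_iff_disj)
  qed
  then obtain Di where Di: "\<And>i. Di i \<ge> 0" "\<And>i w. w \<in> sphere 0 1 \<Longrightarrow> norm (g i w - g i 0) \<le> Di i" by metis
  define D where "D = (\<Sum>i<M. Di i)"
  have D: "D \<ge> 0" unfolding D_def using Di by (intro sum_nonneg) auto
  define B where "B = phi z + norm v + D"
  have B: "B \<ge> 0" using phi_nonneg[of z] D by (simp add: B_def)
  \<comment> \<open>The amount cut from both ends of each arc. The gaps have total length
    \<open>2 * tau * M\<close>, and on them the inner integral is only known to be at most
    \<open>B\<close>.\<close>
  define tau where "tau = min (1 / (4 * M)) (e / (8 * M * (B + 1)))"
  have tau: "0 < tau" "tau \<le> 1 / (4 * M)" "B * (2 * tau * M) \<le> e / 4"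
  proof -
    show "0 < tau" "tau \<le> 1 / (4 * M)" using e B M0 by (auto simp: tau_def)
    have "tau \<le> e / (8 * M * (B + 1))" by (simp add: tau_def)
    moreover have "8 * M * (B + 1) > 0" using M0 B by simp
    ultimately have "tau * (8 * M * (B + 1)) \<le> e" by (simp only: pos_le_divide_eq)
    moreover have "2 * tau * M * (4 * (B + 1)) = tau * (8 * M * (B + 1))" by simp
    moreover have "4 * (B + 1) > 0" using B by simp
    ultimately have "2 * tau * M \<le> e / (4 * (B + 1))" by (simp only: pos_le_divide_eq)
    then have "B * (2 * tau * M) \<le> B * (e / (4 * (B + 1)))" using B by (rule mult_left_mono)
    also have "\<dots> \<le> e / 4" using B e by (simp add: field_simps)
    finally show "B * (2 * tau * M) \<le> e / 4" .
  qed
  define A where "A i = {i / M + tau..(i + 1) / M - tau}" for i :: nat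
  have A01: "A i \<subseteq> {0<..<1}" if "i < M" for i
  proof -
    have 1: "(real i + 1) / M \<le> 1" using that M0 by (simp add: divide_le_eq)
    have 2: "0 \<le> real i / M" by simp
    have 3: "real i / M + tau \<le> x" "x \<le> (real i + 1) / M - tau" if "x \<in> A i" for x
      using that by (simp_all add: A_def add.commute)
    have "0 < x" "x < 1" if x: "x \<in> A i" for x using 3[OF x] 1 2 tau(1) by linarith+
    then show ?thesis by auto
  qed
  define C where "C i = (\<lambda>t. cis (2 * pi * t)) ` A i" for i
  have Ccl: "closed (C i)" for i unfolding C_def A_def
    by (intro compact_imp_closed compact_continuous_image continuous_intros) auto
  have CS: "C i \<subseteq> sphere 0 1" for i by (auto simp: C_def)
  have Cdisj: "C i \<inter> C j = {}" if "i < M" "j < M" "i \<noteq> j" for i j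
  proof -
    have "False" if "i < j" "j < M" "s \<in> A i" "t \<in> A j" "cis (2 * pi * s) = cis (2 * pi * t)" for i j s t
    proof -
      have s: "0 < s" "s < 1" and t: "0 < t" "t < 1" using A01[of i] A01[of j] that by auto
      have "cis (2 * pi * s - 2 * pi * t) = 1" using that(5) by (simp add: cis_divide[symmetric])
      then obtain n :: int where "2 * pi * s - 2 * pi * t = 2 * pi * of_int n"
        unfolding cis_conv_exp exp_eq_1 by (auto simp: mult_ac)
      then have "2 * pi * (s - t) = 2 * pi * of_int n" by (simp add: right_diff_distrib)
      then have n: "s - t = of_int n" by simp
      then have "\<bar>of_int n :: real\<bar> < 1" using s t by (simp add: n[symmetric] abs_less_iff)
      then have "n = 0" by (simp only: of_int_abs[symmetric])
      then have "s = t" using n by simp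
      moreover have "(real i + 1) / M \<le> real j / M" using that(1) by (intro divide_right_mono) auto
      moreover have "s \<le> (real i + 1) / M - tau" "real j / M + tau \<le> t" using that(3,4) by (simp_all add: A_def add.commute)
      ultimately show False using tau(1) by linarith
    qed
    then show ?thesis using that unfolding C_def by (fastforce simp: neq_iff)
  qed
  define eta where "eta = min (1 / 2) (e / (4 * (D + 1)))"
  have eta: "0 < eta" "eta < 1" "eta * D \<le> e / 4"
  proof -
    show "0 < eta" "eta < 1" using e D by (auto simp: eta_def)
    have "eta * D \<le> (e / (4 * (D + 1))) * D" using D by (intro mult_right_mono) (auto simp: eta_def)
    also have "\<dots> \<le> e / 4" using D e by (simp add: field_simps)
    finally show "eta * D \<le> e / 4" .
  qed
  \<comment> \<open>Separation by Stone-Weierstrass requires disjoint closed sets, which the gaps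
    provide.\<close>
  have "\<exists>f\<in>trig_poly. f ` sphere 0 1 \<subseteq> {0..1} \<and> (\<forall>x\<in>(\<Union>j\<in>{..<M}-{i}. C j). f x < eta) \<and> (\<forall>x\<in>C i. f x > 1 - eta)" if "i < M" for i
  proof (rule function_ring_on.two[OF function_ring_trig_poly])
    show "closed (\<Union>j\<in>{..<M}-{i}. C j)" by (intro closed_UN ballI Ccl) auto
    show "(\<Union>j\<in>{..<M}-{i}. C j) \<inter> C i = {}" using Cdisj that by blast
  qed (use CS Ccl eta in auto)
  then have ex: "\<forall>i. \<exists>f. i < M \<longrightarrow> f \<in> trig_poly \<and> f ` sphere 0 1 \<subseteq> {0..1} \<and> (\<forall>x\<in>(\<Union>j\<in>{..<M}-{i}. C j). f x < eta) \<and> (\<forall>x\<in>C i. f x > 1 - eta)"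
    by blast
  obtain chi where chi0: "\<forall>i. i < M \<longrightarrow> chi i \<in> trig_poly \<and> chi i ` sphere 0 1 \<subseteq> {0..1} \<and> (\<forall>x\<in>(\<Union>j\<in>{..<M}-{i}. C j). chi i x < eta) \<and> (\<forall>x\<in>C i. chi i x > 1 - eta)"
    using choice[OF ex] by blast
  have chi: "\<And>i. i < M \<Longrightarrow> chi i \<in> trig_poly" "\<And>i. i < M \<Longrightarrow> chi i ` sphere 0 1 \<subseteq> {0..1}"
     "\<And>i j x. i < M \<Longrightarrow> j < M \<Longrightarrow> j \<noteq> i \<Longrightarrow> x \<in> C j \<Longrightarrow> chi i x < eta" "\<And>i x. i < M \<Longrightarrow> x \<in> C i \<Longrightarrow> chi i x > 1 - eta"
    using chi0 by (auto simp: Ball_def)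
  have chi01: "0 \<le> chi i (cis x)" "chi i (cis x) \<le> 1" if "i < M" for i x
    using chi(2)[OF that] by (auto simp: image_subset_iff)
  define G where "G s t = z + cis (2 * pi * s) *s v + (\<Sum>i<M. of_real (chi i (cis (2 * pi * s))) *s (g i (cis (2 * pi * t)) - g i 0))" for s t
  have chic: "continuous_on (sphere 0 1) (chi i)" if "i < M" for i using chi(1)[OF that] by (simp add: trig_poly_def)
  have Gc: "continuous_on UNIV (\<lambda>x. G (fst x) (snd x))"
    unfolding G_def
    by (intro continuous_intros continuous_on_compose2[OF chic] continuous_on_compose2[OF continuous_on_poly_disc[OF g(1)]]) auto
  have Gc': "continuous_on S (\<lambda>x. phi (G (a x) (b x)))" if "continuous_on S a" "continuous_on S b" for S :: "'c::topological_space set" and a b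
    using continuous_on_compose2[OF phi_cont[OF Gc] continuous_on_Pair[OF that]] by simp
  have Gi: "(\<lambda>t. phi (G s t)) integrable_on {0..1}" for s by (intro integrable_continuous_real Gc' continuous_intros)
  have bound: "integral {0..1} (\<lambda>t. phi (G s t)) \<le> B" for s
  proof -
    have "phi (G s t) \<le> B" for t
    proof -
      have "norm (G s t - z) \<le> norm (cis (2 * pi * s) *s v) + norm (\<Sum>i<M. of_real (chi i (cis (2 * pi * s))) *s (g i (cis (2 * pi * t)) - g i 0))"
        using norm_triangle_ineq[of "cis (2 * pi * s) *s v"] by (simp add: G_def)
      also have "\<dots> \<le> norm v + (\<Sum>i<M. Di i)"
      proof (intro add_mono order_trans[OF norm_sum sum_mono])
        fix i assume i: "i \<in> {..<M}"
        show "norm (of_real (chi i (cis (2 * pi * s))) *s (g i (cis (2 * pi * t)) - g i 0)) \<le> Di i"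
          using mult_mono[of "chi i (cis (2 * pi * s))" 1 "norm (g i (cis (2 * pi * t)) - g i 0)" "Di i"]
            chi01[of i "2 * pi * s"] Di(2)[of "cis (2 * pi * t)" i] i
          unfolding norm_vector_scalar_mult by simp
      qed (simp add: norm_vector_scalar_mult)
      finally show ?thesis using phi_lip[of "G s t" z] unfolding B_def D_def by (simp add: abs_le_iff)
    qed
    then have "integral {0..1} (\<lambda>t. phi (G s t)) \<le> integral {0..1} (\<lambda>t::real. B)" by (intro integral_le Gi) auto
    then show ?thesis by simp
  qed
  have cisdiff: "norm (cis (2 * pi * s) - cis (2 * pi * t)) \<le> 2 * pi * \<bar>s - t\<bar>" for s t :: real
  proof -
    have "cis (2 * pi * s) - cis (2 * pi * t) = cis (2 * pi * t) * (exp (\<i> * of_real (2 * pi * (s - t))) - 1)"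
      by (simp add: cis_conv_exp algebra_simps exp_diff exp_minus field_simps)
    then have "norm (cis (2 * pi * s) - cis (2 * pi * t)) = 2 * \<bar>sin (2 * pi * (s - t) / 2)\<bar>"
      using dist_exp_i_1[of "2 * pi * (s - t)"] by (simp add: norm_mult)
    also have "\<dots> \<le> 2 * \<bar>2 * pi * (s - t) / 2\<bar>" using abs_sin_x_le_abs_x by (intro mult_left_mono) auto
    finally show ?thesis by (simp add: abs_mult)
  qed
  have good: "integral {0..1} (\<lambda>t. phi (G s t)) \<le> ?E (z + cis (2 * pi * s) *s v) + 3 * e / 4" if i: "i < M" and s: "s \<in> A i" for i s
  proof -
    have si: "\<bar>s - real i / M\<bar> \<le> 1 / M" using s tau(1) by (auto simp: A_def abs_le_iff add_divide_distrib)
    have c: "norm ((cis (2 * pi * s) - cis (2 * pi * (real i / M))) *s v) \<le> 2 * pi / M * norm v"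
    proof -
      have "2 * pi * \<bar>s - real i / M\<bar> \<le> 2 * pi * (1 / M)" using si by (intro mult_left_mono) auto
      then show ?thesis using cisdiff[of s "real i / M"] unfolding norm_vector_scalar_mult by (intro mult_right_mono) auto
    qed
    have sC: "cis (2 * pi * s) \<in> C i" using s by (auto simp: C_def)
    have "phi (G s t) \<le> phi (g i (cis (2 * pi * t))) + (2 * pi / M * norm v + eta * D)" for t
    proof -
      let ?d = "\<lambda>j. g j (cis (2 * pi * t)) - g j 0"
      have "G s t - g i (cis (2 * pi * t)) = (cis (2 * pi * s) - cis (2 * pi * (real i / M))) *s v +
         (\<Sum>j<M. (of_real (chi j (cis (2 * pi * s))) - (if j = i then 1 else 0)) *s ?d j)"
      proof -
        have "(\<Sum>j<M. (of_real (chi j (cis (2 * pi * s))) - (if j = i then 1 else 0)) *s ?d j) =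
          (\<Sum>j<M. of_real (chi j (cis (2 * pi * s))) *s ?d j) - (\<Sum>j<M. (if j = i then ?d j else 0))"
          by (subst sum_subtractf[symmetric], intro sum.cong) (auto simp: vec_eq_iff left_diff_distrib)
        also have "(\<Sum>j<M. (if j = i then ?d j else 0)) = ?d i" using i by (simp add: sum.delta)
        finally show ?thesis unfolding G_def g(2)[of i] by (simp add: vec_eq_iff algebra_simps)
      qed
      also have "norm \<dots> \<le> 2 * pi / M * norm v + (\<Sum>j<M. eta * Di j)"
      proof (rule order_trans[OF norm_triangle_ineq add_mono[OF c order_trans[OF norm_sum sum_mono]]])
        fix j assume j: "j \<in> {..<M}"
        have "norm (of_real (chi j (cis (2 * pi * s))) - (if j = i then 1 else 0) :: complex) \<le> eta"
        proof (cases "j = i")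
          case True
          have "of_real (chi i (cis (2 * pi * s))) - 1 = (of_real (chi i (cis (2 * pi * s)) - 1) :: complex)" by simp
          then have "norm (of_real (chi i (cis (2 * pi * s))) - 1 :: complex) = \<bar>chi i (cis (2 * pi * s)) - 1\<bar>" by (simp only: norm_of_real)
          then show ?thesis using True chi(4)[OF i sC] chi01(2)[OF i, of "2 * pi * s"] by simp
        next
          case False
          then show ?thesis using chi(3)[of j i "cis (2 * pi * s)"] chi01(1)[of j "2 * pi * s"] j i sC by simp
        qed
        then show "norm ((of_real (chi j (cis (2 * pi * s))) - (if j = i then 1 else 0)) *s ?d j) \<le> eta * Di j"
          unfolding norm_vector_scalar_mult using Di(2)[of "cis (2 * pi * t)" j] eta(1) by (intro mult_mono) auto
      qed
      also have "(\<Sum>j<M. eta * Di j) = eta * D" by (simp add: D_def sum_distrib_left)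
      finally show ?thesis using phi_lip[of "G s t" "g i (cis (2 * pi * t))"] by (simp add: abs_le_iff)
    qed
    then have "integral {0..1} (\<lambda>t. phi (G s t)) \<le> integral {0..1} (\<lambda>t. phi (g i (cis (2 * pi * t))) + (2 * pi / M * norm v + eta * D))"
      by (intro integral_le Gi integrable_add disc_cost_integrable g integrable_const_ivl) auto
    also have "\<dots> = integral {0..1} (\<lambda>t. phi (g i (cis (2 * pi * t)))) + (2 * pi / M * norm v + eta * D)"
      by (subst integral_add) (auto intro: disc_cost_integrable g integrable_const_ivl)
    also have "\<dots> \<le> ?E (z + cis (2 * pi * (real i / M)) *s v) + e / 4 + (2 * pi / M * norm v + eta * D)"
      using g(3)[of i] by simp
    also have "?E (z + cis (2 * pi * (real i / M)) *s v) \<le> ?E (z + cis (2 * pi * s) *s v) + 2 * pi / M * norm v"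
    proof -
      have "(z + cis (2 * pi * s) *s v) - (z + cis (2 * pi * (real i / M)) *s v) = (cis (2 * pi * s) - cis (2 * pi * (real i / M))) *s v"
        by (simp add: vec_eq_iff algebra_simps)
      then show ?thesis using disc_envelope_lipschitz[of "z + cis (2 * pi * s) *s v" "z + cis (2 * pi * (real i / M)) *s v"] c
        by (simp add: abs_le_iff)
    qed
    finally show ?thesis using Mv eta(3) by (simp add: field_simps)
  qed
  \<comment> \<open>A sum of indicators that is at least 1 on every gap; overlaps do no harm,
    because \<open>T\<close> only serves as an upper bound.\<close>
  define T where "T s = (\<Sum>i<M. (if s \<in> {real i / M..real i / M + tau} then 1 else 0) + (if s \<in> {(real i + 1) / M - tau..(real i + 1) / M} then 1 else (0::real)))" for s
  have Tint: "(T has_integral (2 * tau * M)) {0..1}"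
  proof -
    have ind: "((\<lambda>s. if s \<in> {a..b} then 1 else (0::real)) has_integral (b - a)) {0..1}" if "0 \<le> a" "a \<le> b" "b \<le> 1" for a b :: real
      using has_integral_const_real[of "1::real" a b] that
      by (subst has_integral_restrict) auto
    have "((\<lambda>s. \<Sum>i<M. (if s \<in> {real i / M..real i / M + tau} then 1 else 0) + (if s \<in> {(real i + 1) / M - tau..(real i + 1) / M} then 1 else (0::real)))
       has_integral (\<Sum>i<M. ((real i / M + tau) - real i / M) + ((real i + 1) / M - ((real i + 1) / M - tau)))) {0..1}"
    proof (intro has_integral_sum has_integral_add ind)
      fix i assume i: "i \<in> {..<M}"
      have q: "(real i + 1) / M = real i / M + 1 / M" by (simp add: add_divide_distrib)
      have 1: "(real i + 1) / M \<le> 1" using i M0 by (simp add: divide_le_eq)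
      have 2: "tau \<le> 1 / M" using tau(2) M0 by (simp add: field_simps)
      show "real i / M + tau \<le> 1" "0 \<le> (real i + 1) / M - tau" using 1 2 q divide_nonneg_nonneg[of "real i" "real M"] by linarith+
      show "(real i + 1) / M \<le> 1" by (rule 1)
    qed (use tau(1) in auto)
    then show ?thesis unfolding T_def by (simp add: mult_ac)
  qed
  have le: "integral {0..1} (\<lambda>t. phi (G s t)) \<le> (?E (z + cis (2 * pi * s) *s v) + 3 * e / 4) + B * T s" if s: "s \<in> {0..1}" for s
  proof -
    \<comment> \<open>The index of the arc containing \<open>s\<close>; the endpoint 1 is assigned
      to the last arc.\<close>
    define i where "i = (if s = 1 then M - 1 else nat \<lfloor>s * M\<rfloor>)"
    have i: "i < M \<and> real i / M \<le> s \<and> s \<le> (real i + 1) / M"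
    proof (cases "s = 1")
      case True then show ?thesis using M0 by (auto simp: i_def of_nat_diff)
    next
      case False
      then have s1: "0 \<le> s" "s < 1" using s by auto
      have fl: "real i = of_int \<lfloor>s * M\<rfloor>" using False s1 by (simp add: i_def)
      have r: "real i \<le> s * M" "s * M \<le> real i + 1" unfolding fl using floor_correct[of "s * M"] by auto
      have "s * real M < 1 * real M" using s1 M0 by (intro mult_strict_right_mono) auto
      then have "real i < real M" using r by simp
      then show ?thesis using r M0 by (simp add: field_simps)
    qed
    have T0: "0 \<le> T s" unfolding T_def by (intro sum_nonneg) auto
    show ?thesis
    proof (cases "s \<in> A i")
      case True
      then show ?thesis using good[of i s] i B T0 mult_nonneg_nonneg[OF B T0] by linarith
    next
      case False
      then have "1 \<le> (if s \<in> {real i / M..real i / M + tau} then 1 else 0) + (if s \<in> {(real i + 1) / M - tau..(real i + 1) / M} then 1 else (0::real))"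
        using i by (auto simp: A_def add.commute)
      also have "\<dots> \<le> T s" unfolding T_def using i
        by (intro member_le_sum[where f = "\<lambda>i. (if s \<in> {real i / M..real i / M + tau} then 1 else 0) + (if s \<in> {(real i + 1) / M - tau..(real i + 1) / M} then 1 else (0::real))"]) auto
      finally have "B * 1 \<le> B * T s" using B by (intro mult_left_mono)
      then show ?thesis using bound[of s] disc_envelope_nonneg[of "z + cis (2 * pi * s) *s v"] e by linarith
    qed
  qed
  have "?E z \<le> integral {0..1} (\<lambda>s. integral {0..1} (\<lambda>t. phi (G s t)))"
    unfolding G_def using chi(1) g(1) by (intro disc_envelope_glue) auto
  also have "\<dots> \<le> integral {0..1} (\<lambda>s. (?E (z + cis (2 * pi * s) *s v) + 3 * e / 4) + B * T s)"
  proof (rule integral_le)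
    have "continuous_on UNIV (\<lambda>s. integral (cbox 0 1) (\<lambda>t. phi (G s t)))"
      by (rule integral_continuous_on_param) (auto simp: split_def intro!: Gc' continuous_intros)
    then show "(\<lambda>s. integral {0..1} (\<lambda>t. phi (G s t))) integrable_on {0..1}"
      by (intro integrable_continuous_real) (auto intro: continuous_on_subset)
    show "(\<lambda>s. (?E (z + cis (2 * pi * s) *s v) + 3 * e / 4) + B * T s) integrable_on {0..1}"
      by (intro integrable_add integrable_on_mult_right has_integral_integrable[OF Tint] integrable_continuous_real[OF Ec] integrable_const_ivl)
  qed (rule le)
  also have "\<dots> = (integral {0..1} (\<lambda>s. ?E (z + cis (2 * pi * s) *s v)) + 3 * e / 4) + B * (2 * tau * M)"
  proof (rule integral_unique, intro has_integral_add has_integral_mult_right Tint)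
    show "((\<lambda>s. ?E (z + cis (2 * pi * s) *s v)) has_integral integral {0..1} (\<lambda>s. ?E (z + cis (2 * pi * s) *s v))) {0..1}"
      by (intro integrable_integral integrable_continuous_real Ec)
    show "((\<lambda>s. 3 * e / 4) has_integral 3 * e / 4) {0..(1::real)}" using has_integral_const_real[of "3 * e / 4" 0 1] by simp
  qed
  finally show "?E z \<le> integral {0..1} (\<lambda>t. ?E (z + cis (2 * pi * t) *s v)) + e" using tau(3) by simp
qed

end

theorem poly_hull_small_disc:
  fixes K :: "(complex^'n) set"
  assumes K: "compact K" and a: "a \<in> poly_hull K" and e: "e > 0"
  shows "\<exists>f. poly_disc f \<and> f 0 = a \<and> integral {0..1} (\<lambda>t. infdist (f (cis (2 * pi * t))) K) < e"
proof -
  have ne: "K \<noteq> {}" using a poly_hull_empty by auto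
  have lip: "\<bar>infdist z K - infdist w K\<bar> \<le> norm (z - w)" for z w :: "complex^'n"
    using infdist_triangle_abs[of z K w] by (simp add: dist_norm)
  note env = lip infdist_nonneg
  have "disc_envelope (\<lambda>z. infdist z K) a \<le> 0"
  proof (rule submean_le_on_poly_hull[OF K _ _ _ a])
    show "disc_envelope (\<lambda>z. infdist z K) z \<le> 0" if "z \<in> K" for z
      using disc_envelope_le_self[OF env, of z] that by simp
  qed (rule disc_envelope_lipschitz[OF env] disc_envelope_submean[OF env])+
  moreover obtain f where "poly_disc f" "f 0 = a" "integral {0..1} (\<lambda>t. infdist (f (cis (2 * pi * t))) K) < disc_envelope (\<lambda>z. infdist z K) a + e"
    using disc_envelope_approx[OF env e] by blast
  ultimately show ?thesis by (intro exI[of _ f]) linarith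
qed

section \<open>Herglotz transforms on the circle\<close>

abbreviation unit_interval :: "real measure" where
  "unit_interval \<equiv> lebesgue_on {0..1}"

definition circ :: "real \<Rightarrow> complex" where
  "circ t = cis (2 * pi * t)"

lemma norm_circ [simp]: "norm (circ t) = 1" by (simp add: circ_def)

lemma circ_nonzero [simp]: "circ t \<noteq> 0" by (simp add: circ_def)

lemma continuous_on_circ [continuous_intros]: "continuous_on S f \<Longrightarrow> continuous_on S (\<lambda>x. circ (f x))"
  unfolding circ_def by (intro continuous_intros)

lemma borel_measurable_circ [measurable]: "circ \<in> borel_measurable borel"
  by (intro borel_measurable_continuous_onI continuous_intros)

lemma measurable_unit_interval: "f \<in> borel_measurable borel \<Longrightarrow> f \<in> borel_measurable unit_interval"
  by (intro measurable_restrict_space1 measurable_completion) simp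

lemma circ_measurable_unit_interval [measurable]: "circ \<in> borel_measurable unit_interval"
  by (rule measurable_unit_interval[OF borel_measurable_circ])

lemma finite_measure_unit_interval: "finite_measure unit_interval"
  by (rule finite_measureI) (simp add: emeasure_restrict_space)

interpretation unit_interval: finite_measure unit_interval by (rule finite_measure_unit_interval)

lemma measure_unit_interval: "measure unit_interval {0..1} = 1"
  by (simp add: measure_restrict_space)

lemma sigma_T_eq: "sigma_T = distr unit_interval borel circ"
  by (simp add: sigma_T_def circ_def[abs_def])

lemma integrable_sigma_T:
  fixes f :: "complex \<Rightarrow> 'a::{banach, second_countable_topology}"
  shows "f \<in> borel_measurable borel \<Longrightarrow> integrable sigma_T f \<longleftrightarrow> integrable unit_interval (\<lambda>t. f (circ t))"
  unfolding sigma_T_eq by (rule integrable_distr_eq) auto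

lemma integral_sigma_T:
  fixes f :: "complex \<Rightarrow> 'a::{banach, second_countable_topology}"
  shows "f \<in> borel_measurable borel \<Longrightarrow> integral\<^sup>L sigma_T f = integral\<^sup>L unit_interval (\<lambda>t. f (circ t))"
  unfolding sigma_T_eq by (rule integral_distr) auto

definition herglotz :: "complex \<Rightarrow> complex \<Rightarrow> complex" where
  "herglotz p z = (p + z) / (p - z)"

lemma herglotz_0 [simp]: "p \<noteq> 0 \<Longrightarrow> herglotz p 0 = 1" by (simp add: herglotz_def)

lemma herglotz_measurable [measurable]: "(\<lambda>p. herglotz p z) \<in> borel_measurable borel"
  unfolding herglotz_def by measurable

lemma norm_diff_ge: "norm p = 1 \<Longrightarrow> 1 - norm z \<le> norm (p - z :: complex)"
  using norm_triangle_ineq2[of p z] by simp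

lemma norm_herglotz_le:
  assumes "norm p = 1" "norm z < 1"
  shows "norm (herglotz p z) \<le> (1 + norm z) / (1 - norm z)"
  unfolding herglotz_def norm_divide using norm_diff_ge[OF assms(1), of z] norm_triangle_ineq[of p z] assms
  by (intro frac_le) auto

lemma Re_herglotz:
  assumes "norm p = 1" "norm z < 1"
  shows "Re (herglotz p z) = (1 - (norm z)\<^sup>2) / (norm (p - z))\<^sup>2" "0 < Re (herglotz p z)"
proof -
  have "p - z \<noteq> 0" using norm_diff_ge[OF assms(1), of z] assms by auto
  have "(p + z) / (p - z) = (p + z) * cnj (p - z) / of_real ((norm (p - z))\<^sup>2)"
    using \<open>p - z \<noteq> 0\<close> by (simp add: complex_norm_square divide_simps del: of_real_power)
  then have "Re (herglotz p z) = Re ((p + z) * cnj (p - z)) / (norm (p - z))\<^sup>2"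
    unfolding herglotz_def by (simp only: Re_divide_of_real)
  also have "Re ((p + z) * cnj (p - z)) = (norm p)\<^sup>2 - (norm z)\<^sup>2"
    unfolding cmod_power2 by (simp add: algebra_simps power2_eq_square)
  finally show *: "Re (herglotz p z) = (1 - (norm z)\<^sup>2) / (norm (p - z))\<^sup>2" using assms by simp
  have "(norm z)\<^sup>2 < 1" using assms(2) by (simp add: power_less_one_iff)
  then show "0 < Re (herglotz p z)" unfolding * using \<open>p - z \<noteq> 0\<close> by simp
qed

lemma Re_herglotz_circle:
  assumes "norm p = 1" "norm z = 1"
  shows "Re (herglotz p z) = 0"
proof (cases "p = z")
  case False
  have "(p + z) / (p - z) = (p + z) * cnj (p - z) / of_real ((norm (p - z))\<^sup>2)"
    using False by (simp add: complex_norm_square divide_simps del: of_real_power)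
  then have "Re (herglotz p z) = Re ((p + z) * cnj (p - z)) / (norm (p - z))\<^sup>2"
    unfolding herglotz_def by (simp only: Re_divide_of_real)
  also have "Re ((p + z) * cnj (p - z)) = (norm p)\<^sup>2 - (norm z)\<^sup>2"
    unfolding cmod_power2 by (simp add: algebra_simps power2_eq_square)
  finally show ?thesis using assms by simp
qed (simp add: herglotz_def)

lemma integrable_herglotz:
  assumes c: "integrable M c" and p: "p \<in> borel_measurable M" and p1: "AE w in M. norm (p w) = 1" and z: "norm z < 1"
  shows "integrable M (\<lambda>w. herglotz (p w) z * of_real (c w))"
proof (rule Bochner_Integration.integrable_bound)
  show "integrable M (\<lambda>w. (1 + norm z) / (1 - norm z) * c w)" using c by simp
  have "herglotz (p w) z = (p w + z) / (p w - z)" for w by (simp add: herglotz_def)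
  then show "(\<lambda>w. herglotz (p w) z * of_real (c w)) \<in> borel_measurable M"
    using p borel_measurable_integrable[OF c] by simp
  show "AE w in M. norm (herglotz (p w) z * of_real (c w)) \<le> norm ((1 + norm z) / (1 - norm z) * c w)"
    using p1
  proof eventually_elim
    case (elim w)
    have "norm (herglotz (p w) z) * \<bar>c w\<bar> \<le> (1 + norm z) / (1 - norm z) * \<bar>c w\<bar>"
      by (intro mult_right_mono norm_herglotz_le elim z) auto
    then show ?case using z by (simp add: norm_mult abs_mult)
  qed
qed

lemma Re_integral_herglotz:
  assumes "integrable M c" "p \<in> borel_measurable M" "AE w in M. norm (p w) = 1" "norm z < 1"
  shows "Re (integral\<^sup>L M (\<lambda>w. herglotz (p w) z * of_real (c w))) = integral\<^sup>L M (\<lambda>w. Re (herglotz (p w) z) * c w)"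
  using integral_Re[OF integrable_herglotz[OF assms]] by simp

text \<open>The kernel is 1 plus twice the sum of the positive powers of \<open>z / p\<close>, and
  termwise integration gives a power series. Allowing a measure space with a map \<open>p\<close> to
  the circle covers arc length, measures on the circle and image measures alike.\<close>

lemma herglotz_transform_holomorphic:
  assumes c: "integrable M c" and p: "p \<in> borel_measurable M" and p1: "AE w in M. norm (p w) = 1"
  shows "(\<lambda>z. integral\<^sup>L M (\<lambda>w. herglotz (p w) z * of_real (c w))) holomorphic_on ball 0 1"
proof -
  define a where "a k = (if k = 0 then 1 else 2) * integral\<^sup>L M (\<lambda>w. (1 / p w) ^ k * of_real (c w))" for k
  have int: "integrable M (\<lambda>w. (1 / p w) ^ k * of_real (c w))" for k
  proof (rule Bochner_Integration.integrable_bound[OF c])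
    show "(\<lambda>w. (1 / p w) ^ k * of_real (c w)) \<in> borel_measurable M"
      using p borel_measurable_integrable[OF c] by simp
    show "AE w in M. norm ((1 / p w) ^ k * of_real (c w)) \<le> norm (c w)"
      using p1 by eventually_elim (simp add: norm_mult norm_power norm_divide)
  qed
  define I where "I = integral\<^sup>L M (\<lambda>w. \<bar>c w\<bar>)"
  have "(\<lambda>k. a k * (z - 0) ^ k) sums integral\<^sup>L M (\<lambda>w. herglotz (p w) z * of_real (c w))" if z: "z \<in> ball 0 1" for z
  proof -
    have z1: "norm z < 1" using z by simp
    have partial: "(\<Sum>k<Suc n. a k * z ^ k) = integral\<^sup>L M (\<lambda>w. (\<Sum>k<Suc n. (if k = 0 then 1 else 2) * (z / p w) ^ k) * of_real (c w))" for n
    proof -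
      have "a k * z ^ k = integral\<^sup>L M (\<lambda>w. (if k = 0 then 1 else 2) * (z / p w) ^ k * of_real (c w))" for k
      proof -
        have "a k * z ^ k = ((if k = 0 then 1 else 2) * z ^ k) * integral\<^sup>L M (\<lambda>w. (1 / p w) ^ k * of_real (c w))"
          by (simp add: a_def)
        also have "\<dots> = integral\<^sup>L M (\<lambda>w. ((if k = 0 then 1 else 2) * z ^ k) * ((1 / p w) ^ k * of_real (c w)))"
          by (rule integral_mult_right_zero[symmetric])
        also have "\<dots> = integral\<^sup>L M (\<lambda>w. (if k = 0 then 1 else 2) * (z / p w) ^ k * of_real (c w))"
          by (intro Bochner_Integration.integral_cong refl) (simp add: power_divide)
        finally show ?thesis .
      qed
      moreover have "integrable M (\<lambda>w. (if k = 0 then 1 else 2) * (z / p w) ^ k * of_real (c w))" for k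
      proof -
        have "integrable M (\<lambda>w. ((if k = 0 then 1 else 2) * z ^ k) * ((1 / p w) ^ k * of_real (c w)))" using int by simp
        then show ?thesis by (simp add: power_divide mult_ac)
      qed
      ultimately show ?thesis by (simp only: sum_distrib_right Bochner_Integration.integral_sum)
    qed
    have geo: "herglotz q z - (\<Sum>k<Suc n. (if k = 0 then 1 else 2) * (z / q) ^ k) = 2 * (z / q) ^ Suc n / (1 - z / q)" if q: "norm q = 1" for q n
    proof -
      define y where "y = z / q"
      have q0: "q \<noteq> 0" using q by auto
      have "norm y < 1" using q z1 by (simp add: y_def norm_divide)
      then have y1: "y \<noteq> 1" by auto
      have "1 + y = (q + z) / q" "1 - y = (q - z) / q" using q0 by (simp_all add: y_def add_divide_distrib diff_divide_distrib)
      then have H: "herglotz q z = (1 + y) / (1 - y)" unfolding herglotz_def using q0 by simp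
      have S: "(\<Sum>k<Suc n. (if k = 0 then 1 else 2) * y ^ k) = 2 * (\<Sum>k<Suc n. y ^ k) - 1"
        by (induction n) (auto simp: algebra_simps)
      have "(\<Sum>k<Suc n. y ^ k) = (1 - y ^ Suc n) / (1 - y)"
        using one_diff_power_eq[of y "Suc n"] y1 by (simp add: field_simps)
      then have "herglotz q z - (\<Sum>k<Suc n. (if k = 0 then 1 else 2) * y ^ k) = (1 + y) / (1 - y) - (2 * ((1 - y ^ Suc n) / (1 - y)) - (1 - y) / (1 - y))"
        unfolding H S using y1 by simp
      also have "\<dots> = ((1 + y) - (2 * (1 - y ^ Suc n) - (1 - y))) / (1 - y)" by (simp only: diff_divide_distrib[symmetric] times_divide_eq_right)
      also have "\<dots> = 2 * y ^ Suc n / (1 - y)" by (simp add: algebra_simps)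
      finally show ?thesis by (simp add: y_def)
    qed
    have rem: "norm ((\<Sum>k<Suc n. a k * z ^ k) - integral\<^sup>L M (\<lambda>w. herglotz (p w) z * of_real (c w))) \<le> 2 * norm z ^ Suc n / (1 - norm z) * I" for n
    proof -
      let ?S = "\<lambda>w. \<Sum>k<Suc n. (if k = 0 then 1 else 2) * (z / p w) ^ k"
      have iS: "integrable M (\<lambda>w. ?S w * of_real (c w))"
      proof (rule Bochner_Integration.integrable_bound)
        show "integrable M (\<lambda>w. (\<Sum>k<Suc n. 2) * c w)" using c by simp
        show "(\<lambda>w. ?S w * of_real (c w)) \<in> borel_measurable M" using p borel_measurable_integrable[OF c] by simp
        show "AE w in M. norm (?S w * of_real (c w)) \<le> norm ((\<Sum>k<Suc n. 2) * c w)" using p1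
        proof eventually_elim
          case (elim w)
          have "norm (?S w) \<le> (\<Sum>k<Suc n. 2)"
          proof (rule order_trans[OF norm_sum sum_mono])
            fix k
            have "norm ((z / p w) ^ k) \<le> 1" using elim z1 by (simp add: norm_power norm_divide power_le_one)
            then show "norm ((if k = 0 then 1 else 2) * (z / p w) ^ k) \<le> 2" by (auto simp: norm_mult)
          qed
          then have "norm (?S w) * \<bar>c w\<bar> \<le> (\<Sum>k<Suc n. 2) * \<bar>c w\<bar>" by (rule mult_right_mono) simp
          then show ?case unfolding norm_mult real_norm_def abs_mult norm_of_real by simp
        qed
      qed
      have "(\<Sum>k<Suc n. a k * z ^ k) - integral\<^sup>L M (\<lambda>w. herglotz (p w) z * of_real (c w)) =
          integral\<^sup>L M (\<lambda>w. ?S w * of_real (c w) - herglotz (p w) z * of_real (c w))"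
        unfolding partial by (rule Bochner_Integration.integral_diff[symmetric, OF iS integrable_herglotz[OF c p p1 z1]])
      also have "norm \<dots> \<le> integral\<^sup>L M (\<lambda>w. 2 * norm z ^ Suc n / (1 - norm z) * \<bar>c w\<bar>)"
      proof (rule order_trans[OF integral_norm_bound integral_mono_AE])
        show "integrable M (\<lambda>w. norm (?S w * of_real (c w) - herglotz (p w) z * of_real (c w)))"
          by (rule integrable_norm[OF Bochner_Integration.integrable_diff[OF iS integrable_herglotz[OF c p p1 z1]]])
        show "integrable M (\<lambda>w. 2 * norm z ^ Suc n / (1 - norm z) * \<bar>c w\<bar>)" using c by simp
        show "AE w in M. norm (?S w * of_real (c w) - herglotz (p w) z * of_real (c w)) \<le> 2 * norm z ^ Suc n / (1 - norm z) * \<bar>c w\<bar>"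
          using p1
        proof eventually_elim
          case (elim w)
          have "norm (1 - z / p w) \<ge> 1 - norm z" using norm_triangle_ineq2[of 1 "z / p w"] elim by (simp add: norm_divide)
          then have "norm (2 * (z / p w) ^ Suc n / (1 - z / p w)) \<le> 2 * norm z ^ Suc n / (1 - norm z)"
            unfolding norm_divide norm_mult norm_power using elim z1 by (intro frac_le) auto
          then have n: "norm (?S w - herglotz (p w) z) \<le> 2 * norm z ^ Suc n / (1 - norm z)"
            using geo[OF elim, of n] by (metis norm_minus_commute)
          have "?S w * of_real (c w) - herglotz (p w) z * of_real (c w) = (?S w - herglotz (p w) z) * of_real (c w)" by (rule left_diff_distrib[symmetric])
          then show ?case using mult_right_mono[OF n, of "\<bar>c w\<bar>"] by (simp only: norm_mult norm_of_real abs_ge_zero)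
        qed
      qed
      finally show ?thesis unfolding I_def by simp
    qed
    have "(\<lambda>n. 2 * norm z ^ Suc n / (1 - norm z) * I) \<longlonglongrightarrow> 2 * 0 / (1 - norm z) * I"
      using z1 by (intro tendsto_intros LIMSEQ_Suc[OF LIMSEQ_power_zero]) auto
    then have lim0: "(\<lambda>n. 2 * norm z ^ Suc n / (1 - norm z) * I) \<longlonglongrightarrow> 0" by (simp only: mult_zero_right div_0 mult_zero_left)
    have "(\<lambda>n. (\<Sum>k<Suc n. a k * z ^ k) - integral\<^sup>L M (\<lambda>w. herglotz (p w) z * of_real (c w))) \<longlonglongrightarrow> 0"
      by (rule Lim_null_comparison[OF eventuallyI[OF rem] lim0])
    then have "(\<lambda>n. \<Sum>k<Suc n. a k * z ^ k) \<longlonglongrightarrow> integral\<^sup>L M (\<lambda>w. herglotz (p w) z * of_real (c w))"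
      by (rule LIM_zero_cancel)
    then show ?thesis unfolding sums_def diff_zero by (rule LIMSEQ_imp_Suc)
  qed
  then show ?thesis by (rule power_series_holomorphic)
qed

section \<open>Mean values on circles\<close>

lemma integral_mean_value:
  assumes f: "f holomorphic_on ball 0 R" and r: "0 \<le> r" "r < R"
  shows "integral\<^sup>L unit_interval (\<lambda>t. f (of_real r * circ t)) = f 0"
    and "integrable unit_interval (\<lambda>t. f (of_real r * circ t))"
proof -
  have c: "continuous_on {0..1} (\<lambda>t. f (of_real r * circ t))"
    by (rule continuous_on_compose2[OF holomorphic_on_imp_continuous_on[OF f]])
       (use r in \<open>auto intro!: continuous_intros simp: norm_mult\<close>)
  show i: "integrable unit_interval (\<lambda>t. f (of_real r * circ t))"
    by (rule continuous_imp_integrable_real[OF c])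
  have "integral {0..1} (\<lambda>t. f (of_real r * circ t)) = f 0"
  proof (cases "r = 0")
    case False
    have "(\<lambda>u. f u / (u - 0)) = (\<lambda>u. f u / u)" by simp
    have "((\<lambda>u. f u / (u - 0)) has_contour_integral (2 * of_real pi * \<i> * f 0)) (circlepath 0 r)"
      using r False by (intro Cauchy_integral_circlepath_simple holomorphic_on_subset[OF f]) auto
    then have "((\<lambda>t. f (circlepath 0 r t) / (circlepath 0 r t) * vector_derivative (circlepath 0 r) (at t within {0..1})) has_integral 2 * of_real pi * \<i> * f 0) {0..1}"
      by (simp add: has_contour_integral_def)
    then have "((\<lambda>t. f (of_real r * circ t) * (2 * of_real pi * \<i>)) has_integral 2 * of_real pi * \<i> * f 0) {0..1}"
    proof (rule has_integral_eq[rotated])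
      fix t :: real assume t: "t \<in> {0..1}"
      have cp: "circlepath 0 r t = of_real r * circ t" by (simp add: circlepath_def part_circlepath_def linepath_def circ_def cis_conv_exp mult_ac scaleR_conv_of_real)
      show "f (circlepath 0 r t) / circlepath 0 r t * vector_derivative (circlepath 0 r) (at t within {0..1}) = f (of_real r * circ t) * (2 * of_real pi * \<i>)"
        using t False unfolding cp by (simp add: vector_derivative_circlepath01 circ_def cis_conv_exp mult_ac)
    qed
    from has_integral_mult_left[OF this, of "1 / (2 * of_real pi * \<i>)"]
    show ?thesis by (simp add: integral_unique)
  qed simp
  then show "integral\<^sup>L unit_interval (\<lambda>t. f (of_real r * circ t)) = f 0"
    using lebesgue_integral_eq_integral[OF i] by simp
qed

text \<open>On the circle conjugation is inversion, so the kernel is the conjugate of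
  \<open>(1 + cnj z * w) / (1 - cnj z * w)\<close>, which is holomorphic past the closed disc; the
  mean value property evaluates the conjugated integral.\<close>

lemma integral_herglotz_cnj:
  assumes z: "norm z < 1" and f: "f holomorphic_on ball 0 R" "R > 1"
  shows "integral\<^sup>L unit_interval (\<lambda>t. herglotz (circ t) z * cnj (f (circ t))) = cnj (f 0)"
    and "integrable unit_interval (\<lambda>t. herglotz (circ t) z * cnj (f (circ t)))"
proof -
  define F where "F w = (1 + cnj z * w) / (1 - cnj z * w) * f w" for w
  obtain R' where R: "R' > 1" "norm z * R' < 1" "R' \<le> R"
  proof (cases "z = 0")
    case False
    have "1 < min R ((1 + 1 / norm z) / 2)" using z f(2) False by (auto simp: field_simps)
    moreover have "norm z * min R ((1 + 1 / norm z) / 2) \<le> norm z * ((1 + 1 / norm z) / 2)" by (intro mult_left_mono min.cobounded2) auto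
    moreover have "norm z * ((1 + 1 / norm z) / 2) < 1" using z False by (auto simp: field_simps)
    ultimately show ?thesis using that[of "min R ((1 + 1 / norm z) / 2)"] by simp
  qed (use that[of R] f in simp)
  have F: "F holomorphic_on ball 0 R'" unfolding F_def
  proof (intro holomorphic_intros holomorphic_on_subset[OF f(1)])
    fix w :: complex assume "w \<in> ball 0 R'"
    then have "norm (cnj z * w) < 1" using R mult_left_mono[of "norm w" R' "norm z"] by (simp add: norm_mult)
    then show "1 - cnj z * w \<noteq> 0" by auto
  qed (use R in auto)
  have eq: "herglotz (circ t) z * cnj (f (circ t)) = cnj (F (of_real 1 * circ t))" for t
  proof -
    have c: "circ t * cnj (circ t) = 1" by (simp add: complex_norm_square[symmetric])
    have ne: "circ t - z \<noteq> 0" using z by (metis norm_circ less_irrefl right_minus_eq)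
    have "(1 - z * cnj (circ t)) * circ t = circ t - z" "(1 + z * cnj (circ t)) * circ t = circ t + z"
      using c by (simp_all add: algebra_simps)
    then have "herglotz (circ t) z = ((1 + z * cnj (circ t)) * circ t) / ((1 - z * cnj (circ t)) * circ t)"
      by (simp add: herglotz_def)
    also have "\<dots> = (1 + z * cnj (circ t)) / (1 - z * cnj (circ t))" by simp
    finally show ?thesis by (simp add: F_def)
  qed
  have i: "integrable unit_interval (\<lambda>t. F (of_real 1 * circ t))" using integral_mean_value(2)[OF F, of 1] R by simp
  show "integrable unit_interval (\<lambda>t. herglotz (circ t) z * cnj (f (circ t)))"
    unfolding eq by (rule integrable_bounded_linear[OF bounded_linear_cnj i])
  have "integral\<^sup>L unit_interval (\<lambda>t. herglotz (circ t) z * cnj (f (circ t))) = cnj (integral\<^sup>L unit_interval (\<lambda>t. F (of_real 1 * circ t)))"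
    unfolding eq using integral_bounded_linear[OF bounded_linear_cnj i] by simp
  also have "\<dots> = cnj (f 0)" using integral_mean_value(1)[OF F, of 1] R by (simp add: F_def)
  finally show "integral\<^sup>L unit_interval (\<lambda>t. herglotz (circ t) z * cnj (f (circ t))) = cnj (f 0)" .
qed

lemma integral_herglotz_circle:
  assumes "norm z < 1"
  shows "integral\<^sup>L unit_interval (\<lambda>t. herglotz (circ t) z) = 1"
  using integral_herglotz_cnj(1)[OF assms, of "\<lambda>_. 1" 2] by simp

section \<open>Centres of Nevanlinna discs\<close>

text \<open>Rests on
  \<open>|1 - cnj a * z|^2 - |a - z|^2 = (1 - |a|^2) * (1 - |z|^2)\<close>.\<close>

lemma norm_bfac_le:
  assumes "norm a < 1" "norm z < 1"
  shows "norm (bfac a z) \<le> 1"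
proof (cases "a = 0")
  case False
  have "(norm (1 - cnj a * z))\<^sup>2 - (norm (a - z))\<^sup>2 = (1 - (norm a)\<^sup>2) * (1 - (norm z)\<^sup>2)"
    unfolding cmod_power2 by (simp add: power2_eq_square algebra_simps)
  moreover have "(norm a)\<^sup>2 \<le> 1" "(norm z)\<^sup>2 \<le> 1" using assms by (auto simp: power_le_one)
  ultimately have "(norm (a - z))\<^sup>2 \<le> (norm (1 - cnj a * z))\<^sup>2"
    using mult_nonneg_nonneg[of "1 - (norm a)\<^sup>2" "1 - (norm z)\<^sup>2"] by linarith
  then have "norm (a - z) \<le> norm (1 - cnj a * z)" using power2_le_imp_le norm_ge_zero by blast
  then show ?thesis using False by (simp add: bfac_def norm_mult norm_divide divide_le_eq_1)
qed (use assms in \<open>simp add: bfac_def\<close>)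

lemma norm_one_minus_mult_ge: "norm a < 1 \<Longrightarrow> norm z < 1 \<Longrightarrow> 1 - norm z \<le> norm (1 - cnj a * z)"
  using norm_triangle_ineq2[of 1 "cnj a * z"] mult_right_mono[of "norm a" 1 "norm z"] by (simp add: norm_mult)

text \<open>For \<open>a \<noteq> 0\<close> the normalization by \<open>norm a / a\<close> makes
  \<open>1 - norm a\<close> a factor of the difference, so the Blaschke condition yields absolute
  convergence of the product.\<close>

lemma norm_bfac_minus_one_le:
  assumes a: "norm a < 1" and z: "norm z < 1"
  shows "norm (bfac a z - 1) \<le> (1 + norm z) / (1 - norm z) * (1 - norm a)"
proof (cases "a = 0")
  case True
  have "norm (z - 1) \<le> 1 + norm z" using norm_triangle_ineq4[of z 1] by simp
  also have "1 + norm z \<le> (1 + norm z) / (1 - norm z)" using z by (simp add: le_divide_eq mult_left_le)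
  finally show ?thesis using True by (simp add: bfac_def)
next
  case False
  have d: "norm (1 - cnj a * z) \<ge> 1 - norm z" by (rule norm_one_minus_mult_ge[OF a z])
  then have ne: "1 - cnj a * z \<noteq> 0" using z by auto
  have aa: "of_real (norm a) * of_real (norm a) = a * cnj a"
    by (metis complex_norm_square of_real_power power2_eq_square)
  have na: "of_real (norm a) \<noteq> (0::complex)" using False by simp
  have E: "of_real (norm a) / a = cnj a / of_real (norm a)" using False na aa by (simp add: field_simps)
  have "of_real (norm a) / a * (a - z) = of_real (norm a) - of_real (norm a) / a * z" using False by (simp add: right_diff_distrib)
  then have "bfac a z = (of_real (norm a) - cnj a / of_real (norm a) * z) / (1 - cnj a * z)"
    unfolding bfac_def E using False by simp
  then have "bfac a z - 1 = - (of_real (1 - norm a) * (1 + cnj a / of_real (norm a) * z)) / (1 - cnj a * z)"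
    using ne na by (simp add: divide_simps) (simp add: algebra_simps)
  then have "norm (bfac a z - 1) = (1 - norm a) * norm (1 + cnj a / of_real (norm a) * z) / norm (1 - cnj a * z)"
    using a by (simp add: norm_mult norm_divide del: of_real_diff)
  also have "\<dots> \<le> (1 - norm a) * (1 + norm z) / (1 - norm z)"
  proof (intro frac_le mult_left_mono d)
    have "norm (cnj a / of_real (norm a) * z) = norm z" using False by (simp add: norm_mult norm_divide)
    then show "norm (1 + cnj a / of_real (norm a) * z) \<le> 1 + norm z" using norm_triangle_ineq[of 1 "cnj a / of_real (norm a) * z"] by simp
  qed (use a z in auto)
  finally show ?thesis by (simp add: mult_ac)
qed

lemma bfac_convergent_prod:
  assumes a: "\<And>k. k \<in> I \<Longrightarrow> norm (a k) < 1" and s: "summable (\<lambda>k. if k \<in> I then 1 - norm (a k) else 0)" and z: "norm z < 1"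
  shows "convergent_prod (\<lambda>k. if k \<in> I then bfac (a k) z else 1)"
proof -
  have "summable (\<lambda>k. norm ((if k \<in> I then bfac (a k) z else 1) - 1))"
  proof (rule summable_comparison_test'[of _ 0])
    show "summable (\<lambda>k. (1 + norm z) / (1 - norm z) * (if k \<in> I then 1 - norm (a k) else 0))" by (rule summable_mult[OF s])
    fix k show "norm (norm ((if k \<in> I then bfac (a k) z else 1) - 1)) \<le> (1 + norm z) / (1 - norm z) * (if k \<in> I then 1 - norm (a k) else 0)"
      using norm_bfac_minus_one_le[OF a z, of k] by auto
  qed
  then have "abs_convergent_prod (\<lambda>k. if k \<in> I then bfac (a k) z else 1)" by (simp add: abs_convergent_prod_conv_summable)
  then show ?thesis by (rule abs_convergent_prod_imp_convergent_prod)
qed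

lemma norm_blaschke_le:
  assumes "blaschke B" "norm z < 1"
  shows "norm (B z) \<le> 1"
proof -
  obtain c a I where B: "norm c = 1" "\<And>k. k \<in> I \<Longrightarrow> norm (a k) < 1" "summable (\<lambda>k. if k \<in> I then 1 - norm (a k) else 0)"
    "B z = c * (\<Prod>k. if k \<in> I then bfac (a k) z else 1)"
  proof -
    obtain c a I where "norm c = 1" "\<forall>k\<in>I. a k \<in> ball 0 1" "summable (\<lambda>k. if k \<in> I then 1 - norm (a k) else 0)"
      "\<forall>z\<in>ball 0 1. B z = c * (\<Prod>k. if k \<in> I then bfac (a k) z else 1)"
      using assms(1) unfolding blaschke_def by blast
    then show ?thesis using assms(2) by (intro that[of c I a]) auto
  qed
  let ?f = "\<lambda>k. if k \<in> I then bfac (a k) z else 1"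
  have "(\<lambda>n. \<Prod>k\<le>n. ?f k) \<longlonglongrightarrow> prodinf ?f"
    by (rule convergent_prod_LIMSEQ[OF bfac_convergent_prod[OF B(2,3) assms(2)]])
  then have lim: "(\<lambda>n. norm (\<Prod>k\<le>n. ?f k)) \<longlonglongrightarrow> norm (prodinf ?f)" by (rule tendsto_norm)
  have "norm (\<Prod>k\<le>n. ?f k) \<le> 1" for n
    unfolding prod_norm[symmetric] using norm_bfac_le[OF B(2) assms(2)] by (intro prod_le_1) auto
  then have "norm (prodinf ?f) \<le> 1" by (intro LIMSEQ_le_const2[OF lim]) blast
  then show ?thesis using B by (simp add: norm_mult)
qed

section \<open>Bounds for the singular and outer factors\<close>

lemma circle_measure_AE: "circle_measure mu \<Longrightarrow> AE w in mu. norm w = 1"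
  unfolding circle_measure_def by (intro AE_I[of _ _ "UNIV - sphere 0 1"]) auto

lemma circle_measure_integrable:
  assumes "circle_measure mu"
  shows "integrable mu (\<lambda>_. 1 :: real)" "(\<lambda>w. w) \<in> borel_measurable mu"
proof -
  interpret finite_measure mu using assms by (simp add: circle_measure_def)
  show "integrable mu (\<lambda>_. 1 :: real)" by simp
  have "sets mu = sets borel" using assms by (simp add: circle_measure_def)
  then show "(\<lambda>w. w) \<in> borel_measurable mu" by (metis borel_measurable_const measurable_cong_sets measurable_ident_sets)
qed

lemma measure_circle:
  assumes "circle_measure mu"
  shows "measure mu (sphere 0 1) = measure mu (space mu)"
proof -
  interpret finite_measure mu using assms by (simp add: circle_measure_def)
  have s: "sets mu = sets borel" "space mu = UNIV" using assms sets_eq_imp_space_eq[of mu borel] by (auto simp: circle_measure_def)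
  have "measure mu (UNIV - sphere 0 1) = 0" using assms by (simp add: circle_measure_def measure_def)
  moreover have "sphere 0 1 \<in> sets mu" by (simp add: s)
  ultimately show ?thesis using finite_measure_compl[of "sphere 0 1"] s by simp
qed

text \<open>Nonnegativity of the signed measure says that \<open>mn \<le> mp\<close>, so the Poisson
  integral of the difference is nonnegative; this integral is the logarithm of
  \<open>norm (sing_fun mp mn z)\<close>.\<close>

lemma sing_fun_properties:
  assumes mu: "circle_measure mp" "circle_measure mn" and pos: "\<And>A. A \<in> sets borel \<Longrightarrow> signed_val mp mn A \<ge> 0"
  shows "sing_fun mp mn holomorphic_on ball 0 1" "\<And>z. norm z < 1 \<Longrightarrow> 1 \<le> norm (sing_fun mp mn z)"
    "norm (sing_fun mp mn 0) = exp (signed_val mp mn (sphere 0 1))"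
proof -
  interpret p: finite_measure mp using mu by (simp add: circle_measure_def)
  interpret n: finite_measure mn using mu by (simp add: circle_measure_def)
  have sets: "sets mp = sets borel" "sets mn = sets borel" using mu by (auto simp: circle_measure_def)
  note facts = circle_measure_integrable[OF mu(1)] circle_measure_AE[OF mu(1)]
  note factsn = circle_measure_integrable[OF mu(2)] circle_measure_AE[OF mu(2)]
  have sf: "sing_fun mp mn z = exp (integral\<^sup>L mp (\<lambda>w. herglotz w z * of_real 1) - integral\<^sup>L mn (\<lambda>w. herglotz w z * of_real 1))" for z
    by (simp add: sing_fun_def herglotz_def)
  show "sing_fun mp mn holomorphic_on ball 0 1"
    unfolding sf using herglotz_transform_holomorphic[OF facts] herglotz_transform_holomorphic[OF factsn]
    by (intro holomorphic_intros)
  have norm: "norm (sing_fun mp mn z) = exp (integral\<^sup>L mp (\<lambda>w. Re (herglotz w z)) - integral\<^sup>L mn (\<lambda>w. Re (herglotz w z)))" if "norm z < 1" for z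
    unfolding sf norm_exp_eq_Re using Re_integral_herglotz[OF facts that] Re_integral_herglotz[OF factsn that] by simp
  show "1 \<le> norm (sing_fun mp mn z)" if z: "norm z < 1" for z
  proof -
    \<comment> \<open>The kernel is cut off to the circle because positivity of its real part is
      known only there, while the two measures are compared on the whole plane.\<close>
    let ?h = "\<lambda>w. if norm w = 1 then Re (herglotz w z) else 0"
    have hm: "?h \<in> borel_measurable borel" by measurable
    have h0: "0 \<le> ?h w" for w using Re_herglotz(2)[of w z] z by (auto intro: less_imp_le)
    have le: "mn \<le> mp"
    proof (subst le_measure)
      show "sets mn = sets mp" using sets by simp
      show "\<forall>A\<in>sets mn. emeasure mn A \<le> emeasure mp A"
        using pos sets by (auto simp: signed_val_def p.emeasure_eq_measure n.emeasure_eq_measure)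
    qed
    have eq: "integral\<^sup>L mp (\<lambda>w. Re (herglotz w z)) = integral\<^sup>L mp ?h" "integral\<^sup>L mn (\<lambda>w. Re (herglotz w z)) = integral\<^sup>L mn ?h"
    proof -
      have m: "(\<lambda>w. Re (herglotz w z)) \<in> borel_measurable borel" by measurable
      show "integral\<^sup>L mp (\<lambda>w. Re (herglotz w z)) = integral\<^sup>L mp ?h"
        using facts(3) m hm sets by (intro integral_cong_AE) (auto cong: measurable_cong_sets elim: eventually_mono)
      show "integral\<^sup>L mn (\<lambda>w. Re (herglotz w z)) = integral\<^sup>L mn ?h"
        using factsn(3) m hm sets by (intro integral_cong_AE) (auto cong: measurable_cong_sets elim: eventually_mono)
    qed
    have "integral\<^sup>L mn ?h \<le> integral\<^sup>L mp ?h"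
    proof -
      have i: "integrable mp ?h"
      proof -
        have "integrable mp (\<lambda>w. Re (herglotz w z * of_real 1))" by (rule integrable_Re[OF integrable_herglotz[OF facts z]])
        then show ?thesis using facts(3) hm sets
          by (subst integrable_cong_AE[where g = "\<lambda>w. Re (herglotz w z * of_real 1)"])
             (auto cong: measurable_cong_sets elim: eventually_mono)
      qed
      have "integral\<^sup>L mn ?h = enn2real (\<integral>\<^sup>+w. ennreal (?h w) \<partial>mn)"
        using hm h0 sets by (intro integral_eq_nn_integral) (auto cong: measurable_cong_sets)
      also have "\<dots> \<le> enn2real (\<integral>\<^sup>+w. ennreal (?h w) \<partial>mp)"
      proof (rule enn2real_mono)
        show "(\<integral>\<^sup>+w. ennreal (?h w) \<partial>mn) \<le> (\<integral>\<^sup>+w. ennreal (?h w) \<partial>mp)"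
          using le sets by (intro nn_integral_mono_measure) auto
        have "(\<integral>\<^sup>+w. ennreal (?h w) \<partial>mp) = ennreal (integral\<^sup>L mp ?h)" using i h0 by (intro nn_integral_eq_integral) auto
        then show "(\<integral>\<^sup>+w. ennreal (?h w) \<partial>mp) < top" by simp
      qed
      also have "\<dots> = integral\<^sup>L mp ?h"
        using hm h0 sets by (intro integral_eq_nn_integral[symmetric]) (auto cong: measurable_cong_sets)
      finally show ?thesis .
    qed
    then show ?thesis unfolding norm[OF z] eq by simp
  qed
  have one: "integral\<^sup>L mu (\<lambda>w. Re (herglotz w 0)) = measure mu (sphere 0 1)" if c: "circle_measure mu" for mu
  proof -
    have s: "sets mu = sets borel" using c by (simp add: circle_measure_def)
    have m: "(\<lambda>w. Re (herglotz w 0)) \<in> borel_measurable borel" by measurable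
    have "integral\<^sup>L mu (\<lambda>w. Re (herglotz w 0)) = integral\<^sup>L mu (\<lambda>w. 1)"
    proof (rule integral_cong_AE)
      show "(\<lambda>w. Re (herglotz w 0)) \<in> borel_measurable mu" using m s by (simp cong: measurable_cong_sets)
      show "AE w in mu. Re (herglotz w 0) = 1" using circle_measure_AE[OF c]
        by eventually_elim (subst herglotz_0, auto)
    qed simp
    then show ?thesis using measure_circle[OF c] by simp
  qed
  show "norm (sing_fun mp mn 0) = exp (signed_val mp mn (sphere 0 1))"
    using norm[of 0] one[OF mu(1)] one[OF mu(2)] by (simp add: signed_val_def)
qed

lemma outer_norm:
  assumes "outer Ou"
  shows "\<exists>h. integrable unit_interval h \<and> (\<forall>z. norm z < 1 \<longrightarrow> norm (Ou z) = exp (integral\<^sup>L unit_interval (\<lambda>t. Re (herglotz (circ t) z) * h t)))"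
proof -
  obtain c h where ch: "norm c = 1" "integrable sigma_T h"
     "\<And>z. z \<in> ball 0 1 \<Longrightarrow> Ou z = c * exp (integral\<^sup>L sigma_T (\<lambda>w. (w + z) / (w - z) * of_real (h w)))"
    using assms unfolding outer_def by blast
  have hm: "h \<in> borel_measurable borel" using borel_measurable_integrable[OF ch(2)] by (simp add: sigma_T_eq)
  have hi: "integrable unit_interval (\<lambda>t. h (circ t))" using ch(2) integrable_sigma_T[OF hm] by simp
  have "norm (Ou z) = exp (integral\<^sup>L unit_interval (\<lambda>t. Re (herglotz (circ t) z) * h (circ t)))" if z: "norm z < 1" for z
  proof -
    have m: "(\<lambda>w. herglotz w z * of_real (h w)) \<in> borel_measurable borel" using hm by measurable
    have "Ou z = c * exp (integral\<^sup>L sigma_T (\<lambda>w. herglotz w z * of_real (h w)))" using ch(3)[of z] z by (simp add: herglotz_def)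
    also have "integral\<^sup>L sigma_T (\<lambda>w. herglotz w z * of_real (h w)) = integral\<^sup>L unit_interval (\<lambda>t. herglotz (circ t) z * of_real (h (circ t)))"
      by (rule integral_sigma_T[OF m])
    finally show ?thesis using ch(1) Re_integral_herglotz[OF hi circ_measurable_unit_interval _ z] by (simp add: norm_mult norm_exp_eq_Re)
  qed
  then show ?thesis using hi by blast
qed

text \<open>The form in which the singular measure enters the hull inequality. The Blaschke factor
  is dropped, \<open>S\<close> is the singular factor, and the outer factor only grows when its
  boundary function is replaced by the positive part. The zero function is covered by
  constants.\<close>

lemma singular_measure_bound:
  assumes sm: "is_singular_measure g mp mn" and pos: "\<And>A. A \<in> sets borel \<Longrightarrow> signed_val mp mn A \<ge> 0"
    and mass: "signed_val mp mn (sphere 0 1) < e"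
  shows "\<exists>S h. S holomorphic_on ball 0 1 \<and> (\<forall>z. norm z < 1 \<longrightarrow> 1 \<le> norm (S z)) \<and> norm (S 0) \<le> exp e \<and>
    integrable unit_interval h \<and> (\<forall>t. 0 \<le> h t) \<and>
    (\<forall>z. norm z < 1 \<longrightarrow> norm (g z) \<le> norm (S z) * exp (integral\<^sup>L unit_interval (\<lambda>t. Re (herglotz (circ t) z) * h t)))"
proof (cases "\<forall>z\<in>ball 0 1. g z = 0")
  case True
  have "signed_val mp mn (sphere 0 1) \<ge> 0" by (rule pos) simp
  then have "0 < e" using mass by simp
  then show ?thesis using True by (intro exI[of _ "\<lambda>_. 1"] exI[of _ "\<lambda>_. 0"]) auto
next
  case False
  obtain B Ou where g: "blaschke B" "outer Ou" "\<And>z. z \<in> ball 0 1 \<Longrightarrow> g z = B z * Ou z * sing_fun mp mn z"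
    and mu: "circle_measure mp" "circle_measure mn"
    using sm unfolding is_singular_measure_def if_not_P[OF False] by blast
  obtain h where h: "integrable unit_interval h" "\<And>z. norm z < 1 \<Longrightarrow> norm (Ou z) = exp (integral\<^sup>L unit_interval (\<lambda>t. Re (herglotz (circ t) z) * h t))"
    using outer_norm[OF g(2)] by blast
  note S = sing_fun_properties[OF mu pos]
  have h': "integrable unit_interval (\<lambda>t. max 0 (h t))" using h(1) by (intro integrable_max) auto
  have "norm (g z) \<le> norm (sing_fun mp mn z) * exp (integral\<^sup>L unit_interval (\<lambda>t. Re (herglotz (circ t) z) * max 0 (h t)))" if z: "norm z < 1" for z
  proof -
    have i: "integrable unit_interval (\<lambda>t. Re (herglotz (circ t) z) * k t)" if "integrable unit_interval k" for k
      using integrable_Re[OF integrable_herglotz[OF that circ_measurable_unit_interval _ z]] by simp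
    have "integral\<^sup>L unit_interval (\<lambda>t. Re (herglotz (circ t) z) * h t) \<le> integral\<^sup>L unit_interval (\<lambda>t. Re (herglotz (circ t) z) * max 0 (h t))"
      using Re_herglotz(2)[of "circ t" z for t] z
      by (intro integral_mono i h h' mult_left_mono) (auto intro: less_imp_le)
    then have "norm (Ou z) \<le> exp (integral\<^sup>L unit_interval (\<lambda>t. Re (herglotz (circ t) z) * max 0 (h t)))" using h(2)[OF z] by simp
    moreover have "norm (B z) \<le> 1" by (rule norm_blaschke_le[OF g(1) z])
    ultimately have "norm (B z) * norm (Ou z) \<le> 1 * exp (integral\<^sup>L unit_interval (\<lambda>t. Re (herglotz (circ t) z) * max 0 (h t)))"
      by (intro mult_mono) auto
    from mult_left_mono[OF this norm_ge_zero[of "sing_fun mp mn z"]]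
    show ?thesis using g(3)[of z] z by (simp only: norm_mult mem_ball_0 mult_ac mult_1_left)
  qed
  then show ?thesis using S mass h'
    by (intro exI[of _ "sing_fun mp mn"] exI[of _ "\<lambda>t. max 0 (h t)"]) auto
qed

text \<open>The bound has product form so that its logarithm is a sum over the components, to be
  compared with the separate majorants of the components.\<close>

lemma poly_fun_growth:
  fixes P :: "complex^'n \<Rightarrow> complex"
  assumes "P \<in> poly_fun"
  shows "\<exists>C>0. \<exists>d. \<forall>z. norm (P z) \<le> C * (\<Prod>j\<in>UNIV. max 1 (norm (z $ j)) ^ d)"
  using assms
proof (induction rule: poly_fun.induct)
  case (const c)
  have "1 \<le> (\<Prod>j\<in>(UNIV::'n set). max 1 (norm (z $ j)) ^ 0)" for z :: "complex^'n" by simp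
  then show ?case by (intro exI[of _ "norm c + 1"] conjI exI[of _ 0]) (auto simp: add_nonneg_pos)
next
  case (coord i)
  have "norm (z $ i) \<le> 1 * (\<Prod>j\<in>UNIV. max 1 (norm (z $ j)) ^ 1)" for z :: "complex^'n"
  proof -
    have "norm (z $ i) \<le> max 1 (norm (z $ i))" by simp
    also have "\<dots> = (\<Prod>j\<in>{i}. max 1 (norm (z $ j)))" by simp
    also have "\<dots> \<le> (\<Prod>j\<in>UNIV. max 1 (norm (z $ j)))" by (intro prod_mono2) auto
    finally show ?thesis by simp
  qed
  then show ?case by (intro exI[of _ 1] conjI exI[of _ 1]) auto
next
  case (add P Q)
  obtain C d where P: "C > 0" "\<And>z. norm (P z) \<le> C * (\<Prod>j\<in>UNIV. max 1 (norm (z $ j)) ^ d)" using add by blast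
  obtain C' d' where Q: "C' > 0" "\<And>z. norm (Q z) \<le> C' * (\<Prod>j\<in>UNIV. max 1 (norm (z $ j)) ^ d')" using add by blast
  have "norm (P z + Q z) \<le> (C + C') * (\<Prod>j\<in>UNIV. max 1 (norm (z $ j)) ^ (max d d'))" for z
  proof -
    have "(\<Prod>j\<in>UNIV. max 1 (norm (z $ j)) ^ k) \<le> (\<Prod>j\<in>UNIV. max 1 (norm (z $ j)) ^ (max d d'))" if "k \<le> max d d'" for k
      using that by (intro prod_mono) (auto intro: power_increasing)
    from this[of d] this[of d'] have "norm (P z) \<le> C * (\<Prod>j\<in>UNIV. max 1 (norm (z $ j)) ^ (max d d'))"
      "norm (Q z) \<le> C' * (\<Prod>j\<in>UNIV. max 1 (norm (z $ j)) ^ (max d d'))"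
      using order_trans[OF P(2)[of z] mult_left_mono[OF _ less_imp_le[OF P(1)]]] order_trans[OF Q(2)[of z] mult_left_mono[OF _ less_imp_le[OF Q(1)]]] by auto
    then show ?thesis using norm_triangle_ineq[of "P z" "Q z"] by (simp add: distrib_right)
  qed
  then show ?case using P Q by (intro exI[of _ "C + C'"] conjI exI[of _ "max d d'"]) auto
next
  case (mult P Q)
  obtain C d where P: "C > 0" "\<And>z. norm (P z) \<le> C * (\<Prod>j\<in>UNIV. max 1 (norm (z $ j)) ^ d)" using mult by blast
  obtain C' d' where Q: "C' > 0" "\<And>z. norm (Q z) \<le> C' * (\<Prod>j\<in>UNIV. max 1 (norm (z $ j)) ^ d')" using mult by blast
  have "norm (P z * Q z) \<le> (C * C') * (\<Prod>j\<in>UNIV. max 1 (norm (z $ j)) ^ (d + d'))" for z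
    using mult_mono[OF P(2)[of z] Q(2)[of z]] P(1)
    by (simp add: norm_mult power_add prod.distrib mult_ac prod_nonneg)
  then show ?case using P Q by (intro exI[of _ "C * C'"] conjI exI[of _ "d + d'"]) auto
qed

section \<open>The hull inequality at the centre of a disc\<close>

lemma holomorphic_on_poly_fun:
  assumes "P \<in> poly_fun" "\<And>j. (\<lambda>z. f z $ j) holomorphic_on S"
  shows "(\<lambda>z. P (f z)) holomorphic_on S"
  using assms(1) by (induction rule: poly_fun.induct) (auto intro!: holomorphic_intros assms(2))

lemma nt_limit_radial:
  assumes "nt_limit f (circ t) L" "r \<longlonglongrightarrow> 1" "\<And>m. 0 < r m" "\<And>m. r m < 1"
  shows "(\<lambda>m. f (of_real (r m) * circ t)) \<longlonglongrightarrow> L"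
proof -
  have lim: "(f \<longlongrightarrow> L) (at (circ t) within stolz (circ t) 2)" using assms(1) by (simp add: nt_limit_def)
  have "filterlim (\<lambda>m. of_real (r m) * circ t) (at (circ t) within stolz (circ t) 2) sequentially"
    unfolding filterlim_at
  proof (intro conjI always_eventually allI)
    fix m
    have "of_real (r m) * circ t - circ t = of_real (r m - 1) * circ t" by (simp add: algebra_simps)
    then have n: "norm (of_real (r m) * circ t - circ t) = 1 - r m" using assms(4)[of m] by (simp only: norm_mult norm_of_real norm_circ) simp
    then show "of_real (r m) * circ t \<noteq> circ t" using assms(4)[of m] by auto
    show "of_real (r m) * circ t \<in> stolz (circ t) 2" using n assms(3,4)[of m] by (simp add: stolz_def norm_mult)
    have "(\<lambda>m. of_real (r m) * circ t) \<longlonglongrightarrow> of_real 1 * circ t" by (intro tendsto_intros assms)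
    then show "(\<lambda>m. of_real (r m) * circ t) \<longlonglongrightarrow> circ t" by simp
  qed
  from filterlim_compose[OF lim this] show ?thesis .
qed

text \<open>Boundedness permits dominated convergence in the mean value formula over the circles of
  radius \<open>r m\<close>, so a radial bound at almost every boundary point reaches the
  centre.\<close>

lemma radial_maximum_principle:
  assumes f: "f holomorphic_on ball 0 1" and bdd: "\<And>z. norm z < 1 \<Longrightarrow> norm (f z) \<le> B"
    and r: "r \<longlonglongrightarrow> 1" "\<And>m. 0 < r m" "\<And>m. r m < 1"
    and lim: "AE t in unit_interval. \<forall>\<^sub>F m in sequentially. norm (f (of_real (r m) * circ t)) \<le> M"
  shows "norm (f 0) \<le> M"
proof -
  \<comment> \<open>The excess over \<open>M\<close> tends to 0 at almost every point, although the
    modulus itself need not converge.\<close>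
  define psi where "psi m t = max 0 (norm (f (of_real (r m) * circ t)) - M)" for m t
  have i: "integrable unit_interval (\<lambda>t. f (of_real (r m) * circ t))" for m
    using integral_mean_value(2)[OF f] r(2,3)[of m] by simp
  have pm: "psi m \<in> borel_measurable unit_interval" for m
    unfolding psi_def using borel_measurable_integrable[OF i[of m]] by measurable
  have "(\<lambda>m. integral\<^sup>L unit_interval (psi m)) \<longlonglongrightarrow> integral\<^sup>L unit_interval (\<lambda>t. 0)"
  proof (rule integral_dominated_convergence[where w = "\<lambda>t. \<bar>B\<bar> + \<bar>M\<bar>"])
    show "AE t in unit_interval. (\<lambda>m. psi m t) \<longlonglongrightarrow> 0" using lim
    proof eventually_elim
      case (elim t)
      then have "\<forall>\<^sub>F m in sequentially. psi m t = 0" by eventually_elim (simp add: psi_def)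
      then show ?case by (rule tendsto_eventually)
    qed
    show "AE t in unit_interval. norm (psi m t) \<le> \<bar>B\<bar> + \<bar>M\<bar>" for m
    proof (rule AE_I2)
      fix t show "norm (psi m t) \<le> \<bar>B\<bar> + \<bar>M\<bar>"
        using bdd[of "of_real (r m) * circ t"] r(2,3)[of m] by (auto simp: psi_def norm_mult)
    qed
  qed (use pm in auto)
  then have psi0: "(\<lambda>m. M + integral\<^sup>L unit_interval (psi m)) \<longlonglongrightarrow> M + 0" by (intro tendsto_intros) simp
  have "norm (f 0) \<le> M + integral\<^sup>L unit_interval (psi m)" for m
  proof -
    have ip: "integrable unit_interval (psi m)" unfolding psi_def using i by (intro integrable_max) auto
    have "f 0 = integral\<^sup>L unit_interval (\<lambda>t. f (of_real (r m) * circ t))"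
      using integral_mean_value(1)[OF f] r(2,3)[of m] by simp
    then have "norm (f 0) \<le> integral\<^sup>L unit_interval (\<lambda>t. norm (f (of_real (r m) * circ t)))" by (simp only: integral_norm_bound)
    also have "\<dots> \<le> integral\<^sup>L unit_interval (\<lambda>t. M + psi m t)"
      using i ip by (intro integral_mono) (auto simp: psi_def)
    also have "\<dots> = M + integral\<^sup>L unit_interval (psi m)" using ip measure_unit_interval by simp
    finally show ?thesis .
  qed
  then show ?thesis using tendsto_lowerbound[OF psi0 always_eventually] by simp
qed

text \<open>\<open>P (f z)\<close> may be unbounded, so it is divided by a zero-free
  \<open>D\<close> made of the singular factors and the parts of the boundary functions above a
  level \<open>N\<close>. The quotient is bounded, its boundary values stay below \<open>M\<close>
  because \<open>norm (D z) \<ge> 1\<close>, and the bound on \<open>norm (D 0)\<close> tends to 1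
  as \<open>N\<close> grows and \<open>e\<close> shrinks.\<close>

theorem disc_center_in_poly_hull:
  fixes K :: "(complex^'n) set" and a :: "complex^'n"
  assumes discs: "\<And>U e. open U \<Longrightarrow> K \<subseteq> U \<Longrightarrow> e > 0 \<Longrightarrow> \<exists>f. nevanlinna_disc f \<and> f 0 = a \<and>
     (AE w in sigma_T. \<exists>L\<in>U. nt_limit f w L) \<and>
     (\<forall>j. \<exists>mp mn. is_singular_measure (\<lambda>z. f z $ j) mp mn \<and> (\<forall>A\<in>sets borel. signed_val mp mn A \<ge> 0) \<and> signed_val mp mn (sphere 0 1) < e)"
  shows "a \<in> poly_hull K"
proof (rule poly_hullI, rule field_le_epsilon)
  fix P and M0 d0 :: real
  assume P: "P \<in> poly_fun" and PM: "\<And>y. y \<in> K \<Longrightarrow> norm (P y) \<le> M0" and d0: "d0 > 0"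
  define M where "M = M0 + d0"
  define U where "U = {z. norm (P z) < M}"
  have U: "open U" "K \<subseteq> U"
  proof -
    show "open U" unfolding U_def by (intro open_Collect_less continuous_intros continuous_on_poly_fun[OF P])
    show "K \<subseteq> U" using PM d0 by (force simp: U_def M_def)
  qed
  obtain C d where C: "C > 0" "\<And>z. norm (P z) \<le> C * (\<Prod>j\<in>UNIV. max 1 (norm (z $ j)) ^ d)" using poly_fun_growth[OF P] by blast
  define r where "r m = 1 - inverse (real (Suc (Suc m)))" for m :: nat
  have r: "r \<longlonglongrightarrow> 1" "\<And>m. 0 < r m" "\<And>m. r m < 1"
  proof -
    have "(\<lambda>m. 1 - inverse (real (Suc (Suc m)))) \<longlonglongrightarrow> 1 - 0"
      by (intro tendsto_diff tendsto_const LIMSEQ_Suc[OF LIMSEQ_inverse_real_of_nat])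
    then show "r \<longlonglongrightarrow> 1" by (simp add: r_def[abs_def])
  qed (auto simp: r_def inverse_less_1_iff)
  have bound: "norm (P a) \<le> M * (\<Prod>j\<in>(UNIV::'n set). exp e ^ d)" and M0: "0 \<le> M" if e: "e > 0" for e
  proof -
    obtain f where f: "nevanlinna_disc f" "f 0 = a" "AE w in sigma_T. \<exists>L\<in>U. nt_limit f w L"
      "\<forall>j. \<exists>mp mn. is_singular_measure (\<lambda>z. f z $ j) mp mn \<and> (\<forall>A\<in>sets borel. signed_val mp mn A \<ge> 0) \<and> signed_val mp mn (sphere 0 1) < e"
      using discs[OF U e] by blast
    have "\<forall>j. \<exists>Sh. fst Sh holomorphic_on ball 0 1 \<and> (\<forall>z. norm z < 1 \<longrightarrow> 1 \<le> norm (fst Sh z)) \<and> norm (fst Sh 0) \<le> exp e \<and>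
      integrable unit_interval (snd Sh) \<and> (\<forall>t. 0 \<le> snd Sh t) \<and>
      (\<forall>z. norm z < 1 \<longrightarrow> norm (f z $ j) \<le> norm (fst Sh z) * exp (integral\<^sup>L unit_interval (\<lambda>t. Re (herglotz (circ t) z) * snd Sh t)))"
    proof
      fix j
      obtain mp mn where "is_singular_measure (\<lambda>z. f z $ j) mp mn" "\<And>A. A \<in> sets borel \<Longrightarrow> signed_val mp mn A \<ge> 0" "signed_val mp mn (sphere 0 1) < e"
        using f(4) by blast
      from singular_measure_bound[OF this] obtain S h where "S holomorphic_on ball 0 1 \<and> (\<forall>z. norm z < 1 \<longrightarrow> 1 \<le> norm (S z)) \<and> norm (S 0) \<le> exp e \<and>
        integrable unit_interval h \<and> (\<forall>t. 0 \<le> h t) \<and>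
        (\<forall>z. norm z < 1 \<longrightarrow> norm (f z $ j) \<le> norm (S z) * exp (integral\<^sup>L unit_interval (\<lambda>t. Re (herglotz (circ t) z) * h t)))" by blast
      then show "\<exists>Sh. fst Sh holomorphic_on ball 0 1 \<and> (\<forall>z. norm z < 1 \<longrightarrow> 1 \<le> norm (fst Sh z)) \<and> norm (fst Sh 0) \<le> exp e \<and>
      integrable unit_interval (snd Sh) \<and> (\<forall>t. 0 \<le> snd Sh t) \<and>
      (\<forall>z. norm z < 1 \<longrightarrow> norm (f z $ j) \<le> norm (fst Sh z) * exp (integral\<^sup>L unit_interval (\<lambda>t. Re (herglotz (circ t) z) * snd Sh t)))"
        by (intro exI[of _ "(S, h)"]) simp
    qed
    from choice[OF this] obtain Sh where Sh: "\<And>j. fst (Sh j) holomorphic_on ball 0 1" "\<And>j z. norm z < 1 \<Longrightarrow> 1 \<le> norm (fst (Sh j) z)"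
      "\<And>j. norm (fst (Sh j) 0) \<le> exp e" "\<And>j. integrable unit_interval (snd (Sh j))" "\<And>j t. 0 \<le> snd (Sh j) t"
      "\<And>j z. norm z < 1 \<Longrightarrow> norm (f z $ j) \<le> norm (fst (Sh j) z) * exp (integral\<^sup>L unit_interval (\<lambda>t. Re (herglotz (circ t) z) * snd (Sh j) t))"
      by blast
    define S where "S j = fst (Sh j)" for j
    define h where "h j = snd (Sh j)" for j
    note Sh = Sh[folded S_def h_def]
    have hN: "integrable unit_interval (\<lambda>t. max 0 (h j t - real N))" for j N using Sh(4)[of j] by (intro integrable_max Bochner_Integration.integrable_diff) auto
    have main: "norm (P a) \<le> M * ((\<Prod>j\<in>(UNIV::'n set). exp e ^ d) * exp (real d * (\<Sum>j\<in>UNIV. integral\<^sup>L unit_interval (\<lambda>t. max 0 (h j t - real N)))))"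
      and M0: "0 \<le> M" for N :: nat
    proof -
      \<comment> \<open>Only the excess of \<open>h j\<close> over \<open>N\<close> goes into the
        divisor: the part below \<open>N\<close> contributes at most a factor \<open>exp N\<close>,
        and the integral of the excess tends to 0 as \<open>N\<close> grows.\<close>
      define T where "T z = (\<Sum>j\<in>UNIV. integral\<^sup>L unit_interval (\<lambda>t. herglotz (circ t) z * of_real (max 0 (h j t - real N))))" for z
      define D where "D z = (\<Prod>j\<in>UNIV. S j z ^ d) * exp (of_nat d * T z)" for z
      define Phi where "Phi z = P (f z) / D z" for z
      have nT: "norm (exp (of_nat d * T z)) = exp (real d * (\<Sum>j\<in>UNIV. integral\<^sup>L unit_interval (\<lambda>t. Re (herglotz (circ t) z) * max 0 (h j t - real N))))" if z: "norm z < 1" for z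
        using Re_integral_herglotz[OF hN circ_measurable_unit_interval _ z] by (simp add: norm_exp_eq_Re T_def)
      have i: "integrable unit_interval (\<lambda>t. Re (herglotz (circ t) z) * k t)" if "integrable unit_interval k" "norm z < 1" for k z
        using integrable_Re[OF integrable_herglotz[OF that(1) circ_measurable_unit_interval _ that(2)]] by simp
      have Rp: "0 \<le> Re (herglotz (circ t) z)" if "norm z < 1" for t z using Re_herglotz(2)[of "circ t" z] that by simp
      have D1: "1 \<le> norm (D z)" if z: "norm z < 1" for z
      proof -
        have "1 \<le> norm (\<Prod>j\<in>UNIV. S j z ^ d)"
          unfolding prod_norm[symmetric] norm_power using Sh(2)[OF z] by (intro prod_ge_1) auto
        moreover have "1 \<le> norm (exp (of_nat d * T z))" unfolding nT[OF z]
          using Rp[OF z] by (auto intro!: mult_nonneg_nonneg sum_nonneg Bochner_Integration.integral_nonneg)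
        ultimately show ?thesis unfolding D_def norm_mult using mult_mono[of 1 _ 1] by fastforce
      qed
      have hol: "Phi holomorphic_on ball 0 1"
      proof -
        have "(\<lambda>z. f z $ j) holomorphic_on ball 0 1" for j using f(1) by (simp add: nevanlinna_disc_def nevanlinna_def)
        then have "(\<lambda>z. P (f z)) holomorphic_on ball 0 1" by (rule holomorphic_on_poly_fun[OF P])
        moreover have "D holomorphic_on ball 0 1" unfolding D_def T_def
          using Sh(1) herglotz_transform_holomorphic[OF hN circ_measurable_unit_interval] by (intro holomorphic_intros) auto
        moreover have "D z \<noteq> 0" if "z \<in> ball 0 1" for z using D1[of z] that by (metis mem_ball_0 norm_zero not_one_le_zero)
        ultimately show ?thesis unfolding Phi_def by (intro holomorphic_on_divide)
      qed
      have bdd: "norm (Phi z) \<le> C * (\<Prod>j\<in>(UNIV::'n set). exp (real N) ^ d)" if z: "norm z < 1" for z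
      proof -
        let ?q = "\<lambda>j. integral\<^sup>L unit_interval (\<lambda>t. Re (herglotz (circ t) z) * max 0 (h j t - real N))"
        have "max 1 (norm (f z $ j)) \<le> norm (S j z) * (exp (real N) * exp (?q j))" for j
        proof -
          let ?p = "integral\<^sup>L unit_interval (\<lambda>t. Re (herglotz (circ t) z) * h j t)"
          have p0: "0 \<le> ?p" using Rp[OF z] Sh(5) by (intro Bochner_Integration.integral_nonneg) auto
          have "?p \<le> integral\<^sup>L unit_interval (\<lambda>t. Re (herglotz (circ t) z) * real N + Re (herglotz (circ t) z) * max 0 (h j t - real N))"
            using i[OF Sh(4) z] i[OF hN z] i[of "\<lambda>_. real N", OF _ z] mult_left_mono[OF _ Rp[OF z], of "h j t" "real N + max 0 (h j t - real N)" for t]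
            by (intro integral_mono Bochner_Integration.integrable_add) (auto simp: distrib_left[symmetric])
          also have "\<dots> = integral\<^sup>L unit_interval (\<lambda>t. Re (herglotz (circ t) z) * real N) + ?q j"
            using i[OF hN z] i[of "\<lambda>_. real N", OF _ z] by (intro Bochner_Integration.integral_add) auto
          also have "integral\<^sup>L unit_interval (\<lambda>t. Re (herglotz (circ t) z) * real N) = real N"
          proof -
            have "integrable unit_interval (\<lambda>t. herglotz (circ t) z)" using integrable_herglotz[of unit_interval "\<lambda>_. 1" circ z] z by simp
            then have "integral\<^sup>L unit_interval (\<lambda>t. Re (herglotz (circ t) z)) = 1" using integral_herglotz_circle[OF z] integral_Re by fastforce
            then show ?thesis by simp
          qed
          finally have "exp ?p \<le> exp (real N) * exp (?q j)" by (simp flip: exp_add)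
          moreover have "max 1 (norm (f z $ j)) \<le> norm (S j z) * exp ?p"
            using Sh(6)[OF z, of j] mult_mono[OF Sh(2)[OF z, of j], of 1 "exp ?p"] p0 by simp
          ultimately show ?thesis by (meson mult_left_mono norm_ge_zero order_trans)
        qed
        then have "(\<Prod>j\<in>UNIV. max 1 (norm (f z $ j)) ^ d) \<le> (\<Prod>j\<in>UNIV. (norm (S j z) * (exp (real N) * exp (?q j))) ^ d)"
          by (intro prod_mono) (auto intro!: power_mono)
        also have "\<dots> = (\<Prod>j\<in>UNIV. norm (S j z ^ d)) * (\<Prod>j\<in>UNIV. exp (?q j) ^ d) * (\<Prod>j\<in>(UNIV::'n set). exp (real N) ^ d)"
          by (simp add: power_mult_distrib prod.distrib norm_power mult_ac)
        also have "(\<Prod>j\<in>UNIV. exp (?q j) ^ d) = norm (exp (of_nat d * T z))"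
          unfolding nT[OF z] sum_distrib_left by (simp add: exp_sum exp_of_nat_mult)
        finally have "(\<Prod>j\<in>UNIV. max 1 (norm (f z $ j)) ^ d) \<le> norm (D z) * (\<Prod>j\<in>(UNIV::'n set). exp (real N) ^ d)"
          by (simp add: D_def norm_mult prod_norm)
        then have "norm (P (f z)) \<le> C * (norm (D z) * (\<Prod>j\<in>(UNIV::'n set). exp (real N) ^ d))"
          using order_trans[OF C(2)[of "f z"] mult_left_mono[OF _ less_imp_le[OF C(1)]]] by blast
        moreover have "norm (D z) > 0" using D1[OF z] by linarith
        ultimately show ?thesis by (simp add: Phi_def norm_divide divide_le_eq mult_ac)
      qed
      have AEt: "AE t in unit_interval. \<exists>L\<in>U. nt_limit f (circ t) L"
        using f(3) unfolding sigma_T_eq by (rule AE_distrD[rotated]) simp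
      have "norm (Phi 0) \<le> M"
      proof (rule radial_maximum_principle[OF hol bdd r])
        show "AE t in unit_interval. \<forall>\<^sub>F m in sequentially. norm (Phi (of_real (r m) * circ t)) \<le> M" using AEt
        proof eventually_elim
          case (elim t)
          then obtain L where L: "L \<in> U" "nt_limit f (circ t) L" by blast
          have "(\<lambda>m. norm (P (f (of_real (r m) * circ t)))) \<longlonglongrightarrow> norm (P L)"
            using continuous_on_tendsto_compose[OF continuous_on_poly_fun[OF P, of UNIV] nt_limit_radial[OF L(2) r]] by (intro tendsto_norm) simp
          then have "\<forall>\<^sub>F m in sequentially. norm (P (f (of_real (r m) * circ t))) < M"
            using L(1) by (intro order_tendstoD(2)) (auto simp: U_def)
          then show ?case
          proof eventually_elim
            case (elim m)
            have "norm (of_real (r m) * circ t) < 1" using r(2,3)[of m] by (simp add: norm_mult)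
            from D1[OF this] have "norm (Phi (of_real (r m) * circ t)) \<le> norm (P (f (of_real (r m) * circ t)))"
              unfolding Phi_def norm_divide by (simp add: divide_le_eq mult_le_cancel_left1)
            then show ?case using elim by simp
          qed
        qed
      qed
      then show M0: "0 \<le> M" using norm_ge_zero order_trans by blast
      have D0: "norm (D 0) \<le> (\<Prod>j\<in>(UNIV::'n set). exp e ^ d) * exp (real d * (\<Sum>j\<in>UNIV. integral\<^sup>L unit_interval (\<lambda>t. max 0 (h j t - real N))))"
      proof -
        have "norm (\<Prod>j\<in>UNIV. S j 0 ^ d) \<le> (\<Prod>j\<in>(UNIV::'n set). exp e ^ d)"
          unfolding prod_norm[symmetric] norm_power using Sh(3) by (intro prod_mono) (auto intro!: power_mono)
        moreover have "norm (exp (of_nat d * T 0)) = exp (real d * (\<Sum>j\<in>UNIV. integral\<^sup>L unit_interval (\<lambda>t. max 0 (h j t - real N))))"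
          using nT[of 0] by (simp del: norm_exp_eq_Re)
        ultimately show ?thesis unfolding D_def norm_mult by (simp only: mult_right_mono exp_ge_zero)
      qed
      have "D 0 \<noteq> 0" using D1[of 0] by (metis norm_zero not_one_le_zero zero_less_one)
      then have "P a = Phi 0 * D 0" using f(2) by (simp add: Phi_def)
      then have "norm (P a) = norm (Phi 0) * norm (D 0)" by (simp add: norm_mult)
      also have "\<dots> \<le> M * ((\<Prod>j\<in>(UNIV::'n set). exp e ^ d) * exp (real d * (\<Sum>j\<in>UNIV. integral\<^sup>L unit_interval (\<lambda>t. max 0 (h j t - real N)))))"
        using \<open>norm (Phi 0) \<le> M\<close> D0 M0 by (intro mult_mono) auto
      finally show "norm (P a) \<le> \<dots>" .
    qed
    show "0 \<le> M" by (rule M0)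
    have "(\<lambda>N. integral\<^sup>L unit_interval (\<lambda>t. max 0 (h j t - real N))) \<longlonglongrightarrow> integral\<^sup>L unit_interval (\<lambda>t. 0)" for j
    proof (rule integral_dominated_convergence[where w = "h j"])
      show "AE t in unit_interval. (\<lambda>N. max 0 (h j t - real N)) \<longlonglongrightarrow> 0"
      proof (rule AE_I2, rule tendsto_eventually)
        fix t
        obtain N0 :: nat where "h j t \<le> real N0" using real_arch_simple by blast
        then show "\<forall>\<^sub>F N in sequentially. max 0 (h j t - real N) = 0" by (intro eventually_sequentiallyI[of N0]) auto
      qed
    qed (use Sh(4)[of j] Sh(5)[of j] borel_measurable_integrable[OF hN] in auto)
    then have "(\<lambda>N. M * ((\<Prod>j\<in>(UNIV::'n set). exp e ^ d) * exp (real d * (\<Sum>j\<in>UNIV. integral\<^sup>L unit_interval (\<lambda>t. max 0 (h j t - real N))))))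
       \<longlonglongrightarrow> M * ((\<Prod>j\<in>(UNIV::'n set). exp e ^ d) * exp (real d * (\<Sum>j\<in>(UNIV::'n set). 0)))"
      by (intro tendsto_intros) simp
    from tendsto_lowerbound[OF this always_eventually] main
    show "norm (P a) \<le> M * (\<Prod>j\<in>(UNIV::'n set). exp e ^ d)" by simp
  qed
  have "((\<lambda>e. M * (\<Prod>j\<in>(UNIV::'n set). exp e ^ d)) \<longlongrightarrow> M * (\<Prod>j\<in>(UNIV::'n set). exp 0 ^ d)) (at_right 0)"
    by (intro tendsto_intros)
  moreover have "\<forall>\<^sub>F e in at_right 0. norm (P a) \<le> M * (\<Prod>j\<in>(UNIV::'n set). exp e ^ d)"
    using bound by (auto simp: eventually_at_right_field intro!: exI[of _ 1])
  ultimately have "norm (P a) \<le> M * (\<Prod>j\<in>(UNIV::'n set). exp 0 ^ d)" by (rule tendsto_lowerbound) simp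
  then show "norm (P a) \<le> M0 + d0" by (simp add: M_def)
qed

section \<open>Singular multipliers\<close>

lemma sin_ge_linear:
  assumes "0 \<le> x" "x \<le> 1 / 2"
  shows "2 * x \<le> sin (pi * x)"
proof -
  have "convex_on {0..pi/2} (\<lambda>x. - sin x)"
  proof (rule f''_ge0_imp_convex)
    fix y assume "y \<in> {0..pi/2}"
    then show "0 \<le> sin y" by (intro sin_ge_zero) auto
    show "((\<lambda>x. - sin x) has_real_derivative - cos y) (at y)" by (auto intro!: derivative_eq_intros)
    show "((\<lambda>x. - cos x) has_real_derivative sin y) (at y)" by (auto intro!: derivative_eq_intros)
  qed auto
  from convex_onD[OF this, of "2 * x" 0 "pi / 2"] assms show ?thesis by (simp add: mult_ac)
qed

lemma norm_circ_diff: "norm (circ s - circ t) = 2 * \<bar>sin (pi * (s - t))\<bar>"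
proof -
  have "circ s - circ t = circ t * (exp (\<i> * of_real (2 * pi * (s - t))) - 1)"
    by (simp add: circ_def cis_conv_exp algebra_simps exp_diff exp_minus field_simps)
  then show ?thesis using dist_exp_i_1[of "2 * pi * (s - t)"] by (simp add: norm_mult)
qed

lemma norm_circ_diff_le: "norm (circ s - circ t) \<le> 2 * pi * \<bar>s - t\<bar>"
  unfolding norm_circ_diff using abs_sin_x_le_abs_x[of "pi * (s - t)"] by (simp add: abs_mult)

text \<open>Jordan's inequality for the half angle; the minimum accounts for the identification of
  the parameters 0 and 1.\<close>

lemma norm_circ_diff_ge:
  assumes "\<bar>s - t\<bar> \<le> 1"
  shows "4 * min \<bar>s - t\<bar> (1 - \<bar>s - t\<bar>) \<le> norm (circ s - circ t)"
proof -
  define u where "u = \<bar>s - t\<bar>"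
  have u: "0 \<le> u" "u \<le> 1" using assms by (auto simp: u_def)
  have "\<bar>sin (pi * (s - t))\<bar> = sin (pi * u)"
  proof -
    have "0 \<le> sin (pi * u)" using u by (intro sin_ge_zero) (auto simp: mult_left_le)
    moreover have "pi * (s - t) = pi * u \<or> pi * (s - t) = - (pi * u)" by (auto simp: u_def abs_if algebra_simps)
    ultimately show ?thesis by (metis abs_minus_cancel abs_of_nonneg sin_minus)
  qed
  moreover have "2 * min u (1 - u) \<le> sin (pi * u)"
  proof (cases "u \<le> 1/2")
    case False
    have "sin (pi * u) = sin (pi * (1 - u))" by (simp add: right_diff_distrib)
    then show ?thesis using False sin_ge_linear[of "1 - u"] u by simp
  qed (use sin_ge_linear[of u] u in simp)
  ultimately show ?thesis unfolding norm_circ_diff u_def by linarith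
qed

lemma circ_inj:
  assumes "circ s = circ t" "s \<in> {0..1}" "t \<in> {0<..<1}"
  shows "s = t"
proof -
  have st: "\<bar>s - t\<bar> < 1" using assms by (auto simp: abs_less_iff)
  then have "4 * min \<bar>s - t\<bar> (1 - \<bar>s - t\<bar>) \<le> 0" using norm_circ_diff_ge[of s t] assms(1) by simp
  then show ?thesis using st by (auto simp: min_def split: if_splits)
qed

lemma AE_unit_interval_irrational: "AE t in unit_interval. t \<in> {0<..<1} - \<rat>"
proof -
  have N: "\<rat> \<union> {0, 1} \<in> null_sets (lebesgue :: real measure)"
    by (intro null_sets_completionI countable_imp_null_set_lborel) (auto simp: countable_rat)
  have "AE t in lebesgue. t \<in> {0..1::real} \<longrightarrow> t \<in> {0<..<1} - \<rat>"
    by (rule AE_I'[OF N]) (auto simp: less_le)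
  then show ?thesis by (subst AE_restrict_space_iff) auto
qed

lemma emeasure_sigma_T_rational: "emeasure sigma_T (circ ` (\<rat> \<inter> {0..1})) = 0"
proof -
  let ?A = "circ ` (\<rat> \<inter> {0..1})"
  have c: "countable ?A" by (intro countable_image countable_subset[OF _ countable_rat]) auto
  have A: "?A \<in> sets borel" by (rule sets.countable[OF _ c]) simp
  have "AE t in unit_interval. circ t \<notin> ?A" using AE_unit_interval_irrational
  proof eventually_elim
    case (elim t)
    show ?case
    proof
      assume "circ t \<in> ?A"
      then obtain q where "q \<in> \<rat>" "q \<in> {0..1}" "circ q = circ t" by auto
      then show False using circ_inj[of q t] elim by auto
    qed
  qed
  then have "AE w in sigma_T. w \<notin> ?A" unfolding sigma_T_eq using A by (subst AE_distr_iff) auto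
  then have "emeasure sigma_T {w \<in> space sigma_T. \<not> w \<notin> ?A} = 0" by (rule AE_iff_measurable[THEN iffD1, rotated 2]) (auto simp: sigma_T_eq A)
  then show ?thesis by (simp add: sigma_T_eq)
qed

text \<open>Every point of the circle has a parameter in the unit interval, so the exceptional set
  consists of points over rational parameters. Atoms placed at such points are thereby avoided
  almost everywhere.\<close>

lemma AE_sigma_T_irrational:
  assumes "\<And>t. t \<in> {0<..<1} \<Longrightarrow> t \<notin> \<rat> \<Longrightarrow> P (circ t)"
  shows "AE w in sigma_T. P w"
proof (rule AE_I)
  let ?A = "circ ` (\<rat> \<inter> {0..1})"
  let ?N = "?A \<union> (UNIV - sphere 0 1)"
  have c: "countable ?A" by (intro countable_image countable_subset[OF _ countable_rat]) auto
  have A: "?A \<in> sets borel" by (rule sets.countable[OF _ c]) simp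
  show N: "?N \<in> sets sigma_T" using A by (auto simp: sigma_T_eq)
  have "emeasure sigma_T (UNIV - sphere 0 1) = 0"
  proof -
    have "circ -` (UNIV - sphere 0 1) = {}" by auto
    then show ?thesis unfolding sigma_T_eq by (subst emeasure_distr) simp_all
  qed
  then show "emeasure sigma_T ?N = 0" using emeasure_sigma_T_rational A
    by (intro emeasure_Un_null_set[THEN trans] null_setsI) (auto simp: sigma_T_eq)
  show "{w \<in> space sigma_T. \<not> P w} \<subseteq> ?N"
  proof
    fix w assume w: "w \<in> {w \<in> space sigma_T. \<not> P w}"
    show "w \<in> ?N"
    proof (cases "norm w = 1")
      case True
      define t where "t = Arg2pi w / (2 * pi)"
      have "w = exp (\<i> * of_real (Arg2pi w))" using True Arg2pi_eq[of w] by auto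
      then have wt: "w = circ t" by (simp add: circ_def t_def cis_conv_exp)
      have t: "t \<in> {0..1}" using Arg2pi_ge_0[of w] Arg2pi_lt_2pi[of w] by (auto simp: t_def divide_le_eq less_imp_le)
      show ?thesis
      proof (cases "t \<in> {0<..<1} \<and> t \<notin> \<rat>")
        case True then show ?thesis using assms[of t] w wt by auto
      next
        case False
        then have "t \<in> \<rat>" using t by (auto simp: less_le)
        then show ?thesis using t wt by auto
      qed
    qed auto
  qed
qed

text \<open>\<^term>\<open>grid_dist N t\<close> is the distance from t to the grid of multiples of 1/N, and \<^term>\<open>snap N e t\<close>
  is a rational point within e * (grid_dist N t)^2 of t: the atoms of the singular measure accumulate only at
  the grid, and so fast that the Herglotz integral of the atoms minus arc length is small off the cell.\<close>

definition grid_dist :: "nat \<Rightarrow> real \<Rightarrow> real" where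
  "grid_dist N t = min (t - real_of_int \<lfloor>N * t\<rfloor> / N) (real_of_int (\<lfloor>N * t\<rfloor> + 1) / N - t)"

definition snap :: "nat \<Rightarrow> real \<Rightarrow> real \<Rightarrow> real" where
  "snap N e t = (let M = real_of_int \<lceil>1 / (e * (grid_dist N t)\<^sup>2)\<rceil> in real_of_int \<lfloor>t * M\<rfloor> / M)"

lemma snap_measurable [measurable]: "snap N e \<in> borel_measurable borel"
  unfolding snap_def[abs_def] grid_dist_def Let_def by measurable

lemma grid_dist_pos:
  assumes "N > 0" "t \<notin> \<rat>"
  shows "0 < grid_dist N t"
proof -
  have ne: "t \<noteq> real_of_int k / real N" for k using assms(2) by auto
  have "real_of_int \<lfloor>N * t\<rfloor> \<le> N * t" "N * t < real_of_int \<lfloor>N * t\<rfloor> + 1" by linarith+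
  then have "real_of_int \<lfloor>N * t\<rfloor> / N \<le> t" "t < real_of_int (\<lfloor>N * t\<rfloor> + 1) / N"
    using assms(1) by (auto simp: field_simps)
  then show ?thesis unfolding grid_dist_def using ne[of "\<lfloor>N * t\<rfloor>"] by (auto simp: less_le)
qed

lemma grid_dist_le: "N > 0 \<Longrightarrow> grid_dist N t \<le> 1 / 2"
proof -
  assume N: "N > 0"
  have "grid_dist N t \<le> ((t - real_of_int \<lfloor>N * t\<rfloor> / N) + (real_of_int (\<lfloor>N * t\<rfloor> + 1) / N - t)) / 2"
  proof -
    have "min a b \<le> (a + b) / 2" for a b :: real by (auto simp: min_def)
    then show ?thesis unfolding grid_dist_def .
  qed
  also have "\<dots> = 1 / (2 * N)" by (simp add: add_divide_distrib)
  also have "\<dots> \<le> 1 / 2" using N by (simp add: divide_le_eq)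
  finally show ?thesis .
qed

lemma snap_bounds:
  assumes "t \<in> {0..1}" "e > 0"
  shows "snap N e t \<in> {0..1}" "snap N e t \<in> \<rat>"
proof -
  define M where "M = real_of_int \<lceil>1 / (e * (grid_dist N t)\<^sup>2)\<rceil>"
  have s: "snap N e t = real_of_int \<lfloor>t * M\<rfloor> / M" by (simp add: snap_def M_def Let_def)
  have "0 \<le> 1 / (e * (grid_dist N t)\<^sup>2)" using assms by simp
  then have M: "M \<ge> 0" unfolding M_def by linarith
  show "snap N e t \<in> \<rat>" unfolding s M_def by simp
  have "0 \<le> real_of_int \<lfloor>t * M\<rfloor>" using assms M by simp
  moreover have "t * M \<le> M" using mult_right_mono[of t 1 M] assms M by simp
  then have "real_of_int \<lfloor>t * M\<rfloor> \<le> 1 * M" by linarith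
  \<comment> \<open>For \<open>M = 0\<close>, which occurs when \<open>grid_dist N t = 0\<close>,
    division by zero yields the value 0.\<close>
  ultimately show "snap N e t \<in> {0..1}" unfolding s using M by (cases "M = 0") (auto simp: divide_le_eq)
qed

lemma snap_close:
  assumes "e > 0" "grid_dist N t > 0"
  shows "\<bar>snap N e t - t\<bar> \<le> e * (grid_dist N t)\<^sup>2"
proof -
  define M where "M = real_of_int \<lceil>1 / (e * (grid_dist N t)\<^sup>2)\<rceil>"
  have s: "snap N e t = real_of_int \<lfloor>t * M\<rfloor> / M" by (simp add: snap_def M_def Let_def)
  have p: "e * (grid_dist N t)\<^sup>2 > 0" using assms by simp
  have M: "M \<ge> 1 / (e * (grid_dist N t)\<^sup>2)" unfolding M_def by simp
  then have M0: "M > 0" using p by (meson less_le_trans zero_less_divide_1_iff)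
  have "\<bar>real_of_int \<lfloor>t * M\<rfloor> - t * M\<bar> \<le> 1" by linarith
  moreover have "snap N e t - t = (real_of_int \<lfloor>t * M\<rfloor> - t * M) / M" unfolding s using M0 by (simp add: diff_divide_distrib)
  ultimately have "\<bar>snap N e t - t\<bar> \<le> 1 / M" using M0 by (simp add: abs_divide divide_right_mono)
  also have "\<dots> \<le> e * (grid_dist N t)\<^sup>2" using M M0 p by (simp add: field_simps)
  finally show ?thesis .
qed

lemma different_cell_dist:
  assumes N: "N > 0" and "\<lfloor>N * s\<rfloor> \<noteq> \<lfloor>N * t\<rfloor>"
  shows "grid_dist N t \<le> \<bar>s - t\<bar>"
proof -
  have N0: "real N > 0" using N by simp
  consider "\<lfloor>N * s\<rfloor> < \<lfloor>N * t\<rfloor>" | "\<lfloor>N * t\<rfloor> + 1 \<le> \<lfloor>N * s\<rfloor>" using assms(2) by linarith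
  then show ?thesis
  proof cases
    case 1
    then have "N * s < real_of_int \<lfloor>N * t\<rfloor>" by linarith
    then have "s < real_of_int \<lfloor>N * t\<rfloor> / N" using N0 by (simp add: field_simps)
    then show ?thesis unfolding grid_dist_def by linarith
  next
    case 2
    then have "real_of_int (\<lfloor>N * t\<rfloor> + 1) \<le> N * s" by linarith
    then have "real_of_int (\<lfloor>N * t\<rfloor> + 1) / N \<le> s" using N0 by (simp add: field_simps)
    then show ?thesis unfolding grid_dist_def by linarith
  qed
qed

lemma same_cell_dist:
  assumes "\<lfloor>N * s\<rfloor> = \<lfloor>N * t\<rfloor>"
  shows "grid_dist N t - grid_dist N s \<le> \<bar>s - t\<bar>"
  unfolding grid_dist_def assms by linarith

lemma unit_cell_dist:
  assumes N: "N > 0" and t: "t \<in> {0..<1}"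
  shows "grid_dist N t \<le> t" "grid_dist N t \<le> 1 - t"
proof -
  have N0: "real N > 0" using N by simp
  have "0 \<le> real_of_int \<lfloor>N * t\<rfloor> / N" using t N0 by simp
  then show "grid_dist N t \<le> t" unfolding grid_dist_def by linarith
  have "N * t < N" using t N0 by simp
  then have "\<lfloor>N * t\<rfloor> + 1 \<le> int N" by linarith
  then have "real_of_int (\<lfloor>N * t\<rfloor> + 1) \<le> real N" by linarith
  then have "real_of_int (\<lfloor>N * t\<rfloor> + 1) / N \<le> 1" using N0 by simp
  then show "grid_dist N t \<le> 1 - t" unfolding grid_dist_def by linarith
qed

text \<open>Away from the grid the denominators of the snapped points are bounded, so these points
  lie in a finite set that misses the irrational \<open>t0\<close>. Near the grid \<open>t\<close>
  itself is far from \<open>t0\<close>, and \<open>snap\<close> moves it by at most a quarter of the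
  grid distance of \<open>t0\<close>.\<close>

lemma snap_separated:
  assumes N: "N > 0" and e: "0 < e" "e \<le> 1" and t0: "t0 \<notin> \<rat>"
  shows "\<exists>k>0. \<forall>t. t \<in> {0..1} \<longrightarrow> grid_dist N t > 0 \<longrightarrow> k \<le> \<bar>snap N e t - t0\<bar>"
proof -
  define d0 where "d0 = grid_dist N t0"
  have d0: "d0 > 0" unfolding d0_def by (rule grid_dist_pos[OF N t0])
  define M0 where "M0 = \<lceil>1 / (e * (d0 / 2)\<^sup>2)\<rceil>"
  define Q where "Q = (\<lambda>(k, m). real_of_int k / real_of_int m) ` ({0..M0} \<times> {0..M0})"
  have fin: "finite Q" unfolding Q_def by simp
  have t0Q: "t0 \<notin> Q" using t0 unfolding Q_def by auto
  obtain k1 where k1: "k1 > 0" "\<And>q. q \<in> Q \<Longrightarrow> k1 \<le> \<bar>q - t0\<bar>"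
  proof -
    obtain d where "d > 0" "\<forall>x\<in>Q. x \<noteq> t0 \<longrightarrow> d \<le> dist t0 x" using finite_set_avoid[OF fin, of t0] by blast
    then show ?thesis using t0Q by (intro that[of d]) (auto simp: dist_real_def abs_minus_commute)
  qed
  have "min k1 (d0 / 4) \<le> \<bar>snap N e t - t0\<bar>" if t: "t \<in> {0..1}" and dt: "grid_dist N t > 0" for t
  proof (cases "grid_dist N t \<ge> d0 / 2")
    case True
    define M where "M = \<lceil>1 / (e * (grid_dist N t)\<^sup>2)\<rceil>"
    have s: "snap N e t = real_of_int \<lfloor>t * M\<rfloor> / M" by (simp add: snap_def M_def Let_def)
    have "1 / (e * (grid_dist N t)\<^sup>2) \<le> 1 / (e * (d0 / 2)\<^sup>2)"
      using True d0 e by (intro divide_left_mono mult_left_mono power_mono mult_pos_pos) auto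
    then have MM: "M \<le> M0" unfolding M_def M0_def by (rule ceiling_mono)
    have "0 < 1 / (e * (grid_dist N t)\<^sup>2)" using e dt by simp
    then have M1: "0 \<le> M" unfolding M_def by linarith
    have "0 \<le> \<lfloor>t * M\<rfloor>" using t M1 by simp
    moreover have "\<lfloor>t * M\<rfloor> \<le> M" using t M1 mult_right_mono[of t 1 "real_of_int M"] by (simp add: floor_le_iff)
    ultimately have "snap N e t \<in> Q" unfolding s Q_def using MM M1 by force
    then show ?thesis using k1(2) by fastforce
  next
    case False
    have close: "\<bar>snap N e t - t\<bar> \<le> e * (grid_dist N t)\<^sup>2" by (rule snap_close[OF e(1) dt])
    have "e * (grid_dist N t)\<^sup>2 \<le> 1 * (grid_dist N t * (1 / 2))"
      unfolding power2_eq_square using e dt grid_dist_le[OF N, of t] by (intro mult_mono) auto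
    then have c: "\<bar>snap N e t - t\<bar> \<le> d0 / 4" using close False by linarith
    have "d0 / 2 \<le> \<bar>t - t0\<bar>"
    proof (cases "\<lfloor>N * t\<rfloor> = \<lfloor>N * t0\<rfloor>")
      case True
      then show ?thesis using same_cell_dist[OF True] False by (simp add: d0_def)
    next
      case False
      then show ?thesis using different_cell_dist[OF N False] d0 by (simp add: d0_def)
    qed
    then show ?thesis using c by linarith
  qed
  then show ?thesis using k1(1) d0 by (intro exI[of _ "min k1 (d0 / 4)"]) auto
qed

lemma circ_separated:
  assumes "t0 \<in> {0<..<1}" "k > 0"
  shows "\<exists>k'>0. \<forall>x. x \<in> {0..1} \<longrightarrow> k \<le> \<bar>x - t0\<bar> \<longrightarrow> k' \<le> norm (circ x - circ t0)"
proof -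
  define k' where "k' = 4 * min k (min t0 (1 - t0))"
  have "k' \<le> norm (circ x - circ t0)" if "x \<in> {0..1}" "k \<le> \<bar>x - t0\<bar>" for x
  proof -
    have a: "\<bar>x - t0\<bar> \<le> 1" using that assms by (auto simp: abs_le_iff)
    have b: "min k (min t0 (1 - t0)) \<le> min \<bar>x - t0\<bar> (1 - \<bar>x - t0\<bar>)" using that assms by (auto simp: min_def abs_if)
    show ?thesis using norm_circ_diff_ge[OF a] b unfolding k'_def by linarith
  qed
  moreover have "k' > 0" using assms by (simp add: k'_def)
  ultimately show ?thesis by blast
qed

text \<open>Where the mass stays at distance \<open>k\<close> from \<open>z0\<close>, the kernel is
  Lipschitz in its second argument near \<open>z0\<close>, uniformly over the mass. On the circle
  itself the kernel is purely imaginary off its pole.\<close>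

lemma herglotz_integral_tendsto:
  assumes c: "integrable M c" and p: "p \<in> borel_measurable M" and p1: "\<And>w. norm (p w) = 1"
    and z0: "norm z0 = 1" and k: "k > 0" and sep: "AE w in M. c w \<noteq> 0 \<longrightarrow> k \<le> norm (p w - z0)"
  shows "((\<lambda>z. integral\<^sup>L M (\<lambda>w. herglotz (p w) z * of_real (c w))) \<longlongrightarrow> integral\<^sup>L M (\<lambda>w. herglotz (p w) z0 * of_real (c w))) (at z0 within ball 0 1)"
    and "Re (integral\<^sup>L M (\<lambda>w. herglotz (p w) z0 * of_real (c w))) = 0"
    and "integrable M (\<lambda>w. herglotz (p w) z0 * of_real (c w))"
proof -
  define I where "I = integral\<^sup>L M (\<lambda>w. \<bar>c w\<bar>)"
  have m: "(\<lambda>w. herglotz (p w) z * of_real (c w)) \<in> borel_measurable M" for z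
    unfolding herglotz_def using p borel_measurable_integrable[OF c] by measurable
  show i0: "integrable M (\<lambda>w. herglotz (p w) z0 * of_real (c w))"
  proof (rule Bochner_Integration.integrable_bound[OF _ m])
    show "integrable M (\<lambda>w. 2 / k * c w)" using c by simp
    show "AE w in M. norm (herglotz (p w) z0 * of_real (c w)) \<le> norm (2 / k * c w)" using sep
    proof eventually_elim
      case (elim w)
      show ?case
      proof (cases "c w = 0")
        case False
        have "norm (herglotz (p w) z0) \<le> 2 / k" unfolding herglotz_def norm_divide
          using elim False k norm_triangle_ineq[of "p w" z0] p1[of w] z0 by (intro frac_le) auto
        from mult_right_mono[OF this abs_ge_zero[of "c w"]] show ?thesis using k by (simp add: norm_mult abs_mult)
      qed simp
    qed
  qed
  have "AE w in M. Re (herglotz (p w) z0 * of_real (c w)) = 0" using Re_herglotz_circle[OF p1 z0] by (intro AE_I2) simp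
  then have "integral\<^sup>L M (\<lambda>w. Re (herglotz (p w) z0 * of_real (c w))) = 0" by (rule integral_eq_zero_AE)
  then show "Re (integral\<^sup>L M (\<lambda>w. herglotz (p w) z0 * of_real (c w))) = 0" using integral_Re[OF i0] by simp
  have bound: "norm (integral\<^sup>L M (\<lambda>w. herglotz (p w) z * of_real (c w)) - integral\<^sup>L M (\<lambda>w. herglotz (p w) z0 * of_real (c w))) \<le> 4 / k\<^sup>2 * I * norm (z - z0)"
    if z: "norm z < 1" "norm (z - z0) < k / 2" for z
  proof -
    have i: "integrable M (\<lambda>w. herglotz (p w) z * of_real (c w))" using p1 z by (intro integrable_herglotz c p) auto
    have "integral\<^sup>L M (\<lambda>w. herglotz (p w) z * of_real (c w)) - integral\<^sup>L M (\<lambda>w. herglotz (p w) z0 * of_real (c w)) =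
      integral\<^sup>L M (\<lambda>w. herglotz (p w) z * of_real (c w) - herglotz (p w) z0 * of_real (c w))"
      by (rule Bochner_Integration.integral_diff[symmetric, OF i i0])
    also have "norm \<dots> \<le> integral\<^sup>L M (\<lambda>w. 4 / k\<^sup>2 * norm (z - z0) * \<bar>c w\<bar>)"
    proof (rule order_trans[OF integral_norm_bound integral_mono_AE])
      show "integrable M (\<lambda>w. norm (herglotz (p w) z * of_real (c w) - herglotz (p w) z0 * of_real (c w)))"
        by (intro integrable_norm Bochner_Integration.integrable_diff i i0)
      show "integrable M (\<lambda>w. 4 / k\<^sup>2 * norm (z - z0) * \<bar>c w\<bar>)" using c by simp
      show "AE w in M. norm (herglotz (p w) z * of_real (c w) - herglotz (p w) z0 * of_real (c w)) \<le> 4 / k\<^sup>2 * norm (z - z0) * \<bar>c w\<bar>" using sep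
      proof eventually_elim
        case (elim w)
        show ?case
        proof (cases "c w = 0")
          case False
          have d0: "k \<le> norm (p w - z0)" using elim False by simp
          have d: "k / 2 \<le> norm (p w - z)" using d0 z(2) norm_triangle_ineq[of "p w - z" "z - z0"] by simp
          have ne: "p w - z0 \<noteq> 0" "p w - z \<noteq> 0" using d0 d k by auto
          have "herglotz (p w) z - herglotz (p w) z0 = 2 * p w * (z - z0) / ((p w - z) * (p w - z0))"
            unfolding herglotz_def using ne by (simp add: divide_simps) (simp add: algebra_simps)
          then have "norm (herglotz (p w) z - herglotz (p w) z0) = 2 * norm (z - z0) / (norm (p w - z) * norm (p w - z0))"
            using p1[of w] by (simp add: norm_mult norm_divide)
          also have "\<dots> \<le> 2 * norm (z - z0) / (k / 2 * k)" using d d0 k by (intro divide_left_mono mult_mono mult_pos_pos) (auto simp: ne)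
          also have "\<dots> = 4 / k\<^sup>2 * norm (z - z0)" by (simp add: power2_eq_square)
          finally have "norm (herglotz (p w) z - herglotz (p w) z0) \<le> 4 / k\<^sup>2 * norm (z - z0)" .
          from mult_right_mono[OF this abs_ge_zero[of "c w"]] show ?thesis by (simp only: left_diff_distrib[symmetric] norm_mult norm_of_real)
        qed simp
      qed
    qed
    also have "\<dots> = 4 / k\<^sup>2 * I * norm (z - z0)" by (simp add: I_def)
    finally show ?thesis .
  qed
  have "\<forall>\<^sub>F z in at z0 within ball 0 1. norm (integral\<^sup>L M (\<lambda>w. herglotz (p w) z * of_real (c w)) - integral\<^sup>L M (\<lambda>w. herglotz (p w) z0 * of_real (c w))) \<le> 4 / k\<^sup>2 * I * norm (z - z0)"
    unfolding eventually_at using k bound by (intro exI[of _ "k / 2"]) (auto simp: dist_norm)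
  moreover have "((\<lambda>z. 4 / k\<^sup>2 * I * norm (z - z0)) \<longlongrightarrow> 4 / k\<^sup>2 * I * norm (z0 - z0)) (at z0 within ball 0 1)"
    by (intro tendsto_intros)
  then have "((\<lambda>z. 4 / k\<^sup>2 * I * norm (z - z0)) \<longlongrightarrow> 0) (at z0 within ball 0 1)" by (simp only: diff_self norm_zero mult_zero_right)
  ultimately have "((\<lambda>z. integral\<^sup>L M (\<lambda>w. herglotz (p w) z * of_real (c w)) - integral\<^sup>L M (\<lambda>w. herglotz (p w) z0 * of_real (c w))) \<longlongrightarrow> 0) (at z0 within ball 0 1)"
    by (rule Lim_null_comparison)
  then show "((\<lambda>z. integral\<^sup>L M (\<lambda>w. herglotz (p w) z * of_real (c w))) \<longlongrightarrow> integral\<^sup>L M (\<lambda>w. herglotz (p w) z0 * of_real (c w))) (at z0 within ball 0 1)"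
    by (rule LIM_zero_cancel)
qed

lemma herglotz_diff_pole:
  assumes "p \<noteq> z" "p' \<noteq> z"
  shows "herglotz p z - herglotz p' z = 2 * z * (p' - p) / ((p - z) * (p' - z))"
  unfolding herglotz_def using assms by (simp add: divide_simps) (simp add: algebra_simps)

text \<open>\<open>mu\<close> is the image of \<open>c dt\<close> under \<open>circ\<close> composed
  with \<open>snap\<close>, and \<open>h\<close> is \<open>- c\<close> on the circle, so the total
  mass is 0 and \<open>Xi 0 = 0\<close>. At an irrational \<open>t0\<close> the atoms keep a
  distance and contribute only an imaginary part; subtracting the constant \<open>c t0\<close>
  removes the arc around \<open>t0\<close> from the second integral, which leaves the real part
  \<open>- c t0\<close>. If \<open>c t0 = 0\<close>, every piece of mass nearly cancels the piece of
  arc from which it was moved.\<close>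

lemma singular_multiplier:
  fixes N :: nat and g :: "nat \<Rightarrow> real" and dl :: real
  assumes N: "N > 0" and g: "\<And>i. 0 \<le> g i" and dl: "dl > 0"
  defines "c \<equiv> \<lambda>t::real. g (nat \<lfloor>real N * t\<rfloor>)"
  shows "\<exists>mu h Xi C. circle_measure mu \<and> singular_to_sigma mu \<and> measure mu (sphere 0 1) = integral\<^sup>L unit_interval c \<and>
     integrable sigma_T h \<and>
     (\<forall>z\<in>ball 0 1. Xi z = integral\<^sup>L mu (\<lambda>w. (w + z) / (w - z)) + integral\<^sup>L sigma_T (\<lambda>w. (w + z) / (w - z) * of_real (h w))) \<and>
     Xi holomorphic_on ball 0 1 \<and> Xi 0 = 0 \<and> (\<forall>z\<in>ball 0 1. - C \<le> Re (Xi z)) \<and>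
     (\<forall>t. t \<in> {0<..<1} \<longrightarrow> t \<notin> \<rat> \<longrightarrow> (\<exists>x. (Xi \<longlongrightarrow> x) (at (circ t) within ball 0 1) \<and> Re x = - c t \<and> (c t = 0 \<longrightarrow> norm x \<le> dl)))"
proof -
  have cm [measurable]: "c \<in> borel_measurable borel" unfolding c_def by measurable
  have c0: "0 \<le> c t" for t unfolding c_def by (rule g)
  define cM where "cM = (\<Sum>i\<le>N. g i)"
  have cM: "c t \<le> cM" if "t \<in> {0..1}" for t
  proof -
    have "real N * t \<le> real N" using that N by (simp add: mult_left_le)
    then have "nat \<lfloor>real N * t\<rfloor> \<le> N" by linarith
    then show ?thesis unfolding c_def cM_def using g by (intro member_le_sum) auto
  qed
  have ci: "integrable unit_interval c"
  proof (rule unit_interval.integrable_const_bound[of _ cM])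
    show "AE t in unit_interval. norm (c t) \<le> cM" using cM c0 by (intro AE_I2) auto
  qed (rule measurable_unit_interval[OF cm])
  define I where "I = integral\<^sup>L unit_interval c"
  have I: "I \<ge> 0" unfolding I_def using c0 by (intro Bochner_Integration.integral_nonneg) auto
  \<comment> \<open>The bound by \<open>dl / (2 * (I + 1))\<close> makes the limit small where
    \<open>c\<close> vanishes. The bound \<open>1 / 4\<close> keeps a snapped point within
    \<open>d\<close> of the original one on the circle, which is at least \<open>4 * d\<close> away
    from \<open>z0\<close>; here \<open>d\<close> is the grid distance.\<close>
  define e where "e = min (1 / 4) (dl / (2 * (I + 1)))"
  have e: "0 < e" "e \<le> 1 / 4" "2 * e * I \<le> dl"
  proof -
    show "0 < e" using I dl by (auto simp: e_def)
    show "e \<le> 1 / 4" unfolding e_def by (rule min.cobounded1)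
    have "2 * e * I \<le> 2 * (dl / (2 * (I + 1))) * I" using I by (intro mult_right_mono mult_left_mono) (auto simp: e_def)
    also have "\<dots> \<le> dl" using I dl by (simp add: field_simps)
    finally show "2 * e * I \<le> dl" .
  qed
  define p where "p t = circ (snap N e t)" for t
  have pm: "p \<in> borel_measurable borel" unfolding p_def by measurable
  have pm': "p \<in> borel_measurable unit_interval" by (rule measurable_unit_interval[OF pm])
  have p1: "norm (p t) = 1" for t by (simp add: p_def)
  define mu where "mu = distr (density unit_interval (\<lambda>t. ennreal (c t))) borel p"
  have pd: "p \<in> measurable (density unit_interval (\<lambda>t. ennreal (c t))) borel" using pm' by simp
  have cmu: "(\<lambda>t. ennreal (c t)) \<in> borel_measurable unit_interval" using measurable_unit_interval[OF cm] by measurable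
  have emu: "emeasure mu B = (\<integral>\<^sup>+t. ennreal (c t) * indicator (p -` B) t \<partial>unit_interval)" if "B \<in> sets borel" for B
  proof -
    have "p -` B \<inter> {0..1} \<in> sets unit_interval" using measurable_sets[OF pm' that] by simp
    then have "emeasure mu B = (\<integral>\<^sup>+t. ennreal (c t) * indicator (p -` B \<inter> {0..1}) t \<partial>unit_interval)"
      unfolding mu_def using that pd cmu by (simp add: emeasure_distr emeasure_density)
    also have "\<dots> = (\<integral>\<^sup>+t. ennreal (c t) * indicator (p -` B) t \<partial>unit_interval)"
      by (intro nn_integral_cong) (auto simp: indicator_def)
    finally show ?thesis .
  qed
  have nn: "(\<integral>\<^sup>+t. ennreal (c t) \<partial>unit_interval) = ennreal I"
    unfolding I_def using ci c0 by (intro nn_integral_eq_integral) auto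
  have mu_sphere: "emeasure mu (sphere 0 1) = ennreal I"
  proof -
    have "p -` sphere 0 1 = UNIV" using p1 by auto
    then show ?thesis using emu[of "sphere 0 1"] nn by simp
  qed
  have circle: "circle_measure mu" unfolding circle_measure_def
  proof (intro conjI)
    show "sets mu = sets borel" by (simp add: mu_def)
    have "emeasure mu (space mu) = ennreal I" using emu[of UNIV] nn by (simp add: mu_def)
    then show "finite_measure mu" by (intro finite_measureI) simp
    have "p -` (UNIV - sphere 0 1) = {}" using p1 by auto
    then show "emeasure mu (UNIV - sphere 0 1) = 0" using emu[of "UNIV - sphere 0 1"] by simp
  qed
  have sing: "singular_to_sigma mu" unfolding singular_to_sigma_def
  proof (intro bexI[of _ "circ ` (\<rat> \<inter> {0..1})"] conjI)
    have cc: "countable (circ ` (\<rat> \<inter> {0..1}))" by (intro countable_image countable_subset[OF _ countable_rat]) auto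
    show A: "circ ` (\<rat> \<inter> {0..1}) \<in> sets borel" by (rule sets.countable[OF _ cc]) simp
    show "circ ` (\<rat> \<inter> {0..1}) \<subseteq> sphere 0 1" by auto
    show "emeasure sigma_T (circ ` (\<rat> \<inter> {0..1})) = 0" by (rule emeasure_sigma_T_rational)
    have "emeasure mu (sphere 0 1 - circ ` (\<rat> \<inter> {0..1})) = (\<integral>\<^sup>+t. ennreal (c t) * indicator (p -` (sphere 0 1 - circ ` (\<rat> \<inter> {0..1}))) t \<partial>unit_interval)"
      using A by (intro emu) auto
    also have "\<dots> = (\<integral>\<^sup>+t. 0 \<partial>unit_interval)"
      using snap_bounds[OF _ e(1), of _ N] by (intro nn_integral_cong) (auto simp: indicator_def p_def)
    finally show "emeasure mu (sphere 0 1 - circ ` (\<rat> \<inter> {0..1})) = 0" by simp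
  qed
  have int_mu: "integral\<^sup>L mu (\<lambda>w. (w + z) / (w - z)) = integral\<^sup>L unit_interval (\<lambda>t. herglotz (p t) z * of_real (c t))" for z
  proof -
    have hz: "(\<lambda>w. (w + z) / (w - z)) \<in> borel_measurable borel" by measurable
    have "integral\<^sup>L mu (\<lambda>w. (w + z) / (w - z)) = integral\<^sup>L (density unit_interval (\<lambda>t. ennreal (c t))) (\<lambda>t. herglotz (p t) z)"
      unfolding mu_def herglotz_def by (rule integral_distr[OF pd hz])
    also have "\<dots> = integral\<^sup>L unit_interval (\<lambda>t. c t *\<^sub>R herglotz (p t) z)"
    proof (rule integral_density)
      show "(\<lambda>t. herglotz (p t) z) \<in> borel_measurable unit_interval" using measurable_compose[OF pm' herglotz_measurable] .
      show "c \<in> borel_measurable unit_interval" by (rule measurable_unit_interval[OF cm])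
    qed (use c0 in auto)
    finally show ?thesis by (simp add: scaleR_conv_of_real mult.commute)
  qed
  \<comment> \<open>A finite sum over closed arcs is Borel measurable. Neighbouring arcs share
    endpoints, so agreement with \<open>- c\<close> is claimed only at irrational
    parameters.\<close>
  define h where "h w = - (\<Sum>i<N. g i * indicator (circ ` {real i / real N..(real i + 1) / real N}) w)" for w
  have arc: "circ ` {a..b} \<in> sets borel" for a b :: real
    by (intro borel_compact compact_continuous_image continuous_intros) auto
  have hm: "h \<in> borel_measurable borel" unfolding h_def using arc by measurable
  have hc: "h (circ t) = - c t" if t: "t \<in> {0<..<1}" "t \<notin> \<rat>" for t
  proof -
    define i0 where "i0 = nat \<lfloor>real N * t\<rfloor>"
    have i0r: "real i0 = real_of_int \<lfloor>real N * t\<rfloor>" using t N by (simp add: i0_def)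
    have b: "real i0 \<le> real N * t" "real N * t < real i0 + 1" unfolding i0r by linarith+
    have "real N * t < N" using t N by simp
    then have iN: "i0 < N" using b by linarith
    have "indicator (circ ` {real i / real N..(real i + 1) / real N}) (circ t) = (if i = i0 then 1 else (0::real))" if i: "i < N" for i
    proof -
      have "circ t \<in> circ ` {real i / real N..(real i + 1) / real N} \<longleftrightarrow> t \<in> {real i / real N..(real i + 1) / real N}"
      proof
        assume "circ t \<in> circ ` {real i / real N..(real i + 1) / real N}"
        then obtain s where s: "s \<in> {real i / real N..(real i + 1) / real N}" "circ s = circ t" by auto
        have "0 \<le> real i / real N" "(real i + 1) / real N \<le> 1" using i N by (auto simp: divide_le_eq)
        then have "s \<in> {0..1}" using s(1) unfolding atLeastAtMost_iff by linarith
        then show "t \<in> {real i / real N..(real i + 1) / real N}" using circ_inj[OF s(2) _ t(1)] s(1) by simp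
      qed auto
      also have "\<dots> \<longleftrightarrow> i = i0"
      proof
        assume "t \<in> {real i / real N..(real i + 1) / real N}"
        then have "real i \<le> real N * t" "real N * t \<le> real i + 1" using N by (auto simp: field_simps)
        moreover have "real N * t \<noteq> real i + 1"
        proof
          assume "real N * t = real i + 1"
          then have "t = (real i + 1) / real N" using N by (simp add: field_simps)
          then show False using t(2) by auto
        qed
        ultimately show "i = i0" using b by linarith
      next
        assume "i = i0" then show "t \<in> {real i / real N..(real i + 1) / real N}" using b N by (auto simp: field_simps)
      qed
      finally show ?thesis by (simp add: indicator_def)
    qed
    then have "h (circ t) = - (\<Sum>i<N. g i * (if i = i0 then 1 else 0))" unfolding h_def by (intro arg_cong[where f = uminus] sum.cong) auto
    also have "(\<Sum>i<N. g i * (if i = i0 then 1 else 0)) = (\<Sum>i<N. if i = i0 then g i else 0)" by (intro sum.cong) auto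
    also have "- \<dots> = - g i0" using iN by simp
    finally show ?thesis by (simp add: c_def i0_def)
  qed
  have AEirr: "AE t in unit_interval. h (circ t) = - c t" using AE_unit_interval_irrational by eventually_elim (use hc in auto)
  have hcm: "(\<lambda>t. h (circ t)) \<in> borel_measurable unit_interval" using measurable_compose[OF circ_measurable_unit_interval hm] .
  have hi: "integrable sigma_T h"
  proof -
    have "integrable unit_interval (\<lambda>t. h (circ t))"
      using ci by (subst integrable_cong_AE[OF hcm _ AEirr]) (auto intro: measurable_unit_interval)
    then show ?thesis using integrable_sigma_T[OF hm] by simp
  qed
  have int_h: "integral\<^sup>L sigma_T (\<lambda>w. (w + z) / (w - z) * of_real (h w)) = - integral\<^sup>L unit_interval (\<lambda>t. herglotz (circ t) z * of_real (c t))" for z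
  proof -
    have hz: "(\<lambda>w. (w + z) / (w - z) * of_real (h w)) \<in> borel_measurable borel" using hm by measurable
    have "integral\<^sup>L sigma_T (\<lambda>w. (w + z) / (w - z) * of_real (h w)) = integral\<^sup>L unit_interval (\<lambda>t. herglotz (circ t) z * of_real (h (circ t)))"
      unfolding herglotz_def by (rule integral_sigma_T[OF hz])
    also have "\<dots> = integral\<^sup>L unit_interval (\<lambda>t. - (herglotz (circ t) z * of_real (c t)))"
    proof (rule integral_cong_AE)
      show "(\<lambda>t. herglotz (circ t) z * of_real (h (circ t))) \<in> borel_measurable unit_interval"
        using measurable_compose[OF circ_measurable_unit_interval herglotz_measurable] hcm by measurable
      show "(\<lambda>t. - (herglotz (circ t) z * of_real (c t))) \<in> borel_measurable unit_interval"
        using measurable_compose[OF circ_measurable_unit_interval herglotz_measurable] measurable_unit_interval[OF cm] by measurable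
      show "AE t in unit_interval. herglotz (circ t) z * of_real (h (circ t)) = - (herglotz (circ t) z * of_real (c t))"
        using AEirr by eventually_elim simp
    qed
    finally show ?thesis by simp
  qed
  define A where "A z = integral\<^sup>L unit_interval (\<lambda>t. herglotz (p t) z * of_real (c t))" for z
  define B where "B z = integral\<^sup>L unit_interval (\<lambda>t. herglotz (circ t) z * of_real (c t))" for z
  define Xi where "Xi z = A z - B z" for z
  have Xi_eq: "Xi z = integral\<^sup>L mu (\<lambda>w. (w + z) / (w - z)) + integral\<^sup>L sigma_T (\<lambda>w. (w + z) / (w - z) * of_real (h w))" for z
    unfolding Xi_def A_def B_def int_mu int_h by simp
  have hol: "Xi holomorphic_on ball 0 1" unfolding Xi_def A_def B_def
    using herglotz_transform_holomorphic[OF ci pm'] herglotz_transform_holomorphic[OF ci circ_measurable_unit_interval] p1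
    by (intro holomorphic_intros) auto
  have Xi0: "Xi 0 = 0"
  proof -
    have "p t \<noteq> 0" for t using p1[of t] by auto
    then show ?thesis by (simp add: Xi_def A_def B_def)
  qed
  have lower: "- cM \<le> Re (Xi z)" if z: "z \<in> ball 0 1" for z
  proof -
    have z1: "norm z < 1" using z by simp
    have i1: "integrable unit_interval (\<lambda>t. Re (herglotz (circ t) z) * k t)" if "integrable unit_interval k" for k
      using integrable_Re[OF integrable_herglotz[OF that circ_measurable_unit_interval _ z1]] by simp
    have "Re (A z) = integral\<^sup>L unit_interval (\<lambda>t. Re (herglotz (p t) z) * c t)"
      unfolding A_def using p1 by (intro Re_integral_herglotz ci pm' z1) auto
    also have "\<dots> \<ge> 0" using Re_herglotz(2)[OF p1 z1] c0 by (intro Bochner_Integration.integral_nonneg mult_nonneg_nonneg) (auto intro: less_imp_le)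
    finally have A0: "0 \<le> Re (A z)" .
    have "Re (B z) = integral\<^sup>L unit_interval (\<lambda>t. Re (herglotz (circ t) z) * c t)"
      unfolding B_def by (intro Re_integral_herglotz ci circ_measurable_unit_interval z1) auto
    also have "\<dots> \<le> integral\<^sup>L unit_interval (\<lambda>t. Re (herglotz (circ t) z) * cM)"
      using Re_herglotz(2)[OF norm_circ z1] cM by (intro integral_mono i1 ci mult_left_mono) (auto intro: less_imp_le)
    also have "\<dots> = cM"
    proof -
      have "integrable unit_interval (\<lambda>t. herglotz (circ t) z)" using integrable_herglotz[of unit_interval "\<lambda>_. 1" circ z] z1 by simp
      then have "integral\<^sup>L unit_interval (\<lambda>t. Re (herglotz (circ t) z)) = 1" using integral_herglotz_circle[OF z1] integral_Re by fastforce
      then show ?thesis by simp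
    qed
    finally show ?thesis using A0 by (simp add: Xi_def)
  qed
  have lim: "\<exists>x. (Xi \<longlongrightarrow> x) (at (circ t0) within ball 0 1) \<and> Re x = - c t0 \<and> (c t0 = 0 \<longrightarrow> norm x \<le> dl)"
    if t0: "t0 \<in> {0<..<1}" "t0 \<notin> \<rat>" for t0
  proof -
    define z0 where "z0 = circ t0"
    have z0: "norm z0 = 1" by (simp add: z0_def)
    obtain k where k: "k > 0" "\<And>t. t \<in> {0..1} \<Longrightarrow> grid_dist N t > 0 \<Longrightarrow> k \<le> \<bar>snap N e t - t0\<bar>"
      using snap_separated[OF N e(1) _ t0(2)] e(2) by force
    obtain k1 where k1: "k1 > 0" "\<And>x. x \<in> {0..1} \<Longrightarrow> k \<le> \<bar>x - t0\<bar> \<Longrightarrow> k1 \<le> norm (circ x - circ t0)"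
      using circ_separated[OF t0(1) k(1)] by blast
    have sepA: "AE t in unit_interval. c t \<noteq> 0 \<longrightarrow> k1 \<le> norm (p t - z0)" using AE_unit_interval_irrational
    proof eventually_elim
      case (elim t)
      then have "t \<in> {0..1}" "grid_dist N t > 0" using grid_dist_pos[OF N] by auto
      then show ?case unfolding p_def z0_def using k1(2) k(2) snap_bounds(1)[OF _ e(1)] by blast
    qed
    have d0: "grid_dist N t0 > 0" by (rule grid_dist_pos[OF N t0(2)])
    obtain k2 where k2: "k2 > 0" "\<And>x. x \<in> {0..1} \<Longrightarrow> grid_dist N t0 \<le> \<bar>x - t0\<bar> \<Longrightarrow> k2 \<le> norm (circ x - circ t0)"
      using circ_separated[OF t0(1) d0] by blast
    have cell: "\<lfloor>real N * t\<rfloor> \<noteq> \<lfloor>real N * t0\<rfloor>" if "c t \<noteq> c t0" for t using that unfolding c_def by auto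
    \<comment> \<open>In the cell of \<open>t0\<close> the difference \<open>c t - c t0\<close>
      vanishes, and every other cell is at least \<open>grid_dist N t0\<close> away.\<close>
    have sepB: "AE t in unit_interval. c t - c t0 \<noteq> 0 \<longrightarrow> k2 \<le> norm (circ t - z0)"
    proof (rule AE_I2, rule impI)
      fix t assume t: "t \<in> space unit_interval" "c t - c t0 \<noteq> 0"
      then have "grid_dist N t0 \<le> \<bar>t - t0\<bar>" using different_cell_dist[OF N cell[of t]] by simp
      then show "k2 \<le> norm (circ t - z0)" unfolding z0_def using t by (intro k2(2)) auto
    qed
    have ci': "integrable unit_interval (\<lambda>t. c t - c t0)" using ci by simp
    note A_lim = herglotz_integral_tendsto[OF ci pm' p1 z0 k1(1) sepA]
    note B_lim = herglotz_integral_tendsto[OF ci' circ_measurable_unit_interval norm_circ z0 k2(1) sepB]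
    define Bs where "Bs z = integral\<^sup>L unit_interval (\<lambda>t. herglotz (circ t) z * of_real (c t - c t0))" for z
    have BBs: "B z = Bs z + of_real (c t0)" if z: "norm z < 1" for z
    proof -
      have i2: "integrable unit_interval (\<lambda>t. herglotz (circ t) z)" using integrable_herglotz[of unit_interval "\<lambda>_. 1" circ z] z by simp
      have "Bs z = integral\<^sup>L unit_interval (\<lambda>t. herglotz (circ t) z * of_real (c t) - herglotz (circ t) z * of_real (c t0))"
        unfolding Bs_def by (simp add: right_diff_distrib)
      also have "\<dots> = B z - integral\<^sup>L unit_interval (\<lambda>t. herglotz (circ t) z * of_real (c t0))"
        unfolding B_def using integrable_herglotz[OF ci circ_measurable_unit_interval _ z] i2 by (intro Bochner_Integration.integral_diff) auto
      also have "integral\<^sup>L unit_interval (\<lambda>t. herglotz (circ t) z * of_real (c t0)) = of_real (c t0)" using integral_herglotz_circle[OF z] by simp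
      finally show ?thesis by simp
    qed
    define x where "x = A z0 - (Bs z0 + of_real (c t0))"
    have "((\<lambda>z. A z - (Bs z + of_real (c t0))) \<longlongrightarrow> x) (at z0 within ball 0 1)"
      unfolding x_def A_def Bs_def by (intro tendsto_intros A_lim(1) B_lim(1))
    moreover have "\<forall>\<^sub>F z in at z0 within ball 0 1. A z - (Bs z + of_real (c t0)) = Xi z"
      unfolding eventually_at_filter Xi_def using BBs by (intro always_eventually) simp
    ultimately have 1: "(Xi \<longlongrightarrow> x) (at z0 within ball 0 1)" by (rule Lim_transform_eventually)
    have 2: "Re x = - c t0" using A_lim(2) B_lim(2) by (simp add: x_def A_def Bs_def)
    have 3: "norm x \<le> dl" if ct0: "c t0 = 0"
    proof -
      have B0: "integrable unit_interval (\<lambda>t. herglotz (circ t) z0 * of_real (c t))" using B_lim(3) ct0 by simp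
      have "x = integral\<^sup>L unit_interval (\<lambda>t. herglotz (p t) z0 * of_real (c t) - herglotz (circ t) z0 * of_real (c t))"
        unfolding x_def A_def Bs_def ct0 using Bochner_Integration.integral_diff[OF A_lim(3) B0] by simp
      also have "norm \<dots> \<le> integral\<^sup>L unit_interval (\<lambda>t. 2 * e * c t)"
      proof (rule order_trans[OF integral_norm_bound integral_mono_AE])
        show "integrable unit_interval (\<lambda>t. norm (herglotz (p t) z0 * of_real (c t) - herglotz (circ t) z0 * of_real (c t)))"
          by (intro integrable_norm Bochner_Integration.integrable_diff A_lim(3) B0)
        show "integrable unit_interval (\<lambda>t. 2 * e * c t)" using ci by simp
        show "AE t in unit_interval. norm (herglotz (p t) z0 * of_real (c t) - herglotz (circ t) z0 * of_real (c t)) \<le> 2 * e * c t"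
          using AE_unit_interval_irrational
        proof eventually_elim
          case (elim t)
          show ?case
          proof (cases "c t = 0")
            case False
            define d where "d = grid_dist N t"
            have d: "0 < d" "d \<le> 1 / 2" unfolding d_def using grid_dist_pos[OF N] grid_dist_le[OF N] elim by auto
            have dd: "d \<le> \<bar>t0 - t\<bar>" unfolding d_def using cell[of t] False ct0 by (intro different_cell_dist[OF N]) auto
            have "d \<le> t" "d \<le> 1 - t" unfolding d_def using unit_cell_dist[OF N, of t] elim by auto
            then have "d \<le> 1 - \<bar>t0 - t\<bar>" using t0(1) elim by (auto simp: abs_if)
            moreover from this have "\<bar>t - t0\<bar> \<le> 1" using d by (simp add: abs_minus_commute)
            ultimately have ge: "4 * d \<le> norm (circ t - z0)"
              using dd norm_circ_diff_ge[of t t0] unfolding z0_def abs_minus_commute[of t t0] by (simp add: min_def split: if_splits)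
            have "\<bar>snap N e t - t\<bar> \<le> e * d\<^sup>2" unfolding d_def using snap_close[OF e(1)] d by (simp add: d_def)
            then have le: "norm (p t - circ t) \<le> 2 * pi * (e * d\<^sup>2)" unfolding p_def
              using norm_circ_diff_le[of "snap N e t" t] by (meson mult_left_mono order_trans pi_ge_zero zero_le_numeral mult_nonneg_nonneg)
            have "2 * pi * (e * d\<^sup>2) \<le> 2 * 4 * ((1 / 4) * (d * (1 / 2)))"
              unfolding power2_eq_square using e d pi_less_4 by (intro mult_mono) auto
            then have "norm (p t - circ t) \<le> d" using le by simp
            then have ge2: "2 * d \<le> norm (p t - z0)" using ge norm_triangle_ineq[of "circ t - p t" "p t - z0"] d by (simp add: norm_minus_commute)
            have "norm (herglotz (p t) z0 - herglotz (circ t) z0) = 2 * norm (p t - circ t) / (norm (p t - z0) * norm (circ t - z0))"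
              using ge ge2 d z0 by (subst herglotz_diff_pole) (auto simp: norm_mult norm_divide norm_minus_commute)
            \<comment> \<open>The squared grid distance in the displacement cancels the two
              distances in the denominator, each at least a multiple of \<open>d\<close>. This is
              the reason for the square in \<open>snap\<close>.\<close>
            also have "\<dots> \<le> 2 * (2 * pi * (e * d\<^sup>2)) / (2 * d * (4 * d))"
              using le ge ge2 d e by (intro frac_le mult_mono) auto
            also have "\<dots> = pi / 2 * e" using d by (simp add: power2_eq_square field_simps)
            also have "\<dots> \<le> 2 * e" using pi_less_4 e by (intro mult_right_mono) auto
            finally have "norm (herglotz (p t) z0 - herglotz (circ t) z0) \<le> 2 * e" .
            from mult_right_mono[OF this c0[of t]] show ?thesis using c0[of t]
              by (simp only: left_diff_distrib[symmetric] norm_mult norm_of_real abs_of_nonneg)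
          qed simp
        qed
      qed
      also have "\<dots> = 2 * e * I" by (simp add: I_def)
      finally show ?thesis using e(3) by simp
    qed
    from 1 2 3 show ?thesis unfolding z0_def by blast
  qed
  have "measure mu (sphere 0 1) = integral\<^sup>L unit_interval c" using mu_sphere I by (simp add: measure_def I_def)
  then show ?thesis using circle sing hi Xi_eq hol Xi0 lower lim by blast
qed

section \<open>Jensen factorization\<close>

text \<open>Splitting off \<open>f z\<close> times the kernel leaves
  \<open>(w + z) * (f w - f z) / (w - z)\<close>, whose singularity at \<open>z\<close> is
  removable, so the mean value property applies to it.\<close>

lemma integral_herglotz_holomorphic:
  assumes z: "norm z < 1" and f: "f holomorphic_on ball 0 R" "R > 1"
  shows "integral\<^sup>L unit_interval (\<lambda>t. herglotz (circ t) z * f (circ t)) = 2 * f z - f 0"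
    and "integrable unit_interval (\<lambda>t. herglotz (circ t) z * f (circ t))"
proof -
  define q where "q w = (if w = z then deriv f z else (f w - f z) / (w - z))" for w
  have q: "q holomorphic_on ball 0 R" unfolding q_def using z f by (intro pole_lemma_open) auto
  define F where "F w = (w + z) * q w" for w
  have F: "F holomorphic_on ball 0 R" unfolding F_def by (intro holomorphic_intros q)
  have eq: "herglotz (circ t) z * f (circ t) = F (of_real 1 * circ t) + f z * herglotz (circ t) z" for t
  proof -
    have ne: "circ t \<noteq> z" using z by (metis norm_circ less_irrefl)
    then show ?thesis by (simp add: F_def q_def herglotz_def add_divide_distrib[symmetric]) (simp add: algebra_simps)
  qed
  have i1: "integrable unit_interval (\<lambda>t. F (of_real 1 * circ t))" using integral_mean_value(2)[OF F, of 1] f by simp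
  have i2: "integrable unit_interval (\<lambda>t. herglotz (circ t) z)" using integrable_herglotz[of unit_interval "\<lambda>_. 1" circ z] z by simp
  show "integrable unit_interval (\<lambda>t. herglotz (circ t) z * f (circ t))" unfolding eq using i1 i2 by (intro Bochner_Integration.integrable_add integrable_mult_right)
  have "integral\<^sup>L unit_interval (\<lambda>t. herglotz (circ t) z * f (circ t)) = F 0 + f z * 1"
    unfolding eq using integral_mean_value(1)[OF F, of 1] f i1 i2 integral_herglotz_circle[OF z]
    by (subst Bochner_Integration.integral_add) auto
  also have "F 0 = f z - f 0"
  proof (cases "z = 0")
    case False
    then show ?thesis by (simp add: F_def q_def field_simps)
  qed (simp add: F_def)
  finally show "integral\<^sup>L unit_interval (\<lambda>t. herglotz (circ t) z * f (circ t)) = 2 * f z - f 0" by simp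
qed

lemma schwarz_integral_formula:
  assumes z: "norm z < 1" and f: "f holomorphic_on ball 0 R" "R > 1"
  shows "integral\<^sup>L unit_interval (\<lambda>t. herglotz (circ t) z * of_real (Re (f (circ t)))) = f z - \<i> * of_real (Im (f 0))"
proof -
  have eq: "herglotz (circ t) z * of_real (Re (f (circ t))) = (herglotz (circ t) z * f (circ t) + herglotz (circ t) z * cnj (f (circ t))) / 2" for t
    by (simp add: complex_add_cnj distrib_left[symmetric])
  have "integral\<^sup>L unit_interval (\<lambda>t. herglotz (circ t) z * of_real (Re (f (circ t)))) = ((2 * f z - f 0) + cnj (f 0)) / 2"
    unfolding eq using integral_herglotz_holomorphic[OF z f] integral_herglotz_cnj[OF z f] by simp
  also have "\<dots> = f z - \<i> * of_real (Im (f 0))" by (simp add: complex_eq_iff)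
  finally show ?thesis .
qed

lemma integrable_circle_continuous:
  fixes f :: "complex \<Rightarrow> real"
  assumes "continuous_on (sphere 0 1) f"
  shows "integrable unit_interval (\<lambda>t. f (circ t))"
  by (rule continuous_imp_integrable_real)
     (auto intro!: continuous_on_compose2[OF assms] continuous_intros)

lemma AE_circ_notin_countable:
  assumes "countable Z"
  shows "AE t in unit_interval. circ t \<notin> Z"
proof -
  have "AE t in unit_interval. circ t \<noteq> a" for a
  proof (cases "\<exists>t1\<in>{0<..<1}. circ t1 = a")
    case True
    then obtain t1 where t1: "t1 \<in> {0<..<1}" "circ t1 = a" by blast
    have N: "{t1} \<in> null_sets (lebesgue :: real measure)" by (intro null_sets_completionI) auto
    have "AE t in lebesgue. t \<noteq> t1" by (rule AE_I'[OF N]) auto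
    then have "AE t in unit_interval. t \<noteq> t1" by (subst AE_restrict_space_iff) auto
    with AE_unit_interval_irrational show ?thesis
    proof eventually_elim
      case (elim t)
      then show ?case using circ_inj[of t t1] t1 by auto
    qed
  next
    case False
    show ?thesis using AE_unit_interval_irrational by eventually_elim (use False in auto)
  qed
  then have "AE t in unit_interval. \<forall>a\<in>Z. circ t \<noteq> a" by (intro AE_ball_countable' assms)
  then show ?thesis by eventually_elim auto
qed

lemma AE_circ_notin_finite: "finite Z \<Longrightarrow> AE t in unit_interval. circ t \<notin> Z"
  by (rule AE_circ_notin_countable[OF countable_finite])

text \<open>For \<open>norm a < 1\<close> the function \<open>Ln (1 - cnj a * w)\<close> is
  holomorphic past the closed disc, and Schwarz's formula recovers it from its real part on the
  circle. In other words, \<open>1 - cnj a * z\<close> is outer.\<close>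

lemma circle_log_factor_interior:
  assumes a: "norm a < 1" and z: "norm z < 1"
  shows "integrable unit_interval (\<lambda>t. ln (norm (1 - cnj a * circ t)))"
    and "exp (integral\<^sup>L unit_interval (\<lambda>t. herglotz (circ t) z * of_real (ln (norm (1 - cnj a * circ t))))) = 1 - cnj a * z"
    and "integral\<^sup>L unit_interval (\<lambda>t. ln (norm (1 - cnj a * circ t))) = 0"
proof -
  obtain R where R: "R > 1" "norm a * R < 1"
  proof (cases "a = 0")
    case False
    have "1 < (1 + 1 / norm a) / 2" "norm a * ((1 + 1 / norm a) / 2) < 1" using a False by (auto simp: field_simps)
    then show ?thesis using that by blast
  qed (use that[of 2] in simp)
  have small: "norm (cnj a * w) < 1" if "norm w < R" for w
    using that R mult_left_mono[of "norm w" R "norm a"] by (simp add: norm_mult)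
  then have ne: "1 - cnj a * w \<noteq> 0" if "norm w < R" for w using that by fastforce
  define f where "f w = Ln (1 - cnj a * w)" for w
  have pos: "0 < Re (1 - cnj a * w)" if "norm w < R" for w
    using small[OF that] complex_Re_le_cmod[of "cnj a * w"] unfolding minus_complex.sel one_complex.sel by linarith
  have f: "f holomorphic_on ball 0 R" unfolding f_def
    using pos by (intro holomorphic_intros) (fastforce simp: complex_nonpos_Reals_iff)
  have Re: "Re (f w) = ln (norm (1 - cnj a * w))" if "norm w < R" for w using ne[OF that] by (simp add: f_def)
  have "continuous_on (sphere 0 1) (\<lambda>w. ln (norm (1 - cnj a * w)))" using ne R(1) by (intro continuous_intros) auto
  from integrable_circle_continuous[OF this] show "integrable unit_interval (\<lambda>t. ln (norm (1 - cnj a * circ t)))" .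
  have S: "integral\<^sup>L unit_interval (\<lambda>t. herglotz (circ t) w * of_real (ln (norm (1 - cnj a * circ t)))) = f w" if "norm w < 1" for w
    using schwarz_integral_formula[OF that f R(1)] Re R(1) by (simp add: f_def)
  have "exp (f z) = 1 - cnj a * z" unfolding f_def using ne[of z] z R(1) by (intro exp_Ln) auto
  then show "exp (integral\<^sup>L unit_interval (\<lambda>t. herglotz (circ t) z * of_real (ln (norm (1 - cnj a * circ t))))) = 1 - cnj a * z" by (simp add: S[OF z])
  have "complex_of_real (integral\<^sup>L unit_interval (\<lambda>t. ln (norm (1 - cnj a * circ t)))) = 0"
    using S[of 0] by (simp add: f_def)
  then show "integral\<^sup>L unit_interval (\<lambda>t. ln (norm (1 - cnj a * circ t))) = 0" by simp
qed

text \<open>The logarithm is singular at \<open>a\<close>, so integrability comes from Fatou's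
  lemma: \<open>ln 2 - u n\<close> is nonnegative with integral \<open>ln 2\<close> for all
  \<open>n\<close>. Since \<open>norm (1 - e) / 2 \<le> norm (1 - s * e)\<close> for
  \<open>0 \<le> s < 1\<close> and \<open>norm e = 1\<close>, the approximants are
  dominated.\<close>

lemma circle_log_factor_approx:
  assumes a: "norm a = 1"
  defines "L \<equiv> \<lambda>t. ln (norm (1 - cnj a * circ t))"
    and "u \<equiv> \<lambda>n t. ln (norm (1 - cnj (of_real (real n / real (Suc n)) * a) * circ t))"
  shows "integrable unit_interval L"
    and "AE t in unit_interval. (\<lambda>n. u n t) \<longlonglongrightarrow> L t"
    and "AE t in unit_interval. \<forall>n. \<bar>u n t\<bar> \<le> 2 * ln 2 + \<bar>L t\<bar>"
proof -
  define s where "s n = real n / real (Suc n)" for n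
  have s: "0 \<le> s n" "s n < 1" for n by (auto simp: s_def)
  have slim: "s \<longlonglongrightarrow> 1" unfolding s_def by (rule LIMSEQ_n_over_Suc_n)
  define e where "e t = cnj a * circ t" for t
  have e1: "norm (e t) = 1" for t using a by (simp add: e_def norm_mult)
  have u: "u n t = ln (norm (1 - of_real (s n) * e t))" for n t by (simp add: u_def s_def e_def mult_ac)
  have L: "L t = ln (norm (1 - e t))" for t by (simp add: L_def e_def)
  have "AE t in unit_interval. circ t \<notin> {a}" by (rule AE_circ_notin_finite) simp
  then have AEne: "AE t in unit_interval. e t \<noteq> 1"
  proof eventually_elim
    case (elim t)
    then have "circ t \<noteq> a" by simp
    moreover have "a * cnj a = 1" using a by (simp add: complex_norm_square[symmetric])
    ultimately show "e t \<noteq> 1" unfolding e_def by (metis mult.assoc mult.left_commute mult.right_neutral mult.commute)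
  qed
  have low: "norm (1 - e t) / 2 \<le> norm (1 - of_real (s n) * e t)" for n t
  proof -
    have "norm (1 - e t) \<le> norm (1 - of_real (s n) * e t) + norm (of_real (s n - 1) * e t)"
      using norm_triangle_ineq[of "1 - of_real (s n) * e t" "of_real (s n - 1) * e t"] by (simp add: algebra_simps)
    also have "norm (of_real (s n - 1) * e t) = 1 - s n" unfolding norm_mult norm_of_real using e1 s(2)[of n] by simp
    also have "1 - s n \<le> norm (1 - of_real (s n) * e t)"
      using norm_triangle_ineq2[of 1 "of_real (s n) * e t"] e1 s(1)[of n] by (simp add: norm_mult)
    finally show ?thesis by simp
  qed
  have upp: "norm (1 - of_real (s n) * e t) \<le> 2" for n t
    using norm_triangle_ineq4[of 1 "of_real (s n) * e t"] e1 s[of n] by (simp add: norm_mult)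
  have pos: "0 < norm (1 - of_real (s n) * e t)" for n t
  proof -
    have "norm (of_real (s n) * e t) < 1" using e1 s[of n] by (simp add: norm_mult)
    then show ?thesis by fastforce
  qed
  have ule: "u n t \<le> ln 2" for n t unfolding u using pos upp by (subst ln_le_cancel_iff) auto
  have uge: "L t - ln 2 \<le> u n t" if "e t \<noteq> 1" for n t
  proof -
    have "ln (norm (1 - e t) / 2) \<le> u n t" unfolding u using pos low that by (subst ln_le_cancel_iff) auto
    then show ?thesis unfolding L using that by (simp add: ln_div)
  qed
  show "AE t in unit_interval. \<forall>n. \<bar>u n t\<bar> \<le> 2 * ln 2 + \<bar>L t\<bar>" using AEne
  proof eventually_elim
    case (elim t)
    have "(0::real) \<le> ln 2" by simp
    then show ?case using ule[of _ t] uge[OF elim] by (intro allI) (smt (verit))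
  qed
  show lim: "AE t in unit_interval. (\<lambda>n. u n t) \<longlonglongrightarrow> L t" using AEne
  proof eventually_elim
    case (elim t)
    have "(\<lambda>n. ln (norm (1 - of_real (s n) * e t))) \<longlonglongrightarrow> ln (norm (1 - of_real 1 * e t))"
      using elim by (intro tendsto_intros slim) auto
    then show ?case by (simp add: u L)
  qed
  have Lm: "L \<in> borel_measurable unit_interval" unfolding L_def by measurable
  have um: "u n \<in> borel_measurable unit_interval" for n unfolding u_def by measurable
  have ui: "integrable unit_interval (u n)" "integral\<^sup>L unit_interval (u n) = 0" for n
  proof -
    have "norm (of_real (s n) * a) < 1" using a s[of n] by (simp add: norm_mult)
    from circle_log_factor_interior(1,3)[OF this, of 0] show "integrable unit_interval (u n)" "integral\<^sup>L unit_interval (u n) = 0"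
      by (simp_all add: u_def s_def)
  qed
  have one: "integral\<^sup>L unit_interval (\<lambda>t. x) = x" for x :: real using measure_unit_interval by simp
  have "(\<integral>\<^sup>+t. ennreal (ln 2 - L t) \<partial>unit_interval) \<le> (\<integral>\<^sup>+t. liminf (\<lambda>n. ennreal (ln 2 - u n t)) \<partial>unit_interval)"
  proof (rule nn_integral_mono_AE)
    show "AE t in unit_interval. ennreal (ln 2 - L t) \<le> liminf (\<lambda>n. ennreal (ln 2 - u n t))" using lim
    proof eventually_elim
      case (elim t)
      have "(\<lambda>n. ennreal (ln 2 - u n t)) \<longlonglongrightarrow> ennreal (ln 2 - L t)" by (intro tendsto_ennrealI tendsto_intros elim)
      then show ?case using lim_imp_Liminf[OF trivial_limit_sequentially] by fastforce
    qed
  qed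
  also have "\<dots> \<le> liminf (\<lambda>n. \<integral>\<^sup>+t. ennreal (ln 2 - u n t) \<partial>unit_interval)" using um by (intro nn_integral_liminf) auto
  also have "(\<lambda>n. \<integral>\<^sup>+t. ennreal (ln 2 - u n t) \<partial>unit_interval) = (\<lambda>n. ennreal (ln 2))"
  proof
    fix n
    have "(\<integral>\<^sup>+t. ennreal (ln 2 - u n t) \<partial>unit_interval) = ennreal (integral\<^sup>L unit_interval (\<lambda>t. ln 2 - u n t))"
      using ui ule by (intro nn_integral_eq_integral) auto
    also have "integral\<^sup>L unit_interval (\<lambda>t. ln 2 - u n t) = ln 2" using ui one[of "ln 2"] by (subst Bochner_Integration.integral_diff) auto
    finally show "(\<integral>\<^sup>+t. ennreal (ln 2 - u n t) \<partial>unit_interval) = ennreal (ln 2)" .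
  qed
  also have "liminf (\<lambda>n::nat. ennreal (ln 2)) < \<infinity>" by (simp add: Liminf_const)
  finally have fin: "(\<integral>\<^sup>+t. ennreal (ln 2 - L t) \<partial>unit_interval) < \<infinity>" .
  have "integrable unit_interval (\<lambda>t. ln 2 - L t)"
  proof (rule integrableI_nonneg)
    show "AE t in unit_interval. 0 \<le> ln 2 - L t" using lim
    proof eventually_elim
      case (elim t)
      show ?case using LIMSEQ_le_const2[OF elim, of "ln 2"] ule by simp
    qed
  qed (use Lm fin in auto)
  then have "integrable unit_interval (\<lambda>t. ln 2 - (ln 2 - L t))" by (rule Bochner_Integration.integrable_diff[OF unit_interval.integrable_const])
  then show "integrable unit_interval L" by simp
qed

lemma circle_log_factor:
  assumes a: "norm a \<le> 1" and z: "norm z < 1"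
  shows "integrable unit_interval (\<lambda>t. ln (norm (1 - cnj a * circ t)))"
    and "exp (integral\<^sup>L unit_interval (\<lambda>t. herglotz (circ t) z * of_real (ln (norm (1 - cnj a * circ t))))) = 1 - cnj a * z"
proof -
  have "integrable unit_interval (\<lambda>t. ln (norm (1 - cnj a * circ t))) \<and>
    exp (integral\<^sup>L unit_interval (\<lambda>t. herglotz (circ t) z * of_real (ln (norm (1 - cnj a * circ t))))) = 1 - cnj a * z"
  proof (cases "norm a < 1")
    case True
    then show ?thesis using circle_log_factor_interior z by blast
  next
    case False
    then have a1: "norm a = 1" using a by simp
    let ?L = "\<lambda>t. ln (norm (1 - cnj a * circ t))"
    let ?b = "\<lambda>n. of_real (real n / real (Suc n)) * a"
    let ?u = "\<lambda>n t. ln (norm (1 - cnj (?b n) * circ t))"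
    note A = circle_log_factor_approx[OF a1]
    define M where "M = (1 + norm z) / (1 - norm z)"
    have M: "0 \<le> M" using z by (simp add: M_def)
    have "(\<lambda>n. integral\<^sup>L unit_interval (\<lambda>t. herglotz (circ t) z * of_real (?u n t))) \<longlonglongrightarrow> integral\<^sup>L unit_interval (\<lambda>t. herglotz (circ t) z * of_real (?L t))"
    proof (rule integral_dominated_convergence[where w = "\<lambda>t. M * (2 * ln 2 + \<bar>?L t\<bar>)"])
      have H: "(\<lambda>t. herglotz (circ t) z) \<in> borel_measurable unit_interval" using measurable_compose[OF circ_measurable_unit_interval herglotz_measurable] .
      show "(\<lambda>t. herglotz (circ t) z * of_real (?L t)) \<in> borel_measurable unit_interval" using H by measurable
      show "(\<lambda>t. herglotz (circ t) z * of_real (?u n t)) \<in> borel_measurable unit_interval" for n using H by measurable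
      show "integrable unit_interval (\<lambda>t. M * (2 * ln 2 + \<bar>?L t\<bar>))"
        using A(1) by (intro integrable_mult_right Bochner_Integration.integrable_add integrable_abs) auto
      show "AE t in unit_interval. (\<lambda>n. herglotz (circ t) z * of_real (?u n t)) \<longlonglongrightarrow> herglotz (circ t) z * of_real (?L t)"
        using A(2) by eventually_elim (rule tendsto_mult[OF tendsto_const tendsto_of_real])
      show "AE t in unit_interval. norm (herglotz (circ t) z * of_real (?u n t)) \<le> M * (2 * ln 2 + \<bar>?L t\<bar>)" for n
        using A(3)
      proof eventually_elim
        case (elim t)
        have "norm (herglotz (circ t) z) \<le> M" unfolding M_def by (rule norm_herglotz_le[OF norm_circ z])
        then show ?case unfolding norm_mult norm_of_real using elim M by (intro mult_mono) auto
      qed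
    qed
    then have "(\<lambda>n. exp (integral\<^sup>L unit_interval (\<lambda>t. herglotz (circ t) z * of_real (?u n t)))) \<longlonglongrightarrow> exp (integral\<^sup>L unit_interval (\<lambda>t. herglotz (circ t) z * of_real (?L t)))"
      by (rule tendsto_exp)
    moreover have "exp (integral\<^sup>L unit_interval (\<lambda>t. herglotz (circ t) z * of_real (?u n t))) = 1 - cnj (?b n) * z" for n
    proof (rule circle_log_factor_interior(2)[OF _ z])
      show "norm (?b n) < 1" unfolding norm_mult norm_of_real a1 by simp
    qed
    moreover have "(\<lambda>n. 1 - cnj (?b n) * z) \<longlonglongrightarrow> 1 - cnj (of_real 1 * a) * z"
      by (intro tendsto_intros LIMSEQ_n_over_Suc_n)
    ultimately have "exp (integral\<^sup>L unit_interval (\<lambda>t. herglotz (circ t) z * of_real (?L t))) = 1 - cnj (of_real 1 * a) * z"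
      using LIMSEQ_unique by (simp only:) blast
    then show ?thesis using A(1) by simp
  qed
  then show "integrable unit_interval (\<lambda>t. ln (norm (1 - cnj a * circ t)))"
    "exp (integral\<^sup>L unit_interval (\<lambda>t. herglotz (circ t) z * of_real (ln (norm (1 - cnj a * circ t))))) = 1 - cnj a * z" by blast+
qed

section \<open>Removal of zeros and Jensen's formula\<close>

lemma divide_out_zeros:
  fixes G :: "complex \<Rightarrow> complex"
  assumes "finite Z" "open S" "G holomorphic_on S" "Z \<subseteq> S" "\<And>a. a \<in> Z \<Longrightarrow> G a = 0"
  shows "\<exists>q. q holomorphic_on S \<and> (\<forall>z\<in>S. G z = (\<Prod>a\<in>Z. z - a) * q z)"
  using assms(1,4,5)
proof (induction Z rule: finite_induct)
  case empty
  show ?case using assms(3) by auto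
next
  case (insert b Z)
  then obtain q where q: "q holomorphic_on S" "\<And>z. z \<in> S \<Longrightarrow> G z = (\<Prod>a\<in>Z. z - a) * q z" by auto
  have "(\<Prod>a\<in>Z. b - a) \<noteq> 0" using insert.hyps by (auto simp: prod_zero_iff)
  then have qb: "q b = 0" using q(2)[of b] insert.prems by auto
  define p where "p w = (if w = b then deriv q b else (q w - q b) / (w - b))" for w
  have "p holomorphic_on S" unfolding p_def using q(1) assms(2) by (rule pole_lemma_open)
  moreover have "G z = (\<Prod>a\<in>insert b Z. z - a) * p z" if "z \<in> S" for z
    using q(2)[OF that] insert.hyps qb by (auto simp: p_def)
  ultimately show ?case by blast
qed

text \<open>A zero inside the disc contributes a Blaschke factor and an outer factor, a zero on the
  circle only an outer factor.\<close>

lemma linear_factor_bfac: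
  assumes "norm a \<le> 1"
  shows "\<exists>c. norm c = 1 \<and> (\<forall>z. norm z < 1 \<longrightarrow> z - a = c * (if norm a < 1 then bfac a z else 1) * (1 - cnj a * z))"
proof (cases "a = 0")
  case True
  then show ?thesis by (intro exI[of _ 1]) (simp add: bfac_def)
next
  case False
  show ?thesis
  proof (cases "norm a < 1")
    case True
    have "z - a = - (a / of_real (norm a)) * bfac a z * (1 - cnj a * z)" if "norm z < 1" for z
    proof -
      have "1 - cnj a * z \<noteq> 0" using norm_one_minus_mult_ge[OF True that] that by auto
      then show ?thesis using False by (simp add: bfac_def)
    qed
    then show ?thesis using True False by (intro exI[of _ "- (a / of_real (norm a))"]) (simp add: norm_divide)
  next
    case F: False
    then have "a * cnj a = 1" using assms by (simp add: complex_norm_square[symmetric])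
    then have "z - a = - a * (1 - cnj a * z)" for z by (simp add: algebra_simps)
    then show ?thesis using F assms by (intro exI[of _ "- a"]) simp
  qed
qed

lemma norm_circ_minus: "norm (circ t - a) = norm (1 - cnj a * circ t)"
proof -
  have c: "cnj (circ t) * circ t = 1" by (simp add: complex_norm_square[symmetric] mult.commute)
  have "norm (1 - cnj a * circ t) = norm (cnj (circ t - a) * circ t)" using c by (simp add: algebra_simps)
  also have "\<dots> = norm (circ t - a)" unfolding norm_mult complex_mod_cnj by simp
  finally show ?thesis by simp
qed

text \<open>After division by the finitely many zeros in the closed disc, the quotient has a
  logarithm on a slightly larger disc, to which Schwarz's formula applies. Simplicity of the zeros
  lets the Blaschke product run over a set instead of a multiset.\<close>

lemma jensen_factorization:
  assumes F: "F holomorphic_on ball 0 R" "R > 1"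
    and simple: "\<And>z. z \<in> ball 0 R \<Longrightarrow> F z = 0 \<Longrightarrow> deriv F z \<noteq> 0"
  shows "finite {z\<in>cball 0 1. F z = 0}" and "integrable unit_interval (\<lambda>t. ln (norm (F (circ t))))"
    and "\<exists>c. norm c = 1 \<and> (\<forall>z. norm z < 1 \<longrightarrow> F z = c * (\<Prod>a\<in>{z\<in>ball 0 1. F z = 0}. bfac a z) *
          exp (integral\<^sup>L unit_interval (\<lambda>t. herglotz (circ t) z * of_real (ln (norm (F (circ t)))))))"
proof -
  let ?Z = "{z\<in>cball 0 1. F z = 0}"
  show fin: "finite ?Z"
  proof (cases "F constant_on ball 0 R")
    case True
    then obtain k where k: "\<And>z. z \<in> ball 0 R \<Longrightarrow> F z = k" by (auto simp: constant_on_def)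
    have "k \<noteq> 0"
    proof
      assume "k = 0"
      have "deriv F 0 = deriv (\<lambda>_. k) 0"
        using F(2) by (intro deriv_cong_ev eventually_nhds_in_open[of "ball 0 R", THEN eventually_mono]) (auto simp: k)
      then show False using simple[of 0] k[of 0] \<open>k = 0\<close> F(2) by simp
    qed
    then have "?Z = {}" using k F(2) by auto
    then show ?thesis by (simp only: finite.emptyI)
  next
    case False
    show ?thesis using F by (intro holomorphic_compact_finite_zeros[OF F(1) _ _ _ _ False]) auto
  qed
  have "\<exists>q. q holomorphic_on ball 0 R \<and> (\<forall>z\<in>ball 0 R. F z = (\<Prod>a\<in>?Z. z - a) * q z)"
    by (rule divide_out_zeros[OF fin open_ball F(1)]) (use F(2) in auto)
  then obtain q where q: "q holomorphic_on ball 0 R" "\<And>z. z \<in> ball 0 R \<Longrightarrow> F z = (\<Prod>a\<in>?Z. z - a) * q z" by blast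
  \<comment> \<open>A zero of \<open>q\<close> in the closed disc would be a multiple zero of
    \<open>F\<close>.\<close>
  have qne: "q z \<noteq> 0" if z: "z \<in> cball 0 1" for z
  proof
    assume q0: "q z = 0"
    have zR: "z \<in> ball 0 R" using z F(2) by simp
    have F0: "F z = 0" using q(2)[OF zR] q0 by simp
    define p where "p w = (\<Prod>a\<in>?Z - {z}. w - a) * q w" for w
    have p: "p holomorphic_on ball 0 R" unfolding p_def by (intro holomorphic_intros q)
    have "F w = (w - z) * p w" if "w \<in> ball 0 R" for w
      unfolding q(2)[OF that] p_def using prod.remove[OF fin, of z "\<lambda>a. w - a"] z F0 by (simp add: mult_ac)
    then have "deriv F z = deriv (\<lambda>w. (w - z) * p w) z"
      using zR by (intro deriv_cong_ev eventually_nhds_in_open[of "ball 0 R", THEN eventually_mono]) auto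
    also have "\<dots> = p z"
    proof (rule DERIV_imp_deriv)
      have "(p has_field_derivative deriv p z) (at z)" by (rule holomorphic_derivI[OF p open_ball zR])
      then show "((\<lambda>w. (w - z) * p w) has_field_derivative p z) (at z)" by (auto intro!: derivative_eq_intros)
    qed
    also have "\<dots> = 0" by (simp add: p_def q0)
    finally show False using simple[OF zR F0] by simp
  qed
  obtain R' where R': "R' > 1" "R' \<le> R" "\<And>z. z \<in> ball 0 R' \<Longrightarrow> q z \<noteq> 0"
  proof -
    have "open (ball 0 R \<inter> q -` (- {0}))" by (rule continuous_open_preimage[OF holomorphic_on_imp_continuous_on[OF q(1)]]) auto
    moreover have "cball 0 1 \<subseteq> ball 0 R \<inter> q -` (- {0})" using qne F(2) by auto
    ultimately obtain e where e: "e > 0" "(\<Union>x\<in>cball 0 1. ball x e) \<subseteq> ball 0 R \<inter> q -` (- {0})"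
      using compact_subset_open_imp_ball_epsilon_subset[of "cball 0 1"] by (metis compact_cball)
    have "q z \<noteq> 0" if z: "norm z < 1 + e" for z
    proof (cases "norm z \<le> 1")
      case True
      then show ?thesis using qne by simp
    next
      case False
      have "dist (z / of_real (norm z)) z = norm z - 1"
      proof -
        have "z / of_real (norm z) - z = (z / of_real (norm z)) * of_real (1 - norm z)" using False by (cases "z = 0") (auto simp: field_simps)
        moreover have "norm (z / of_real (norm z)) = 1" using False by (auto simp: norm_divide)
        ultimately have "norm (z / of_real (norm z) - z) = \<bar>1 - norm z\<bar>" by (simp only: norm_mult norm_of_real mult_1_left)
        then show ?thesis using False by (simp add: dist_norm)
      qed
      then have "z \<in> ball (z / of_real (norm z)) e" using z by simp
      moreover have "z / of_real (norm z) \<in> cball 0 1" using False by (auto simp: norm_divide)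
      ultimately show ?thesis using e(2) by blast
    qed
    then show ?thesis using that[of "min R (1 + e)"] e(1) F(2) by auto
  qed
  obtain Q where Q: "Q holomorphic_on ball 0 R'" "\<And>z. z \<in> ball 0 R' \<Longrightarrow> q z = exp (Q z)"
    using contractible_imp_holomorphic_log[OF holomorphic_on_subset[OF q(1)], of "ball 0 R'"] R' convex_imp_contractible[OF convex_ball]
    by (metis subset_ball)
  define lq where "lq t = Re (Q (circ t))" for t
  define la where "la a t = ln (norm (1 - cnj a * circ t))" for a t
  have lqi: "integrable unit_interval lq" unfolding lq_def
    by (rule integrable_circle_continuous[of "\<lambda>w. Re (Q w)"])
       (use R' in \<open>auto intro!: continuous_intros continuous_on_subset[OF holomorphic_on_imp_continuous_on[OF Q(1)]]\<close>)
  have lai: "integrable unit_interval (la a)" if "a \<in> ?Z" for a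
    unfolding la_def using that by (intro circle_log_factor(1)[of _ 0]) auto
  have ln_eq: "AE t in unit_interval. ln (norm (F (circ t))) = (\<Sum>a\<in>?Z. la a t) + lq t"
    using AE_circ_notin_finite[OF fin]
  proof eventually_elim
    case (elim t)
    have tR: "circ t \<in> ball 0 R" "circ t \<in> ball 0 R'" using F(2) R' by auto
    have "norm (F (circ t)) = (\<Prod>a\<in>?Z. norm (1 - cnj a * circ t)) * exp (Re (Q (circ t)))"
      unfolding q(2)[OF tR(1)] norm_mult prod_norm[symmetric] norm_circ_minus Q(2)[OF tR(2)] by simp
    moreover have pos: "0 < norm (1 - cnj a * circ t)" if "a \<in> ?Z" for a
      using that elim unfolding norm_circ_minus[symmetric] by auto
    ultimately have "ln (norm (F (circ t))) = ln (\<Prod>a\<in>?Z. norm (1 - cnj a * circ t)) + Re (Q (circ t))"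
      by (simp only: ln_mult_pos[OF prod_pos exp_gt_zero] ln_exp)
    also have "ln (\<Prod>a\<in>?Z. norm (1 - cnj a * circ t)) = (\<Sum>a\<in>?Z. la a t)" unfolding la_def by (rule ln_prod[OF fin]) (metis less_irrefl pos)
    finally show ?case by (simp only: lq_def)
  qed
  have Fm: "(\<lambda>t. ln (norm (F (circ t)))) \<in> borel_measurable unit_interval"
  proof -
    have "continuous_on {0..1} (\<lambda>t. F (circ t))"
      by (rule continuous_on_compose2[OF holomorphic_on_imp_continuous_on[OF F(1)]]) (use F(2) in \<open>auto intro!: continuous_intros\<close>)
    then have "(\<lambda>t. F (circ t)) \<in> borel_measurable unit_interval" by (rule continuous_imp_measurable_on_sets_lebesgue) auto
    then show ?thesis by measurable
  qed
  have si: "integrable unit_interval (\<lambda>t. (\<Sum>a\<in>?Z. la a t) + lq t)" using lai lqi by (intro Bochner_Integration.integrable_add Bochner_Integration.integrable_sum) auto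
  show "integrable unit_interval (\<lambda>t. ln (norm (F (circ t))))"
    by (rule integrable_cong_AE_imp[OF si Fm]) (use ln_eq in \<open>auto\<close>)
  have "\<forall>a\<in>?Z. \<exists>c. norm c = 1 \<and> (\<forall>z. norm z < 1 \<longrightarrow> z - a = c * (if norm a < 1 then bfac a z else 1) * (1 - cnj a * z))"
    by (intro ballI linear_factor_bfac) auto
  from bchoice[OF this] obtain k where
    "\<forall>a\<in>?Z. norm (k a) = 1 \<and> (\<forall>z. norm z < 1 \<longrightarrow> z - a = k a * (if norm a < 1 then bfac a z else 1) * (1 - cnj a * z))" by blast
  then have k: "\<And>a. a \<in> ?Z \<Longrightarrow> norm (k a) = 1"
    "\<And>a z. a \<in> ?Z \<Longrightarrow> norm z < 1 \<Longrightarrow> z - a = k a * (if norm a < 1 then bfac a z else 1) * (1 - cnj a * z)" by blast+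
  define c where "c = (\<Prod>a\<in>?Z. k a) * exp (\<i> * of_real (Im (Q 0)))"
  have c1: "norm c = 1" unfolding c_def norm_mult prod_norm[symmetric] using k(1) by simp
  have "F z = c * (\<Prod>a\<in>{z\<in>ball 0 1. F z = 0}. bfac a z) * exp (integral\<^sup>L unit_interval (\<lambda>t. herglotz (circ t) z * of_real (ln (norm (F (circ t))))))"
    if z: "norm z < 1" for z
  proof -
    let ?H = "\<lambda>t. herglotz (circ t) z"
    have zR: "z \<in> ball 0 R" "z \<in> ball 0 R'" using z F(2) R' by auto
    have Hm: "?H \<in> borel_measurable unit_interval" using measurable_compose[OF circ_measurable_unit_interval herglotz_measurable] .
    have iH: "integrable unit_interval (\<lambda>t. ?H t * of_real (u t))" if "integrable unit_interval u" for u
      using integrable_herglotz[OF that circ_measurable_unit_interval _ z] by simp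
    have "integral\<^sup>L unit_interval (\<lambda>t. ?H t * of_real (ln (norm (F (circ t))))) = integral\<^sup>L unit_interval (\<lambda>t. (\<Sum>a\<in>?Z. ?H t * of_real (la a t)) + ?H t * of_real (lq t))"
    proof (rule integral_cong_AE)
      show "AE t in unit_interval. ?H t * of_real (ln (norm (F (circ t)))) = (\<Sum>a\<in>?Z. ?H t * of_real (la a t)) + ?H t * of_real (lq t)"
        using ln_eq by eventually_elim (simp add: distrib_left sum_distrib_left)
      show "(\<lambda>t. ?H t * of_real (ln (norm (F (circ t))))) \<in> borel_measurable unit_interval" using Hm Fm by measurable
      show "(\<lambda>t. (\<Sum>a\<in>?Z. ?H t * of_real (la a t)) + ?H t * of_real (lq t)) \<in> borel_measurable unit_interval"
        using borel_measurable_integrable[OF iH[OF lqi]] borel_measurable_integrable[OF iH[OF lai]]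
        by (intro borel_measurable_add borel_measurable_sum) auto
    qed
    also have "\<dots> = (\<Sum>a\<in>?Z. integral\<^sup>L unit_interval (\<lambda>t. ?H t * of_real (la a t))) + integral\<^sup>L unit_interval (\<lambda>t. ?H t * of_real (lq t))"
      using iH[OF lqi] iH[OF lai] by (subst Bochner_Integration.integral_add) (auto intro!: Bochner_Integration.integral_sum Bochner_Integration.integrable_sum)
    also have "integral\<^sup>L unit_interval (\<lambda>t. ?H t * of_real (lq t)) = Q z - \<i> * of_real (Im (Q 0))"
      unfolding lq_def by (rule schwarz_integral_formula[OF z Q(1) R'(1)])
    finally have I: "integral\<^sup>L unit_interval (\<lambda>t. ?H t * of_real (ln (norm (F (circ t))))) = (\<Sum>a\<in>?Z. integral\<^sup>L unit_interval (\<lambda>t. ?H t * of_real (la a t))) + (Q z - \<i> * of_real (Im (Q 0)))" .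
    have E: "exp (integral\<^sup>L unit_interval (\<lambda>t. ?H t * of_real (ln (norm (F (circ t)))))) * exp (\<i> * of_real (Im (Q 0))) = (\<Prod>a\<in>?Z. 1 - cnj a * z) * q z"
    proof -
      have "exp (integral\<^sup>L unit_interval (\<lambda>t. ?H t * of_real (la a t))) = 1 - cnj a * z" if "a \<in> ?Z" for a
        unfolding la_def using that by (intro circle_log_factor(2) z) auto
      then have S: "exp (\<Sum>a\<in>?Z. integral\<^sup>L unit_interval (\<lambda>t. ?H t * of_real (la a t))) = (\<Prod>a\<in>?Z. 1 - cnj a * z)"
        unfolding exp_sum[OF fin] by (intro prod.cong refl)
      show ?thesis unfolding I exp_add exp_diff S Q(2)[OF zR(2)] by simp
    qed
    have "(\<Prod>a\<in>?Z. if norm a < 1 then bfac a z else 1) = (\<Prod>a\<in>{z\<in>ball 0 1. F z = 0}. bfac a z)"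
      by (rule prod.mono_neutral_cong_right) (use fin in auto)
    moreover have "F z = (\<Prod>a\<in>?Z. k a * (if norm a < 1 then bfac a z else 1) * (1 - cnj a * z)) * q z"
      unfolding q(2)[OF zR(1)] using k(2)[OF _ z] by (intro arg_cong2[where f = "(*)"] prod.cong) auto
    ultimately have "F z = (\<Prod>a\<in>?Z. k a) * (\<Prod>a\<in>{z\<in>ball 0 1. F z = 0}. bfac a z) * ((\<Prod>a\<in>?Z. 1 - cnj a * z) * q z)"
      by (simp only: prod.distrib mult_ac)
    then show ?thesis unfolding E[symmetric] c_def by (simp only: mult_ac)
  qed
  then show "\<exists>c. norm c = 1 \<and> (\<forall>z. norm z < 1 \<longrightarrow> F z = c * (\<Prod>a\<in>{z\<in>ball 0 1. F z = 0}. bfac a z) *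
          exp (integral\<^sup>L unit_interval (\<lambda>t. herglotz (circ t) z * of_real (ln (norm (F (circ t)))))))" using c1 by blast
qed

section \<open>Blaschke-outer factorization\<close>

lemma holomorphic_on_bfac:
  assumes "norm a < 1"
  shows "bfac a holomorphic_on ball 0 1"
proof (cases "a = 0")
  case True
  then show ?thesis by (simp add: bfac_def[abs_def])
next
  case False
  have "(\<lambda>z. (of_real (norm a) / a) * (a - z) / (1 - cnj a * z)) holomorphic_on ball 0 1"
    using norm_one_minus_mult_ge[OF assms] False by (intro holomorphic_intros) fastforce+
  then show ?thesis using False by (simp add: bfac_def[abs_def])
qed

lemma blaschke_partial_products:
  assumes "\<And>k. k \<in> I \<Longrightarrow> norm (a k) < 1" and "summable (\<lambda>k. if k \<in> I then 1 - norm (a k) else 0)" and "norm z < 1"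
  shows "(\<lambda>n. \<Prod>k<n. if k \<in> I then bfac (a k) z else 1) \<longlonglongrightarrow> (\<Prod>k. if k \<in> I then bfac (a k) z else 1)"
  using convergent_prod_LIMSEQ[OF bfac_convergent_prod[OF assms]] by (simp add: LIMSEQ_lessThan_iff_atMost)

lemma blaschke_product_holomorphic:
  assumes a: "\<And>k. k \<in> I \<Longrightarrow> norm (a k) < 1" and s: "summable (\<lambda>k. if k \<in> I then 1 - norm (a k) else 0)"
  shows "(\<lambda>z. \<Prod>k. if k \<in> I then bfac (a k) z else 1) holomorphic_on ball 0 1"
proof -
  define f where "f k z = (if k \<in> I then bfac (a k) z else 1)" for k z
  have fh: "f k holomorphic_on ball 0 1" for k
    using holomorphic_on_bfac[OF a] by (cases "k \<in> I") (auto simp: f_def[abs_def])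
  have "(\<lambda>z. \<Prod>k. f k z) holomorphic_on ball 0 r" if r: "r \<in> {0<..<1}" for r
  proof -
    have sub: "cball 0 r \<subseteq> ball (0::complex) 1" using r by auto
    have "uniformly_convergent_on (cball 0 r) (\<lambda>N x. \<Prod>n<N. f n x)"
    proof (rule uniformly_convergent_on_prod')
      show "continuous_on (cball 0 r) (f n)" for n
        by (rule continuous_on_subset[OF holomorphic_on_imp_continuous_on[OF fh] sub])
      show "uniformly_convergent_on (cball 0 r) (\<lambda>N x. \<Sum>n<N. norm (f n x - 1))"
      proof (rule Weierstrass_m_test')
        show "summable (\<lambda>k. (1 + r) / (1 - r) * (if k \<in> I then 1 - norm (a k) else 0))" by (rule summable_mult[OF s])
        fix k and x :: complex assume x: "x \<in> cball 0 r"
        show "norm (norm (f k x - 1)) \<le> (1 + r) / (1 - r) * (if k \<in> I then 1 - norm (a k) else 0)"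
        proof (cases "k \<in> I")
          case True
          have x1: "norm x < 1" "norm x \<le> r" using x r by auto
          have "norm (bfac (a k) x - 1) \<le> (1 + norm x) / (1 - norm x) * (1 - norm (a k))" by (rule norm_bfac_minus_one_le[OF a[OF True] x1(1)])
          also have "\<dots> \<le> (1 + r) / (1 - r) * (1 - norm (a k))" using a[OF True] x1 r by (intro mult_right_mono frac_le) auto
          finally show ?thesis using True by (simp add: f_def)
        qed (simp add: f_def)
      qed
    qed simp
    then obtain l where l: "uniform_limit (cball 0 r) (\<lambda>N x. \<Prod>n<N. f n x) l sequentially" by (auto simp: uniformly_convergent_on_def)
    have "\<forall>\<^sub>F n in sequentially. continuous_on (cball 0 r) (\<lambda>x. \<Prod>n<n. f n x) \<and> (\<lambda>x. \<Prod>n<n. f n x) holomorphic_on ball 0 r"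
      using fh sub by (intro always_eventually allI conjI continuous_on_prod holomorphic_on_prod
        continuous_on_subset[OF holomorphic_on_imp_continuous_on[OF fh]] holomorphic_on_subset[OF fh]) auto
    then have lh: "l holomorphic_on ball 0 r" using holomorphic_uniform_limit[OF _ l] by (metis trivial_limit_sequentially)
    have "l z = (\<Prod>k. f k z)" if z: "z \<in> ball 0 r" for z
    proof -
      have "(\<lambda>n. \<Prod>k<n. f k z) \<longlonglongrightarrow> l z" using z by (intro tendsto_uniform_limitI[OF l]) auto
      moreover have "(\<lambda>n. \<Prod>k<n. f k z) \<longlonglongrightarrow> (\<Prod>k. f k z)" unfolding f_def using z r by (intro blaschke_partial_products a s) auto
      ultimately show ?thesis by (rule LIMSEQ_unique)
    qed
    then show ?thesis by (rule holomorphic_transform[OF lh])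
  qed
  then have "(\<lambda>z. \<Prod>k. f k z) holomorphic_on (\<Union>r\<in>{0<..<1}. ball 0 r)" by (intro holomorphic_on_UN_open) auto
  moreover have "(\<Union>r\<in>{0<..<1}. ball 0 r) = ball (0::complex) 1"
  proof (intro set_eqI iffI)
    fix x :: complex assume x: "x \<in> ball 0 1"
    then have "(1 + norm x) / 2 \<in> {0<..<1}" "x \<in> ball 0 ((1 + norm x) / 2)" by (auto simp: add_pos_nonneg)
    then show "x \<in> (\<Union>r\<in>{0<..<1}. ball 0 r)" by blast
  qed auto
  ultimately show ?thesis by (simp add: f_def)
qed

lemma herglotz_exp_tendsto:
  assumes u: "\<And>m. integrable unit_interval (u m)" and h: "integrable unit_interval h"
    and lim: "(\<lambda>m. integral\<^sup>L unit_interval (\<lambda>t. \<bar>u m t - h t\<bar>)) \<longlonglongrightarrow> 0" and z: "norm z < 1"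
  shows "(\<lambda>m. exp (integral\<^sup>L unit_interval (\<lambda>t. herglotz (circ t) z * of_real (u m t)))) \<longlonglongrightarrow>
     exp (integral\<^sup>L unit_interval (\<lambda>t. herglotz (circ t) z * of_real (h t)))"
proof (rule tendsto_exp, rule LIM_zero_cancel, rule Lim_null_comparison)
  let ?H = "\<lambda>t. herglotz (circ t) z"
  let ?M = "(1 + norm z) / (1 - norm z)"
  show "\<forall>\<^sub>F m in sequentially. norm (integral\<^sup>L unit_interval (\<lambda>t. ?H t * of_real (u m t)) - integral\<^sup>L unit_interval (\<lambda>t. ?H t * of_real (h t)))
     \<le> ?M * integral\<^sup>L unit_interval (\<lambda>t. \<bar>u m t - h t\<bar>)"
  proof (intro always_eventually allI)
    fix m
    have i: "integrable unit_interval (\<lambda>t. ?H t * of_real (v t))" if "integrable unit_interval v" for v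
      using integrable_herglotz[OF that circ_measurable_unit_interval _ z] by simp
    have "integral\<^sup>L unit_interval (\<lambda>t. ?H t * of_real (u m t)) - integral\<^sup>L unit_interval (\<lambda>t. ?H t * of_real (h t)) =
      integral\<^sup>L unit_interval (\<lambda>t. ?H t * of_real (u m t - h t))"
      using i[OF u] i[OF h] by (subst Bochner_Integration.integral_diff[symmetric]) (auto simp: right_diff_distrib)
    also have "norm \<dots> \<le> integral\<^sup>L unit_interval (\<lambda>t. ?M * \<bar>u m t - h t\<bar>)"
    proof (rule order_trans[OF integral_norm_bound integral_mono])
      show "integrable unit_interval (\<lambda>t. norm (?H t * of_real (u m t - h t)))" using u h by (intro integrable_norm i) auto
      show "integrable unit_interval (\<lambda>t. ?M * \<bar>u m t - h t\<bar>)" using u h by (intro integrable_mult_right integrable_abs) auto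
      show "norm (?H t * of_real (u m t - h t)) \<le> ?M * \<bar>u m t - h t\<bar>" for t
        unfolding norm_mult norm_of_real by (intro mult_right_mono norm_herglotz_le[OF norm_circ z]) auto
    qed
    finally show "norm (integral\<^sup>L unit_interval (\<lambda>t. ?H t * of_real (u m t)) - integral\<^sup>L unit_interval (\<lambda>t. ?H t * of_real (h t)))
     \<le> ?M * integral\<^sup>L unit_interval (\<lambda>t. \<bar>u m t - h t\<bar>)" by simp
  qed
  show "(\<lambda>m. ?M * integral\<^sup>L unit_interval (\<lambda>t. \<bar>u m t - h t\<bar>)) \<longlonglongrightarrow> 0" using tendsto_mult_left[OF lim, of ?M] by simp
qed

section \<open>Functions without singular inner part\<close>

lemma prod_le_prod_subset:
  fixes f :: "'a \<Rightarrow> real"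
  assumes "finite B" "A \<subseteq> B" "\<And>x. x \<in> B \<Longrightarrow> 0 \<le> f x" "\<And>x. x \<in> B \<Longrightarrow> f x \<le> 1"
  shows "prod f B \<le> prod f A"
proof -
  have "prod f B = prod f (B - A) * prod f A" by (rule prod.subset_diff[OF assms(2,1)])
  also have "\<dots> \<le> 1 * prod f A" using assms by (intro mult_right_mono prod_le_1 prod_nonneg) auto
  finally show ?thesis by simp
qed

lemma norm_bfac_0: "norm (bfac a 0) = norm a"
  by (simp add: bfac_def norm_mult norm_divide)

text \<open>Convergence in mean of the logarithms on circles to the boundary function is what
  excludes a singular part. Dividing the Jensen factorizations on the radii \<open>r m\<close> by
  their outer parts exhibits \<open>norm (Phi z)\<close> as a limit of moduli of finite Blaschke
  products. It is dominated by the product \<open>B\<close> over all zeros, with equality at 0, so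
  by the maximum principle \<open>Phi / B\<close> is a unimodular constant.\<close>

lemma blaschke_outer_factorization_nonzero:
  fixes G :: "complex \<Rightarrow> complex" and h :: "complex \<Rightarrow> real"
  assumes G: "G holomorphic_on ball 0 1" and simple: "\<And>z. z \<in> ball 0 1 \<Longrightarrow> G z = 0 \<Longrightarrow> deriv G z \<noteq> 0" and G0: "G 0 \<noteq> 0"
    and r: "\<And>m. 0 < r m" "\<And>m. r m < 1" "r \<longlonglongrightarrow> 1"
    and h: "h \<in> borel_measurable borel" "integrable unit_interval (\<lambda>t. h (circ t))"
    and lim: "(\<lambda>m. integral\<^sup>L unit_interval (\<lambda>t. \<bar>ln (norm (G (of_real (r m) * circ t))) - h (circ t)\<bar>)) \<longlonglongrightarrow> 0"
  shows "\<exists>B Ou. blaschke B \<and> outer Ou \<and> (\<forall>z\<in>ball 0 1. G z = B z * Ou z)"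
proof -
  define Z where "Z = {z\<in>ball 0 1. G z = 0}"
  have Z1: "norm b < 1" "b \<noteq> 0" if "b \<in> Z" for b using that G0 by (auto simp: Z_def)
  define Zm where "Zm m = {b\<in>Z. norm b < r m}" for m
  define u where "u m t = ln (norm (G (of_real (r m) * circ t)))" for m t
  define E where "E m z = exp (integral\<^sup>L unit_interval (\<lambda>t. herglotz (circ t) z * of_real (u m t)))" for m z
  define Ou where "Ou z = exp (integral\<^sup>L unit_interval (\<lambda>t. herglotz (circ t) z * of_real (h (circ t))))" for z
  have jensen: "finite (Zm m)" "integrable unit_interval (u m)"
    "norm z < 1 \<Longrightarrow> norm (G (of_real (r m) * z)) = (\<Prod>b\<in>Zm m. norm (bfac (b / of_real (r m)) z)) * norm (E m z)" for m z
  proof -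
    let ?F = "\<lambda>z. G (of_real (r m) * z)"
    have R: "1 / r m > 1" using r(1,2)[of m] by simp
    have sub: "of_real (r m) * z \<in> ball 0 1" if "z \<in> ball 0 (1 / r m)" for z :: complex
      using that r(1)[of m] by (simp add: norm_mult field_simps)
    have F: "?F holomorphic_on ball 0 (1 / r m)"
      using sub by (intro holomorphic_on_compose_gen[OF _ G, unfolded o_def] holomorphic_intros) auto
    have simpleF: "deriv ?F z \<noteq> 0" if z: "z \<in> ball 0 (1 / r m)" "?F z = 0" for z
    proof -
      have "(G has_field_derivative deriv G (of_real (r m) * z)) (at (of_real (r m) * z))"
        by (rule holomorphic_derivI[OF G open_ball sub[OF z(1)]])
      then have "(?F has_field_derivative deriv G (of_real (r m) * z) * of_real (r m)) (at z)"
        by (rule DERIV_chain2) (auto intro!: derivative_eq_intros)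
      then have "deriv ?F z = deriv G (of_real (r m) * z) * of_real (r m)" by (rule DERIV_imp_deriv)
      then show ?thesis using simple[OF sub[OF z(1)] z(2)] r(1)[of m] by simp
    qed
    note J = jensen_factorization[OF F R simpleF]
    have img: "(\<lambda>b. b / of_real (r m)) ` Zm m = {z\<in>ball 0 1. ?F z = 0}"
    proof (intro set_eqI iffI)
      fix z :: complex assume "z \<in> {z\<in>ball 0 1. ?F z = 0}"
      then have z: "norm z < 1" "?F z = 0" by auto
      have "norm (of_real (r m) * z) < r m" using z(1) r(1)[of m] by (simp add: norm_mult)
      then have "of_real (r m) * z \<in> Zm m" using z(2) r(2)[of m] by (simp add: Zm_def Z_def)
      moreover have "z = of_real (r m) * z / of_real (r m)" using r(1)[of m] by simp
      ultimately show "z \<in> (\<lambda>b. b / of_real (r m)) ` Zm m" by blast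
    qed (use r(1)[of m] in \<open>auto simp: Zm_def Z_def norm_divide\<close>)
    have inj: "inj_on (\<lambda>b. b / of_real (r m)) (Zm m)" using r(1)[of m] by (auto simp: inj_on_def)
    have "finite {z\<in>ball 0 1. ?F z = 0}" by (rule finite_subset[OF _ J(1)]) auto
    then show "finite (Zm m)" using img inj by (metis finite_image_iff)
    show "integrable unit_interval (u m)" unfolding u_def by (rule J(2))
    show "norm (G (of_real (r m) * z)) = (\<Prod>b\<in>Zm m. norm (bfac (b / of_real (r m)) z)) * norm (E m z)" if z: "norm z < 1"
    proof -
      obtain c where c: "norm c = 1" "?F z = c * (\<Prod>a\<in>{z\<in>ball 0 1. ?F z = 0}. bfac a z) * E m z"
        using J(3) z unfolding E_def u_def by blast
      have "(\<Prod>a\<in>{z\<in>ball 0 1. ?F z = 0}. bfac a z) = (\<Prod>b\<in>Zm m. bfac (b / of_real (r m)) z)"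
        unfolding img[symmetric] by (subst prod.reindex[OF inj]) simp
      then show ?thesis using c by (simp add: norm_mult prod_norm)
    qed
  qed
  have hh: "(\<lambda>z. integral\<^sup>L unit_interval (\<lambda>t. herglotz (circ t) z * of_real (h (circ t)))) holomorphic_on ball 0 1"
    by (rule herglotz_transform_holomorphic[OF h(2) circ_measurable_unit_interval]) simp
  define Phi where "Phi z = G z / Ou z" for z
  have Phi: "Phi holomorphic_on ball 0 1" unfolding Phi_def Ou_def using hh by (intro holomorphic_intros G) auto
  have PhiE: "G z = Phi z * Ou z" for z by (simp add: Phi_def Ou_def)
  have Plim: "(\<lambda>m. \<Prod>b\<in>Zm m. norm (bfac (b / of_real (r m)) z)) \<longlonglongrightarrow> norm (Phi z)" if z: "norm z < 1" for z
  proof -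
    have "(\<lambda>m. E m z) \<longlonglongrightarrow> Ou z" unfolding E_def Ou_def using lim unfolding u_def[symmetric]
      by (rule herglotz_exp_tendsto[OF jensen(2) h(2) _ z])
    moreover have "(\<lambda>m. G (of_real (r m) * z)) \<longlonglongrightarrow> G z"
    proof -
      have "isCont G z" using z by (intro holomorphic_on_imp_continuous_on[OF G, THEN continuous_on_interior]) auto
      moreover have "(\<lambda>m. of_real (r m) * z) \<longlonglongrightarrow> of_real 1 * z" by (intro tendsto_intros r)
      ultimately show ?thesis using isCont_tendsto_compose[of z G] by simp
    qed
    ultimately have "(\<lambda>m. norm (G (of_real (r m) * z)) / norm (E m z)) \<longlonglongrightarrow> norm (G z) / norm (Ou z)"
      by (intro tendsto_intros) (auto simp: Ou_def)
    moreover have "norm (G (of_real (r m) * z)) / norm (E m z) = (\<Prod>b\<in>Zm m. norm (bfac (b / of_real (r m)) z))" for m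
      using jensen(3)[OF z, of m] by (simp add: E_def)
    ultimately show ?thesis by (simp add: Phi_def norm_divide)
  qed
  have small: "norm (b / of_real (r m)) < 1" if "b \<in> Zm m" for b m using that r(1)[of m] by (simp add: Zm_def norm_divide)
  have A: "norm (Phi z) \<le> (\<Prod>b\<in>F. norm (bfac b z))" if F: "finite F" "F \<subseteq> Z" and z: "norm z < 1" for F z
  proof (rule LIMSEQ_le[OF Plim[OF z]])
    show "(\<lambda>m. \<Prod>b\<in>F. norm (bfac (b / of_real (r m)) z)) \<longlonglongrightarrow> (\<Prod>b\<in>F. norm (bfac b z))"
    proof (intro tendsto_prod tendsto_norm)
      fix b assume "b \<in> F"
      then have b: "norm b < 1" "b \<noteq> 0" using F Z1 by auto
      have d: "1 - cnj (b / of_real 1) * z \<noteq> 0" using norm_one_minus_mult_ge[OF b(1) z] z by auto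
      have "(\<lambda>m. (of_real (norm (b / of_real (r m))) / (b / of_real (r m))) * (b / of_real (r m) - z) / (1 - cnj (b / of_real (r m)) * z)) \<longlonglongrightarrow>
        (of_real (norm (b / of_real 1)) / (b / of_real 1)) * (b / of_real 1 - z) / (1 - cnj (b / of_real 1) * z)"
        using b d by (intro tendsto_intros r) auto
      moreover have "b / of_real (r m) \<noteq> 0" for m using b r(1)[of m] by simp
      ultimately show "(\<lambda>m. bfac (b / of_real (r m)) z) \<longlonglongrightarrow> bfac b z" using b by (simp add: bfac_def)
    qed
    have "\<forall>\<^sub>F m in sequentially. \<forall>b\<in>F. norm b < r m"
      using F Z1 by (intro eventually_ball_finite ballI order_tendstoD(1)[OF r(3)]) auto
    then have "\<forall>\<^sub>F m in sequentially. (\<Prod>b\<in>Zm m. norm (bfac (b / of_real (r m)) z)) \<le> (\<Prod>b\<in>F. norm (bfac (b / of_real (r m)) z))"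
    proof eventually_elim
      case (elim m)
      show ?case using F elim norm_bfac_le[OF small z] jensen(1) by (intro prod_le_prod_subset) (auto simp: Zm_def)
    qed
    then show "\<exists>N. \<forall>m\<ge>N. (\<Prod>b\<in>Zm m. norm (bfac (b / of_real (r m)) z)) \<le> (\<Prod>b\<in>F. norm (bfac (b / of_real (r m)) z))"
      by (simp add: eventually_sequentially)
  qed
  have beta: "norm (Phi 0) > 0" using G0 by (simp add: Phi_def Ou_def)
  have "Z = (\<Union>m. Zm m)"
  proof (intro set_eqI iffI)
    fix b assume b: "b \<in> Z"
    then have "\<forall>\<^sub>F m in sequentially. norm b < r m" using Z1 by (intro order_tendstoD(1)[OF r(3)])
    then obtain m where "norm b < r m" by (auto simp: eventually_sequentially)
    then show "b \<in> (\<Union>m. Zm m)" using b by (auto simp: Zm_def)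
  qed (auto simp: Zm_def)
  moreover have "countable (\<Union>m. Zm m)" using jensen(1) by (intro countable_UN) (auto intro: countable_finite)
  ultimately have Zc: "countable Z" by simp
  define I where "I = to_nat_on Z ` Z"
  define a where "a = from_nat_into Z"
  have aI: "a k \<in> Z" if "k \<in> I" for k using that Zc by (auto simp: I_def a_def)
  have inj: "inj_on a I" using Zc by (auto simp: inj_on_def I_def a_def)
  define f where "f k z = (if k \<in> I then bfac (a k) z else 1)" for k z
  have partial: "(\<Prod>k<n. norm (f k z)) = (\<Prod>b\<in>a ` (I \<inter> {..<n}). norm (bfac b z))" for n z
  proof -
    have "(\<Prod>b\<in>a ` (I \<inter> {..<n}). norm (bfac b z)) = (\<Prod>k\<in>I \<inter> {..<n}. norm (bfac (a k) z))"
      by (subst prod.reindex) (auto intro: inj_on_subset[OF inj])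
    also have "\<dots> = (\<Prod>k<n. norm (f k z))" by (rule prod.mono_neutral_cong_left) (auto simp: f_def)
    finally show ?thesis by simp
  qed
  have a1: "norm (a k) < 1" if "k \<in> I" for k using Z1 aI[OF that] by blast
  \<comment> \<open>The Blaschke condition follows from \<open>A\<close> at 0: since
    \<open>1 - x \<le> - ln x\<close>, the partial sums are at most
    \<open>- ln (norm (Phi 0))\<close>.\<close>
  have s: "summable (\<lambda>k. if k \<in> I then 1 - norm (a k) else 0)"
  proof (rule summableI_nonneg_bounded)
    show "0 \<le> (if n \<in> I then 1 - norm (a n) else 0)" for n using a1[of n] by auto
    fix n
    let ?F = "a ` (I \<inter> {..<n})"
    have F: "finite ?F" "?F \<subseteq> Z" using aI by auto
    have "norm (Phi 0) \<le> (\<Prod>b\<in>?F. norm b)" using A[OF F, of 0] unfolding norm_bfac_0 by simp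
    then have "ln (norm (Phi 0)) \<le> ln (\<Prod>b\<in>?F. norm b)" using beta by (subst ln_le_cancel_iff) linarith+
    also have "\<dots> = (\<Sum>b\<in>?F. ln (norm b))" using F Z1 by (intro ln_prod) auto
    also have "\<dots> \<le> (\<Sum>b\<in>?F. norm b - 1)" using F Z1 by (intro sum_mono ln_le_minus_one) auto
    finally have "(\<Sum>b\<in>?F. 1 - norm b) \<le> - ln (norm (Phi 0))" by (simp add: sum_subtractf)
    moreover have "(\<Sum>b\<in>?F. 1 - norm b) = (\<Sum>k\<in>I \<inter> {..<n}. 1 - norm (a k))" by (subst sum.reindex) (auto intro: inj_on_subset[OF inj])
    moreover have "\<dots> = (\<Sum>k<n. if k \<in> I then 1 - norm (a k) else 0)" by (rule sum.mono_neutral_cong_left) auto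
    ultimately show "(\<Sum>k<n. if k \<in> I then 1 - norm (a k) else 0) \<le> - ln (norm (Phi 0))" by simp
  qed
  define B where "B z = (\<Prod>k. f k z)" for z
  have Bh: "B holomorphic_on ball 0 1" unfolding B_def f_def by (rule blaschke_product_holomorphic[OF a1 s])
  have Blim: "(\<lambda>n. \<Prod>k<n. norm (f k z)) \<longlonglongrightarrow> norm (B z)" if "norm z < 1" for z
    unfolding prod_norm B_def f_def by (intro tendsto_norm blaschke_partial_products a1 s that)
  have PB: "norm (Phi z) \<le> norm (B z)" if z: "norm z < 1" for z
  proof (rule LIMSEQ_le_const[OF Blim[OF z]], intro exI allI impI)
    fix n show "norm (Phi z) \<le> (\<Prod>k<n. norm (f k z))" unfolding partial using aI by (intro A z) auto
  qed
  \<comment> \<open>The opposite inequality at 0 compares \<open>norm b\<close> with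
    \<open>norm b / r m\<close>: rescaling to a smaller disc only enlarges the factors.\<close>
  have B0: "norm (B 0) \<le> norm (Phi 0)"
  proof (rule LIMSEQ_le_const[OF Plim])
    have "norm (B 0) \<le> (\<Prod>b\<in>Zm m. norm (bfac (b / of_real (r m)) 0))" for m
    proof (rule LIMSEQ_le_const2[OF Blim])
      have "\<forall>\<^sub>F n in sequentially. \<forall>b\<in>Zm m. to_nat_on Z b < n" using jensen(1) by (intro eventually_ball_finite ballI eventually_gt_at_top)
      then have "\<forall>\<^sub>F n in sequentially. (\<Prod>k<n. norm (f k 0)) \<le> (\<Prod>b\<in>Zm m. norm (bfac (b / of_real (r m)) 0))"
      proof eventually_elim
        case (elim n)
        have "Zm m \<subseteq> a ` (I \<inter> {..<n})"
        proof
          fix b assume b: "b \<in> Zm m"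
          then have "b \<in> Z" by (simp add: Zm_def)
          then have "b = a (to_nat_on Z b)" "to_nat_on Z b \<in> I" using Zc by (auto simp: a_def I_def)
          then show "b \<in> a ` (I \<inter> {..<n})" using elim b by blast
        qed
        then have "(\<Prod>k<n. norm (f k 0)) \<le> (\<Prod>b\<in>Zm m. norm b)" unfolding partial norm_bfac_0
          using aI Z1 by (intro prod_le_prod_subset) (auto intro: less_imp_le)
        also have "\<dots> \<le> (\<Prod>b\<in>Zm m. norm (bfac (b / of_real (r m)) 0))"
          unfolding norm_bfac_0 norm_divide using r(1,2)[of m] by (intro prod_mono) (auto simp: divide_simps mult_left_le)
        finally show ?case .
      qed
      then show "\<exists>N. \<forall>n\<ge>N. (\<Prod>k<n. norm (f k 0)) \<le> (\<Prod>b\<in>Zm m. norm (bfac (b / of_real (r m)) 0))" by (simp add: eventually_sequentially)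
    qed simp
    then show "\<exists>N. \<forall>m\<ge>N. norm (B 0) \<le> (\<Prod>b\<in>Zm m. norm (bfac (b / of_real (r m)) 0))" by blast
  qed simp
  have Bne: "B 0 \<noteq> 0" using PB[of 0] beta by auto
  \<comment> \<open>The quotient \<open>Phi / B\<close> is formed only near 0, where
    \<open>B\<close> has no zeros; the resulting identity spreads to the disc by analytic
    continuation.\<close>
  obtain s0 where s0: "s0 > 0" "ball 0 s0 \<subseteq> ball 0 1 \<inter> B -` (- {0})"
  proof -
    have "open (ball 0 1 \<inter> B -` (- {0}))" by (rule continuous_open_preimage[OF holomorphic_on_imp_continuous_on[OF Bh]]) auto
    moreover have "0 \<in> ball 0 1 \<inter> B -` (- {0})" using Bne by simp
    ultimately show ?thesis using that open_contains_ball by blast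
  qed
  have "(\<lambda>z. Phi z / B z) constant_on ball 0 s0"
  proof (rule maximum_modulus_principle[where U = "ball 0 s0" and \<xi> = 0])
    show "(\<lambda>z. Phi z / B z) holomorphic_on ball 0 s0"
      using s0 by (intro holomorphic_intros holomorphic_on_subset[OF Phi] holomorphic_on_subset[OF Bh]) auto
    fix z :: complex assume z: "z \<in> ball 0 s0"
    then have z1: "norm z < 1" "B z \<noteq> 0" using s0 by auto
    have "norm (Phi z / B z) \<le> 1" using PB[OF z1(1)] z1 by (simp add: norm_divide divide_le_eq_1)
    also have "1 \<le> norm (Phi 0 / B 0)" using B0 Bne by (simp add: norm_divide le_divide_eq_1)
    finally show "norm (Phi z / B z) \<le> norm (Phi 0 / B 0)" .
  qed (use s0 in auto)
  then obtain kap where kap: "\<And>z. z \<in> ball 0 s0 \<Longrightarrow> Phi z / B z = kap" by (auto simp: constant_on_def)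
  have "norm kap = norm (Phi 0) / norm (B 0)" using kap[of 0] s0(1) by (metis centre_in_ball norm_divide)
  then have k1: "norm kap = 1" using B0 PB[of 0] Bne by simp
  have eq: "Phi z = kap * B z" if z: "z \<in> ball 0 1" for z
  proof (rule analytic_continuation_open[where s = "ball 0 s0" and s' = "ball 0 1" and f = Phi and g = "\<lambda>z. kap * B z"])
    show "Phi w = kap * B w" if "w \<in> ball 0 s0" for w
    proof -
      have "B w \<noteq> 0" using that s0 by auto
      then show ?thesis using kap[OF that] by (simp add: field_simps)
    qed
  qed (use s0 z Phi Bh in \<open>auto intro!: holomorphic_intros\<close>)
  have "blaschke (\<lambda>z. kap * B z)" unfolding blaschke_def B_def f_def using k1 a1 s by (intro exI[of _ kap] exI[of _ a] exI[of _ I]) auto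
  moreover have "outer Ou" unfolding outer_def
  proof (intro exI[of _ 1] exI[of _ h] conjI ballI)
    show "integrable sigma_T h" using integrable_sigma_T[OF h(1)] h(2) by simp
    fix z
    have "(\<lambda>w. (w + z) / (w - z) * of_real (h w)) \<in> borel_measurable borel" using h(1) by measurable
    from integral_sigma_T[OF this] show "Ou z = 1 * exp (integral\<^sup>L sigma_T (\<lambda>w. (w + z) / (w - z) * of_real (h w)))"
      by (simp add: Ou_def herglotz_def)
  qed simp
  ultimately show ?thesis using PhiE eq by (intro exI[of _ "\<lambda>z. kap * B z"] exI[of _ Ou]) auto
qed

lemma blaschke_times_id:
  assumes "blaschke B"
  shows "blaschke (\<lambda>z. z * B z)"
proof -
  obtain c a I where B: "norm c = 1" "\<And>k. k \<in> I \<Longrightarrow> norm (a k) < 1" "summable (\<lambda>k. if k \<in> I then 1 - norm (a k) else 0)"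
    "\<And>z. z \<in> ball 0 1 \<Longrightarrow> B z = c * (\<Prod>k. if k \<in> I then bfac (a k) z else 1)"
  proof -
    obtain c a I where "norm c = 1" "\<forall>k\<in>I. a k \<in> ball 0 1" "summable (\<lambda>k. if k \<in> I then 1 - norm (a k) else 0)"
      "\<forall>z\<in>ball 0 1. B z = c * (\<Prod>k. if k \<in> I then bfac (a k) z else 1)"
      using assms unfolding blaschke_def by blast
    then show ?thesis by (intro that[of c I a]) auto
  qed
  \<comment> \<open>Indices are shifted by one to make room for the zero at the origin.\<close>
  define a' where "a' k = (if k = 0 then 0 else a (k - 1))" for k
  define I' where "I' = insert 0 (Suc ` I)"
  have I': "0 \<in> I'" "Suc k \<in> I' \<longleftrightarrow> k \<in> I" for k by (auto simp: I'_def)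
  have a'1: "norm (a' k) < 1" if "k \<in> I'" for k using that B(2) by (auto simp: a'_def I'_def)
  have s': "summable (\<lambda>k. if k \<in> I' then 1 - norm (a' k) else 0)"
    by (subst summable_Suc_iff[symmetric]) (use B(3) in \<open>simp add: I' a'_def cong: if_cong\<close>)
  have "z * B z = c * (\<Prod>k. if k \<in> I' then bfac (a' k) z else 1)" if z: "z \<in> ball 0 1" for z
  proof -
    let ?p = "\<Prod>k. if k \<in> I then bfac (a k) z else 1" and ?p' = "\<Prod>k. if k \<in> I' then bfac (a' k) z else 1"
    have z1: "norm z < 1" using z by simp
    have "(\<lambda>n. z * (\<Prod>k<n. if k \<in> I then bfac (a k) z else 1)) \<longlonglongrightarrow> z * ?p"
      by (intro tendsto_intros blaschke_partial_products B z1)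
    moreover have "z * (\<Prod>k<n. if k \<in> I then bfac (a k) z else 1) = (\<Prod>k<Suc n. if k \<in> I' then bfac (a' k) z else 1)" for n
      by (subst prod.lessThan_Suc_shift) (simp add: I' a'_def bfac_def[of 0] cong: if_cong)
    moreover have "(\<lambda>n. \<Prod>k<Suc n. if k \<in> I' then bfac (a' k) z else 1) \<longlonglongrightarrow> ?p'"
      by (rule LIMSEQ_Suc[OF blaschke_partial_products[OF a'1 s' z1]])
    ultimately have "z * ?p = ?p'" using LIMSEQ_unique by (simp only:) blast
    then show ?thesis using B(4)[OF z] by (simp add: mult.left_commute)
  qed
  then show ?thesis unfolding blaschke_def using B(1) a'1 s' by (intro exI[of _ c] exI[of _ a'] exI[of _ I']) auto
qed

text \<open>A zero at the origin is simple and can be divided out. On the circle of radius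
  \<open>r m\<close> this changes the logarithm by the constant \<open>ln (r m)\<close>, which tends
  to 0.\<close>

theorem blaschke_outer_factorization:
  fixes G :: "complex \<Rightarrow> complex" and h :: "complex \<Rightarrow> real"
  assumes G: "G holomorphic_on ball 0 1" and simple: "\<And>z. z \<in> ball 0 1 \<Longrightarrow> G z = 0 \<Longrightarrow> deriv G z \<noteq> 0"
    and r: "\<And>m. 0 < r m" "\<And>m. r m < 1" "r \<longlonglongrightarrow> 1"
    and h: "h \<in> borel_measurable borel" "integrable unit_interval (\<lambda>t. h (circ t))"
    and ui: "\<And>m. integrable unit_interval (\<lambda>t. ln (norm (G (of_real (r m) * circ t))))"
    and lim: "(\<lambda>m. integral\<^sup>L unit_interval (\<lambda>t. \<bar>ln (norm (G (of_real (r m) * circ t))) - h (circ t)\<bar>)) \<longlonglongrightarrow> 0"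
  shows "\<exists>B Ou. blaschke B \<and> outer Ou \<and> (\<forall>z\<in>ball 0 1. G z = B z * Ou z)"
proof (cases "G 0 = 0")
  case False
  then show ?thesis using blaschke_outer_factorization_nonzero[OF G simple _ r h lim] by blast
next
  case True
  define q where "q w = (if w = 0 then deriv G 0 else (G w - G 0) / (w - 0))" for w
  have q: "q holomorphic_on ball 0 1" unfolding q_def using G by (intro pole_lemma_open) auto
  have Gq: "G z = z * q z" for z using True by (simp add: q_def)
  have q0: "q 0 \<noteq> 0" using simple[of 0] True by (simp add: q_def)
  have sq: "deriv q z \<noteq> 0" if z: "z \<in> ball 0 1" "q z = 0" for z
  proof
    assume "deriv q z = 0"
    moreover have "(q has_field_derivative deriv q z) (at z)" by (rule holomorphic_derivI[OF q open_ball z(1)])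
    ultimately have "((\<lambda>w. w * q w) has_field_derivative 0) (at z)" using z(2) by (auto intro!: derivative_eq_intros)
    moreover have "(\<lambda>w. w * q w) = G" using Gq by auto
    ultimately have "deriv G z = 0" using DERIV_imp_deriv by auto
    then show False using simple[OF z(1)] Gq[of z] z(2) by simp
  qed
  have lq: "AE t in unit_interval. ln (norm (q (of_real (r m) * circ t))) = ln (norm (G (of_real (r m) * circ t))) - ln (r m)" for m
  proof -
    have "finite {z\<in>cball 0 (r m). G z = 0}"
    proof (rule holomorphic_compact_finite_zeros[OF G])
      show "\<not> G constant_on ball 0 1"
      proof
        assume "G constant_on ball 0 1"
        then obtain k where k: "\<And>z. z \<in> ball 0 1 \<Longrightarrow> G z = k" by (auto simp: constant_on_def)
        have "deriv G 0 = deriv (\<lambda>_. k) 0"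
          by (intro deriv_cong_ev eventually_nhds_in_open[of "ball 0 1", THEN eventually_mono]) (auto simp: k)
        then show False using simple[of 0] True by simp
      qed
    qed (use r(2)[of m] in auto)
    then have "finite ((\<lambda>z. z / of_real (r m)) ` {z\<in>cball 0 (r m). G z = 0})" by simp
    from AE_circ_notin_finite[OF this] show ?thesis
    proof eventually_elim
      case (elim t)
      have "G (of_real (r m) * circ t) \<noteq> 0"
      proof
        assume "G (of_real (r m) * circ t) = 0"
        then have "of_real (r m) * circ t \<in> {z\<in>cball 0 (r m). G z = 0}" using r(1)[of m] by (simp add: norm_mult)
        moreover have "circ t = of_real (r m) * circ t / of_real (r m)" using r(1)[of m] by simp
        ultimately show False using elim by blast
      qed
      then show ?case using r(1)[of m] unfolding Gq by (simp add: norm_mult ln_mult)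
    qed
  qed
  define w where "w m t = ln (norm (G (of_real (r m) * circ t))) - h (circ t)" for m t
  have wi: "integrable unit_interval (w m)" for m unfolding w_def using ui h(2) by simp
  have qm: "(\<lambda>t. ln (norm (q (of_real (r m) * circ t)))) \<in> borel_measurable unit_interval" for m
  proof -
    have "continuous_on {0..1} (\<lambda>t. q (of_real (r m) * circ t))"
      by (rule continuous_on_compose2[OF holomorphic_on_imp_continuous_on[OF q]]) (use r(1,2)[of m] in \<open>auto intro!: continuous_intros simp: norm_mult\<close>)
    then have "(\<lambda>t. q (of_real (r m) * circ t)) \<in> borel_measurable unit_interval" by (rule continuous_imp_measurable_on_sets_lebesgue) auto
    then show ?thesis by measurable
  qed
  have hm: "(\<lambda>t. h (circ t)) \<in> borel_measurable unit_interval" using h(2) by auto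
  have le: "integral\<^sup>L unit_interval (\<lambda>t. \<bar>ln (norm (q (of_real (r m) * circ t))) - h (circ t)\<bar>) \<le> integral\<^sup>L unit_interval (\<lambda>t. \<bar>w m t\<bar>) + \<bar>ln (r m)\<bar>" for m
  proof -
    have "integral\<^sup>L unit_interval (\<lambda>t. \<bar>ln (norm (q (of_real (r m) * circ t))) - h (circ t)\<bar>) = integral\<^sup>L unit_interval (\<lambda>t. \<bar>w m t - ln (r m)\<bar>)"
          proof (rule integral_cong_AE)
      show "AE t in unit_interval. \<bar>ln (norm (q (of_real (r m) * circ t))) - h (circ t)\<bar> = \<bar>w m t - ln (r m)\<bar>"
        using lq[of m] by (auto simp: w_def algebra_simps)
    qed (use qm hm borel_measurable_integrable[OF wi] in measurable)
    also have "\<dots> \<le> integral\<^sup>L unit_interval (\<lambda>t. \<bar>w m t\<bar> + \<bar>ln (r m)\<bar>)" using wi by (intro integral_mono) auto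
    also have "\<dots> = integral\<^sup>L unit_interval (\<lambda>t. \<bar>w m t\<bar>) + \<bar>ln (r m)\<bar>" using wi measure_unit_interval by (subst Bochner_Integration.integral_add) auto
    finally show ?thesis .
  qed
  have lim': "(\<lambda>m. integral\<^sup>L unit_interval (\<lambda>t. \<bar>ln (norm (q (of_real (r m) * circ t))) - h (circ t)\<bar>)) \<longlonglongrightarrow> 0"
  proof (rule tendsto_sandwich[where f = "\<lambda>_. 0" and h = "\<lambda>m. integral\<^sup>L unit_interval (\<lambda>t. \<bar>w m t\<bar>) + \<bar>ln (r m)\<bar>"])
    have "(\<lambda>m. integral\<^sup>L unit_interval (\<lambda>t. \<bar>w m t\<bar>) + \<bar>ln (r m)\<bar>) \<longlonglongrightarrow> 0 + \<bar>ln 1\<bar>"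
      unfolding w_def by (intro tendsto_intros lim r) auto
    then show "(\<lambda>m. integral\<^sup>L unit_interval (\<lambda>t. \<bar>w m t\<bar>) + \<bar>ln (r m)\<bar>) \<longlonglongrightarrow> 0" by simp
  qed (use le in \<open>auto intro: always_eventually\<close>)
  obtain B Ou where "blaschke B" "outer Ou" "\<And>z. z \<in> ball 0 1 \<Longrightarrow> q z = B z * Ou z"
    using blaschke_outer_factorization_nonzero[OF q sq q0 r h lim'] by blast
  then show ?thesis using blaschke_times_id by (intro exI[of _ "\<lambda>z. z * B z"] exI[of _ Ou]) (auto simp: Gq)
qed

section \<open>Generic shifts\<close>

text \<open>Factoring out the larger of \<open>x\<close> and \<open>y\<close> in modulus leaves
  \<open>norm (1 - cnj a * circ s)\<close> with \<open>norm a \<le> 1\<close>, whose logarithm has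
  mean 0.\<close>

lemma integral_ln_norm_circle:
  assumes xy: "x \<noteq> 0 \<or> y \<noteq> 0"
  shows "integrable unit_interval (\<lambda>s. ln (norm (x + y * circ s)))"
    and "integral\<^sup>L unit_interval (\<lambda>s. ln (norm (x + y * circ s))) = ln (max (norm x) (norm y))"
    and "AE s in unit_interval. x + y * circ s \<noteq> 0"
proof -
  show AE: "AE s in unit_interval. x + y * circ s \<noteq> 0"
  proof (cases "y = 0")
    case False
    have "AE s in unit_interval. circ s \<notin> {- x / y}" by (rule AE_circ_notin_finite) simp
    then show ?thesis
    proof eventually_elim
      case (elim s)
      show ?case
      proof
        assume "x + y * circ s = 0"
        then have "circ s = - x / y" using False by (simp add: field_simps add_eq_0_iff)
        then show False using elim by simp
      qed
    qed
  qed (use xy in simp)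
  have main: "integrable unit_interval (\<lambda>s. ln (norm (x + y * circ s))) \<and> integral\<^sup>L unit_interval (\<lambda>s. ln (norm (x + y * circ s))) = ln (norm b)"
    if a: "norm a \<le> 1" and b: "b \<noteq> 0" and eq: "\<And>s. norm (x + y * circ s) = norm b * norm (1 - cnj a * circ s)" for a b
  proof -
    let ?L = "\<lambda>s. ln (norm (1 - cnj a * circ s))"
    have i: "integrable unit_interval ?L" by (rule circle_log_factor(1)[OF a, of 0]) simp
    have "exp (complex_of_real (integral\<^sup>L unit_interval ?L)) = 1" using circle_log_factor(2)[OF a, of 0] by simp
    then have z: "integral\<^sup>L unit_interval ?L = 0" by (metis exp_of_real exp_eq_one_iff of_real_eq_1_iff)
    have e: "AE s in unit_interval. ln (norm b) + ?L s = ln (norm (x + y * circ s))" using AE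
    proof eventually_elim
      case (elim s)
      then have "norm b * norm (1 - cnj a * circ s) \<noteq> 0" unfolding eq[symmetric] by simp
      then show ?case unfolding eq using b by (simp add: ln_mult)
    qed
    have m: "(\<lambda>s. ln (norm (x + y * circ s))) \<in> borel_measurable unit_interval" by measurable
    have i2: "integrable unit_interval (\<lambda>s. ln (norm b) + ?L s)" using i by simp
    have "integral\<^sup>L unit_interval (\<lambda>s. ln (norm (x + y * circ s))) = integral\<^sup>L unit_interval (\<lambda>s. ln (norm b) + ?L s)"
      by (rule integral_cong_AE) (use e i2 m in auto)
    also have "\<dots> = ln (norm b)" using i z measure_unit_interval by (subst Bochner_Integration.integral_add) auto
    finally show ?thesis using integrable_cong_AE_imp[OF i2 m] e by auto
  qed
  have "integrable unit_interval (\<lambda>s. ln (norm (x + y * circ s))) \<and> integral\<^sup>L unit_interval (\<lambda>s. ln (norm (x + y * circ s))) = ln (max (norm x) (norm y))"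
  proof (cases "norm y \<le> norm x")
    case True
    then have x: "x \<noteq> 0" using xy by auto
    have e: "norm (x + y * circ s) = norm x * norm (1 - cnj (cnj (- y / x)) * circ s)" for s
    proof -
      have "x + y * circ s = x * (1 - cnj (cnj (- y / x)) * circ s)" using x by (simp add: field_simps)
      then show ?thesis by (metis norm_mult)
    qed
    have n: "norm (cnj (- y / x)) \<le> 1" using True x by (simp add: norm_divide divide_le_eq_1)
    show ?thesis unfolding max_absorb1[OF True] by (rule main[OF n x e])
  next
    case False
    then have y: "y \<noteq> 0" by auto
    have e: "norm (x + y * circ s) = norm y * norm (1 - cnj (- x / y) * circ s)" for s
    proof -
      have "x + y * circ s = y * (circ s - (- x / y))" using y by (simp add: field_simps)
      then show ?thesis by (metis norm_mult norm_circ_minus)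
    qed
    have n: "norm (- x / y) \<le> 1" using False y by (simp add: norm_divide divide_le_eq_1)
    have "norm x \<le> norm y" using False by simp
    show ?thesis unfolding max_absorb2[OF \<open>norm x \<le> norm y\<close>] by (rule main[OF n y e])
  qed
  then show "integrable unit_interval (\<lambda>s. ln (norm (x + y * circ s)))"
    "integral\<^sup>L unit_interval (\<lambda>s. ln (norm (x + y * circ s))) = ln (max (norm x) (norm y))" by auto
qed

interpretation unit_square: pair_sigma_finite unit_interval unit_interval
  by (intro pair_sigma_finite.intro finite_measure.axioms(1) finite_measure_unit_interval)

text \<open>The constant \<open>C\<close> makes the integrand nonnegative, so Tonelli's theorem
  computes its norm in mean over the square by integrating over \<open>s\<close> first. What remains
  is the bounded function \<open>ln (max (norm (x t)) (norm (y t)))\<close>.\<close>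

lemma ln_circle_shift_product:
  assumes x [measurable]: "x \<in> borel_measurable unit_interval" and y [measurable]: "y \<in> borel_measurable unit_interval"
    and bd: "\<And>t. norm (x t) \<le> M" "\<And>t. norm (y t) \<le> M" and low: "\<And>t. d \<le> norm (y t)" "0 < d"
    and C: "C \<ge> ln (2 * M)" "C \<ge> 0"
  shows "(\<lambda>(t, s). C - ln (norm (x t + y t * circ s))) \<in> borel_measurable (unit_interval \<Otimes>\<^sub>M unit_interval)"
    and "(\<integral>\<^sup>+ p. ennreal (norm ((\<lambda>(t, s). C - ln (norm (x t + y t * circ s))) p)) \<partial>(unit_interval \<Otimes>\<^sub>M unit_interval))
        = ennreal (C - integral\<^sup>L unit_interval (\<lambda>t. ln (max (norm (x t)) (norm (y t)))))"
    and "integrable (unit_interval \<Otimes>\<^sub>M unit_interval) (\<lambda>(t, s). C - ln (norm (x t + y t * circ s)))"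
    and "integrable unit_interval (\<lambda>t. ln (max (norm (x t)) (norm (y t))))"
proof -
  let ?f = "\<lambda>(t, s). C - ln (norm (x t + y t * circ s))"
  let ?m = "\<lambda>t. ln (max (norm (x t)) (norm (y t)))"
  show meas: "?f \<in> borel_measurable (unit_interval \<Otimes>\<^sub>M unit_interval)" by measurable
  have M: "0 < M" using low bd(2)[of 0] by (meson less_le_trans)
  have mb: "\<bar>?m t\<bar> \<le> \<bar>ln d\<bar> + \<bar>ln M\<bar>" for t
  proof -
    have "d \<le> max (norm (x t)) (norm (y t))" "max (norm (x t)) (norm (y t)) \<le> M" using low bd by (auto simp: le_max_iff_disj)
    then have "ln d \<le> ?m t" "?m t \<le> ln M" using low(2) M by (auto intro!: ln_mono)
    then show ?thesis by linarith
  qed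
  show mi: "integrable unit_interval ?m"
  proof (rule unit_interval.integrable_const_bound[of _ "\<bar>ln d\<bar> + \<bar>ln M\<bar>"])
    show "?m \<in> borel_measurable unit_interval" by measurable
  qed (use mb in auto)
  \<comment> \<open>Where the argument vanishes, \<open>ln 0 = 0\<close> by convention; there the
    inequality is \<open>C \<ge> 0\<close>.\<close>
  have nonneg: "0 \<le> C - ln (norm (x t + y t * circ s))" for t s
  proof (cases "x t + y t * circ s = 0")
    case False
    have "norm (x t + y t * circ s) \<le> 2 * M" using norm_triangle_ineq[of "x t" "y t * circ s"] bd(1)[of t] bd(2)[of t] by (simp add: norm_mult)
    then have "ln (norm (x t + y t * circ s)) \<le> ln (2 * M)" using False by (intro ln_mono) auto
    then show ?thesis using C by simp
  qed (use C in simp)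
  have y0: "y t \<noteq> 0" for t using low(1)[of t] low(2) by auto
  have inner: "(\<integral>\<^sup>+ s. ennreal (norm (?f (t, s))) \<partial>unit_interval) = ennreal (C - ?m t)" for t
  proof -
    have i: "integrable unit_interval (\<lambda>s. ln (norm (x t + y t * circ s)))" using y0 by (intro integral_ln_norm_circle) auto
    have "(\<integral>\<^sup>+ s. ennreal (norm (?f (t, s))) \<partial>unit_interval) = (\<integral>\<^sup>+ s. ennreal (C - ln (norm (x t + y t * circ s))) \<partial>unit_interval)"
      using nonneg by simp
    also have "\<dots> = ennreal (integral\<^sup>L unit_interval (\<lambda>s. C - ln (norm (x t + y t * circ s))))"
      using i nonneg by (intro nn_integral_eq_integral) auto
    also have "integral\<^sup>L unit_interval (\<lambda>s. C - ln (norm (x t + y t * circ s))) = C - ?m t"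
      using i integral_ln_norm_circle(2)[of "x t" "y t"] y0 measure_unit_interval by (subst Bochner_Integration.integral_diff) auto
    finally show ?thesis .
  qed
  have mC: "?m t \<le> C" for t
  proof -
    have "max (norm (x t)) (norm (y t)) \<le> 2 * M" using bd(1)[of t] bd(2)[of t] M by auto
    then have "?m t \<le> ln (2 * M)" using y0 by (intro ln_mono) (auto simp: less_max_iff_disj)
    then show ?thesis using C by simp
  qed
  have "(\<integral>\<^sup>+ p. ennreal (norm (?f p)) \<partial>(unit_interval \<Otimes>\<^sub>M unit_interval)) = (\<integral>\<^sup>+ t. \<integral>\<^sup>+ s. ennreal (norm (?f (t, s))) \<partial>unit_interval \<partial>unit_interval)"
    using meas by (intro unit_interval.nn_integral_fst[symmetric]) measurable
  also have "\<dots> = (\<integral>\<^sup>+ t. ennreal (C - ?m t) \<partial>unit_interval)" unfolding inner ..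
  also have "\<dots> = ennreal (integral\<^sup>L unit_interval (\<lambda>t. C - ?m t))" using mi mC by (intro nn_integral_eq_integral) auto
  also have "integral\<^sup>L unit_interval (\<lambda>t. C - ?m t) = C - integral\<^sup>L unit_interval ?m"
    using mi measure_unit_interval by (subst Bochner_Integration.integral_diff) auto
  finally show nn: "(\<integral>\<^sup>+ p. ennreal (norm (?f p)) \<partial>(unit_interval \<Otimes>\<^sub>M unit_interval)) = ennreal (C - integral\<^sup>L unit_interval ?m)" .
  show "integrable (unit_interval \<Otimes>\<^sub>M unit_interval) ?f"
    by (rule integrableI_bounded[OF meas]) (simp only: nn, simp)
qed

text \<open>A multiple zero at \<open>z\<close> forces \<open>c = - deriv G z\<close> and
  \<open>W z = 0\<close> for \<open>W z = z * deriv G z - G z\<close>. A nonconstant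
  \<open>W\<close> has countably many zeros, a nonzero constant has none, and if \<open>W\<close>
  vanishes identically then \<open>deriv G\<close> is constant and leaves at most one
  \<open>c\<close>.\<close>

lemma countable_critical_shifts:
  assumes G: "G holomorphic_on ball 0 1"
  shows "countable {c. \<exists>z\<in>ball 0 1. G z + c * z = 0 \<and> deriv (\<lambda>z. G z + c * z) z = 0}"
proof -
  have D: "deriv G holomorphic_on ball 0 1" using G by (intro holomorphic_deriv) auto
  have d: "deriv (\<lambda>z. G z + c * z) z = deriv G z + c" if "z \<in> ball 0 1" for c z
  proof (rule DERIV_imp_deriv)
    have "(G has_field_derivative deriv G z) (at z)" by (rule holomorphic_derivI[OF G open_ball that])
    then show "((\<lambda>z. G z + c * z) has_field_derivative deriv G z + c) (at z)" by (auto intro!: derivative_eq_intros)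
  qed
  define W where "W z = z * deriv G z - G z" for z
  have W: "W holomorphic_on ball 0 1" unfolding W_def by (intro holomorphic_intros D G)
  have crit: "W z = 0 \<and> c = - deriv G z" if "z \<in> ball 0 1" "G z + c * z = 0" "deriv (\<lambda>z. G z + c * z) z = 0" for c z
  proof -
    have c: "c = - deriv G z" using d[OF that(1), of c] that(3) by (simp add: eq_neg_iff_add_eq_0 add.commute)
    then show ?thesis using that(2) by (simp add: W_def algebra_simps)
  qed
  show ?thesis
  proof (cases "W constant_on ball 0 1")
    case False
    have C1: "countable (\<Union>n::nat. {z\<in>cball 0 (real n / real (Suc n)). W z = 0})"
    proof (rule countable_UN)
      show "countable {z\<in>cball 0 (real n / real (Suc n)). W z = 0}" for n
      proof (rule countable_finite, rule holomorphic_compact_finite_zeros[OF W _ _ _ _ False])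
        have "real n / real (Suc n) < 1" by simp
        then show "cball 0 (real n / real (Suc n)) \<subseteq> ball (0::complex) 1" by (subst cball_subset_ball_iff) simp
      qed auto
    qed auto
    have C2: "{z\<in>ball 0 1. W z = 0} \<subseteq> (\<Union>n::nat. {z\<in>cball 0 (real n / real (Suc n)). W z = 0})"
    proof
      fix z assume z: "z \<in> {z\<in>ball 0 1. W z = 0}"
      then have "\<forall>\<^sub>F n in sequentially. norm z < real n / real (Suc n)" by (intro order_tendstoD(1)[OF LIMSEQ_n_over_Suc_n]) simp
      then obtain n where "norm z < real n / real (Suc n)" by (auto simp: eventually_sequentially)
      then have "z \<in> {z\<in>cball 0 (real n / real (Suc n)). W z = 0}" using z by simp
      then show "z \<in> (\<Union>n::nat. {z\<in>cball 0 (real n / real (Suc n)). W z = 0})" by blast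
    qed
    have "countable ((\<lambda>z. - deriv G z) ` {z\<in>ball 0 1. W z = 0})" by (rule countable_image[OF countable_subset[OF C2 C1]])
    then show ?thesis
    proof (rule countable_subset[rotated], intro subsetI)
      fix c assume "c \<in> {c. \<exists>z\<in>ball 0 1. G z + c * z = 0 \<and> deriv (\<lambda>z. G z + c * z) z = 0}"
      then obtain z where z: "z \<in> ball 0 1" "G z + c * z = 0" "deriv (\<lambda>z. G z + c * z) z = 0" by blast
      show "c \<in> (\<lambda>z. - deriv G z) ` {z\<in>ball 0 1. W z = 0}" using crit[OF z] z(1) by blast
    qed
  next
    case True
    then obtain k where k: "\<And>z. z \<in> ball 0 1 \<Longrightarrow> W z = k" by (auto simp: constant_on_def)
    show ?thesis
    proof (cases "k = 0")
      case False
      then have "{c. \<exists>z\<in>ball 0 1. G z + c * z = 0 \<and> deriv (\<lambda>z. G z + c * z) z = 0} = {}" using crit k by blast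
      then show ?thesis by (simp only: countable_empty)
    next
      case k0: True
      have DD: "deriv (deriv G) holomorphic_on ball 0 1" by (rule holomorphic_deriv[OF D open_ball])
      \<comment> \<open>Differentiating \<open>W = 0\<close> gives
        \<open>z * deriv (deriv G) z = 0\<close>; the origin is recovered by continuation.\<close>
      have 0: "deriv (deriv G) z = 0" if z: "z \<in> ball 0 1 - {0}" for z
      proof -
        have z1: "z \<in> ball 0 1" using z by simp
        have "(deriv G has_field_derivative deriv (deriv G) z) (at z)" "(G has_field_derivative deriv G z) (at z)"
          by (rule holomorphic_derivI[OF _ open_ball z1], rule D G)+
        then have "(W has_field_derivative z * deriv (deriv G) z) (at z)" unfolding W_def by (auto intro!: derivative_eq_intros)
        then have "deriv W z = z * deriv (deriv G) z" by (rule DERIV_imp_deriv)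
        moreover have "deriv W z = deriv (\<lambda>_. 0) z"
          using z1 k k0 by (intro deriv_cong_ev eventually_nhds_in_open[of "ball 0 1", THEN eventually_mono]) auto
        ultimately show ?thesis using z by simp
      qed
      have 1: "deriv (deriv G) z = 0" if "z \<in> ball 0 1" for z
      proof (rule analytic_continuation_open[where s = "ball 0 1 - {0}" and s' = "ball 0 1" and f = "deriv (deriv G)" and g = "\<lambda>_. 0"])
        have "(1/2 :: complex) \<in> ball 0 1 - {0}" by (simp add: norm_divide)
        then show "ball 0 1 - {0 :: complex} \<noteq> {}" by blast
      qed (use 0 DD that in \<open>auto intro: open_delete\<close>)
      have "(deriv G has_field_derivative 0) (at z within ball 0 1)" if "z \<in> ball 0 1" for z
        using holomorphic_derivI[OF D open_ball that] 1[OF that] by (simp add: has_field_derivative_at_within)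
      then obtain c0 where c0: "\<And>z. z \<in> ball 0 1 \<Longrightarrow> deriv G z = c0" using has_field_derivative_zero_constant[OF convex_ball] by metis
      have "{c. \<exists>z\<in>ball 0 1. G z + c * z = 0 \<and> deriv (\<lambda>z. G z + c * z) z = 0} \<subseteq> {- c0}" using crit c0 by auto
      then show ?thesis by (rule countable_subset) simp
    qed
  qed
qed

text \<open>Frostman's argument: the mean over s of \<^term>\<open>ln (norm (x + y * circ s))\<close> is \<^term>\<open>ln (max (norm x) (norm y))\<close>, which is a bounded
  continuous function of \<^term>\<open>x\<close> for fixed \<^term>\<open>y \<noteq> 0\<close>. Scheffe's lemma on the product space therefore gives convergence in mean
  of the logarithms to their boundary values for almost every shift.\<close>

theorem frostman_shift:
  assumes G: "G holomorphic_on ball 0 1" and bd: "\<And>z. z \<in> ball 0 1 \<Longrightarrow> norm (G z) \<le> M0" and rho: "rho > 0"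
    and radial: "AE t in unit_interval. \<exists>x. (G \<longlongrightarrow> x) (at (circ t) within ball 0 1)"
  shows "\<exists>s B Ou. blaschke B \<and> outer Ou \<and> (\<forall>z\<in>ball 0 1. G z + of_real rho * circ s * z = B z * Ou z)"
proof -
  define r where "r m = real (Suc m) / real (Suc (Suc m))" for m
  have r: "0 < r m" "r m < 1" "1 / 2 \<le> r m" for m by (auto simp: r_def field_simps)
  have rlim: "r \<longlonglongrightarrow> 1" unfolding r_def using LIMSEQ_Suc[OF LIMSEQ_n_over_Suc_n] by simp
  \<comment> \<open>The indicator extends the dilated function to a Borel function on the plane,
    because \<open>outer\<close> asks for a boundary function integrable with respect to
    \<open>sigma_T\<close>, whose sigma-algebra is the Borel one.\<close>
  define g where "g m w = indicator (sphere 0 1) w *\<^sub>R G (of_real (r m) * w)" for m and w :: complex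
  have gm [measurable]: "g m \<in> borel_measurable borel" for m unfolding g_def
  proof (rule borel_measurable_continuous_on_indicator)
    show "continuous_on (sphere 0 1) (\<lambda>w. G (of_real (r m) * w))"
      by (rule continuous_on_compose2[OF holomorphic_on_imp_continuous_on[OF G]]) (use r[of m] in \<open>auto intro!: continuous_intros simp: norm_mult\<close>)
  qed simp
  \<comment> \<open>Where the radial limit fails to exist, \<open>lim\<close> may take any value;
    the test on the norm keeps \<open>gl\<close> bounded everywhere.\<close>
  define gl where "gl w = (if norm (lim (\<lambda>m. g m w)) \<le> M0 then lim (\<lambda>m. g m w) else 0)" for w
  have glm [measurable]: "gl \<in> borel_measurable borel" unfolding gl_def by measurable
  have gc: "g m (circ t) = G (of_real (r m) * circ t)" for m t by (simp add: g_def)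
  have inb: "of_real (r m) * circ t \<in> ball 0 1" for m t using r[of m] by (simp add: norm_mult)
  have M0: "0 \<le> M0" using order_trans[OF norm_ge_zero bd[of 0]] by simp
  have gb: "norm (g m (circ t)) \<le> M0" for m t unfolding gc by (rule bd[OF inb])
  have glb: "norm (gl w) \<le> M0" for w using M0 by (simp add: gl_def)
  have glim: "AE t in unit_interval. (\<lambda>m. g m (circ t)) \<longlonglongrightarrow> gl (circ t)" using radial
  proof eventually_elim
    case (elim t)
    then obtain x where x: "(G \<longlongrightarrow> x) (at (circ t) within ball 0 1)" by blast
    have "(\<lambda>m. of_real (r m) * circ t) \<longlonglongrightarrow> of_real 1 * circ t" by (intro tendsto_intros rlim)
    moreover have "of_real (r m) * circ t \<noteq> circ t" for m using r(2)[of m] by simp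
    ultimately have "filterlim (\<lambda>m. of_real (r m) * circ t) (at (circ t) within ball 0 1) sequentially"
      unfolding filterlim_at using inb by (intro conjI always_eventually allI) auto
    from filterlim_compose[OF x this] have l: "(\<lambda>m. g m (circ t)) \<longlonglongrightarrow> x" by (simp only: gc)
    have "norm x \<le> M0" by (rule LIMSEQ_le_const2[OF tendsto_norm[OF l]]) (use gb in auto)
    then show ?case using l limI[OF l] by (simp add: gl_def)
  qed
  \<comment> \<open>The shift \<open>rho * circ s * z\<close> at \<open>z = r m * circ t\<close>,
    without the factor \<open>circ s\<close>. Its modulus is at least \<open>rho / 2\<close>, which
    keeps the maximum under the logarithm away from 0.\<close>
  define y where "y m t = of_real (rho * r m) * circ t" for m t
  define yl where "yl t = of_real rho * circ t" for t
  define M where "M = M0 + rho"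
  have M: "0 < M" using M0 rho by (simp add: M_def)
  define C where "C = max 0 (ln (2 * M))"
  have C: "C \<ge> ln (2 * M)" "C \<ge> 0" by (auto simp: C_def)
  have nys: "norm (y m t) = rho * r m" "norm (yl t) = rho" for m t unfolding y_def yl_def norm_mult norm_of_real using rho r(1)[of m] by auto
  have yb: "norm (y m t) \<le> M" "norm (yl t) \<le> M" "rho / 2 \<le> norm (y m t)" "rho / 2 \<le> norm (yl t)" for m t
  proof -
    have "rho * r m \<le> rho * 1" "rho * (1 / 2) \<le> rho * r m" using rho r[of m] by (intro mult_left_mono; simp)+
    then show "norm (y m t) \<le> M" "norm (yl t) \<le> M" "rho / 2 \<le> norm (y m t)" "rho / 2 \<le> norm (yl t)"
      unfolding nys M_def using rho M0 by linarith+
  qed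
  have cm: "(\<lambda>t. g m (circ t)) \<in> borel_measurable unit_interval" "(\<lambda>t. gl (circ t)) \<in> borel_measurable unit_interval"
    "y m \<in> borel_measurable unit_interval" "yl \<in> borel_measurable unit_interval" for m
    unfolding y_def yl_def by measurable
  have xb: "norm (g m (circ t)) \<le> M" "norm (gl (circ t)) \<le> M" for m t using gb[of m t] glb[of "circ t"] rho by (auto simp: M_def)
  have rho2: "0 < rho / 2" using rho by simp
  define u where "u m t s = C - ln (norm (g m (circ t) + y m t * circ s))" for m t s
  define ul where "ul t s = C - ln (norm (gl (circ t) + yl t * circ s))" for t s
  let ?P = "unit_interval \<Otimes>\<^sub>M unit_interval"
  have Pm: "case_prod (u m) \<in> borel_measurable ?P"
    "(\<integral>\<^sup>+ p. ennreal (norm (case_prod (u m) p)) \<partial>?P) = ennreal (C - integral\<^sup>L unit_interval (\<lambda>t. ln (max (norm (g m (circ t))) (norm (y m t)))))"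
    "integrable ?P (case_prod (u m))" "integrable unit_interval (\<lambda>t. ln (max (norm (g m (circ t))) (norm (y m t))))" for m
    unfolding u_def[abs_def] by (rule ln_circle_shift_product[OF cm(1)[of m] cm(3)[of m] xb(1)[of m] yb(1)[of m] yb(3)[of m] rho2 C])+
  have Pl: "case_prod ul \<in> borel_measurable ?P"
    "(\<integral>\<^sup>+ p. ennreal (norm (case_prod ul p)) \<partial>?P) = ennreal (C - integral\<^sup>L unit_interval (\<lambda>t. ln (max (norm (gl (circ t))) (norm (yl t)))))"
    "integrable ?P (case_prod ul)" "integrable unit_interval (\<lambda>t. ln (max (norm (gl (circ t))) (norm (yl t))))"
    unfolding ul_def[abs_def] by (rule ln_circle_shift_product[OF cm(2) cm(4) xb(2) yb(2) yb(4) rho2 C])+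
  have ml: "(\<lambda>m. integral\<^sup>L unit_interval (\<lambda>t. ln (max (norm (g m (circ t))) (norm (y m t))))) \<longlonglongrightarrow> integral\<^sup>L unit_interval (\<lambda>t. ln (max (norm (gl (circ t))) (norm (yl t))))"
  proof (rule integral_dominated_convergence[where w = "\<lambda>_. \<bar>ln (rho / 2)\<bar> + \<bar>ln M\<bar>"])
    show "AE t in unit_interval. (\<lambda>m. ln (max (norm (g m (circ t))) (norm (y m t)))) \<longlonglongrightarrow> ln (max (norm (gl (circ t))) (norm (yl t)))"
      using glim
    proof eventually_elim
      case (elim t)
      have "(\<lambda>m. y m t) \<longlonglongrightarrow> of_real (rho * 1) * circ t" unfolding y_def by (intro tendsto_intros rlim)
      then have "(\<lambda>m. y m t) \<longlonglongrightarrow> yl t" by (simp add: yl_def)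
      then show ?case using elim yb(4)[of t] rho2 by (intro tendsto_ln tendsto_max tendsto_norm) (auto simp: max_def split: if_splits)
    qed
    show "AE t in unit_interval. norm (ln (max (norm (g m (circ t))) (norm (y m t)))) \<le> \<bar>ln (rho / 2)\<bar> + \<bar>ln M\<bar>" for m
    proof (rule AE_I2)
      fix t
      have "rho / 2 \<le> max (norm (g m (circ t))) (norm (y m t))" "max (norm (g m (circ t))) (norm (y m t)) \<le> M" using yb xb by (auto simp: le_max_iff_disj)
      then have "ln (rho / 2) \<le> ln (max (norm (g m (circ t))) (norm (y m t)))" "ln (max (norm (g m (circ t))) (norm (y m t))) \<le> ln M"
        using rho2 M by (auto intro!: ln_mono)
      then show "norm (ln (max (norm (g m (circ t))) (norm (y m t)))) \<le> \<bar>ln (rho / 2)\<bar> + \<bar>ln M\<bar>" unfolding real_norm_def by linarith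
    qed
  qed (use Pm(4) Pl(4) in auto)
  define U where "U m = case_prod (u m)" for m
  define Ul where "Ul = case_prod ul"
  have Um [measurable]: "U m \<in> borel_measurable ?P" and Ulm [measurable]: "Ul \<in> borel_measurable ?P" for m
    using Pm(1) Pl(1) by (auto simp: U_def Ul_def)
  have AEp: "AE p in ?P. (\<lambda>m. U m p) \<longlonglongrightarrow> Ul p"
  proof (rule unit_square.AE_pair_measure)
    \<comment> \<open>Convergence is rewritten through \<open>Cauchy\<close> and \<open>lim\<close>,
      for which measurability of the set is available.\<close>
    have eq: "X \<longlonglongrightarrow> L \<longleftrightarrow> Cauchy X \<and> lim X = L" for X :: "nat \<Rightarrow> real" and L
      by (metis Cauchy_convergent_iff convergent_LIMSEQ_iff convergentI limI)
    show "{p \<in> space ?P. (\<lambda>m. U m p) \<longlonglongrightarrow> Ul p} \<in> sets ?P" unfolding eq by measurable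
    show "AE t in unit_interval. AE s in unit_interval. (\<lambda>m. U m (t, s)) \<longlonglongrightarrow> Ul (t, s)" using glim
    proof eventually_elim
      case (elim t)
      have "(\<lambda>m. y m t) \<longlonglongrightarrow> of_real (rho * 1) * circ t" unfolding y_def by (intro tendsto_intros rlim)
      then have yl: "(\<lambda>m. y m t) \<longlonglongrightarrow> yl t" by (simp add: yl_def)
      have "yl t \<noteq> 0" using rho by (simp add: yl_def)
      then have "AE s in unit_interval. gl (circ t) + yl t * circ s \<noteq> 0" by (intro integral_ln_norm_circle(3)) simp
      then show ?case
      proof eventually_elim
        case (elim s)
        then show ?case unfolding U_def Ul_def u_def ul_def prod.case
          by (intro tendsto_diff tendsto_const tendsto_ln tendsto_norm tendsto_add tendsto_mult yl \<open>(\<lambda>m. g m (circ t)) \<longlonglongrightarrow> gl (circ t)\<close>) simp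
      qed
    qed
  qed
  have Ui: "integrable ?P (U m)" "integrable ?P Ul" for m using Pm(3) Pl(3) by (auto simp: U_def Ul_def)
  have "(\<lambda>m. \<integral>\<^sup>+ p. ennreal (norm (U m p - Ul p)) \<partial>?P) \<longlonglongrightarrow> 0"
  proof (rule Scheffe_lemma1[OF Ui AEp])
    have "(\<lambda>m. ennreal (C - integral\<^sup>L unit_interval (\<lambda>t. ln (max (norm (g m (circ t))) (norm (y m t)))))) \<longlonglongrightarrow>
        ennreal (C - integral\<^sup>L unit_interval (\<lambda>t. ln (max (norm (gl (circ t))) (norm (yl t)))))"
      by (intro tendsto_ennrealI tendsto_intros ml)
    then have "(\<lambda>m. \<integral>\<^sup>+ p. ennreal (norm (U m p)) \<partial>?P) \<longlonglongrightarrow> (\<integral>\<^sup>+ p. ennreal (norm (Ul p)) \<partial>?P)"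
      using Pm(2) Pl(2) by (simp only: U_def Ul_def)
    from lim_imp_Limsup[OF trivial_limit_sequentially this]
    show "limsup (\<lambda>m. \<integral>\<^sup>+ p. ennreal (norm (U m p)) \<partial>?P) \<le> (\<integral>\<^sup>+ p. ennreal (norm (Ul p)) \<partial>?P)" by simp
  qed
  moreover have di: "integrable ?P (\<lambda>p. \<bar>U m p - Ul p\<bar>)" for m using Ui by (intro integrable_abs Bochner_Integration.integrable_diff)
  ultimately have "(\<lambda>m. ennreal (integral\<^sup>L ?P (\<lambda>p. \<bar>U m p - Ul p\<bar>))) \<longlonglongrightarrow> ennreal 0"
    by (simp add: nn_integral_eq_integral)
  then have L1: "(\<lambda>m. integral\<^sup>L ?P (\<lambda>p. \<bar>U m p - Ul p\<bar>)) \<longlonglongrightarrow> 0"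
    by (subst (asm) tendsto_ennreal_iff) auto
  define D where "D m s = integral\<^sup>L unit_interval (\<lambda>t. \<bar>u m t s - ul t s\<bar>)" for m s
  have cp: "(\<lambda>p. \<bar>U m p - Ul p\<bar>) = case_prod (\<lambda>t s. \<bar>u m t s - ul t s\<bar>)" for m by (auto simp: U_def Ul_def)
  have Di: "integrable unit_interval (D m)" for m unfolding D_def
    by (rule unit_square.integrable_snd[OF di[unfolded cp]])
  have DI: "integral\<^sup>L unit_interval (D m) = integral\<^sup>L ?P (\<lambda>p. \<bar>U m p - Ul p\<bar>)" for m unfolding D_def cp
    by (rule unit_square.integral_snd[OF di[unfolded cp]])
  have D0: "0 \<le> D m s" for m s by (simp add: D_def)
  have "(\<lambda>m. integral\<^sup>L unit_interval (\<lambda>s. norm (D m s))) \<longlonglongrightarrow> 0" using L1 D0 by (simp add: DI[symmetric])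
  \<comment> \<open>Convergence in mean over \<open>s\<close> yields almost everywhere convergence
    along a subsequence \<open>k\<close>, which suffices since the factorization needs a single
    sequence of radii.\<close>
  from tendsto_L1_AE_subseq[OF Di this] obtain k where k: "strict_mono k" "AE s in unit_interval. (\<lambda>n. D (k n) s) \<longlonglongrightarrow> 0" by blast
  have "AE s in unit_interval. integrable unit_interval (\<lambda>t. u m t s)" for m
    by (rule unit_square.AE_integrable_snd[OF Ui(1)[unfolded U_def]])
  then have a1: "AE s in unit_interval. \<forall>m. integrable unit_interval (\<lambda>t. u m t s)" by (simp add: AE_all_countable)
  have a2: "AE s in unit_interval. integrable unit_interval (\<lambda>t. ul t s)"
    by (rule unit_square.AE_integrable_snd[OF Ui(2)[unfolded Ul_def]])
  let ?bad = "{c. \<exists>z\<in>ball 0 1. G z + c * z = 0 \<and> deriv (\<lambda>z. G z + c * z) z = 0}"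
  have "countable ((\<lambda>c. c / of_real rho) ` ?bad)" using countable_critical_shifts[OF G] by (rule countable_image)
  then have a3: "AE s in unit_interval. circ s \<notin> (\<lambda>c. c / of_real rho) ` ?bad" by (rule AE_circ_notin_countable)
  have ne: "ae_filter unit_interval \<noteq> bot" unfolding ae_filter_eq_bot_iff by (simp add: emeasure_restrict_space)
  have "AE s in unit_interval. (\<lambda>n. D (k n) s) \<longlonglongrightarrow> 0 \<and> (\<forall>m. integrable unit_interval (\<lambda>t. u m t s)) \<and> integrable unit_interval (\<lambda>t. ul t s) \<and>
     circ s \<notin> (\<lambda>c. c / of_real rho) ` ?bad" using k(2) a1 a2 a3 by eventually_elim blast
  from eventually_happens[OF this] ne obtain s where s: "(\<lambda>n. D (k n) s) \<longlonglongrightarrow> 0" "\<And>m. integrable unit_interval (\<lambda>t. u m t s)"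
    "integrable unit_interval (\<lambda>t. ul t s)" "circ s \<notin> (\<lambda>c. c / of_real rho) ` ?bad" by blast
  define H where "H z = G z + of_real rho * circ s * z" for z
  define h where "h w = ln (norm (gl w + of_real rho * circ s * w))" for w
  have Hh: "H holomorphic_on ball 0 1" unfolding H_def by (intro holomorphic_intros G)
  have simple: "deriv H z \<noteq> 0" if "z \<in> ball 0 1" "H z = 0" for z
  proof
    assume "deriv H z = 0"
    then have "of_real rho * circ s \<in> ?bad" using that unfolding H_def by blast
    moreover have "circ s = of_real rho * circ s / of_real rho" using rho by simp
    ultimately show False using s(4) by blast
  qed
  have hm: "h \<in> borel_measurable borel" unfolding h_def by measurable
  have Hu: "ln (norm (H (of_real (r m) * circ t))) = C - u m t s" for m t
    by (simp add: u_def H_def gc y_def mult_ac)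
  have hu: "h (circ t) = C - ul t s" for t by (simp add: ul_def h_def yl_def mult_ac)
  have "\<exists>B Ou. blaschke B \<and> outer Ou \<and> (\<forall>z\<in>ball 0 1. H z = B z * Ou z)"
  proof (rule blaschke_outer_factorization[where r = "\<lambda>n. r (k n)", OF Hh simple _ _ _ hm])
    show "(\<lambda>n. r (k n)) \<longlonglongrightarrow> 1" using LIMSEQ_subseq_LIMSEQ[OF rlim k(1)] by (simp add: o_def)
    show "integrable unit_interval (\<lambda>t. h (circ t))" unfolding hu using s(3) by simp
    show "integrable unit_interval (\<lambda>t. ln (norm (H (of_real (r (k m)) * circ t))))" for m unfolding Hu using s(2) by simp
    have "\<bar>C - u m t s - (C - ul t s)\<bar> = \<bar>u m t s - ul t s\<bar>" for m t by simp
    then show "(\<lambda>m. integral\<^sup>L unit_interval (\<lambda>t. \<bar>ln (norm (H (of_real (r (k m)) * circ t))) - h (circ t)\<bar>)) \<longlonglongrightarrow> 0"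
      unfolding Hu hu using s(1) by (simp add: D_def)
  qed (use r in auto)
  then show ?thesis unfolding H_def by blast
qed

section \<open>Construction of Nevanlinna discs\<close>

lemma outer_mult_exp:
  assumes "outer Ou" and h: "integrable sigma_T h"
  shows "outer (\<lambda>z. Ou z * exp (integral\<^sup>L sigma_T (\<lambda>w. (w + z) / (w - z) * of_real (h w))))"
proof -
  obtain c k where k: "norm c = 1" "integrable sigma_T k"
    "\<And>z. z \<in> ball 0 1 \<Longrightarrow> Ou z = c * exp (integral\<^sup>L sigma_T (\<lambda>w. (w + z) / (w - z) * of_real (k w)))"
    using assms(1) unfolding outer_def by blast
  have AE1: "AE w in sigma_T. norm w = 1" by (rule AE_sigma_T_irrational) simp
  have idm: "(\<lambda>w. w) \<in> borel_measurable sigma_T" by (simp add: sigma_T_eq)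
  have i: "integrable sigma_T (\<lambda>w. (w + z) / (w - z) * of_real (v w))" if "integrable sigma_T v" "z \<in> ball 0 1" for v z
    using integrable_herglotz[OF that(1) idm AE1, of z] that(2) by (simp add: herglotz_def)
  show ?thesis unfolding outer_def
  proof (intro exI[of _ c] exI[of _ "\<lambda>w. k w + h w"] conjI ballI)
    fix z :: complex assume z: "z \<in> ball 0 1"
    have "integral\<^sup>L sigma_T (\<lambda>w. (w + z) / (w - z) * of_real (k w + h w)) =
      integral\<^sup>L sigma_T (\<lambda>w. (w + z) / (w - z) * of_real (k w)) + integral\<^sup>L sigma_T (\<lambda>w. (w + z) / (w - z) * of_real (h w))"
      unfolding of_real_add distrib_left by (rule Bochner_Integration.integral_add[OF i[OF k(2) z] i[OF h z]])
    then show "Ou z * exp (integral\<^sup>L sigma_T (\<lambda>w. (w + z) / (w - z) * of_real (h w))) =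
      c * exp (integral\<^sup>L sigma_T (\<lambda>w. (w + z) / (w - z) * of_real (k w + h w)))"
      by (simp only: exp_add k(3)[OF z] mult.assoc)
  qed (use k h in auto)
qed

lemma null_measure_circle:
  "circle_measure (null_measure borel)" "singular_to_sigma (null_measure borel)" "measure (null_measure borel) A = 0"
  "integral\<^sup>L (null_measure borel) (f :: complex \<Rightarrow> complex) = 0"
proof -
  show "circle_measure (null_measure borel)" by (auto simp: circle_measure_def intro!: finite_measureI)
  show "singular_to_sigma (null_measure borel)" unfolding singular_to_sigma_def by (intro bexI[of _ "{}"]) auto
  show "measure (null_measure borel) A = 0" by (simp add: measure_def)
  have "AE w in null_measure borel. f w = 0" by (rule AE_I[where N = UNIV]) auto
  then show "integral\<^sup>L (null_measure borel) f = 0" by (rule integral_eq_zero_AE)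
qed

lemma norm_vec_le_sum: "norm (v :: complex^'n) \<le> (\<Sum>i\<in>UNIV. norm (v $ i))"
  unfolding norm_vec_def by (rule L2_set_le_sum) simp

lemma cell_approx:
  assumes "N > 0" "t \<in> {0..1}"
  shows "0 \<le> t - real (nat \<lfloor>real N * t\<rfloor>) / real N" "t - real (nat \<lfloor>real N * t\<rfloor>) / real N < 1 / real N"
    "real (nat \<lfloor>real N * t\<rfloor>) / real N \<in> {0..1}"
proof -
  have i: "real (nat \<lfloor>real N * t\<rfloor>) = real_of_int \<lfloor>real N * t\<rfloor>" using assms by simp
  have b: "real_of_int \<lfloor>real N * t\<rfloor> \<le> real N * t" "real N * t < real_of_int \<lfloor>real N * t\<rfloor> + 1" by linarith+
  have eq: "t - real_of_int \<lfloor>real N * t\<rfloor> / real N = (real N * t - real_of_int \<lfloor>real N * t\<rfloor>) / real N" using assms(1) by (simp add: diff_divide_distrib)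
  show 1: "0 \<le> t - real (nat \<lfloor>real N * t\<rfloor>) / real N" unfolding i eq using b by (intro divide_nonneg_nonneg) auto
  show "t - real (nat \<lfloor>real N * t\<rfloor>) / real N < 1 / real N" unfolding i eq using b assms(1) by (intro divide_strict_right_mono) linarith+
  have "0 \<le> real (nat \<lfloor>real N * t\<rfloor>) / real N" by simp
  then show "real (nat \<lfloor>real N * t\<rfloor>) / real N \<in> {0..1}" using 1 assms(2) unfolding atLeastAtMost_iff by linarith
qed

text \<open>All components share the multiplier \<open>exp Xi\<close>, so every component that is
  not identically zero receives the same singular measure \<open>mu\<close>. Its mass is the
  integral of the step function \<open>c\<close>, at most \<open>2 * C2\<close> times the mean
  distance of \<open>f\<close> from \<open>K\<close>.\<close>

theorem poly_hull_nevanlinna_disc: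
  fixes K :: "(complex^'n) set"
  assumes K: "compact K" and a: "a \<in> poly_hull K" and U: "open U" "K \<subseteq> U" and eps: "eps > 0"
  shows "\<exists>f. nevanlinna_disc f \<and> f 0 = a \<and> (AE w in sigma_T. \<exists>L\<in>U. nt_limit f w L) \<and>
     (\<forall>j. \<exists>mp mn. is_singular_measure (\<lambda>z. f z $ j) mp mn \<and> (\<forall>A\<in>sets borel. signed_val mp mn A \<ge> 0) \<and> signed_val mp mn (sphere 0 1) < eps)"
proof -
  obtain k0 where k0: "k0 \<in> K" using a poly_hull_empty by (metis empty_iff equals0I)
  then have Kne: "K \<noteq> {}" by auto
  obtain d where d: "d > 0" "\<And>x. infdist x K < d \<Longrightarrow> x \<in> U"
  proof -
    obtain e where e: "e > 0" "(\<Union>x\<in>K. ball x e) \<subseteq> U" using compact_subset_open_imp_ball_epsilon_subset[OF K U] by blast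
    have "x \<in> U" if "infdist x K < e" for x
    proof -
      obtain k where "k \<in> K" "infdist x K = dist x k" using infdist_attains_inf[OF compact_imp_closed[OF K] Kne] by blast
      then have "x \<in> ball k e" using that by (simp add: dist_commute)
      then show ?thesis using e(2) \<open>k \<in> K\<close> by blast
    qed
    then show ?thesis using that e(1) by blast
  qed
  obtain D0 where D0: "\<And>k. k \<in> K \<Longrightarrow> dist k k0 \<le> D0" using compact_imp_bounded[OF K] by (metis bounded_any_center dist_commute)
  have D0n: "0 \<le> D0" using D0[OF k0] by simp
  define dl0 where "dl0 = d / 4"
  have dl0: "dl0 > 0" using d by (simp add: dl0_def)
  \<comment> \<open>Chosen so that \<open>C2 * x\<close> dominates \<open>x / d + D0 / d + 1\<close>
    for \<open>x \<ge> dl0\<close>; then the factor \<open>exp (- C2 * x)\<close> brings a point at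
    distance at most \<open>x + D0 + d\<close> from \<open>k0\<close> to within \<open>d\<close> of
    it.\<close>
  define C2 where "C2 = 1 / d + (D0 / d + 1) / dl0"
  have C2: "C2 > 0" using d dl0 D0n by (simp add: C2_def add_pos_nonneg)
  have C2': "x / d + D0 / d + 1 \<le> C2 * x" if "dl0 \<le> x" for x
  proof -
    define Y where "Y = (D0 / d + 1) * (x / dl0)"
    have "(D0 / d + 1) * 1 \<le> Y" unfolding Y_def using that dl0 D0n d by (intro mult_left_mono) auto
    moreover have "C2 * x = x / d + Y" by (simp add: C2_def Y_def distrib_right)
    ultimately show ?thesis by (simp add: add.assoc)
  qed
  obtain f where f: "poly_disc f" "f 0 = a" "integral {0..1} (\<lambda>t. infdist (f (cis (2 * pi * t))) K) < eps / (2 * C2)"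
    using poly_hull_small_disc[OF K a, of "eps / (2 * C2)"] eps C2 by auto
  obtain q where q: "\<And>j z. f z $ j = poly (q j) z" using f(1) unfolding poly_disc_def by metis
  have fc: "continuous_on S (\<lambda>t. f (circ t))" for S
    by (rule continuous_on_compose2[OF continuous_on_poly_disc[OF f(1), of UNIV]]) (auto intro!: continuous_intros)
  define dist_K where "dist_K t = infdist (f (circ t)) K" for t
  have dc: "continuous_on S dist_K" for S unfolding dist_K_def by (intro continuous_on_infdist fc)
  have small: "integral\<^sup>L unit_interval dist_K < eps / (2 * C2)" and dint: "integrable unit_interval dist_K"
  proof -
    show i: "integrable unit_interval dist_K" by (rule continuous_imp_integrable_real[OF dc])
    show "integral\<^sup>L unit_interval dist_K < eps / (2 * C2)" using f(3) lebesgue_integral_eq_integral[OF i] by (simp add: dist_K_def[abs_def] circ_def)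
  qed
  have dK0: "0 \<le> dist_K t" for t by (simp add: dist_K_def infdist_nonneg)
  obtain eta where eta: "eta > 0" "\<And>s t. s \<in> {0..1} \<Longrightarrow> t \<in> {0..1} \<Longrightarrow> dist t s < eta \<Longrightarrow> dist (dist_K t) (dist_K s) < dl0 / 4"
    using compact_uniformly_continuous[OF dc[of "{0..1}"] compact_Icc] dl0 unfolding uniformly_continuous_on_def
    by (metis divide_pos_pos zero_less_numeral)
  obtain N :: nat where N: "N > 0" "1 / real N < eta"
    using reals_Archimedean[OF eta(1)] by (metis inverse_eq_divide zero_less_Suc)
  \<comment> \<open>The weight of a cell is read off at its left endpoint. It is 0 where the sampled
    distance is below \<open>dl0\<close>; elsewhere the oscillation bound \<open>dl0 / 4\<close>
    ensures that \<open>dist_K\<close> is at least half the sampled value throughout the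
    cell.\<close>
  define g where "g i = (if dl0 \<le> dist_K (real i / real N) then C2 * dist_K (real i / real N) else 0)" for i
  have g0: "0 \<le> g i" for i using C2 dl0 dK0 by (simp add: g_def)
  define c where "c t = g (nat \<lfloor>real N * t\<rfloor>)" for t
  have osc: "\<bar>dist_K t - dist_K (real (nat \<lfloor>real N * t\<rfloor>) / real N)\<bar> < dl0 / 4" if t: "t \<in> {0..1}" for t
    using eta(2)[OF cell_approx(3)[OF N(1) t] t] cell_approx(1,2)[OF N(1) t] N(2) by (simp add: dist_real_def)
  have c_le: "c t \<le> 2 * C2 * dist_K t" if t: "t \<in> {0..1}" for t
  proof (cases "dl0 \<le> dist_K (real (nat \<lfloor>real N * t\<rfloor>) / real N)")
    case True
    then have "dist_K (real (nat \<lfloor>real N * t\<rfloor>) / real N) \<le> 2 * dist_K t" using osc[OF t] by linarith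
    then have "C2 * dist_K (real (nat \<lfloor>real N * t\<rfloor>) / real N) \<le> C2 * (2 * dist_K t)" using C2 by (intro mult_left_mono) auto
    then show ?thesis using True by (simp add: c_def g_def)
  qed (use C2 dK0 in \<open>simp add: c_def g_def\<close>)
  \<comment> \<open>The shifts of all components together move a boundary point by at most
    \<open>d / 4\<close>.\<close>
  define rho where "rho = d / (4 * real CARD('n))"
  have rho: "rho > 0" "real CARD('n) * rho = d / 4" using d by (auto simp: rho_def)
  obtain Mf where Mf: "\<And>z. z \<in> cball 0 1 \<Longrightarrow> norm (f z) \<le> Mf"
    using compact_imp_bounded[OF compact_continuous_image[OF continuous_on_poly_disc[OF f(1)] compact_cball]] unfolding bounded_iff by blast
  define M1 where "M1 = \<bar>Mf\<bar> + d + norm k0 + 1"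
  have M1: "M1 > 0" using d by (simp add: M1_def add_pos_nonneg)
  obtain dl where dl: "dl > 0" "\<And>x::complex. norm x \<le> dl \<Longrightarrow> norm (exp x - 1) \<le> d / (4 * M1)"
  proof -
    have "isCont exp (0::complex)" by simp
    moreover have "d / (4 * M1) > 0" using d M1 by simp
    ultimately obtain e where e: "e > 0" "\<And>x::complex. dist x 0 < e \<Longrightarrow> dist (exp x) (exp 0) < d / (4 * M1)"
      unfolding continuous_at_eps_delta by blast
    show ?thesis
    proof (rule that[of "e / 2"])
      fix x :: complex assume "norm x \<le> e / 2"
      then have "dist x 0 < e" using e(1) by simp
      from e(2)[OF this] show "norm (exp x - 1) \<le> d / (4 * M1)" by (simp add: dist_norm)
    qed (use e(1) in simp)
  qed
  obtain mu h Xi Cx where S: "circle_measure mu" "singular_to_sigma mu" "measure mu (sphere 0 1) = integral\<^sup>L unit_interval c"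
    "integrable sigma_T h"
    "\<And>z. z \<in> ball 0 1 \<Longrightarrow> Xi z = integral\<^sup>L mu (\<lambda>w. (w + z) / (w - z)) + integral\<^sup>L sigma_T (\<lambda>w. (w + z) / (w - z) * of_real (h w))"
    "Xi holomorphic_on ball 0 1" "Xi 0 = 0" "\<And>z. z \<in> ball 0 1 \<Longrightarrow> - Cx \<le> Re (Xi z)"
    "\<And>t. t \<in> {0<..<1} \<Longrightarrow> t \<notin> \<rat> \<Longrightarrow> \<exists>x. (Xi \<longlongrightarrow> x) (at (circ t) within ball 0 1) \<and> Re x = - c t \<and> (c t = 0 \<longrightarrow> norm x \<le> dl)"
    using singular_multiplier[of N g dl, OF N(1) g0 dl(1)] unfolding c_def by blast
  have mass: "measure mu (sphere 0 1) < eps"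
  proof -
    have cm: "c \<in> borel_measurable unit_interval" unfolding c_def by (intro measurable_unit_interval) measurable
    have i2: "integrable unit_interval (\<lambda>t. 2 * C2 * dist_K t)" using dint by simp
    have "integrable unit_interval c"
      by (rule Bochner_Integration.integrable_bound[OF i2 cm]) (use c_le g0 C2 dK0 in \<open>auto simp: c_def abs_mult\<close>)
    then have "integral\<^sup>L unit_interval c \<le> integral\<^sup>L unit_interval (\<lambda>t. 2 * C2 * dist_K t)" using c_le i2 by (intro integral_mono) auto
    also have "\<dots> = 2 * C2 * integral\<^sup>L unit_interval dist_K" by simp
    also have "\<dots> < 2 * C2 * (eps / (2 * C2))" using small C2 by (intro mult_strict_left_mono) auto
    also have "\<dots> = eps" using C2 by simp
    finally show ?thesis by (simp add: S(3))
  qed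
  \<comment> \<open>The constant \<open>k0 $ j\<close> is written as
    \<open>k0 $ j * exp (- Xi z)\<close> times \<open>exp (Xi z)\<close>; \<open>G j\<close> stays
    bounded because \<open>Re (Xi z)\<close> is bounded below.\<close>
  define G where "G j z = f z $ j - k0 $ j + k0 $ j * exp (- Xi z)" for j z
  have Gh: "G j holomorphic_on ball 0 1" for j unfolding G_def q using S(6) by (intro holomorphic_intros) auto
  have expb: "norm (exp (- Xi z)) \<le> exp Cx" if "z \<in> ball 0 1" for z using S(8)[OF that] by simp
  have Gb: "norm (G j z) \<le> Mf + norm (k0 $ j) + norm (k0 $ j) * exp Cx" if z: "z \<in> ball 0 1" for j z
  proof -
    have "norm (f z $ j) \<le> Mf" using Mf[of z] z Finite_Cartesian_Product.norm_nth_le[of "f z" j] by auto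
    moreover have "norm (k0 $ j * exp (- Xi z)) \<le> norm (k0 $ j) * exp Cx" unfolding norm_mult using expb[OF z] by (intro mult_left_mono) auto
    ultimately show ?thesis unfolding G_def
      using norm_triangle_ineq[of "f z $ j - k0 $ j" "k0 $ j * exp (- Xi z)"] norm_triangle_ineq4[of "f z $ j" "k0 $ j"] by linarith
  qed
  have ft: "((\<lambda>z. f z $ j) \<longlongrightarrow> f (circ t) $ j) (at (circ t) within ball 0 1)" for j t
    unfolding q by (intro tendsto_intros)
  have radial: "AE t in unit_interval. \<exists>x. (G j \<longlongrightarrow> x) (at (circ t) within ball 0 1)" for j
    using AE_unit_interval_irrational
  proof eventually_elim
    case (elim t)
    then obtain x where "(Xi \<longlongrightarrow> x) (at (circ t) within ball 0 1)" using S(9) by blast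
    then have "(G j \<longlongrightarrow> f (circ t) $ j - k0 $ j + k0 $ j * exp (- x)) (at (circ t) within ball 0 1)"
      unfolding G_def by (intro tendsto_intros ft)
    then show ?case by blast
  qed
  have "\<forall>j. \<exists>s B Ou. blaschke B \<and> outer Ou \<and> (\<forall>z\<in>ball 0 1. G j z + of_real rho * circ s * z = B z * Ou z)"
    by (intro allI frostman_shift[OF Gh Gb rho(1) radial])
  then obtain s B Ou where F: "\<And>j. blaschke (B j)" "\<And>j. outer (Ou j)"
    "\<And>j z. z \<in> ball 0 1 \<Longrightarrow> G j z + of_real rho * circ (s j) * z = B j z * Ou j z" by metis
  define fn where "fn z = (\<chi> j. k0 $ j + (f z $ j + of_real rho * circ (s j) * z - k0 $ j) * exp (Xi z))" for z
  have fn_eq: "fn z $ j = (G j z + of_real rho * circ (s j) * z) * exp (Xi z)" for z j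
    by (simp add: fn_def G_def algebra_simps exp_minus)
  have Fh: "(\<lambda>z. G j z + of_real rho * circ (s j) * z) holomorphic_on ball 0 1" for j by (intro holomorphic_intros Gh)
  have nev: "nevanlinna_disc fn" unfolding nevanlinna_disc_def
  proof
    fix j
    show "nevanlinna (\<lambda>z. fn z $ j)" unfolding nevanlinna_def
    proof (intro conjI exI ballI)
      show "(\<lambda>z. fn z $ j) holomorphic_on ball 0 1" unfolding fn_eq by (intro holomorphic_intros Fh S(6))
      show "(\<lambda>z. G j z + of_real rho * circ (s j) * z) holomorphic_on ball 0 1" by (rule Fh)
      show "(\<lambda>z. exp (- Xi z)) holomorphic_on ball 0 1" by (intro holomorphic_intros S(6))
      show "bounded ((\<lambda>z. exp (- Xi z)) ` ball 0 1)" unfolding bounded_iff using expb by blast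
      have "norm (G j z + of_real rho * circ (s j) * z) \<le> Mf + norm (k0 $ j) + norm (k0 $ j) * exp Cx + rho" if z: "z \<in> ball 0 1" for z
      proof -
        have "norm (of_real rho * circ (s j) * z) \<le> rho" using z rho(1) by (simp add: norm_mult mult_left_le)
        then show ?thesis using Gb[OF z, of j] norm_triangle_ineq[of "G j z" "of_real rho * circ (s j) * z"] by linarith
      qed
      then show "bounded ((\<lambda>z. G j z + of_real rho * circ (s j) * z) ` ball 0 1)" unfolding bounded_iff by blast
      fix z
      show "exp (- Xi z) \<noteq> 0" by simp
      show "fn z $ j = (G j z + of_real rho * circ (s j) * z) / exp (- Xi z)" unfolding fn_eq by (simp add: exp_minus field_simps)
    qed
  qed
  have fn0: "fn 0 = a" using f(2) S(7) by (simp add: fn_def vec_eq_iff)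
  have bdry: "\<exists>L\<in>U. nt_limit fn (circ t) L" if t: "t \<in> {0<..<1}" "t \<notin> \<rat>" for t
  proof -
    obtain x where x: "(Xi \<longlongrightarrow> x) (at (circ t) within ball 0 1)" "Re x = - c t" "c t = 0 \<Longrightarrow> norm x \<le> dl" using S(9)[OF t] by blast
    have t01: "t \<in> {0..1}" using t by simp
    define v where "v = (\<chi> j. of_real rho * circ (s j) * circ t :: complex^'n)"
    define W where "W = f (circ t) + v"
    define L where "L = k0 + exp x *s (W - k0)"
    have Llim: "(fn \<longlongrightarrow> L) (at (circ t) within ball 0 1)"
    proof (rule vec_tendstoI)
      fix j
      have "((\<lambda>z. k0 $ j + (f z $ j + of_real rho * circ (s j) * z - k0 $ j) * exp (Xi z)) \<longlongrightarrow>
        k0 $ j + (f (circ t) $ j + of_real rho * circ (s j) * circ t - k0 $ j) * exp x) (at (circ t) within ball 0 1)"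
        by (intro tendsto_intros ft x(1))
      moreover have Lj: "L $ j = k0 $ j + (f (circ t) $ j + of_real rho * circ (s j) * circ t - k0 $ j) * exp x"
        by (simp add: L_def W_def v_def algebra_simps)
      ultimately show "((\<lambda>z. fn z $ j) \<longlongrightarrow> L $ j) (at (circ t) within ball 0 1)"
        by (simp add: fn_def Lj)
    qed
    have nt: "nt_limit fn (circ t) L" unfolding nt_limit_def
      by (intro allI impI, rule tendsto_within_subset[OF Llim]) (auto simp: stolz_def)
    have vn: "norm v \<le> d / 4"
    proof -
      have "norm v \<le> (\<Sum>j\<in>(UNIV :: 'n set). rho)" using norm_vec_le_sum[of v] rho(1) by (simp add: v_def norm_mult)
      then show ?thesis using rho(2) by simp
    qed
    have dW: "infdist W K \<le> dist_K t + d / 4"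
      using infdist_triangle[of W K "f (circ t)"] vn by (simp add: W_def dist_norm dist_K_def)
    let ?i = "real (nat \<lfloor>real N * t\<rfloor>) / real N"
    \<comment> \<open>On a cell with small sampled distance the errors are \<open>5 * d / 16\<close>
      for \<open>f\<close>, \<open>d / 4\<close> for the shift and \<open>d / 4\<close> for
      \<open>exp x\<close> near 1. On the other cells the factor \<open>exp x\<close> contracts the
      boundary value to within \<open>d\<close> of \<open>k0\<close>.\<close>
    have "infdist L K < d"
    proof (cases "dl0 \<le> dist_K ?i")
      case False
      then have c0: "c t = 0" by (simp add: c_def g_def)
      have "norm (f (circ t)) \<le> Mf" by (rule Mf) simp
      then have n1: "norm (W - k0) \<le> M1" using vn norm_triangle_ineq[of "f (circ t)" v] norm_triangle_ineq4[of W k0] d(1) unfolding W_def M1_def by linarith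
      have e1: "L - W = (exp x - 1) *s (W - k0)" by (simp add: L_def vec_eq_iff algebra_simps)
      have "norm (L - W) \<le> d / (4 * M1) * M1"
        unfolding e1 norm_vector_scalar_mult using dl(2)[OF x(3)[OF c0]] n1 M1 d(1) by (intro mult_mono) auto
      then have LW: "norm (L - W) \<le> d / 4" using M1 by simp
      have "dist_K t < dl0 + dl0 / 4" using osc[OF t01] False by linarith
      then show ?thesis using infdist_triangle[of L K W] dW LW d(1) by (simp add: dist_norm dl0_def)
    next
      case True
      then have ct: "c t = C2 * dist_K ?i" by (simp add: c_def g_def)
      obtain k where k: "k \<in> K" "infdist W K = dist W k" using infdist_attains_inf[OF compact_imp_closed[OF K] Kne] by blast
      have "norm (W - k0) \<le> infdist W K + D0" using dist_triangle[of W k0 k] D0[OF k(1)] k(2) by (simp add: dist_norm)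
      also have "\<dots> \<le> dist_K ?i + dl0 / 4 + d / 4 + D0" using dW osc[OF t01] by linarith
      also have "\<dots> \<le> dist_K ?i + D0 + d" using d(1) by (simp add: dl0_def)
      also have "\<dots> < d * (1 + c t)"
      proof -
        have "d * (dist_K ?i / d + D0 / d + 1) \<le> d * c t" unfolding ct using C2'[OF True] d(1) by (intro mult_left_mono) auto
        then show ?thesis using d(1) by (simp add: algebra_simps)
      qed
      also have "\<dots> \<le> d * exp (c t)" using exp_ge_add_one_self[of "c t"] d(1) by (intro mult_left_mono) auto
      finally have "norm (W - k0) < d * exp (c t)" .
      then have "exp (- c t) * norm (W - k0) < exp (- c t) * (d * exp (c t))" by simp
      also have "\<dots> = d" by (simp add: exp_minus)
      finally have "norm (L - k0) < d" unfolding L_def add_diff_cancel_left' norm_vector_scalar_mult norm_exp_eq_Re x(2) .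
      then show ?thesis using infdist_le[OF k0, of L] by (simp add: dist_norm)
    qed
    then show ?thesis using d(2) nt by blast
  qed
  have AE: "AE w in sigma_T. \<exists>L\<in>U. nt_limit fn w L" by (rule AE_sigma_T_irrational) (rule bdry)
  have sing: "\<exists>mp mn. is_singular_measure (\<lambda>z. fn z $ j) mp mn \<and> (\<forall>A\<in>sets borel. signed_val mp mn A \<ge> 0) \<and> signed_val mp mn (sphere 0 1) < eps" for j
  \<comment> \<open>By convention the zero function has singular measure zero, so it is treated
    apart from the factorization.\<close>
  proof (cases "\<forall>z\<in>ball 0 1. fn z $ j = 0")
    case True
    then have "is_singular_measure (\<lambda>z. fn z $ j) (null_measure borel) (null_measure borel)"
      by (simp add: is_singular_measure_def null_measure_circle signed_val_def)
    then show ?thesis using eps by (intro exI[of _ "null_measure borel"]) (simp add: signed_val_def)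
  next
    case False
    let ?E = "\<lambda>z. exp (integral\<^sup>L sigma_T (\<lambda>w. (w + z) / (w - z) * of_real (h w)))"
    have "fn z $ j = B j z * (Ou j z * ?E z) * sing_fun mu (null_measure borel) z" if z: "z \<in> ball 0 1" for z
      unfolding fn_eq F(3)[OF z] S(5)[OF z] sing_fun_def null_measure_circle(4) exp_add by simp
    moreover have "outer (\<lambda>z. Ou j z * ?E z)" by (rule outer_mult_exp[OF F(2) S(4)])
    ultimately have "\<exists>B Ou. blaschke B \<and> outer Ou \<and> (\<forall>z\<in>ball 0 1. fn z $ j = B z * Ou z * sing_fun mu (null_measure borel) z)"
      using F(1)[of j] by (intro exI[of _ "B j"] exI[of _ "\<lambda>z. Ou j z * ?E z"]) simp
    then have "is_singular_measure (\<lambda>z. fn z $ j) mu (null_measure borel)"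
      using False S(1,2) null_measure_circle(1,2) by (auto simp: is_singular_measure_def)
    then show ?thesis using mass by (intro exI[of _ mu] exI[of _ "null_measure borel"]) (simp add: signed_val_def null_measure_circle(3))
  qed
  show ?thesis using nev fn0 AE sing by blast
qed

theorem theorem1:
  fixes K :: "(complex^'n) set" and a :: "complex^'n"
  assumes "compact K" and "connected K"
  shows "a \<in> poly_hull K \<longleftrightarrow>
    (\<forall>U \<epsilon>. open U \<and> K \<subseteq> U \<and> \<epsilon> > 0 \<longrightarrow>
      (\<exists>f :: complex \<Rightarrow> complex^'n. nevanlinna_disc f \<and> f 0 = a \<and>
         (AE \<zeta> in sigma_T. \<exists>L \<in> U. nt_limit f \<zeta> L) \<and>
         (\<forall>j. \<exists>\<mu>p \<mu>n. is_singular_measure (\<lambda>z. f z $ j) \<mu>p \<mu>n \<and>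
               (\<forall>A \<in> sets borel. signed_val \<mu>p \<mu>n A \<ge> 0) \<and>
               signed_val \<mu>p \<mu>n (sphere 0 1) < \<epsilon>)))"
proof
  assume a: "a \<in> poly_hull K"
  show "\<forall>U \<epsilon>. open U \<and> K \<subseteq> U \<and> \<epsilon> > 0 \<longrightarrow>
      (\<exists>f :: complex \<Rightarrow> complex^'n. nevanlinna_disc f \<and> f 0 = a \<and>
         (AE \<zeta> in sigma_T. \<exists>L \<in> U. nt_limit f \<zeta> L) \<and>
         (\<forall>j. \<exists>\<mu>p \<mu>n. is_singular_measure (\<lambda>z. f z $ j) \<mu>p \<mu>n \<and>
               (\<forall>A \<in> sets borel. signed_val \<mu>p \<mu>n A \<ge> 0) \<and>
               signed_val \<mu>p \<mu>n (sphere 0 1) < \<epsilon>))"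
    by (intro allI impI, elim conjE) (rule poly_hull_nevanlinna_disc[OF assms(1) a])
next
  assume "\<forall>U \<epsilon>. open U \<and> K \<subseteq> U \<and> \<epsilon> > 0 \<longrightarrow>
      (\<exists>f :: complex \<Rightarrow> complex^'n. nevanlinna_disc f \<and> f 0 = a \<and>
         (AE \<zeta> in sigma_T. \<exists>L \<in> U. nt_limit f \<zeta> L) \<and>
         (\<forall>j. \<exists>\<mu>p \<mu>n. is_singular_measure (\<lambda>z. f z $ j) \<mu>p \<mu>n \<and>
               (\<forall>A \<in> sets borel. signed_val \<mu>p \<mu>n A \<ge> 0) \<and>
               signed_val \<mu>p \<mu>n (sphere 0 1) < \<epsilon>))"
  then show "a \<in> poly_hull K" by (intro disc_center_in_poly_hull) blast
qed

end
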